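(* The noncommutative Priestley duality $(-)^{\star}$ restricts to a dual equivalence between the category $\mathbf{LNFrm}$ of left-handed noncommutative frames and the category $\mathbf{Sh}(\mathsf{Loc}_d)$ of sheaves on dissolution locales. Explicitly: the assignment $(Y,\mathcal{F})\mapsto (X,j_*\mathcal{F})^{\star}$, where $X=\mathrm{Spec}(\mathcal{O}(Y))$ and $j:Y_d\to X_p$ is the canonical morphism (with the action on morphisms described in the context), is an equivalence of categories $\mathbf{Sh}(\mathsf{Loc}_d)^{\mathrm{op}}\simeq\mathbf{LNFrm}$.
   Context: **Skew lattices.** A skew lattice is a set $A$ with idempotent associative operations $\wedge,\vee$ satisfying $x\wedge(x\vee y)=x=x\vee(x\wedge y)$ and $(x\wedge y)\vee y=y=(x\vee y)\wedge y$. Natural partial order: $a\le b$ iff $a\wedge b=b\wedge a=a$. Green's relation: $a\,\mathcal{D}\,b$ iff $a\wedge b\wedge a=a$ and $b\wedge a\wedge b=b$; it is a congruence, $A/\mathcal{D}$ is a lattice (the commutative shadow), and $[a]$ denotes the class of $a$. $A$ is left-handed if $x\wedge y\wedge x=x\wedge y$ holds identically; strongly distributive if $(x\vee y)\wedge z=(x\wedge z)\vee(y\wedge z)$ and $x\wedge(y\vee z)=(x\wedge y)\vee(x\wedge z)$ hold identically. A skew lattice with $0$ has a distinguished element $0$ with $x\vee 0=x=0\vee x$ for all $x$. A commuting subset is a nonempty subset $\{x_i\}_{i\in I}$ with $x_i\wedge x_j=x_j\wedge x_i$ and $x_i\vee x_j=x_j\vee x_i$ for all $i,j$. $A$ is join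 complete if all commuting subsets have suprema for the natural partial order. **Noncommutative frames.** A noncommutative frame is a strongly distributive, join complete skew lattice $A$ with $0$ such that $(\bigvee_i x_i)\wedge y=\bigvee_i(x_i\wedge y)$ and $x\wedge(\bigvee_i y_i)=\bigvee_i(x\wedge y_i)$ for all $x,y\in A$ and all commuting subsets $\{x_i\},\{y_i\}$. It has a maximal $\mathcal{D}$-class, and $A/\mathcal{D}$ is a frame. A morphism of noncommutative frames is a map preserving $\wedge$, $\vee$, $0$, and suprema of commuting subsets, and sending elements of the maximal $\mathcal{D}$-class to elements of the maximal $\mathcal{D}$-class. $\mathbf{LNFrm}$ is the category of left-handed noncommutative frames. **Noncommutative Priestley duality (known).** For a bounded distributive lattice $D$, $\mathrm{Spec}(D)$ is the set of prime filters of $D$ with basic opens $\widehat{a}=\{F: a\in F\}$; its compact opens are exactly the $\widehat a$. The patch topology is generated by the compact opens and their complements, and the order is inclusion of filters; with these, $\mathrm{Spec}(D)$ is a Priestley space, and all Priestley spaces arise this way. $\mathbf{Sh}(\mathsf{PS})$ has objects $(X,\mathcal{G})$ with $X$ a Priestley space and $\mathcal{G}$ a sheaf on $X$ with all stalks nonempty; morphisms $(X,\mathcal{G})\to(X',\mathcal{G}')$ are pairs $(h,\lambda)$ with $h:X\to X'$ continuous and monotone and $\lambda:\mathcal{G}'\to h_*\mathcal{G}$ a sheaf morphism. $\mathbf{SDL}_{01}$ is the category of left-handed strongly distributive skew lattices $S$ with $0$ with $S/\mathcal{D}$ bounded; its morphisms are the maps $\varphi:S\to S'$ preserving $\wedge,\vee,0$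 that are proper: for every $y\in S'$ there is $x\in S$ with $[y]\le[\varphi(x)]$ in $S'/\mathcal{D}$. $(X,\mathcal{G})^{\star}$ is the set of pairs $(U,s)$ with $U\subseteq X$ upwards closed compact open (in the Priestley topology) and $s\in\mathcal{G}(U)$, with $(U,s)\wedge(V,t)=(U\cap V,s|_{U\cap V})$ and $(U,s)\vee(V,t)=(U\cup V,s|_{U-V}\cup t)$; $(h,\lambda)^{\star}$ sends $(U,s)$ to $(h^{-1}(U),\lambda(s))$. The functor $(-)^{\star}:\mathbf{Sh}(\mathsf{PS})^{\mathrm{op}}\to\mathbf{SDL}_{01}$ is an equivalence. (It is the restriction to bounded commutative shadows of a duality $\mathbf{Sh}(\mathsf{LPS})^{\mathrm{op}}\simeq\mathbf{SDL}$ with local Priestley spaces; commutative shadows of noncommutative frames are always bounded.) **Dissolution locale.** For a locale $Y$ with frame $L=\mathcal{O}(Y)$, $N(L)$ is the frame of nuclei on $L$: maps $\nu:L\to L$ with $a\le\nu(a)$, $\nu(a\wedge b)=\nu(a)\wedge\nu(b)$, $\nu(\nu(a))=\nu(a)$, ordered pointwise. The dissolution locale $Y_d$ is the locale with $\mathcal{O}(Y_d)=N(L)$. The frame embedding $L\to N(L)$, $a\mapsto\nu_a$, $\nu_a(b)=a\vee b$, defines $\delta:Y_d\to Y$; every $\nu_a$ is complemented in $N(L)$, and $L\to N(L)$ is universal among frame morphisms out of $L$ with complemented values. Put $X=\mathrm{Spec}(L)$, $X_p=X$ with the patch topology, and $\pi:X_p\to X$ the identity map. Since $\mathcal{O}(X)\cong\mathrm{Idl}(L)$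 (ideals of $L$), the frame morphism $\mathrm{Idl}(L)\to L$, $I\mapsto\bigvee I$, defines $i:Y\to X$. There is a pullback square of locales with $j:Y_d\to X_p$, $\delta:Y_d\to Y$ and $\pi\circ j=i\circ\delta$. **The category $\mathbf{Sh}(\mathsf{Loc}_d)$.** Objects: pairs $(Y,\mathcal{F})$ with $Y$ a locale and $\mathcal{F}$ a sheaf on $Y_d$ with $\mathcal{F}(Y_d)\neq\varnothing$. Morphisms $(Y,\mathcal{F})\to(Y',\mathcal{F}')$: pairs $(f,\lambda)$ with $f:Y\to Y'$ a locale morphism and $\lambda:\mathcal{F}'\to g_*\mathcal{F}$ a sheaf morphism, where $g:Y_d\to Y'_d$ is induced by $f$. **The functor.** $(Y,\mathcal{F})$ is sent to $(X,j_*\mathcal{F})^{\star}$, with $X=\mathrm{Spec}(\mathcal{O}(Y))$ regarded as a Priestley space (patch topology, inclusion of filters). Identifying compact opens of $X$ with elements of $\mathcal{O}(Y)$, this is the set of pairs $(U,s)$ with $U\in\mathcal{O}(Y)$ and $s\in\mathcal{F}(\delta^{-1}(U))$, with $(U,s)\wedge(V,t)=(U\cap V,s|_{U\cap V})$ and $(U,s)\vee(V,t)=(U\cup V,s|_{U-V}\cup t)$, where $s|_{U-V}\cup t$ is the unique section over $\delta^{-1}(U\cup V)$ restricting to $s$ on $\delta^{-1}(U)-\delta^{-1}(V)$ and to $t$ on $\delta^{-1}(V)$. A morphism $(f,\lambda):(Y,\mathcal{F})\to(Y',\mathcal{F}')$ is sent to the map $(U,s)\mapsto(f^{-1}(U),\lambda(s))$.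 *)

theory Defs
  imports "HOL-Algebra.Complete_Lattice" "HOL-Analysis.Abstract_Topology"
begin

section \<open>Categories and functors\<close>

text \<open>
  Morphisms do not carry their source and target: all operations on morphisms take the objects
  involved as arguments, and \<open>Comp C X Y Z g f\<close> is the composite of \<open>f : X \<rightarrow> Y\<close> and \<open>g : Y \<rightarrow> Z\<close>.
  So that equality of HOL functions is equality of morphisms, every function that is (a part of)
  a morphism is required to be extensional, i.e. \<open>undefined\<close> off its domain.
\<close>

record ('o, 'm) category =
  Obj :: "'o set"
  Hom :: "'o \<Rightarrow> 'o \<Rightarrow> 'm set"
  Ident :: "'o \<Rightarrow> 'm"
  Comp :: "'o \<Rightarrow> 'o \<Rightarrow> 'o \<Rightarrow> 'm \<Rightarrow> 'm \<Rightarrow> 'm"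

definition is_category :: "('o, 'm) category \<Rightarrow> bool" where
  "is_category C \<longleftrightarrow>
     (\<forall>X\<in>Obj C. Ident C X \<in> Hom C X X) \<and>
     (\<forall>X\<in>Obj C. \<forall>Y\<in>Obj C. \<forall>Z\<in>Obj C. \<forall>f\<in>Hom C X Y. \<forall>g\<in>Hom C Y Z. Comp C X Y Z g f \<in> Hom C X Z) \<and>
     (\<forall>X\<in>Obj C. \<forall>Y\<in>Obj C. \<forall>f\<in>Hom C X Y.
        Comp C X X Y f (Ident C X) = f \<and> Comp C X Y Y (Ident C Y) f = f) \<and>
     (\<forall>W\<in>Obj C. \<forall>X\<in>Obj C. \<forall>Y\<in>Obj C. \<forall>Z\<in>Obj C.
        \<forall>f\<in>Hom C W X. \<forall>g\<in>Hom C X Y. \<forall>h\<in>Hom C Y Z.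
        Comp C W Y Z h (Comp C W X Y g f) = Comp C W X Z (Comp C X Y Z h g) f)"

definition opposite :: "('o, 'm) category \<Rightarrow> ('o, 'm) category" where
  "opposite C = \<lparr>Obj = Obj C, Hom = (\<lambda>X Y. Hom C Y X), Ident = Ident C,
                 Comp = (\<lambda>X Y Z g f. Comp C Z Y X f g)\<rparr>"

definition is_functor ::
  "('o, 'm) category \<Rightarrow> ('p, 'n) category \<Rightarrow> ('o \<Rightarrow> 'p) \<Rightarrow> ('o \<Rightarrow> 'o \<Rightarrow> 'm \<Rightarrow> 'n) \<Rightarrow> bool" where
  "is_functor C D F\<^sub>0 F\<^sub>1 \<longleftrightarrow>
     is_category C \<and> is_category D \<and>
     (\<forall>X\<in>Obj C. F\<^sub>0 X \<in> Obj D) \<and>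
     (\<forall>X\<in>Obj C. \<forall>Y\<in>Obj C. \<forall>f\<in>Hom C X Y. F\<^sub>1 X Y f \<in> Hom D (F\<^sub>0 X) (F\<^sub>0 Y)) \<and>
     (\<forall>X\<in>Obj C. F\<^sub>1 X X (Ident C X) = Ident D (F\<^sub>0 X)) \<and>
     (\<forall>X\<in>Obj C. \<forall>Y\<in>Obj C. \<forall>Z\<in>Obj C. \<forall>f\<in>Hom C X Y. \<forall>g\<in>Hom C Y Z.
        F\<^sub>1 X Z (Comp C X Y Z g f) = Comp D (F\<^sub>0 X) (F\<^sub>0 Y) (F\<^sub>0 Z) (F\<^sub>1 Y Z g) (F\<^sub>1 X Y f))"


section \<open>Skew lattices and noncommutative frames\<close>

record 'a skew_lat = "'a partial_object" +
  smeet :: "'a \<Rightarrow> 'a \<Rightarrow> 'a" (infixl \<open>\<curlywedge>\<index>\<close> 70)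
  sjoin :: "'a \<Rightarrow> 'a \<Rightarrow> 'a" (infixl \<open>\<curlyvee>\<index>\<close> 65)
  zer :: "'a"

locale skew_lattice =
  fixes A :: "'a skew_lat" (structure)
  assumes smeet_closed: "\<lbrakk>x \<in> carrier A; y \<in> carrier A\<rbrakk> \<Longrightarrow> x \<curlywedge> y \<in> carrier A"
    and sjoin_closed: "\<lbrakk>x \<in> carrier A; y \<in> carrier A\<rbrakk> \<Longrightarrow> x \<curlyvee> y \<in> carrier A"
    and smeet_idem: "x \<in> carrier A \<Longrightarrow> x \<curlywedge> x = x"
    and sjoin_idem: "x \<in> carrier A \<Longrightarrow> x \<curlyvee> x = x"
    and smeet_assoc: "\<lbrakk>x \<in> carrier A; y \<in> carrier A; z \<in> carrier A\<rbrakk>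
          \<Longrightarrow> (x \<curlywedge> y) \<curlywedge> z = x \<curlywedge> (y \<curlywedge> z)"
    and sjoin_assoc: "\<lbrakk>x \<in> carrier A; y \<in> carrier A; z \<in> carrier A\<rbrakk>
          \<Longrightarrow> (x \<curlyvee> y) \<curlyvee> z = x \<curlyvee> (y \<curlyvee> z)"
    and absorb: "\<lbrakk>x \<in> carrier A; y \<in> carrier A\<rbrakk> \<Longrightarrow>
          x \<curlywedge> (x \<curlyvee> y) = x \<and> x \<curlyvee> (x \<curlywedge> y) = x \<and> (x \<curlywedge> y) \<curlyvee> y = y \<and> (x \<curlyvee> y) \<curlywedge> y = y"

definition natural_order :: "'a skew_lat \<Rightarrow> 'a gorder" where
  "natural_order A =
     \<lparr>carrier = carrier A, eq = (=), le = (\<lambda>a b. a \<curlywedge>\<^bsub>A\<^esub> b = a \<and> b \<curlywedge>\<^bsub>A\<^esub> a = a)\<rparr>"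

definition D_class :: "'a skew_lat \<Rightarrow> 'a \<Rightarrow> 'a set" where
  "D_class A a = {b \<in> carrier A. a \<curlywedge>\<^bsub>A\<^esub> b \<curlywedge>\<^bsub>A\<^esub> a = a \<and> b \<curlywedge>\<^bsub>A\<^esub> a \<curlywedge>\<^bsub>A\<^esub> b = b}"

definition D_le :: "'a skew_lat \<Rightarrow> 'a \<Rightarrow> 'a \<Rightarrow> bool" where
  "D_le A a b \<longleftrightarrow> D_class A (a \<curlywedge>\<^bsub>A\<^esub> b) = D_class A a"
  \<comment> \<open>\<open>[a] \<le> [b]\<close> in the lattice of classes, where \<open>[a] \<and> [b] = [a \<and> b]\<close>\<close>

definition in_max_D_class :: "'a skew_lat \<Rightarrow> 'a \<Rightarrow> bool" where
  "in_max_D_class A t \<longleftrightarrow>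
     t \<in> carrier A \<and> (\<forall>x\<in>carrier A. D_le A t x \<longrightarrow> D_class A x = D_class A t)"

definition left_handed :: "'a skew_lat \<Rightarrow> bool" where
  "left_handed A \<longleftrightarrow> (\<forall>x\<in>carrier A. \<forall>y\<in>carrier A. x \<curlywedge>\<^bsub>A\<^esub> y \<curlywedge>\<^bsub>A\<^esub> x = x \<curlywedge>\<^bsub>A\<^esub> y)"

definition commuting_subset :: "'a skew_lat \<Rightarrow> 'a set \<Rightarrow> bool" where
  "commuting_subset A C \<longleftrightarrow> C \<noteq> {} \<and> C \<subseteq> carrier A \<and>
     (\<forall>x\<in>C. \<forall>y\<in>C. x \<curlywedge>\<^bsub>A\<^esub> y = y \<curlywedge>\<^bsub>A\<^esub> x \<and> x \<curlyvee>\<^bsub>A\<^esub> y = y \<curlyvee>\<^bsub>A\<^esub> x)"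

locale noncommutative_frame = skew_lattice +
  assumes zer_closed: "zer A \<in> carrier A"
    and zer_sjoin: "x \<in> carrier A \<Longrightarrow> x \<curlyvee> zer A = x \<and> zer A \<curlyvee> x = x"
    and strongly_distributive: "\<lbrakk>x \<in> carrier A; y \<in> carrier A; z \<in> carrier A\<rbrakk> \<Longrightarrow>
          (x \<curlyvee> y) \<curlywedge> z = (x \<curlywedge> z) \<curlyvee> (y \<curlywedge> z) \<and> x \<curlywedge> (y \<curlyvee> z) = (x \<curlywedge> y) \<curlyvee> (x \<curlywedge> z)"
    and join_complete: "commuting_subset A C \<Longrightarrow>
          \<exists>s. least (natural_order A) s (Upper (natural_order A) C)"
    and Sup_smeet: "\<lbrakk>commuting_subset A C; y \<in> carrier A\<rbrakk> \<Longrightarrow>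
          \<Squnion>\<^bsub>natural_order A\<^esub> C \<curlywedge> y = \<Squnion>\<^bsub>natural_order A\<^esub> ((\<lambda>x. x \<curlywedge> y) ` C)"
    and smeet_Sup: "\<lbrakk>x \<in> carrier A; commuting_subset A C\<rbrakk> \<Longrightarrow>
          x \<curlywedge> \<Squnion>\<^bsub>natural_order A\<^esub> C = \<Squnion>\<^bsub>natural_order A\<^esub> ((\<lambda>y. x \<curlywedge> y) ` C)"

definition ncframe_hom :: "'a skew_lat \<Rightarrow> 'b skew_lat \<Rightarrow> ('a \<Rightarrow> 'b) set" where
  "ncframe_hom A B = {\<phi> \<in> carrier A \<rightarrow>\<^sub>E carrier B.
     (\<forall>x\<in>carrier A. \<forall>y\<in>carrier A. \<phi> (x \<curlywedge>\<^bsub>A\<^esub> y) = \<phi> x \<curlywedge>\<^bsub>B\<^esub> \<phi> y \<and> \<phi> (x \<curlyvee>\<^bsub>A\<^esub> y) = \<phi> x \<curlyvee>\<^bsub>B\<^esub> \<phi> y) \<and>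
     \<phi> (zer A) = zer B \<and>
     (\<forall>C. commuting_subset A C \<longrightarrow>
        \<phi> (\<Squnion>\<^bsub>natural_order A\<^esub> C) = \<Squnion>\<^bsub>natural_order B\<^esub> (\<phi> ` C)) \<and>
     (\<forall>t. in_max_D_class A t \<longrightarrow> in_max_D_class B (\<phi> t))}"

definition ncframe_id :: "'a skew_lat \<Rightarrow> 'a \<Rightarrow> 'a" where
  "ncframe_id A = (\<lambda>x\<in>carrier A. x)"

definition LNFrm :: "('a skew_lat, 'a \<Rightarrow> 'a) category" where
  "LNFrm = \<lparr>Obj = {A. noncommutative_frame A \<and> left_handed A}, Hom = ncframe_hom,
            Ident = ncframe_id, Comp = (\<lambda>A B C \<psi> \<phi>. compose (carrier A) \<psi> \<phi>)\<rparr>"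

definition ncframe_iso :: "'a skew_lat \<Rightarrow> 'b skew_lat \<Rightarrow> ('a \<Rightarrow> 'b) set" where
  "ncframe_iso A B = {\<phi> \<in> ncframe_hom A B. \<exists>\<psi>\<in>ncframe_hom B A.
     compose (carrier A) \<psi> \<phi> = ncframe_id A \<and> compose (carrier B) \<phi> \<psi> = ncframe_id B}"


section \<open>Frames, nuclei and the dissolution locale\<close>

text \<open>
  A locale \<open>Y\<close> is given by its frame \<open>L = \<O>(Y)\<close>; a morphism of locales \<open>Y \<rightarrow> Y'\<close> is a frame
  morphism \<open>\<O>(Y') \<rightarrow> \<O>(Y)\<close>.
\<close>

definition frame :: "'l gorder \<Rightarrow> bool" where
  "frame L \<longleftrightarrow> complete_lattice L \<and>
     (\<forall>a\<in>carrier L. \<forall>S\<subseteq>carrier L. a \<sqinter>\<^bsub>L\<^esub> \<Squnion>\<^bsub>L\<^esub> S = \<Squnion>\<^bsub>L\<^esub> ((\<lambda>s. a \<sqinter>\<^bsub>L\<^esub> s) ` S))"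

definition frame_hom :: "'l gorder \<Rightarrow> 'm gorder \<Rightarrow> ('l \<Rightarrow> 'm) set" where
  "frame_hom L M = {h \<in> carrier L \<rightarrow>\<^sub>E carrier M.
     h \<top>\<^bsub>L\<^esub> = \<top>\<^bsub>M\<^esub> \<and>
     (\<forall>a\<in>carrier L. \<forall>b\<in>carrier L. h (a \<sqinter>\<^bsub>L\<^esub> b) = h a \<sqinter>\<^bsub>M\<^esub> h b) \<and>
     (\<forall>S\<subseteq>carrier L. h (\<Squnion>\<^bsub>L\<^esub> S) = \<Squnion>\<^bsub>M\<^esub> (h ` S))}"

definition nuclei :: "'l gorder \<Rightarrow> ('l \<Rightarrow> 'l) gorder" where
  "nuclei L = \<lparr>carrier = {\<nu> \<in> carrier L \<rightarrow>\<^sub>E carrier L.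
       (\<forall>a\<in>carrier L. a \<sqsubseteq>\<^bsub>L\<^esub> \<nu> a \<and> \<nu> (\<nu> a) = \<nu> a) \<and>
       (\<forall>a\<in>carrier L. \<forall>b\<in>carrier L. \<nu> (a \<sqinter>\<^bsub>L\<^esub> b) = \<nu> a \<sqinter>\<^bsub>L\<^esub> \<nu> b)},
     eq = (=), le = (\<lambda>\<mu> \<nu>. \<forall>a\<in>carrier L. \<mu> a \<sqsubseteq>\<^bsub>L\<^esub> \<nu> a)\<rparr>"

definition closed_nucleus :: "'l gorder \<Rightarrow> 'l \<Rightarrow> 'l \<Rightarrow> 'l" where
  "closed_nucleus L a = (\<lambda>b\<in>carrier L. a \<squnion>\<^bsub>L\<^esub> b)"
  \<comment> \<open>\<open>closed_nucleus L\<close> is the frame embedding \<open>L \<rightarrow> N(L)\<close>, i.e. the inverse image of \<open>\<delta>\<close>\<close>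

definition dissolution_map ::
  "'l gorder \<Rightarrow> 'm gorder \<Rightarrow> ('m \<Rightarrow> 'l) \<Rightarrow> ('m \<Rightarrow> 'm) \<Rightarrow> 'l \<Rightarrow> 'l" where
  "dissolution_map L L' f = (THE g. g \<in> frame_hom (nuclei L') (nuclei L) \<and>
     (\<forall>a\<in>carrier L'. g (closed_nucleus L' a) = closed_nucleus L (f a)))"
  \<comment> \<open>the frame morphism \<open>N(L') \<rightarrow> N(L)\<close> induced by \<open>f : L' \<rightarrow> L\<close> through the universal property
      of \<open>L' \<rightarrow> N(L')\<close>\<close>


section \<open>Sheaves\<close>

record ('o, 's) presheaf =
  sections :: "'o \<Rightarrow> 's set"
  res :: "'o \<Rightarrow> 'o \<Rightarrow> 's \<Rightarrow> 's"
  \<comment> \<open>\<open>res F U V\<close> restricts from \<open>U\<close> to \<open>V\<close>\<close>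

definition sheaf :: "'o gorder \<Rightarrow> ('o, 's) presheaf \<Rightarrow> bool" where
  "sheaf P F \<longleftrightarrow>
     (\<forall>U\<in>carrier P. \<forall>V\<in>carrier P. V \<sqsubseteq>\<^bsub>P\<^esub> U \<longrightarrow> res F U V \<in> sections F U \<rightarrow> sections F V) \<and>
     (\<forall>U\<in>carrier P. \<forall>s\<in>sections F U. res F U U s = s) \<and>
     (\<forall>U\<in>carrier P. \<forall>V\<in>carrier P. \<forall>W\<in>carrier P. V \<sqsubseteq>\<^bsub>P\<^esub> U \<longrightarrow> W \<sqsubseteq>\<^bsub>P\<^esub> V \<longrightarrow>
        (\<forall>s\<in>sections F U. res F V W (res F U V s) = res F U W s)) \<and>
     (\<forall>C\<subseteq>carrier P. \<forall>s. (\<forall>U\<in>C. s U \<in> sections F U) \<longrightarrow>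
        (\<forall>U\<in>C. \<forall>V\<in>C. res F U (U \<sqinter>\<^bsub>P\<^esub> V) (s U) = res F V (U \<sqinter>\<^bsub>P\<^esub> V) (s V)) \<longrightarrow>
        (\<exists>!t. t \<in> sections F (\<Squnion>\<^bsub>P\<^esub> C) \<and> (\<forall>U\<in>C. res F (\<Squnion>\<^bsub>P\<^esub> C) U t = s U)))"

definition sheaf_hom ::
  "'o gorder \<Rightarrow> ('o, 's) presheaf \<Rightarrow> ('o, 't) presheaf \<Rightarrow> ('o \<Rightarrow> 's \<Rightarrow> 't) set" where
  "sheaf_hom P F G = {\<alpha>. \<alpha> \<in> (\<Pi>\<^sub>E U\<in>carrier P. sections F U \<rightarrow>\<^sub>E sections G U) \<and>
     (\<forall>U\<in>carrier P. \<forall>V\<in>carrier P. V \<sqsubseteq>\<^bsub>P\<^esub> U \<longrightarrow>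
        (\<forall>s\<in>sections F U. \<alpha> V (res F U V s) = res G U V (\<alpha> U s)))}"

definition pushforward :: "('p \<Rightarrow> 'o) \<Rightarrow> ('o, 's) presheaf \<Rightarrow> ('p, 's) presheaf" where
  "pushforward g F = \<lparr>sections = (\<lambda>U. sections F (g U)), res = (\<lambda>U V. res F (g U) (g V))\<rparr>"
  \<comment> \<open>direct image along the morphism of locales whose inverse image is \<open>g\<close>\<close>

definition opens :: "'x topology \<Rightarrow> 'x set gorder" where
  "opens T = \<lparr>carrier = {U. openin T U}, eq = (=), le = (\<subseteq>)\<rparr>"

definition preimg :: "'x topology \<Rightarrow> ('x \<Rightarrow> 'y) \<Rightarrow> 'y set \<Rightarrow> 'x set" where
  "preimg T h U = {x \<in> topspace T. h x \<in> U}"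

definition germ ::
  "'x topology \<Rightarrow> ('x set, 's) presheaf \<Rightarrow> 'x \<Rightarrow> 'x set \<Rightarrow> 's \<Rightarrow> ('x set \<times> 's) set" where
  "germ T G x U s = {(V, t). openin T V \<and> x \<in> V \<and> t \<in> sections G V \<and>
     (\<exists>W. openin T W \<and> x \<in> W \<and> W \<subseteq> U \<inter> V \<and> res G U W s = res G V W t)}"

definition stalk ::
  "'x topology \<Rightarrow> ('x set, 's) presheaf \<Rightarrow> 'x \<Rightarrow> ('x set \<times> 's) set set" where
  "stalk T G x = {germ T G x U s | U s. openin T U \<and> x \<in> U \<and> s \<in> sections G U}"


section \<open>Sheaves on dissolution locales\<close>

type_synonym ('l, 's) sh_loc = "'l gorder \<times> ('l \<Rightarrow> 'l, 's) presheaf"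

text \<open>
  A morphism \<open>(L, F) \<rightarrow> (L', F')\<close> consists of a frame morphism \<open>L' \<rightarrow> L\<close> and a sheaf morphism
  \<open>F' \<rightarrow> g\<^sub>* F\<close>, so both components of the pair go from the target to the source. Homs are
  defined for objects over different types, since isomorphisms between such objects are needed.
\<close>

type_synonym ('l, 's, 'm, 't) sh_loc_arr = "('m \<Rightarrow> 'l) \<times> (('m \<Rightarrow> 'm) \<Rightarrow> 't \<Rightarrow> 's)"

definition sh_loc_hom ::
  "('l, 's) sh_loc \<Rightarrow> ('m, 't) sh_loc \<Rightarrow> ('l, 's, 'm, 't) sh_loc_arr set" where
  "sh_loc_hom = (\<lambda>(L, F) (L', F'). {(f, \<alpha>). f \<in> frame_hom L' L \<and>
     \<alpha> \<in> sheaf_hom (nuclei L') F' (pushforward (dissolution_map L L' f) F)})"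

definition sh_loc_id :: "('l, 's) sh_loc \<Rightarrow> ('l, 's, 'l, 's) sh_loc_arr" where
  "sh_loc_id = (\<lambda>(L, F).
     (\<lambda>a\<in>carrier L. a, \<lambda>\<nu>\<in>carrier (nuclei L). \<lambda>s\<in>sections F \<nu>. s))"

definition sh_loc_comp ::
  "('l, 's) sh_loc \<Rightarrow> ('m, 't) sh_loc \<Rightarrow> ('n, 'u) sh_loc \<Rightarrow>
   ('m, 't, 'n, 'u) sh_loc_arr \<Rightarrow> ('l, 's, 'm, 't) sh_loc_arr \<Rightarrow> ('l, 's, 'n, 'u) sh_loc_arr" where
  "sh_loc_comp = (\<lambda>(L, F) (L', F') (L'', F'') (f', \<alpha>') (f, \<alpha>).
     (compose (carrier L'') f f',
      \<lambda>\<nu>\<in>carrier (nuclei L''). \<lambda>s\<in>sections F'' \<nu>. \<alpha> (dissolution_map L' L'' f' \<nu>) (\<alpha>' \<nu> s)))"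

definition Sh_Loc\<^sub>d :: "(('l, 's) sh_loc, ('l, 's, 'l, 's) sh_loc_arr) category" where
  "Sh_Loc\<^sub>d = \<lparr>Obj = {(L, F). frame L \<and> sheaf (nuclei L) F \<and> sections F \<top>\<^bsub>nuclei L\<^esub> \<noteq> {}},
              Hom = sh_loc_hom, Ident = sh_loc_id, Comp = sh_loc_comp\<rparr>"

definition sh_loc_iso ::
  "('l, 's) sh_loc \<Rightarrow> ('m, 't) sh_loc \<Rightarrow> ('l, 's, 'm, 't) sh_loc_arr set" where
  "sh_loc_iso X Y = {m \<in> sh_loc_hom X Y. \<exists>n\<in>sh_loc_hom Y X.
     sh_loc_comp X Y X n m = sh_loc_id X \<and> sh_loc_comp Y X Y m n = sh_loc_id Y}"


section \<open>Sheaves on Priestley spaces and the functor \<open>\<star>\<close>\<close>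

definition compact_opens :: "'x topology \<Rightarrow> 'x set set" where
  "compact_opens T = {U. openin T U \<and> compactin T U}"

definition upset :: "'x topology \<Rightarrow> 'x rel \<Rightarrow> 'x set \<Rightarrow> bool" where
  "upset T r U \<longleftrightarrow> U \<subseteq> topspace T \<and> (\<forall>x\<in>U. \<forall>y\<in>topspace T. (x, y) \<in> r \<longrightarrow> y \<in> U)"

definition priestley_space :: "'x topology \<Rightarrow> 'x rel \<Rightarrow> bool" where
  "priestley_space T r \<longleftrightarrow> compact_space T \<and> partial_order_on (topspace T) r \<and>
     (\<forall>x\<in>topspace T. \<forall>y\<in>topspace T. (x, y) \<notin> r \<longrightarrow>
        (\<exists>U. openin T U \<and> closedin T U \<and> upset T r U \<and> x \<in> U \<and> y \<notin> U))"

type_synonym ('x, 's) sh_ps = "'x topology \<times> 'x rel \<times> ('x set, 's) presheaf"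
type_synonym ('x, 's) sh_ps_arr = "('x \<Rightarrow> 'x) \<times> ('x set \<Rightarrow> 's \<Rightarrow> 's)"

definition Sh_PS :: "(('x, 's) sh_ps, ('x, 's) sh_ps_arr) category" where
  "Sh_PS = \<lparr>Obj = {(T, r, G). priestley_space T r \<and> sheaf (opens T) G \<and>
                     (\<forall>x\<in>topspace T. stalk T G x \<noteq> {})},
     Hom = (\<lambda>(T, r, G) (T', r', G'). {(h, \<alpha>). h \<in> topspace T \<rightarrow>\<^sub>E topspace T' \<and>
        continuous_map T T' h \<and> (\<forall>x y. (x, y) \<in> r \<longrightarrow> (h x, h y) \<in> r') \<and>
        \<alpha> \<in> sheaf_hom (opens T') G' (pushforward (preimg T h) G)}),
     Ident = (\<lambda>(T, r, G).
        (\<lambda>x\<in>topspace T. x, \<lambda>U\<in>carrier (opens T). \<lambda>s\<in>sections G U. s)),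
     Comp = (\<lambda>(T, r, G) (T', r', G') (T'', r'', G'') (h', \<alpha>') (h, \<alpha>).
        (compose (topspace T) h' h,
         \<lambda>U\<in>carrier (opens T''). \<lambda>s\<in>sections G'' U. \<alpha> (preimg T' h' U) (\<alpha>' U s)))\<rparr>"

definition star_ob :: "('x, 's) sh_ps \<Rightarrow> ('x set \<times> 's) skew_lat" where
  "star_ob = (\<lambda>(T, r, G).
     \<lparr>carrier = {(U, s). U \<in> compact_opens T \<and> upset T r U \<and> s \<in> sections G U},
      smeet = (\<lambda>(U, s) (V, t). (U \<inter> V, res G U (U \<inter> V) s)),
      sjoin = (\<lambda>(U, s) (V, t). (U \<union> V, THE w. w \<in> sections G (U \<union> V) \<and>
         res G (U \<union> V) (U - V) w = res G U (U - V) s \<and> res G (U \<union> V) V w = t)),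
      zer = ({}, THE s. s \<in> sections G {})\<rparr>)"

definition star_arr ::
  "('x, 's) sh_ps \<Rightarrow> ('x, 's) sh_ps \<Rightarrow> ('x, 's) sh_ps_arr \<Rightarrow> 'x set \<times> 's \<Rightarrow> 'x set \<times> 's" where
  "star_arr X' X = (\<lambda>(h, \<alpha>).
     \<lambda>(U, s)\<in>carrier (star_ob X'). (preimg (fst X) h U, \<alpha> U s))"
  \<comment> \<open>contravariant: for \<open>(h, \<alpha>) : X \<rightarrow> X'\<close> this is a map \<open>X'\<^sup>\<star> \<rightarrow> X\<^sup>\<star>\<close>\<close>


section \<open>The functor from sheaves on dissolution locales\<close>

definition prime_filters :: "'l gorder \<Rightarrow> 'l set set" where
  "prime_filters L = {P. P \<subseteq> carrier L \<and> \<top>\<^bsub>L\<^esub> \<in> P \<and> \<bottom>\<^bsub>L\<^esub> \<notin> P \<and>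
     (\<forall>a\<in>P. \<forall>b\<in>carrier L. a \<sqsubseteq>\<^bsub>L\<^esub> b \<longrightarrow> b \<in> P) \<and>
     (\<forall>a\<in>P. \<forall>b\<in>P. a \<sqinter>\<^bsub>L\<^esub> b \<in> P) \<and>
     (\<forall>a\<in>carrier L. \<forall>b\<in>carrier L. a \<squnion>\<^bsub>L\<^esub> b \<in> P \<longrightarrow> a \<in> P \<or> b \<in> P)}"

definition basic_open :: "'l gorder \<Rightarrow> 'l \<Rightarrow> 'l set set" where
  "basic_open L a = {P \<in> prime_filters L. a \<in> P}"

definition spec :: "'l gorder \<Rightarrow> 'l set topology" where
  "spec L = topology_generated_by (basic_open L ` carrier L)"

definition patch :: "'x topology \<Rightarrow> 'x topology" where
  "patch T = topology_generated_by
     (compact_opens T \<union> (\<lambda>U. topspace T - U) ` compact_opens T)"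

definition spec_order :: "'l gorder \<Rightarrow> 'l set rel" where
  "spec_order L = {(P, Q). P \<in> prime_filters L \<and> Q \<in> prime_filters L \<and> P \<subseteq> Q}"

definition i_inv :: "'l gorder \<Rightarrow> 'l set set \<Rightarrow> 'l" where
  "i_inv L W = \<Squnion>\<^bsub>L\<^esub> {a \<in> carrier L. basic_open L a \<subseteq> W}"
  \<comment> \<open>inverse image of \<open>i : Y \<rightarrow> X\<close>: the isomorphism \<open>\<O>(X) \<cong> Idl(L)\<close> sends an open set \<open>W\<close> to the
      ideal of all \<open>a\<close> with \<open>basic_open L a \<subseteq> W\<close>\<close>

definition j_inv :: "'l gorder \<Rightarrow> 'l set set \<Rightarrow> 'l \<Rightarrow> 'l" where
  "j_inv L = (THE h. h \<in> frame_hom (opens (patch (spec L))) (nuclei L) \<and>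
     (\<forall>W. openin (spec L) W \<longrightarrow> h W = closed_nucleus L (i_inv L W)))"
  \<comment> \<open>inverse image of \<open>j : Y\<^sub>d \<rightarrow> X\<^sub>p\<close>, determined by \<open>\<pi> \<circ> j = i \<circ> \<delta>\<close> because the image of a
      compact open set determines that of its complement\<close>

definition spec_ob :: "('l, 's) sh_loc \<Rightarrow> ('l set, 's) sh_ps" where
  "spec_ob = (\<lambda>(L, F). (patch (spec L), spec_order L, pushforward (j_inv L) F))"

definition spec_arr ::
  "('l, 's) sh_loc \<Rightarrow> ('l, 's) sh_loc \<Rightarrow> ('l, 's, 'l, 's) sh_loc_arr \<Rightarrow> ('l set, 's) sh_ps_arr" where
  "spec_arr = (\<lambda>(L, F) (L', F') (f, \<alpha>).
     (\<lambda>P\<in>prime_filters L. {a \<in> carrier L'. f a \<in> P},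
      \<lambda>W\<in>carrier (opens (patch (spec L'))). \<lambda>s\<in>sections F' (j_inv L' W). \<alpha> (j_inv L' W) s))"

definition dual_ob :: "('l, 's) sh_loc \<Rightarrow> ('l set set \<times> 's) skew_lat" where
  "dual_ob X = star_ob (spec_ob X)"

definition dual_arr ::
  "('l, 's) sh_loc \<Rightarrow> ('l, 's) sh_loc \<Rightarrow> ('l, 's, 'l, 's) sh_loc_arr
   \<Rightarrow> 'l set set \<times> 's \<Rightarrow> 'l set set \<times> 's" where
  "dual_arr X' X m = star_arr (spec_ob X') (spec_ob X) (spec_arr X X' m)"
  \<comment> \<open>contravariant, for \<open>m : X \<rightarrow> X'\<close>\<close>

text \<open>
  HOL has no type of all sets, so each of the categories above is one category for every choice of
  the types that hold the carriers. The skew lattice of an object of \<open>Sh_Loc\<^sub>d\<close> over types \<open>'l\<close>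
  and \<open>'s\<close> has its carrier in the type \<open>'a = 'l set set \<times> 's\<close>, and a quasi-inverse produces
  from a noncommutative frame with carrier in a type \<open>'a\<close> a frame of \<open>\<D>\<close>-classes and a sheaf with
  larger value sets; it has to land in \<open>Sh_Loc\<^sub>d\<close> over larger types.
\<close>

type_synonym 'a sh_loc_of = "('a set, 'a set \<Rightarrow> 'a set) sh_loc"
type_synonym 'a sh_loc_of_arr =
  "('a set, 'a set \<Rightarrow> 'a set, 'a set, 'a set \<Rightarrow> 'a set) sh_loc_arr"

end

theory Submission
  imports Defs "HOL-Analysis.Function_Topology"
begin

text \<open>
  The compact open up-sets of the spectrum of a frame \<open>L\<close> are the basic opens, and \<open>j\<close> carries them to
  the closed nuclei \<open>\<nu>\<^sub>b\<close>; so the dual of \<open>(L, F)\<close> is the skew lattice of pairs \<open>(b, s)\<close> with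
  \<open>s \<in> F(\<nu>\<^sub>b)\<close>. The differences \<open>\<nu>\<^sub>b \<and> \<not>\<nu>\<^sub>a\<close> form a basis of \<open>N(L)\<close>, so a section of \<open>F\<close> is locally
  the restriction of a global one, and a morphism of sheaves can be recovered from its action on
  pairs; this gives full faithfulness.

  For essential surjectivity let \<open>t\<close> be a maximal element of \<open>A\<close> and \<open>L\<close> the frame of elements below
  \<open>t\<close>. For \<open>x\<close>, \<open>y\<close> in the maximal \<open>\<D>\<close>-class, the places where they agree form a nucleus \<open>E(x, y)\<close>,
  so this class is a set valued in \<open>N(L)\<close>, with its sheaf of singletons \<open>F\<close>. Join completeness shows
  that every singleton whose extent is a closed nucleus is represented by an element of the class;
  hence \<open>A\<close> is isomorphic to the skew lattice of pairs of \<open>(L, F)\<close>.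
\<close>

section \<open>Frames\<close>

text \<open>Suprema of nuclei have no pointwise formula. They are handled through their upper
  bounds: \<open>diff_nucleus L b a\<close> lies below \<mu> exactly when b \<le> \<mu> a, so
  inequalities between suprema of differences become inequalities in L. The induced maps on nuclei
  and the inverse image of j are obtained in this way; for the latter, preservation of suprema comes
  down to compactness of the patch topology.

  The same obstacle shapes the representation of a singleton \<sigma>. Its extent is the supremum of
  the nuclei \<sigma> x, and to find one x that represents \<sigma> this supremum has to be read off
  at an element of L. Join completeness makes it pointwise: for each a the values \<sigma> x a have
  a greatest one, attained at an element glued from all x. The element attained at bottom represents
  \<sigma> when the extent is a closed nucleus.

  The quasi-inverse has to land in prescribed types; this is why L consists of one-element sets and
  why singletons are recoded by an injective map.\<close>

locale frame_lattice = complete_lattice L for L :: "'l gorder" (structure) +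
  assumes Sup_distrib: "\<lbrakk>a \<in> carrier L; S \<subseteq> carrier L\<rbrakk> \<Longrightarrow> a \<sqinter> \<Squnion>S = \<Squnion>((\<lambda>s. a \<sqinter> s) ` S)"

lemma frame_iff: "frame L \<longleftrightarrow> frame_lattice L"
  unfolding frame_def frame_lattice_def frame_lattice_axioms_def by blast

context complete_lattice
begin

lemma le_meet_iff:
  "\<lbrakk>x \<in> carrier L; y \<in> carrier L; z \<in> carrier L\<rbrakk> \<Longrightarrow> z \<sqsubseteq> x \<sqinter> y \<longleftrightarrow> z \<sqsubseteq> x \<and> z \<sqsubseteq> y"
  by (meson le_trans meet_closed meet_le meet_left meet_right)

lemma join_le_iff:
  "\<lbrakk>x \<in> carrier L; y \<in> carrier L; z \<in> carrier L\<rbrakk> \<Longrightarrow> x \<squnion> y \<sqsubseteq> z \<longleftrightarrow> x \<sqsubseteq> z \<and> y \<sqsubseteq> z"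
  by (meson le_trans join_closed join_le join_left join_right)

lemma Sup_le_iff:
  "\<lbrakk>S \<subseteq> carrier L; z \<in> carrier L\<rbrakk> \<Longrightarrow> \<Squnion>S \<sqsubseteq> z \<longleftrightarrow> (\<forall>s\<in>S. s \<sqsubseteq> z)"
  by (meson le_trans subsetD sup_closed sup_least sup_upper)

lemma eq_if_same_upper_bounds:
  assumes "x \<in> carrier L" "y \<in> carrier L" "\<And>z. z \<in> carrier L \<Longrightarrow> x \<sqsubseteq> z \<longleftrightarrow> y \<sqsubseteq> z"
  shows "x = y"
  using assms by (meson le_antisym le_refl)

lemma eq_if_same_lower_bounds:
  assumes "x \<in> carrier L" "y \<in> carrier L" "\<And>z. z \<in> carrier L \<Longrightarrow> z \<sqsubseteq> x \<longleftrightarrow> z \<sqsubseteq> y"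
  shows "x = y"
  using assms by (meson le_antisym le_refl)

lemma meet_absorb1: "\<lbrakk>x \<in> carrier L; y \<in> carrier L; x \<sqsubseteq> y\<rbrakk> \<Longrightarrow> x \<sqinter> y = x"
  by (metis le_iff_join)

lemma meet_absorb2: "\<lbrakk>x \<in> carrier L; y \<in> carrier L; y \<sqsubseteq> x\<rbrakk> \<Longrightarrow> x \<sqinter> y = y"
  by (metis le_iff_join meet_comm)

lemma join_absorb1: "\<lbrakk>x \<in> carrier L; y \<in> carrier L; y \<sqsubseteq> x\<rbrakk> \<Longrightarrow> x \<squnion> y = x"
  by (metis le_iff_meet join_comm)

lemma join_absorb2: "\<lbrakk>x \<in> carrier L; y \<in> carrier L; x \<sqsubseteq> y\<rbrakk> \<Longrightarrow> x \<squnion> y = y"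
  by (metis le_iff_meet)

lemma meet_top [simp]: "x \<in> carrier L \<Longrightarrow> x \<sqinter> \<top> = x" "x \<in> carrier L \<Longrightarrow> \<top> \<sqinter> x = x"
  by (simp_all add: meet_absorb1 meet_absorb2)

lemma meet_bottom [simp]: "x \<in> carrier L \<Longrightarrow> x \<sqinter> \<bottom> = \<bottom>" "x \<in> carrier L \<Longrightarrow> \<bottom> \<sqinter> x = \<bottom>"
  by (simp_all add: meet_absorb1 meet_absorb2)

lemma join_bottom [simp]: "x \<in> carrier L \<Longrightarrow> x \<squnion> \<bottom> = x" "x \<in> carrier L \<Longrightarrow> \<bottom> \<squnion> x = x"
  by (simp_all add: join_absorb1 join_absorb2)

lemma meet_self [simp]: "x \<in> carrier L \<Longrightarrow> x \<sqinter> x = x"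
  by (simp add: meet_absorb1)

lemma join_self [simp]: "x \<in> carrier L \<Longrightarrow> x \<squnion> x = x"
  by (simp add: join_absorb1)

lemma Sup_empty [simp]: "\<Squnion>{} = \<bottom>"
  using weak_sup_empty eq_is_equal by simp

lemma top_unique: "\<lbrakk>x \<in> carrier L; \<top> \<sqsubseteq> x\<rbrakk> \<Longrightarrow> x = \<top>"
  by (simp add: le_antisym)

lemma bottom_unique: "\<lbrakk>x \<in> carrier L; x \<sqsubseteq> \<bottom>\<rbrakk> \<Longrightarrow> x = \<bottom>"
  by (simp add: le_antisym)

lemma meet_mono:
  "\<lbrakk>x \<sqsubseteq> x'; y \<sqsubseteq> y'; x \<in> carrier L; x' \<in> carrier L; y \<in> carrier L; y' \<in> carrier L\<rbrakk> \<Longrightarrow> x \<sqinter> y \<sqsubseteq> x' \<sqinter> y'"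
  by (meson le_trans meet_closed meet_le meet_left meet_right)

end

context frame_lattice
begin

text \<open>Distributivity applied on one side and then on the other. It serves whenever two
  elements are known only as suprema, such as nuclei written as suprema of differences.\<close>

lemma Sup_meet_Sup_le:
  assumes "S \<subseteq> carrier L" "T \<subseteq> carrier L" "z \<in> carrier L"
    and "\<And>s t. \<lbrakk>s \<in> S; t \<in> T\<rbrakk> \<Longrightarrow> s \<sqinter> t \<sqsubseteq> z"
  shows "\<Squnion>S \<sqinter> \<Squnion>T \<sqsubseteq> z"
proof -
  have *: "s \<sqinter> \<Squnion>T \<sqsubseteq> z" if "s \<in> S" for s
    using assms that by (subst Sup_distrib) (auto 0 3 intro!: sup_least intro: meet_closed)
  have "\<Squnion>T \<sqinter> \<Squnion>S \<sqsubseteq> z"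
    using assms * by (subst Sup_distrib) (auto 0 3 intro!: sup_least simp: meet_comm[of L "\<Squnion>T"])
  then show ?thesis by (simp add: meet_comm)
qed

lemma meet_Sup_le:
  assumes "S \<subseteq> carrier L" "x \<in> carrier L" "z \<in> carrier L" "\<And>s. s \<in> S \<Longrightarrow> x \<sqinter> s \<sqsubseteq> z"
  shows "x \<sqinter> \<Squnion>S \<sqsubseteq> z"
  using Sup_meet_Sup_le[of "{x}" S z] assms by auto

lemma meet_join_distrib:
  assumes "x \<in> carrier L" "y \<in> carrier L" "z \<in> carrier L"
  shows "x \<sqinter> (y \<squnion> z) = (x \<sqinter> y) \<squnion> (x \<sqinter> z)"
  unfolding join_def using Sup_distrib[of x "{y, z}"] assms by simp

lemma join_meet_distrib:
  assumes "x \<in> carrier L" "y \<in> carrier L" "z \<in> carrier L"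
  shows "x \<squnion> (y \<sqinter> z) = (x \<squnion> y) \<sqinter> (x \<squnion> z)"
proof -
  have "(x \<squnion> y) \<sqinter> (x \<squnion> z) = ((x \<squnion> y) \<sqinter> x) \<squnion> ((x \<squnion> y) \<sqinter> z)"
    using assms by (simp add: meet_join_distrib)
  also have "(x \<squnion> y) \<sqinter> x = x"
    using assms by (simp add: meet_absorb2 join_left)
  also have "(x \<squnion> y) \<sqinter> z = (x \<sqinter> z) \<squnion> (y \<sqinter> z)"
    using assms by (metis join_closed meet_comm meet_join_distrib)
  also have "x \<squnion> ((x \<sqinter> z) \<squnion> (y \<sqinter> z)) = (x \<squnion> (x \<sqinter> z)) \<squnion> (y \<sqinter> z)"
    using assms by (simp add: join_assoc)
  also have "x \<squnion> (x \<sqinter> z) = x"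
    using assms by (simp add: join_absorb1 meet_left)
  finally show ?thesis ..
qed

text \<open>Distributing y over \<top> = x \<squnion> z and z over \<top> = x \<squnion> y shows
  that both equal y \<sqinter> z. Used to pin down the value of a frame morphism on a complemented
  element.\<close>

lemma complement_unique:
  assumes "x \<in> carrier L" "y \<in> carrier L" "z \<in> carrier L"
    and "x \<sqinter> y = \<bottom>" "x \<squnion> y = \<top>" "x \<sqinter> z = \<bottom>" "x \<squnion> z = \<top>"
  shows "y = z"
proof -
  have "y = y \<sqinter> (x \<squnion> z)" using assms by simp
  also have "\<dots> = (y \<sqinter> x) \<squnion> (y \<sqinter> z)" using assms by (intro meet_join_distrib)
  also have "\<dots> = y \<sqinter> z" using assms by (simp add: meet_comm)
  finally have 1: "y = y \<sqinter> z" .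
  have "z = z \<sqinter> (x \<squnion> y)" using assms by simp
  also have "\<dots> = (z \<sqinter> x) \<squnion> (z \<sqinter> y)" using assms by (intro meet_join_distrib)
  also have "\<dots> = z \<sqinter> y" using assms by (simp add: meet_comm)
  finally show ?thesis using 1 by (simp add: meet_comm)
qed

end

definition himp :: "'l gorder \<Rightarrow> 'l \<Rightarrow> 'l \<Rightarrow> 'l" where
  "himp L a b = \<Squnion>\<^bsub>L\<^esub>{c \<in> carrier L. c \<sqinter>\<^bsub>L\<^esub> a \<sqsubseteq>\<^bsub>L\<^esub> b}"

lemma (in frame_lattice) himp_closed [simp]: "himp L a b \<in> carrier L"
  unfolding himp_def by (rule sup_closed) auto

lemma (in frame_lattice) le_himp_iff:
  assumes "a \<in> carrier L" "b \<in> carrier L" "c \<in> carrier L"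
  shows "c \<sqsubseteq> himp L a b \<longleftrightarrow> c \<sqinter> a \<sqsubseteq> b"
proof
  assume "c \<sqinter> a \<sqsubseteq> b" then show "c \<sqsubseteq> himp L a b"
    unfolding himp_def using assms by (auto intro!: sup_upper)
next
  assume "c \<sqsubseteq> himp L a b"
  moreover have "a \<sqinter> himp L a b \<sqsubseteq> b"
    unfolding himp_def using assms by (intro meet_Sup_le) (auto simp: meet_comm)
  moreover have "a \<sqinter> c \<sqsubseteq> a \<sqinter> himp L a b" using assms calculation(1) by (intro meet_mono) auto
  ultimately show "c \<sqinter> a \<sqsubseteq> b"
    using assms le_trans[of "a \<sqinter> c" "a \<sqinter> himp L a b" b] by (simp add: meet_comm[of L c a])
qed


lemma (in frame_lattice) himp_meet_le: "\<lbrakk>a \<in> carrier L; b \<in> carrier L\<rbrakk> \<Longrightarrow> himp L a b \<sqinter> a \<sqsubseteq> b"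
  using le_himp_iff[of a b "himp L a b"] by simp


section \<open>Nuclei\<close>

abbreviation nucleus_le (infixl "\<preceq>\<index>" 50) where "nucleus_le L \<equiv> le (nuclei L)"
abbreviation nucs :: "'l gorder \<Rightarrow> ('l \<Rightarrow> 'l) set" where "nucs L \<equiv> carrier (nuclei L)"

lemma nuclei_le: "\<mu> \<preceq>\<^bsub>L\<^esub> \<nu> \<longleftrightarrow> (\<forall>a\<in>carrier L. \<mu> a \<sqsubseteq>\<^bsub>L\<^esub> \<nu> a)"
  by (simp add: nuclei_def)

definition open_nucleus :: "'l gorder \<Rightarrow> 'l \<Rightarrow> 'l \<Rightarrow> 'l" where
  "open_nucleus L a = (\<lambda>b\<in>carrier L. himp L a b)"

definition diff_nucleus :: "'l gorder \<Rightarrow> 'l \<Rightarrow> 'l \<Rightarrow> 'l \<Rightarrow> 'l" where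
  "diff_nucleus L b a = closed_nucleus L b \<sqinter>\<^bsub>nuclei L\<^esub> open_nucleus L a"
  \<comment> \<open>the part of the dissolution locale lying over \<open>b - a\<close>\<close>

context frame_lattice
begin

lemma nucleus_closed: "\<lbrakk>\<nu> \<in> nucs L; a \<in> carrier L\<rbrakk> \<Longrightarrow> \<nu> a \<in> carrier L"
  by (auto simp: nuclei_def)

lemma nucleus_inflationary: "\<lbrakk>\<nu> \<in> nucs L; a \<in> carrier L\<rbrakk> \<Longrightarrow> a \<sqsubseteq> \<nu> a"
  by (auto simp: nuclei_def)

lemma nucleus_idem: "\<lbrakk>\<nu> \<in> nucs L; a \<in> carrier L\<rbrakk> \<Longrightarrow> \<nu> (\<nu> a) = \<nu> a"
  by (auto simp: nuclei_def)

lemma nucleus_meet: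
  "\<lbrakk>\<nu> \<in> nucs L; a \<in> carrier L; b \<in> carrier L\<rbrakk> \<Longrightarrow> \<nu> (a \<sqinter> b) = \<nu> a \<sqinter> \<nu> b"
  by (auto simp: nuclei_def)

lemma nucleus_mono:
  "\<lbrakk>\<nu> \<in> nucs L; a \<in> carrier L; b \<in> carrier L; a \<sqsubseteq> b\<rbrakk> \<Longrightarrow> \<nu> a \<sqsubseteq> \<nu> b"
  by (metis meet_absorb1 meet_right nucleus_closed nucleus_meet)

text \<open>The equalities in the definition of a nucleus follow from inequalities: inflation gives
  the other half of idempotence, monotonicity the other half of meet preservation.\<close>

lemma nucleusI:
  assumes "\<nu> \<in> extensional (carrier L)"
    and "\<And>a. a \<in> carrier L \<Longrightarrow> \<nu> a \<in> carrier L"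
    and "\<And>a. a \<in> carrier L \<Longrightarrow> a \<sqsubseteq> \<nu> a"
    and "\<And>a. a \<in> carrier L \<Longrightarrow> \<nu> (\<nu> a) \<sqsubseteq> \<nu> a"
    and mono: "\<And>a b. \<lbrakk>a \<in> carrier L; b \<in> carrier L; a \<sqsubseteq> b\<rbrakk> \<Longrightarrow> \<nu> a \<sqsubseteq> \<nu> b"
    and "\<And>a b. \<lbrakk>a \<in> carrier L; b \<in> carrier L\<rbrakk> \<Longrightarrow> \<nu> a \<sqinter> \<nu> b \<sqsubseteq> \<nu> (a \<sqinter> b)"
  shows "\<nu> \<in> nucs L"
proof -
  have "\<nu> (\<nu> a) = \<nu> a" if "a \<in> carrier L" for a
    using assms that by (auto intro!: le_antisym)
  moreover have "\<nu> (a \<sqinter> b) = \<nu> a \<sqinter> \<nu> b" if "a \<in> carrier L" "b \<in> carrier L" for a b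
    using assms that by (auto intro!: le_antisym simp: le_meet_iff meet_left meet_right mono)
  ultimately show ?thesis
    using assms by (auto simp: nuclei_def PiE_def)
qed

lemma nucleus_eqI:
  "\<lbrakk>\<mu> \<in> nucs L; \<nu> \<in> nucs L; \<And>a. a \<in> carrier L \<Longrightarrow> \<mu> a = \<nu> a\<rbrakk> \<Longrightarrow> \<mu> = \<nu>"
  by (auto simp: nuclei_def intro: PiE_ext)

lemma nuclei_partial_order: "partial_order (nuclei L)"
proof -
  have eq: "(.=\<^bsub>nuclei L\<^esub>) = (=)" by (simp add: nuclei_def)
  show ?thesis
  proof (unfold_locales, unfold eq)
    fix x y assume *: "x \<preceq> y" "y \<preceq> x" "x \<in> nucs L" "y \<in> nucs L"
    show "x = y"
      using *(3,4)
    proof (rule nucleus_eqI)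
      fix a assume "a \<in> carrier L"
      then show "x a = y a" using * by (intro le_antisym) (auto simp: nuclei_le nucleus_closed)
    qed
  next
    fix x y z assume "x \<preceq> y" "y \<preceq> z" "x \<in> nucs L" "y \<in> nucs L"
      "z \<in> nucs L"
    then show "x \<preceq> z"
      unfolding nuclei_le using nucleus_closed le_trans by (metis (no_types, lifting))
  qed (simp_all add: nuclei_le nucleus_closed)
qed

text \<open>Each axiom for \<rho> is tested against every member of S, since x \<sqsubseteq> \<rho>
  a only asks for x \<sqsubseteq> \<nu> a. The same recipe fails for suprema, where idempotence
  breaks down. The empty family is allowed and gives the constant map to the top.\<close>

lemma pointwise_Inf_nucleus:
  assumes "S \<subseteq> nucs L"
  defines "\<rho> \<equiv> \<lambda>a\<in>carrier L. \<Sqinter>((\<lambda>\<nu>. \<nu> a) ` S)"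
  shows "\<rho> \<in> nucs L"
    and "\<And>\<mu>. \<mu> \<in> nucs L \<Longrightarrow> \<mu> \<preceq> \<rho> \<longleftrightarrow> (\<forall>\<nu>\<in>S. \<mu> \<preceq> \<nu>)"
proof -
  have sub: "(\<lambda>\<nu>. \<nu> a) ` S \<subseteq> carrier L" if "a \<in> carrier L" for a
    using assms(1) that by (auto intro: nucleus_closed)
  have closed: "\<rho> a \<in> carrier L" if "a \<in> carrier L" for a
    using that sub by (simp add: \<rho>_def)
  have le: "x \<sqsubseteq> \<rho> a \<longleftrightarrow> (\<forall>\<nu>\<in>S. x \<sqsubseteq> \<nu> a)" if "a \<in> carrier L" "x \<in> carrier L" for a x
  proof
    assume "x \<sqsubseteq> \<rho> a"
    moreover have "\<rho> a \<sqsubseteq> \<nu> a" if "\<nu> \<in> S" for \<nu>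
      using that \<open>a \<in> carrier L\<close> sub by (auto simp: \<rho>_def intro!: inf_lower)
    ultimately show "\<forall>\<nu>\<in>S. x \<sqsubseteq> \<nu> a"
      using that sub closed le_trans by (meson assms(1) nucleus_closed subsetD)
  next
    assume "\<forall>\<nu>\<in>S. x \<sqsubseteq> \<nu> a" then show "x \<sqsubseteq> \<rho> a"
      using that sub[of a] unfolding \<rho>_def by (simp add: image_subset_iff) (rule inf_greatest, auto)
  qed
  have lower: "\<rho> a \<sqsubseteq> \<nu> a" if "a \<in> carrier L" "\<nu> \<in> S" for a \<nu>
    using le[OF that(1) closed[OF that(1)]] that closed by auto
  show "\<rho> \<in> nucs L"
  proof (rule nucleusI)
    show "\<rho> \<in> extensional (carrier L)" by (simp add: \<rho>_def)
  next
    fix a assume a: "a \<in> carrier L"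
    then show "a \<sqsubseteq> \<rho> a"
      using assms(1) by (auto simp: le nucleus_inflationary subsetD)
    have "\<rho> (\<rho> a) \<sqsubseteq> \<nu> a" if "\<nu> \<in> S" for \<nu>
    proof -
      have \<nu>: "\<nu> \<in> nucs L" using that assms by auto
      have "\<rho> (\<rho> a) \<sqsubseteq> \<nu> (\<rho> a)" using lower closed a that by simp
      also have "\<nu> (\<rho> a) \<sqsubseteq> \<nu> (\<nu> a)"
        using lower closed a that \<nu> by (simp add: nucleus_mono nucleus_closed)
      finally show ?thesis using \<nu> a closed by (simp add: nucleus_idem nucleus_closed)
    qed
    then show "\<rho> (\<rho> a) \<sqsubseteq> \<rho> a"
      using a closed by (simp add: le)
  next
    fix a b assume a: "a \<in> carrier L" and b: "b \<in> carrier L"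
    { assume ab: "a \<sqsubseteq> b"
      have "\<rho> a \<sqsubseteq> \<nu> b" if "\<nu> \<in> S" for \<nu>
        using lower[OF a that] nucleus_mono[of \<nu> a b] that assms(1) a b ab closed
        by (meson le_trans nucleus_closed subsetD)
      then show "\<rho> a \<sqsubseteq> \<rho> b" using a b closed by (simp add: le)
    }
    have "\<rho> a \<sqinter> \<rho> b \<sqsubseteq> \<nu> (a \<sqinter> b)" if "\<nu> \<in> S" for \<nu>
      using lower[OF a that] lower[OF b that] that assms(1) a b closed nucleus_meet[of \<nu> a b]
      by (simp add: meet_mono nucleus_closed subsetD)
    then show "\<rho> a \<sqinter> \<rho> b \<sqsubseteq> \<rho> (a \<sqinter> b)" using a b closed by (simp add: le)
  qed (rule closed)
  show "\<mu> \<preceq> \<rho> \<longleftrightarrow> (\<forall>\<nu>\<in>S. \<mu> \<preceq> \<nu>)" if "\<mu> \<in> nucs L" for \<mu>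
    using that by (auto simp: nuclei_le le nucleus_closed)
qed

text \<open>Infima suffice for completeness, the empty one being the top. Suprema thereby exist, but
  are accessible only through their universal property.\<close>

lemma nuclei_complete_lattice: "complete_lattice (nuclei L)"
proof -
  interpret N: partial_order "nuclei L" by (rule nuclei_partial_order)
  have inf: "\<exists>i. greatest (nuclei L) i (Lower (nuclei L) S)" if S: "S \<subseteq> nucs L" for S
  proof -
    define \<rho> where "\<rho> = (\<lambda>a\<in>carrier L. \<Sqinter>((\<lambda>\<nu>. \<nu> a) ` S))"
    note \<rho> = pointwise_Inf_nucleus[OF S, folded \<rho>_def]
    have "greatest (nuclei L) \<rho> (Lower (nuclei L) S)"
      using \<rho> S \<rho>(2)[OF \<rho>(1)] N.le_refl[OF \<rho>(1)] by (intro greatest_LowerI) (auto simp: Lower_def)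
    then show ?thesis by (intro exI[of _ \<rho>])
  qed
  show ?thesis
  proof (rule N.complete_lattice_criterion1)
    show "\<exists>g. greatest (nuclei L) g (nucs L)"
      using inf[of "{}"] by simp
  qed (use inf in blast)
qed

text \<open>Distributivity follows from a Heyting implication: if \<tau> is the supremum of all
  \<nu> \<sqinter> s and some nucleus \<rho> lies above every s in S while \<nu> \<sqinter> \<rho>
  lies below \<tau>, then \<rho> bounds the supremum of S. The implication takes a to the infimum of
  \<open>himp L (\<nu> b) (\<tau> b)\<close> over all b above a; ranging over these b, instead of a
  alone, makes it monotone.\<close>

lemma nuclei_frame: "frame_lattice (nuclei L)"
proof -
  interpret N: complete_lattice "nuclei L" by (rule nuclei_complete_lattice)
  have meet: "(\<mu> \<sqinter>\<^bsub>nuclei L\<^esub> \<nu>) a = \<mu> a \<sqinter> \<nu> a"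
    if "\<mu> \<in> nucs L" "\<nu> \<in> nucs L" "a \<in> carrier L" for \<mu> \<nu> a
  proof -
    define \<rho> where "\<rho> = (\<lambda>a\<in>carrier L. \<Sqinter>((\<lambda>\<nu>. \<nu> a) ` {\<mu>, \<nu>}))"
    have "{\<mu>, \<nu>} \<subseteq> nucs L" using that by auto
    note \<rho> = pointwise_Inf_nucleus[OF this, folded \<rho>_def]
    have "\<mu> \<sqinter>\<^bsub>nuclei L\<^esub> \<nu> = \<rho>"
      using that \<rho> by (intro N.eq_if_same_lower_bounds) (auto simp: N.le_meet_iff)
    then show ?thesis using that by (simp add: \<rho>_def meet_def)
  qed
  show ?thesis
  proof (intro frame_lattice.intro frame_lattice_axioms.intro N.complete_lattice_axioms)
    fix \<nu> S assume \<nu>: "\<nu> \<in> nucs L" and S: "S \<subseteq> nucs L"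
    let ?m = "\<lambda>s. \<nu> \<sqinter>\<^bsub>nuclei L\<^esub> s"
    have im: "?m ` S \<subseteq> nucs L" using \<nu> S by auto
    define \<tau> where "\<tau> = \<Squnion>\<^bsub>nuclei L\<^esub>(?m ` S)"
    have \<tau>: "\<tau> \<in> nucs L" unfolding \<tau>_def by (rule N.sup_closed[OF im])
    \<comment> \<open>The Heyting implication \<open>\<nu> \<rightarrow> \<tau>\<close> in the lattice of nuclei.\<close>
    define \<rho> where "\<rho> = (\<lambda>a\<in>carrier L. \<Sqinter>((\<lambda>b. himp L (\<nu> b) (\<tau> b)) ` {b \<in> carrier L. a \<sqsubseteq> b}))"
    have closed: "\<rho> a \<in> carrier L" if "a \<in> carrier L" for a
      using that by (simp add: \<rho>_def image_subsetI)
    have le: "x \<sqsubseteq> \<rho> a \<longleftrightarrow> (\<forall>b\<in>carrier L. a \<sqsubseteq> b \<longrightarrow> x \<sqinter> \<nu> b \<sqsubseteq> \<tau> b)"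
      if "a \<in> carrier L" "x \<in> carrier L" for a x
    proof -
      have "x \<sqsubseteq> \<rho> a \<longleftrightarrow> (\<forall>b\<in>carrier L. a \<sqsubseteq> b \<longrightarrow> x \<sqsubseteq> himp L (\<nu> b) (\<tau> b))"
      proof -
        let ?I = "(\<lambda>b. himp L (\<nu> b) (\<tau> b)) ` {b \<in> carrier L. a \<sqsubseteq> b}"
        have I: "?I \<subseteq> carrier L" by auto
        have "x \<sqsubseteq> \<Sqinter>?I \<longleftrightarrow> (\<forall>i\<in>?I. x \<sqsubseteq> i)"
          using I that inf_lower[OF I] inf_greatest[OF I]
          by (meson inf_closed le_trans subsetD)
        then show ?thesis using that by (auto simp: \<rho>_def)
      qed
      then show ?thesis using \<nu> \<tau> that by (simp add: le_himp_iff nucleus_closed)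
    qed
    have ap: "\<rho> a \<sqinter> \<nu> b \<sqsubseteq> \<tau> b" if "a \<in> carrier L" "b \<in> carrier L" "a \<sqsubseteq> b" for a b
      using le[OF that(1) closed[OF that(1)]] that closed by auto
    have mono: "\<rho> a \<sqsubseteq> \<rho> b" if "a \<in> carrier L" "b \<in> carrier L" "a \<sqsubseteq> b" for a b
      using that closed ap by (simp add: le) (meson le_trans)
    have \<rho>: "\<rho> \<in> nucs L"
    proof (rule nucleusI)
      show "\<rho> \<in> extensional (carrier L)" by (simp add: \<rho>_def)
    next
      have infl0: "a \<sqsubseteq> \<rho> a" if a: "a \<in> carrier L" for a
      proof -
        have "a \<sqinter> \<nu> b \<sqsubseteq> \<tau> b" if "b \<in> carrier L" "a \<sqsubseteq> b" for b
          using that a \<nu> \<tau> nucleus_inflationary[OF \<tau>, of b]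
          by (meson le_trans meet_closed meet_left nucleus_closed)
        then show ?thesis using a by (simp add: le)
      qed
      fix a assume a: "a \<in> carrier L"
      show "a \<sqsubseteq> \<rho> a" by (rule infl0[OF a])
      have "\<rho> (\<rho> a) \<sqinter> \<nu> b \<sqsubseteq> \<tau> b" if b: "b \<in> carrier L" "a \<sqsubseteq> b" for b
      proof -
        let ?x = "\<rho> (\<rho> a) \<sqinter> \<nu> b"
        have c: "?x \<in> carrier L" "\<rho> b \<in> carrier L" "\<nu> b \<in> carrier L" "\<nu> (\<rho> b) \<in> carrier L"
          "\<rho> (\<rho> b) \<in> carrier L" "\<rho> (\<rho> a) \<in> carrier L"
          using a b closed \<nu> by (auto simp: nucleus_closed)
        have ct: "\<tau> (\<rho> b) \<in> carrier L" "\<tau> (\<nu> b) \<in> carrier L" using c \<tau> by (auto simp: nucleus_closed)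
        have infl: "b \<sqsubseteq> \<rho> b"
          by (rule infl0[OF b(1)])
        \<comment> \<open>The outer \<rho> is used at the argument \<rho> b, which gives the bound
          \<tau> (\<rho> b). Together with the bound \<tau> (\<nu> b) this is \<tau> (\<rho> b
          \<sqinter> \<nu> b), where the inner \<rho> applies, and \<tau> is idempotent.\<close>
        have "?x \<sqsubseteq> \<rho> (\<rho> b) \<sqinter> \<nu> (\<rho> b)"
          using a b c mono[of "\<rho> a" "\<rho> b"] mono[OF a b(1) b(2)] infl closed nucleus_mono[OF \<nu> b(1) c(2)]
          by (intro meet_mono) auto
        also have "\<dots> \<sqsubseteq> \<tau> (\<rho> b)" using c by (intro ap) auto
        finally have 1: "?x \<sqsubseteq> \<tau> (\<rho> b)" using c ct by simp
        have "?x \<sqsubseteq> \<nu> b" using c by (simp add: meet_right)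
        also have "\<nu> b \<sqsubseteq> \<tau> (\<nu> b)" using c \<tau> by (simp add: nucleus_inflationary)
        finally have 2: "?x \<sqsubseteq> \<tau> (\<nu> b)" using c ct by simp
        have "?x \<sqsubseteq> \<tau> (\<rho> b \<sqinter> \<nu> b)" using 1 2 c ct \<tau> by (simp add: nucleus_meet le_meet_iff)
        also have "\<tau> (\<rho> b \<sqinter> \<nu> b) \<sqsubseteq> \<tau> (\<tau> b)"
          using c b ap[OF b(1) b(1)] nucleus_closed[OF \<tau> b(1)] by (intro nucleus_mono[OF \<tau>]) auto
        finally show ?thesis using b c \<tau> by (simp add: nucleus_idem nucleus_closed)
      qed
      then show "\<rho> (\<rho> a) \<sqsubseteq> \<rho> a" using a closed by (simp add: le)
    next
      fix a b assume a: "a \<in> carrier L" and b: "b \<in> carrier L"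
      have "(\<rho> a \<sqinter> \<rho> b) \<sqinter> \<nu> d \<sqsubseteq> \<tau> d" if d: "d \<in> carrier L" "a \<sqinter> b \<sqsubseteq> d" for d
      proof -
        let ?x = "(\<rho> a \<sqinter> \<rho> b) \<sqinter> \<nu> d"
        have c: "?x \<in> carrier L" "\<rho> a \<in> carrier L" "\<rho> b \<in> carrier L" "\<nu> d \<in> carrier L"
          "d \<squnion> a \<in> carrier L" "d \<squnion> b \<in> carrier L" "\<nu> (d \<squnion> a) \<in> carrier L" "\<nu> (d \<squnion> b) \<in> carrier L"
          using a b d closed \<nu> by (auto simp: nucleus_closed)
        have ct: "\<tau> (d \<squnion> a) \<in> carrier L" "\<tau> (d \<squnion> b) \<in> carrier L" using c \<tau> by (auto simp: nucleus_closed)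
        \<comment> \<open>The arguments d \<squnion> a and d \<squnion> b are admissible for \<rho>
          a and \<rho> b, and by distributivity their meet is d again, since a \<sqinter> b
          \<sqsubseteq> d.\<close>
        have "?x \<sqsubseteq> \<rho> a \<sqinter> \<nu> (d \<squnion> a)"
          using c a b d \<nu> by (intro meet_mono nucleus_mono[OF \<nu>]) (auto simp: meet_left join_left)
        also have "\<dots> \<sqsubseteq> \<tau> (d \<squnion> a)" using a d by (intro ap) (auto simp: join_right)
        finally have 1: "?x \<sqsubseteq> \<tau> (d \<squnion> a)" using c ct by simp
        have "?x \<sqsubseteq> \<rho> b \<sqinter> \<nu> (d \<squnion> b)"
          using c a b d \<nu> by (intro meet_mono nucleus_mono[OF \<nu>]) (auto simp: meet_right join_left)
        also have "\<dots> \<sqsubseteq> \<tau> (d \<squnion> b)" using b d by (intro ap) (auto simp: join_right)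
        finally have 2: "?x \<sqsubseteq> \<tau> (d \<squnion> b)" using c ct by simp
        have "?x \<sqsubseteq> \<tau> ((d \<squnion> a) \<sqinter> (d \<squnion> b))" using 1 2 c ct \<tau> by (simp add: nucleus_meet le_meet_iff)
        also have "(d \<squnion> a) \<sqinter> (d \<squnion> b) = d"
          using a b d by (simp add: join_absorb1 flip: join_meet_distrib)
        finally show ?thesis .
      qed
      then show "\<rho> a \<sqinter> \<rho> b \<sqsubseteq> \<rho> (a \<sqinter> b)" using a b closed by (simp add: le)
    qed (use closed mono in auto)
    have "s \<preceq> \<rho>" if s: "s \<in> S" for s
    proof -
      have sN: "s \<in> nucs L" using s S by auto
      have "s a \<sqinter> \<nu> b \<sqsubseteq> \<tau> b" if ab: "a \<in> carrier L" "b \<in> carrier L" "a \<sqsubseteq> b" for a b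
      proof -
        have "?m s \<preceq> \<tau>" unfolding \<tau>_def using im s by (auto intro: N.sup_upper)
        then have "\<nu> b \<sqinter> s b \<sqsubseteq> \<tau> b" using meet[OF \<nu> sN ab(2)] ab by (auto simp: nuclei_le)
        moreover have "s a \<sqsubseteq> s b" by (rule nucleus_mono[OF sN ab])
        then have "s a \<sqinter> \<nu> b \<sqsubseteq> \<nu> b \<sqinter> s b"
          using ab nucleus_closed[OF sN] nucleus_closed[OF \<nu>]
          by (subst meet_comm[of L "s a" "\<nu> b"], intro meet_mono) auto
        ultimately show ?thesis using ab sN \<nu> \<tau> by (meson le_trans meet_closed nucleus_closed)
      qed
      then show ?thesis using sN by (auto simp: nuclei_le le nucleus_closed)
    qed
    then have "\<Squnion>\<^bsub>nuclei L\<^esub>S \<preceq> \<rho>" using S \<rho> by (simp add: N.Sup_le_iff)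
    then have le_\<rho>: "(\<Squnion>\<^bsub>nuclei L\<^esub>S) a \<sqsubseteq> \<rho> a" if "a \<in> carrier L" for a using that by (simp add: nuclei_le)
    have SS: "\<Squnion>\<^bsub>nuclei L\<^esub>S \<in> nucs L" using S by simp
    have "\<nu> a \<sqinter> (\<Squnion>\<^bsub>nuclei L\<^esub>S) a \<sqsubseteq> \<tau> a" if a: "a \<in> carrier L" for a
    proof -
      have "\<nu> a \<sqinter> (\<Squnion>\<^bsub>nuclei L\<^esub>S) a \<sqsubseteq> \<nu> a \<sqinter> \<rho> a"
        using a le_\<rho> nucleus_closed[OF \<nu>] nucleus_closed[OF SS] nucleus_closed[OF \<rho>] by (intro meet_mono) auto
      also have "\<dots> \<sqsubseteq> \<tau> a" using ap[OF a a] a by (simp add: meet_comm)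
      finally show ?thesis using a \<nu> \<rho> \<tau> SS by (simp add: nucleus_closed)
    qed
    then have "?m (\<Squnion>\<^bsub>nuclei L\<^esub>S) \<preceq> \<tau>"
      using SS \<nu> by (simp add: nuclei_le meet)
    moreover have "\<tau> \<preceq> ?m (\<Squnion>\<^bsub>nuclei L\<^esub>S)"
      unfolding \<tau>_def
    proof (rule N.sup_least[OF im])
      fix x assume "x \<in> ?m ` S"
      then obtain s where s: "s \<in> S" "x = ?m s" by auto
      then have "s \<in> nucs L" using S by auto
      then show "x \<preceq> ?m (\<Squnion>\<^bsub>nuclei L\<^esub>S)"
        using s \<nu> S SS by (simp add: N.meet_mono N.sup_upper)
    qed (use \<nu> SS in simp)
    ultimately show "?m (\<Squnion>\<^bsub>nuclei L\<^esub>S) = \<Squnion>\<^bsub>nuclei L\<^esub>(?m ` S)"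
      unfolding \<tau>_def[symmetric] using \<tau> SS \<nu> by (intro N.le_antisym) auto
  qed
qed

end

text \<open>A copy of \<open>frame_lattice\<close> under its own name: the frame of nuclei is
  attached to the copy as a plain frame, so that the construction is not iterated.\<close>

locale dissolution = frame_lattice

sublocale dissolution \<subseteq> N: frame_lattice "nuclei L"
  by (rule nuclei_frame)

lemma dissolution_iff: "dissolution L \<longleftrightarrow> frame L"
  by (simp add: dissolution_def frame_iff)

section \<open>Closed, open and difference nuclei\<close>

context dissolution
begin

lemma meet_nucleus_apply:
  assumes "\<mu> \<in> nucs L" "\<nu> \<in> nucs L" "a \<in> carrier L"
  shows "(\<mu> \<sqinter>\<^bsub>nuclei L\<^esub> \<nu>) a = \<mu> a \<sqinter> \<nu> a"
proof -
  define \<rho> where "\<rho> = (\<lambda>a\<in>carrier L. \<Sqinter>((\<lambda>\<nu>. \<nu> a) ` {\<mu>, \<nu>}))"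
  have "{\<mu>, \<nu>} \<subseteq> nucs L" using assms by auto
  note \<rho> = pointwise_Inf_nucleus[OF this, folded \<rho>_def]
  have "\<mu> \<sqinter>\<^bsub>nuclei L\<^esub> \<nu> = \<rho>"
    using assms \<rho> by (intro N.eq_if_same_lower_bounds) (auto simp: N.le_meet_iff)
  then show ?thesis using assms by (simp add: \<rho>_def meet_def)
qed

lemma closed_nucleus [simp]:
  assumes "a \<in> carrier L" shows "closed_nucleus L a \<in> nucs L"
proof (rule nucleusI)
  fix x y assume "x \<in> carrier L" "y \<in> carrier L"
  then show "closed_nucleus L a x \<sqinter> closed_nucleus L a y \<sqsubseteq> closed_nucleus L a (x \<sqinter> y)"
    using assms by (simp add: closed_nucleus_def join_meet_distrib)
next
  fix x y assume "x \<in> carrier L" "y \<in> carrier L" "x \<sqsubseteq> y"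
  then show "closed_nucleus L a x \<sqsubseteq> closed_nucleus L a y"
    using assms by (simp add: closed_nucleus_def join_le_iff join_left)
      (meson join_closed join_right le_trans)
qed (use assms in \<open>auto simp: closed_nucleus_def join_right join_left join_le_iff\<close>)

lemma open_nucleus [simp]:
  assumes "a \<in> carrier L" shows "open_nucleus L a \<in> nucs L"
proof (rule nucleusI)
  fix x y assume x: "x \<in> carrier L" and y: "y \<in> carrier L"
  let ?h = "himp L a"
  have mp: "?h z \<sqinter> a \<sqsubseteq> z" if "z \<in> carrier L" for z
    using le_himp_iff[of a z "?h z"] assms that by simp
  have "(?h x \<sqinter> ?h y) \<sqinter> a \<sqsubseteq> x" "(?h x \<sqinter> ?h y) \<sqinter> a \<sqsubseteq> y"
    using mp[OF x] mp[OF y] assms x y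
    by (meson himp_closed le_refl le_trans meet_closed meet_left meet_right meet_mono)+
  then show "open_nucleus L a x \<sqinter> open_nucleus L a y \<sqsubseteq> open_nucleus L a (x \<sqinter> y)"
    using assms x y by (simp add: open_nucleus_def le_himp_iff le_meet_iff)
next
  fix x y assume "x \<in> carrier L" "y \<in> carrier L" "x \<sqsubseteq> y"
  then show "open_nucleus L a x \<sqsubseteq> open_nucleus L a y"
    using assms by (simp add: open_nucleus_def le_himp_iff)
      (meson himp_closed le_himp_iff le_refl le_trans meet_closed)
next
  fix x assume x: "x \<in> carrier L"
  let ?h = "himp L a"
  have mp: "?h z \<sqinter> a \<sqsubseteq> z" if "z \<in> carrier L" for z
    using le_himp_iff[of a z "?h z"] assms that by simp
  have "?h (?h x) \<sqinter> a \<sqsubseteq> ?h x \<sqinter> a"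
    using mp[of "?h x"] assms x by (simp add: le_meet_iff meet_right)
  then show "open_nucleus L a (open_nucleus L a x) \<sqsubseteq> open_nucleus L a x"
    using assms x mp[OF x] by (simp add: open_nucleus_def le_himp_iff) (meson himp_closed le_trans meet_closed)
qed (use assms in \<open>auto simp: open_nucleus_def le_himp_iff meet_left\<close>)

lemma diff_nucleus [simp]:
  "\<lbrakk>a \<in> carrier L; b \<in> carrier L\<rbrakk> \<Longrightarrow> diff_nucleus L b a \<in> nucs L"
  by (simp add: diff_nucleus_def)

text \<open>Evaluation at a gives one direction, because \<open>himp L a a\<close> is the top and so
  b lies below the value of the difference at a. Conversely let b \<sqsubseteq> \<mu> a and h =
  \<open>himp L a c\<close>; then b \<sqinter> h \<sqsubseteq> \<mu> a \<sqinter> \<mu> h = \<mu> (h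
  \<sqinter> a) \<sqsubseteq> \<mu> c. Later comparisons of suprema of nuclei rest on this
  equivalence.\<close>

lemma diff_nucleus_le_iff:
  assumes "a \<in> carrier L" "b \<in> carrier L" "\<mu> \<in> nucs L"
  shows "diff_nucleus L b a \<preceq> \<mu> \<longleftrightarrow> b \<sqsubseteq> \<mu> a"
proof
  assume "diff_nucleus L b a \<preceq> \<mu>"
  then have "diff_nucleus L b a a \<sqsubseteq> \<mu> a" using assms by (simp add: nuclei_le)
  moreover have "b \<sqsubseteq> diff_nucleus L b a a"
    using assms by (simp add: diff_nucleus_def meet_nucleus_apply)
      (simp add: closed_nucleus_def open_nucleus_def join_left le_himp_iff meet_right le_meet_iff)
  ultimately show "b \<sqsubseteq> \<mu> a" using assms by (meson diff_nucleus le_trans nucleus_closed)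
next
  assume b: "b \<sqsubseteq> \<mu> a"
  have "(b \<squnion> c) \<sqinter> himp L a c \<sqsubseteq> \<mu> c" if c: "c \<in> carrier L" for c
  proof -
    let ?h = "himp L a c"
    have cl: "\<mu> a \<in> carrier L" "\<mu> c \<in> carrier L" "\<mu> ?h \<in> carrier L" using assms c by (auto simp: nucleus_closed)
    have "b \<sqinter> ?h \<sqsubseteq> \<mu> a \<sqinter> \<mu> ?h"
      using assms b cl c by (intro meet_mono nucleus_inflationary[OF assms(3)]) auto
    also have "\<dots> = \<mu> (?h \<sqinter> a)" using assms c cl by (simp add: nucleus_meet meet_comm)
    also have "\<dots> \<sqsubseteq> \<mu> c" using assms c le_himp_iff[of a c ?h] by (intro nucleus_mono[OF assms(3)]) auto
    finally have 1: "b \<sqinter> ?h \<sqsubseteq> \<mu> c" using cl assms by (simp add: nucleus_closed)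
    have 2: "c \<sqinter> ?h \<sqsubseteq> \<mu> c" using assms c cl
      by (meson himp_closed le_trans meet_closed meet_left nucleus_inflationary)
    have "(b \<squnion> c) \<sqinter> ?h = (b \<sqinter> ?h) \<squnion> (c \<sqinter> ?h)"
      using assms c by (metis himp_closed join_closed meet_comm meet_join_distrib)
    then show ?thesis using 1 2 assms c cl by (simp add: join_le_iff)
  qed
  then show "diff_nucleus L b a \<preceq> \<mu>"
    using assms by (simp add: nuclei_le diff_nucleus_def meet_nucleus_apply)
      (simp add: closed_nucleus_def open_nucleus_def)
qed

lemma open_bottom [simp]: "open_nucleus L \<bottom> = \<top>\<^bsub>nuclei L\<^esub>"
proof (rule N.top_unique)
  have "himp L \<bottom> x = \<top>" if "x \<in> carrier L" for x
    using that by (intro top_unique) (auto simp: le_himp_iff)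
  then have "\<mu> \<preceq> open_nucleus L \<bottom>" if "\<mu> \<in> nucs L" for \<mu>
    using that by (simp add: nuclei_le open_nucleus_def nucleus_closed)
  then show "\<top>\<^bsub>nuclei L\<^esub> \<preceq> open_nucleus L \<bottom>" by simp
qed simp

lemma diff_bottom: "b \<in> carrier L \<Longrightarrow> diff_nucleus L b \<bottom> = closed_nucleus L b"
  by (simp add: diff_nucleus_def)

lemma closed_nucleus_le_iff:
  "\<lbrakk>b \<in> carrier L; \<mu> \<in> nucs L\<rbrakk> \<Longrightarrow> closed_nucleus L b \<preceq> \<mu> \<longleftrightarrow> b \<sqsubseteq> \<mu> \<bottom>"
  using diff_nucleus_le_iff[of \<bottom> b \<mu>] by (simp add: diff_bottom)

lemma closed_top [simp]: "closed_nucleus L \<top> = \<top>\<^bsub>nuclei L\<^esub>"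
proof (rule N.top_unique)
  have "\<mu> \<preceq> closed_nucleus L \<top>" if "\<mu> \<in> nucs L" for \<mu>
    using that unfolding nuclei_le
    by (simp add: nucleus_closed closed_nucleus_def join_absorb1)
  then show "\<top>\<^bsub>nuclei L\<^esub> \<preceq> closed_nucleus L \<top>" by simp
qed simp

lemma diff_top: "a \<in> carrier L \<Longrightarrow> diff_nucleus L \<top> a = open_nucleus L a"
  by (simp add: diff_nucleus_def)

lemma open_nucleus_le_iff:
  "\<lbrakk>a \<in> carrier L; \<mu> \<in> nucs L\<rbrakk> \<Longrightarrow> open_nucleus L a \<preceq> \<mu> \<longleftrightarrow> \<mu> a = \<top>"
  using diff_nucleus_le_iff[of a \<top> \<mu>] by (auto simp: diff_top nucleus_closed dest: top_unique)

lemma closed_mono_iff: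
  "\<lbrakk>a \<in> carrier L; b \<in> carrier L\<rbrakk> \<Longrightarrow> closed_nucleus L a \<preceq> closed_nucleus L b \<longleftrightarrow> a \<sqsubseteq> b"
  by (simp add: closed_nucleus_le_iff) (simp add: closed_nucleus_def)

lemma closed_meet:
  "\<lbrakk>a \<in> carrier L; b \<in> carrier L\<rbrakk> \<Longrightarrow>
    closed_nucleus L (a \<sqinter> b) = closed_nucleus L a \<sqinter>\<^bsub>nuclei L\<^esub> closed_nucleus L b"
proof (rule nucleus_eqI)
  fix x assume "a \<in> carrier L" "b \<in> carrier L" "x \<in> carrier L"
  then show "closed_nucleus L (a \<sqinter> b) x = (closed_nucleus L a \<sqinter>\<^bsub>nuclei L\<^esub> closed_nucleus L b) x"
    using join_meet_distrib[of x a b]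
    by (simp add: meet_nucleus_apply) (simp add: closed_nucleus_def join_comm[of L _ x])
qed simp_all

lemma closed_Sup:
  assumes "S \<subseteq> carrier L"
  shows "closed_nucleus L (\<Squnion>S) = \<Squnion>\<^bsub>nuclei L\<^esub>(closed_nucleus L ` S)"
  using assms by (intro N.eq_if_same_upper_bounds)
    (auto simp: closed_nucleus_le_iff Sup_le_iff N.Sup_le_iff nucleus_closed image_subset_iff subsetD)

lemma closed_bottom [simp]: "closed_nucleus L \<bottom> = \<bottom>\<^bsub>nuclei L\<^esub>"
  using closed_Sup[of "{}"] by simp

lemma closed_join:
  "\<lbrakk>a \<in> carrier L; b \<in> carrier L\<rbrakk> \<Longrightarrow>
    closed_nucleus L (a \<squnion> b) = closed_nucleus L a \<squnion>\<^bsub>nuclei L\<^esub> closed_nucleus L b"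
  using closed_Sup[of "{a, b}"] by (simp add: join_def)

lemma closed_meet_open: "a \<in> carrier L \<Longrightarrow> closed_nucleus L a \<sqinter>\<^bsub>nuclei L\<^esub> open_nucleus L a = \<bottom>\<^bsub>nuclei L\<^esub>"
proof -
  assume a: "a \<in> carrier L"
  have "diff_nucleus L a a \<preceq> \<bottom>\<^bsub>nuclei L\<^esub>"
    using a by (simp add: diff_nucleus_le_iff nucleus_inflationary)
  then show ?thesis using a by (simp add: N.bottom_unique flip: diff_nucleus_def)
qed

text \<open>Let j be the join. The closed part gives a \<sqsubseteq> j \<bottom> and the open part
  gives j a = \<top>. Idempotence combines them: \<top> = j a \<sqsubseteq> j (j \<bottom>) = j
  \<bottom>.\<close>

lemma closed_join_open:
  assumes a: "a \<in> carrier L"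
  shows "closed_nucleus L a \<squnion>\<^bsub>nuclei L\<^esub> open_nucleus L a = \<top>\<^bsub>nuclei L\<^esub>"
proof (rule N.top_unique)
  let ?j = "closed_nucleus L a \<squnion>\<^bsub>nuclei L\<^esub> open_nucleus L a"
  show j: "?j \<in> nucs L" using a by simp
  have "a \<sqsubseteq> ?j \<bottom>" using a j N.join_left[of "closed_nucleus L a" "open_nucleus L a"]
    by (simp add: closed_nucleus_le_iff)
  then have "?j a \<sqsubseteq> ?j \<bottom>"
    using nucleus_mono[OF j, of a "?j \<bottom>"] a j by (simp add: nucleus_idem nucleus_closed)
  moreover have "?j a = \<top>" using a j N.join_right[of "closed_nucleus L a" "open_nucleus L a"]
    by (simp add: open_nucleus_le_iff)
  ultimately have "\<top> \<sqsubseteq> ?j \<bottom>" by simp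
  then have "closed_nucleus L \<top> \<preceq> ?j" using j closed_nucleus_le_iff[of \<top> ?j] by blast
  then show "\<top>\<^bsub>nuclei L\<^esub> \<preceq> ?j" by simp
qed

text \<open>Tested on upper bounds: the choice b = \<nu> a turns the condition that \<mu> dominates
  all these differences into \<nu> a \<sqsubseteq> \<mu> a for every a. This reduces statements
  about arbitrary nuclei to differences.\<close>

lemma nucleus_Sup_diff:
  assumes \<nu>: "\<nu> \<in> nucs L"
  shows "\<Squnion>\<^bsub>nuclei L\<^esub>{diff_nucleus L b a | a b. a \<in> carrier L \<and> b \<in> carrier L \<and> b \<sqsubseteq> \<nu> a} = \<nu>"
    (is "\<Squnion>\<^bsub>nuclei L\<^esub>?D = \<nu>")
proof (rule N.eq_if_same_upper_bounds)
  have D: "?D \<subseteq> nucs L" by auto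
  then show "\<Squnion>\<^bsub>nuclei L\<^esub>?D \<in> nucs L" by simp
  fix \<mu> assume \<mu>: "\<mu> \<in> nucs L"
  have "\<Squnion>\<^bsub>nuclei L\<^esub>?D \<preceq> \<mu> \<longleftrightarrow> (\<forall>a\<in>carrier L. \<forall>b\<in>carrier L. b \<sqsubseteq> \<nu> a \<longrightarrow> b \<sqsubseteq> \<mu> a)"
  proof -
    have "?D = (\<lambda>(a, b). diff_nucleus L b a) ` {(a, b). a \<in> carrier L \<and> b \<in> carrier L \<and> b \<sqsubseteq> \<nu> a}" by auto
    then show ?thesis
      unfolding N.Sup_le_iff[OF D \<mu>] by (simp add: Ball_def diff_nucleus_le_iff \<mu>) (auto simp: diff_nucleus_le_iff \<mu>)
  qed
  also have "\<dots> \<longleftrightarrow> \<nu> \<preceq> \<mu>" (is "?l \<longleftrightarrow> ?r")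
  proof
    assume ?l then show ?r using nucleus_closed[OF \<nu>] by (auto simp: nuclei_le)
  next
    assume ?r then show ?l using nucleus_closed[OF \<nu>] nucleus_closed[OF \<mu>]
      by (auto simp: nuclei_le intro: le_trans)
  qed
  finally show "\<Squnion>\<^bsub>nuclei L\<^esub>?D \<preceq> \<mu> \<longleftrightarrow> \<nu> \<preceq> \<mu>" .
qed fact

text \<open>The open parts combine because an element whose meets with a and with a' are below x has
  its meet with a \<squnion> a' below x. The inequality bounds a meet of two suprema of
  differences.\<close>

lemma diff_meet_diff:
  assumes "a \<in> carrier L" "b \<in> carrier L" "a' \<in> carrier L" "b' \<in> carrier L"
  shows "diff_nucleus L b a \<sqinter>\<^bsub>nuclei L\<^esub> diff_nucleus L b' a' \<preceq> diff_nucleus L (b \<sqinter> b') (a \<squnion> a')"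
proof -
  have "himp L a x \<sqinter> himp L a' x \<sqsubseteq> himp L (a \<squnion> a') x" if x: "x \<in> carrier L" for x
  proof -
    let ?h = "himp L a x" and ?k = "himp L a' x"
    have "?h \<sqinter> a \<sqsubseteq> x" "?k \<sqinter> a' \<sqsubseteq> x" using assms x by (auto simp: himp_meet_le)
    then have "(?h \<sqinter> ?k) \<sqinter> a \<sqsubseteq> x" "(?h \<sqinter> ?k) \<sqinter> a' \<sqsubseteq> x"
      using assms x by (meson himp_closed le_refl le_trans meet_closed meet_left meet_right meet_mono)+
    then show ?thesis using assms x by (simp add: le_himp_iff meet_join_distrib join_le_iff)
  qed
  then have o: "open_nucleus L a \<sqinter>\<^bsub>nuclei L\<^esub> open_nucleus L a' \<preceq> open_nucleus L (a \<squnion> a')"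
    using assms by (simp add: nuclei_le meet_nucleus_apply) (simp add: open_nucleus_def)
  define m where "m = diff_nucleus L b a \<sqinter>\<^bsub>nuclei L\<^esub> diff_nucleus L b' a'"
  have mc: "m \<in> nucs L" using assms by (simp add: m_def)
  have "m \<preceq> diff_nucleus L b a" "m \<preceq> diff_nucleus L b' a'"
    using assms by (simp_all add: m_def N.meet_left N.meet_right)
  then have m: "m \<preceq> closed_nucleus L b" "m \<preceq> closed_nucleus L b'"
    "m \<preceq> open_nucleus L a" "m \<preceq> open_nucleus L a'"
    using assms mc by (simp_all add: diff_nucleus_def N.le_meet_iff)
  then have "m \<preceq> open_nucleus L a \<sqinter>\<^bsub>nuclei L\<^esub> open_nucleus L a'"
    using assms mc by (simp add: N.le_meet_iff)
  then have "m \<preceq> open_nucleus L (a \<squnion> a')"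
    by (rule N.le_trans[OF _ o]) (use assms mc in auto)
  then have "m \<preceq> diff_nucleus L (b \<sqinter> b') (a \<squnion> a')" using m assms mc
    by (simp add: diff_nucleus_def closed_meet N.le_meet_iff)
  then show ?thesis by (simp add: m_def)
qed

end

section \<open>Frame morphisms and the universal property of the dissolution\<close>

lemma frame_homD:
  assumes "h \<in> frame_hom L M"
  shows "h \<in> carrier L \<rightarrow>\<^sub>E carrier M" "h \<top>\<^bsub>L\<^esub> = \<top>\<^bsub>M\<^esub>"
    "\<lbrakk>a \<in> carrier L; b \<in> carrier L\<rbrakk> \<Longrightarrow> h (a \<sqinter>\<^bsub>L\<^esub> b) = h a \<sqinter>\<^bsub>M\<^esub> h b"
    "S \<subseteq> carrier L \<Longrightarrow> h (\<Squnion>\<^bsub>L\<^esub> S) = \<Squnion>\<^bsub>M\<^esub> (h ` S)"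
    "a \<in> carrier L \<Longrightarrow> h a \<in> carrier M"
  using assms by (auto simp: frame_hom_def)

lemma frame_hom_mono:
  assumes "complete_lattice L" "complete_lattice M" "h \<in> frame_hom L M"
    "a \<in> carrier L" "b \<in> carrier L" "a \<sqsubseteq>\<^bsub>L\<^esub> b"
  shows "h a \<sqsubseteq>\<^bsub>M\<^esub> h b"
proof -
  interpret L: complete_lattice L by fact
  interpret M: complete_lattice M by fact
  have "h a = h a \<sqinter>\<^bsub>M\<^esub> h b"
    using frame_homD(3)[OF assms(3-5)] assms by (simp add: L.meet_absorb1)
  then show ?thesis
    using frame_homD(5)[OF assms(3)] assms(4,5) by (metis M.meet_right)
qed

lemma frame_hom_join:
  assumes "h \<in> frame_hom L M" "a \<in> carrier L" "b \<in> carrier L"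
  shows "h (a \<squnion>\<^bsub>L\<^esub> b) = h a \<squnion>\<^bsub>M\<^esub> h b"
  using frame_homD(4)[OF assms(1), of "{a, b}"] assms by (simp add: join_def)

lemma frame_hom_bottom:
  assumes "complete_lattice L" "complete_lattice M" "h \<in> frame_hom L M"
  shows "h \<bottom>\<^bsub>L\<^esub> = \<bottom>\<^bsub>M\<^esub>"
proof -
  interpret L: complete_lattice L by fact
  interpret M: complete_lattice M by fact
  show ?thesis using frame_homD(4)[OF assms(3), of "{}"] by simp
qed

lemma frame_hom_compose:
  assumes "h \<in> frame_hom L M" "k \<in> frame_hom M P" "complete_lattice L"
  shows "compose (carrier L) k h \<in> frame_hom L P"
proof -
  interpret L: complete_lattice L by fact
  note h = frame_homD[OF assms(1)] and k = frame_homD[OF assms(2)]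
  have "h ` S \<subseteq> carrier M" if "S \<subseteq> carrier L" for S using h(5) that by auto
  moreover have "compose (carrier L) k h ` S = k ` h ` S" if "S \<subseteq> carrier L" for S
    using that by (auto simp: compose_def image_image subset_iff image_def)
  ultimately show ?thesis
    using h k by (auto simp: frame_hom_def compose_def)
qed

lemma frame_hom_id: "complete_lattice L \<Longrightarrow> (\<lambda>a\<in>carrier L. a) \<in> frame_hom L L"
proof -
  assume "complete_lattice L"
  then interpret L: complete_lattice L .
  have "(\<lambda>a\<in>carrier L. a) ` S = S" if "S \<subseteq> carrier L" for S using that by (auto simp: image_def)
  then show ?thesis by (auto simp: frame_hom_def)
qed

locale dissolution_hom = L': dissolution L' + L: dissolution L
  for L' :: "'m gorder" and L :: "'l gorder" +
  fixes f assumes f: "f \<in> frame_hom L' L"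
begin

lemma f_closed [simp]: "a \<in> carrier L' \<Longrightarrow> f a \<in> carrier L"
  by (rule frame_homD(5)[OF f])

lemma f_mono: "\<lbrakk>a \<in> carrier L'; b \<in> carrier L'; a \<sqsubseteq>\<^bsub>L'\<^esub> b\<rbrakk> \<Longrightarrow> f a \<sqsubseteq>\<^bsub>L\<^esub> f b"
  by (rule frame_hom_mono[OF L'.complete_lattice_axioms L.complete_lattice_axioms f])

lemma f_bottom: "f \<bottom>\<^bsub>L'\<^esub> = \<bottom>\<^bsub>L\<^esub>"
  by (rule frame_hom_bottom[OF L'.complete_lattice_axioms L.complete_lattice_axioms f])

text \<open>The least nucleus \<mu> on L with f (\<nu> a) \<sqsubseteq> \<mu> (f a) for all a. The
  value is forced: \<nu> is the supremum of the differences of \<nu> a and a, and an extension of f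
  to nuclei has to respect differences and suprema.\<close>

definition nucleus_image :: "('m \<Rightarrow> 'm) \<Rightarrow> 'l \<Rightarrow> 'l" where
  "nucleus_image = (\<lambda>\<nu>\<in>nucs L'.
     \<Squnion>\<^bsub>nuclei L\<^esub>{diff_nucleus L (f (\<nu> a)) (f a) | a. a \<in> carrier L'})"

lemma nucleus_image_set:
  "\<nu> \<in> nucs L' \<Longrightarrow> {diff_nucleus L (f (\<nu> a)) (f a) | a. a \<in> carrier L'} \<subseteq> nucs L"
  by (auto simp: L'.nucleus_closed)

lemma nucleus_image_closed: "\<nu> \<in> nucs L' \<Longrightarrow> nucleus_image \<nu> \<in> nucs L"
  unfolding nucleus_image_def using nucleus_image_set by simp

lemma nucleus_image_le_iff:
  assumes "\<nu> \<in> nucs L'" "\<mu> \<in> nucs L"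
  shows "nucleus_image \<nu> \<preceq>\<^bsub>L\<^esub> \<mu> \<longleftrightarrow> (\<forall>a\<in>carrier L'. f (\<nu> a) \<sqsubseteq>\<^bsub>L\<^esub> \<mu> (f a))"
proof -
  have "nucleus_image \<nu> \<preceq>\<^bsub>L\<^esub> \<mu> \<longleftrightarrow>
      (\<forall>a\<in>carrier L'. diff_nucleus L (f (\<nu> a)) (f a) \<preceq>\<^bsub>L\<^esub> \<mu>)"
    using assms nucleus_image_set[OF assms(1)]
    by (simp add: nucleus_image_def L.N.Sup_le_iff) blast
  then show ?thesis using assms by (simp add: L.diff_nucleus_le_iff L'.nucleus_closed)
qed

lemma nucleus_image_apply:
  assumes "\<nu> \<in> nucs L'" "a \<in> carrier L'"
  shows "f (\<nu> a) \<sqsubseteq>\<^bsub>L\<^esub> nucleus_image \<nu> (f a)"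
  using nucleus_image_le_iff[OF assms(1) nucleus_image_closed[OF assms(1)]] assms
  by (simp add: nucleus_image_closed)

text \<open>The right adjoint of \<open>nucleus_image\<close> is \<open>\<mu> \<mapsto> f\<^sub>* \<circ> \<mu> \<circ> f\<close>, with \<open>f\<^sub>*\<close> the right adjoint of \<open>f\<close>.\<close>

lemma nucleus_image_adjoint:
  assumes \<mu>: "\<mu> \<in> nucs L"
  obtains \<rho> where "\<rho> \<in> nucs L'"
    and "\<And>\<nu>. \<nu> \<in> nucs L' \<Longrightarrow> nucleus_image \<nu> \<preceq>\<^bsub>L\<^esub> \<mu> \<longleftrightarrow> \<nu> \<preceq>\<^bsub>L'\<^esub> \<rho>"
proof
  define \<rho> where "\<rho> = (\<lambda>a\<in>carrier L'. \<Squnion>\<^bsub>L'\<^esub>{c \<in> carrier L'. f c \<sqsubseteq>\<^bsub>L\<^esub> \<mu> (f a)})"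
  have closed: "\<rho> a \<in> carrier L'" if "a \<in> carrier L'" for a
    using that by (auto simp: \<rho>_def intro!: L'.sup_closed)
  have \<mu>c: "\<mu> (f a) \<in> carrier L" if "a \<in> carrier L'" for a
    using that \<mu> by (simp add: L.nucleus_closed)
  have f\<rho>: "f (\<rho> a) \<sqsubseteq>\<^bsub>L\<^esub> \<mu> (f a)" if a: "a \<in> carrier L'" for a
  proof -
    let ?S = "{c \<in> carrier L'. f c \<sqsubseteq>\<^bsub>L\<^esub> \<mu> (f a)}"
    have "f (\<Squnion>\<^bsub>L'\<^esub>?S) = \<Squnion>\<^bsub>L\<^esub>(f ` ?S)" by (rule frame_homD(4)[OF f]) auto
    also have "\<dots> \<sqsubseteq>\<^bsub>L\<^esub> \<mu> (f a)" using a \<mu>c by (auto intro!: L.sup_least)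
    finally show ?thesis using a by (simp add: \<rho>_def)
  qed
  have le: "c \<sqsubseteq>\<^bsub>L'\<^esub> \<rho> a \<longleftrightarrow> f c \<sqsubseteq>\<^bsub>L\<^esub> \<mu> (f a)" if "a \<in> carrier L'" "c \<in> carrier L'" for a c
  proof
    assume "c \<sqsubseteq>\<^bsub>L'\<^esub> \<rho> a"
    then have "f c \<sqsubseteq>\<^bsub>L\<^esub> f (\<rho> a)" using that closed by (intro f_mono)
    then show "f c \<sqsubseteq>\<^bsub>L\<^esub> \<mu> (f a)" using f\<rho>[OF that(1)] that closed \<mu>c by (meson L.le_trans f_closed)
  next
    assume "f c \<sqsubseteq>\<^bsub>L\<^esub> \<mu> (f a)"
    then show "c \<sqsubseteq>\<^bsub>L'\<^esub> \<rho> a" using that by (auto simp: \<rho>_def intro!: L'.sup_upper)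
  qed
  show \<rho>: "\<rho> \<in> nucs L'"
  proof (rule L'.nucleusI)
    show "\<rho> \<in> extensional (carrier L')" by (simp add: \<rho>_def)
  next
    fix a assume a: "a \<in> carrier L'"
    then show "a \<sqsubseteq>\<^bsub>L'\<^esub> \<rho> a" using \<mu> by (simp add: le L.nucleus_inflationary)
    have "f (\<rho> (\<rho> a)) \<sqsubseteq>\<^bsub>L\<^esub> \<mu> (f (\<rho> a))" using a closed f\<rho> by simp
    also have "\<mu> (f (\<rho> a)) \<sqsubseteq>\<^bsub>L\<^esub> \<mu> (\<mu> (f a))"
      using a closed f\<rho> \<mu>c by (intro L.nucleus_mono[OF \<mu>]) auto
    also have "\<mu> (\<mu> (f a)) = \<mu> (f a)" using a by (simp add: L.nucleus_idem[OF \<mu>])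
    finally show "\<rho> (\<rho> a) \<sqsubseteq>\<^bsub>L'\<^esub> \<rho> a" using a closed \<mu>c L.nucleus_closed[OF \<mu>] by (simp add: le)
  next
    fix a b assume a: "a \<in> carrier L'" and b: "b \<in> carrier L'"
    { assume "a \<sqsubseteq>\<^bsub>L'\<^esub> b"
      then have "\<mu> (f a) \<sqsubseteq>\<^bsub>L\<^esub> \<mu> (f b)" using a b by (intro L.nucleus_mono[OF \<mu>] f_mono) auto
      then show "\<rho> a \<sqsubseteq>\<^bsub>L'\<^esub> \<rho> b" using f\<rho>[OF a] a b closed \<mu>c
        by (simp add: le) (meson L.le_trans f_closed)
    }
    have "f (\<rho> a \<sqinter>\<^bsub>L'\<^esub> \<rho> b) = f (\<rho> a) \<sqinter>\<^bsub>L\<^esub> f (\<rho> b)" using a b closed by (intro frame_homD(3)[OF f])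
    also have "\<dots> \<sqsubseteq>\<^bsub>L\<^esub> \<mu> (f a) \<sqinter>\<^bsub>L\<^esub> \<mu> (f b)" using a b closed f\<rho> \<mu>c by (intro L.meet_mono) auto
    also have "\<dots> = \<mu> (f (a \<sqinter>\<^bsub>L'\<^esub> b))"
      using a b by (simp add: frame_homD(3)[OF f] L.nucleus_meet[OF \<mu>])
    finally show "\<rho> a \<sqinter>\<^bsub>L'\<^esub> \<rho> b \<sqsubseteq>\<^bsub>L'\<^esub> \<rho> (a \<sqinter>\<^bsub>L'\<^esub> b)" using a b closed by (simp add: le)
  qed (use closed in auto)
  show "nucleus_image \<nu> \<preceq>\<^bsub>L\<^esub> \<mu> \<longleftrightarrow> \<nu> \<preceq>\<^bsub>L'\<^esub> \<rho>" if \<nu>: "\<nu> \<in> nucs L'" for \<nu>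
    unfolding nucleus_image_le_iff[OF \<nu> \<mu>] using \<nu> \<mu> by (simp add: nuclei_le le L'.nucleus_closed)
qed

text \<open>Suprema and monotonicity come from the right adjoint. For meets both sides are suprema
  of differences; \<open>diff_meet_diff\<close> reduces the claim to \<mu> a \<sqinter> \<nu> b
  \<sqsubseteq> (\<mu> \<sqinter> \<nu>) (a \<squnion> b), which is monotonicity of \<mu> and
  \<nu>.\<close>

lemma nucleus_image_frame_hom: "nucleus_image \<in> frame_hom (nuclei L') (nuclei L)"
proof -
  have top: "nucleus_image \<top>\<^bsub>nuclei L'\<^esub> = \<top>\<^bsub>nuclei L\<^esub>"
  proof (rule L.N.top_unique)
    have "f \<top>\<^bsub>L'\<^esub> \<sqsubseteq>\<^bsub>L\<^esub> nucleus_image \<top>\<^bsub>nuclei L'\<^esub> (f \<bottom>\<^bsub>L'\<^esub>)"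
      using nucleus_image_apply[of "\<top>\<^bsub>nuclei L'\<^esub>" "\<bottom>\<^bsub>L'\<^esub>"]
        L'.closed_nucleus_le_iff[of "\<top>\<^bsub>L'\<^esub>" "\<top>\<^bsub>nuclei L'\<^esub>"]
      by (metis L'.N.top_closed L'.N.top_higher L'.bottom_closed L'.closed_top L'.nucleus_closed
          L'.top_closed L'.top_unique)
    then show "\<top>\<^bsub>nuclei L\<^esub> \<preceq>\<^bsub>L\<^esub> nucleus_image \<top>\<^bsub>nuclei L'\<^esub>"
      using L.closed_nucleus_le_iff[of "\<top>\<^bsub>L\<^esub>" "nucleus_image \<top>\<^bsub>nuclei L'\<^esub>"]
      by (simp add: nucleus_image_closed f_bottom frame_homD(2)[OF f])
  qed (simp add: nucleus_image_closed)
  have mono: "nucleus_image \<mu> \<preceq>\<^bsub>L\<^esub> nucleus_image \<nu>"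
    if le: "\<mu> \<in> nucs L'" "\<nu> \<in> nucs L'" "\<mu> \<preceq>\<^bsub>L'\<^esub> \<nu>" for \<mu> \<nu>
  proof -
    obtain \<rho> where "\<rho> \<in> nucs L'"
      and "\<And>\<xi>. \<xi> \<in> nucs L' \<Longrightarrow>
        nucleus_image \<xi> \<preceq>\<^bsub>L\<^esub> nucleus_image \<nu> \<longleftrightarrow> \<xi> \<preceq>\<^bsub>L'\<^esub> \<rho>"
      using nucleus_image_adjoint[OF nucleus_image_closed[OF le(2)]] by blast
    then show ?thesis using le by (meson L.N.le_refl L'.N.le_trans nucleus_image_closed)
  qed
  have meet: "nucleus_image (\<mu> \<sqinter>\<^bsub>nuclei L'\<^esub> \<nu>) = nucleus_image \<mu> \<sqinter>\<^bsub>nuclei L\<^esub> nucleus_image \<nu>"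
    if \<mu>: "\<mu> \<in> nucs L'" and \<nu>: "\<nu> \<in> nucs L'" for \<mu> \<nu>
  proof (rule L.N.le_antisym)
    let ?m = "\<mu> \<sqinter>\<^bsub>nuclei L'\<^esub> \<nu>"
    have m: "?m \<in> nucs L'" using \<mu> \<nu> by simp
    show "nucleus_image ?m \<preceq>\<^bsub>L\<^esub> nucleus_image \<mu> \<sqinter>\<^bsub>nuclei L\<^esub> nucleus_image \<nu>"
      using \<mu> \<nu> m by (auto simp: L.N.le_meet_iff nucleus_image_closed L'.N.meet_left L'.N.meet_right intro!: mono)
    have "diff_nucleus L (f (\<mu> a)) (f a) \<sqinter>\<^bsub>nuclei L\<^esub> diff_nucleus L (f (\<nu> b)) (f b)
        \<preceq>\<^bsub>L\<^esub> nucleus_image ?m" if a: "a \<in> carrier L'" and b: "b \<in> carrier L'" for a b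
    proof -
      have c: "\<mu> a \<in> carrier L'" "\<nu> b \<in> carrier L'" "a \<squnion>\<^bsub>L'\<^esub> b \<in> carrier L'"
        using \<mu> \<nu> a b by (auto simp: L'.nucleus_closed)
      have "\<mu> a \<sqinter>\<^bsub>L'\<^esub> \<nu> b \<sqsubseteq>\<^bsub>L'\<^esub> ?m (a \<squnion>\<^bsub>L'\<^esub> b)"
        using a b c \<mu> \<nu>
        using L'.nucleus_closed[OF \<mu> c(3)] L'.nucleus_closed[OF \<nu> c(3)]
        by (simp add: L'.meet_nucleus_apply L'.meet_mono L'.nucleus_mono[OF \<mu>] L'.nucleus_mono[OF \<nu>] L'.join_left L'.join_right)
      then have "f (\<mu> a \<sqinter>\<^bsub>L'\<^esub> \<nu> b) \<sqsubseteq>\<^bsub>L\<^esub> f (?m (a \<squnion>\<^bsub>L'\<^esub> b))"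
        using a b c m by (intro f_mono) (auto intro: L'.nucleus_closed[OF m])
      also have "f (?m (a \<squnion>\<^bsub>L'\<^esub> b)) \<sqsubseteq>\<^bsub>L\<^esub> nucleus_image ?m (f (a \<squnion>\<^bsub>L'\<^esub> b))"
        using m c by (intro nucleus_image_apply)
      finally have "f (\<mu> a) \<sqinter>\<^bsub>L\<^esub> f (\<nu> b) \<sqsubseteq>\<^bsub>L\<^esub> nucleus_image ?m (f a \<squnion>\<^bsub>L\<^esub> f b)"
        using a b c m L.nucleus_closed[OF nucleus_image_closed[OF m]] L'.nucleus_closed[OF m]
        by (simp add: frame_homD(3)[OF f] frame_hom_join[OF f])
      then have "diff_nucleus L (f (\<mu> a) \<sqinter>\<^bsub>L\<^esub> f (\<nu> b)) (f a \<squnion>\<^bsub>L\<^esub> f b) \<preceq>\<^bsub>L\<^esub> nucleus_image ?m"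
        using a b c m by (simp add: L.diff_nucleus_le_iff nucleus_image_closed)
      then show ?thesis
        using L.diff_meet_diff[of "f a" "f (\<mu> a)" "f b" "f (\<nu> b)"] a b c m
        by (meson L.N.le_trans L.N.meet_closed L.diff_nucleus L.join_closed L.meet_closed f_closed
            nucleus_image_closed)
    qed
    then have "\<Squnion>\<^bsub>nuclei L\<^esub>{diff_nucleus L (f (\<mu> a)) (f a) | a. a \<in> carrier L'} \<sqinter>\<^bsub>nuclei L\<^esub>
        \<Squnion>\<^bsub>nuclei L\<^esub>{diff_nucleus L (f (\<nu> a)) (f a) | a. a \<in> carrier L'} \<preceq>\<^bsub>L\<^esub> nucleus_image ?m"
      by (intro L.N.Sup_meet_Sup_le[OF nucleus_image_set[OF \<mu>] nucleus_image_set[OF \<nu>] nucleus_image_closed[OF m]]) auto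
    then show "nucleus_image \<mu> \<sqinter>\<^bsub>nuclei L\<^esub> nucleus_image \<nu> \<preceq>\<^bsub>L\<^esub> nucleus_image ?m"
      using \<mu> \<nu> by (simp add: nucleus_image_def)
  qed (use \<mu> \<nu> in \<open>auto simp: nucleus_image_closed\<close>)
  have Sup: "nucleus_image (\<Squnion>\<^bsub>nuclei L'\<^esub>S) = \<Squnion>\<^bsub>nuclei L\<^esub>(nucleus_image ` S)"
    if S: "S \<subseteq> nucs L'" for S
  proof (rule L.N.eq_if_same_upper_bounds)
    have im: "nucleus_image ` S \<subseteq> nucs L" using S nucleus_image_closed by auto
    show "nucleus_image (\<Squnion>\<^bsub>nuclei L'\<^esub>S) \<in> nucs L" "\<Squnion>\<^bsub>nuclei L\<^esub>(nucleus_image ` S) \<in> nucs L"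
      using S im by (auto intro: nucleus_image_closed)
    fix \<mu> assume \<mu>: "\<mu> \<in> nucs L"
    obtain \<rho> where \<rho>: "\<rho> \<in> nucs L'"
      "\<And>\<nu>. \<nu> \<in> nucs L' \<Longrightarrow> nucleus_image \<nu> \<preceq>\<^bsub>L\<^esub> \<mu> \<longleftrightarrow> \<nu> \<preceq>\<^bsub>L'\<^esub> \<rho>"
      using nucleus_image_adjoint[OF \<mu>] by blast
    show "nucleus_image (\<Squnion>\<^bsub>nuclei L'\<^esub>S) \<preceq>\<^bsub>L\<^esub> \<mu> \<longleftrightarrow> \<Squnion>\<^bsub>nuclei L\<^esub>(nucleus_image ` S) \<preceq>\<^bsub>L\<^esub> \<mu>"
      using S im \<mu> \<rho> by (simp add: L'.N.Sup_le_iff L.N.Sup_le_iff subsetD)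
  qed
  have "nucleus_image \<in> nucs L' \<rightarrow>\<^sub>E nucs L"
    using nucleus_image_closed by (auto simp: PiE_def nucleus_image_def)
  then show ?thesis using top meet Sup by (simp add: frame_hom_def)
qed

text \<open>In the test against an upper bound \<mu>, the condition f (a \<squnion> b) \<sqsubseteq>
  \<mu> (f b) loses the part f b, which is below \<mu> (f b) anyway; what remains, f a \<sqsubseteq>
  \<mu> (f b), is strongest at b = \<bottom>.\<close>

lemma nucleus_image_closed_nucleus:
  assumes a: "a \<in> carrier L'"
  shows "nucleus_image (closed_nucleus L' a) = closed_nucleus L (f a)"
proof (rule L.N.eq_if_same_upper_bounds)
  fix \<mu> assume \<mu>: "\<mu> \<in> nucs L"
  have "(\<forall>b\<in>carrier L'. f (a \<squnion>\<^bsub>L'\<^esub> b) \<sqsubseteq>\<^bsub>L\<^esub> \<mu> (f b)) \<longleftrightarrow> (\<forall>b\<in>carrier L'. f a \<sqsubseteq>\<^bsub>L\<^esub> \<mu> (f b))"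
    using a \<mu> by (simp add: frame_hom_join[OF f] L.join_le_iff L.nucleus_closed L.nucleus_inflationary)
  also have "\<dots> \<longleftrightarrow> f a \<sqsubseteq>\<^bsub>L\<^esub> \<mu> \<bottom>\<^bsub>L\<^esub>"
  proof
    assume "\<forall>b\<in>carrier L'. f a \<sqsubseteq>\<^bsub>L\<^esub> \<mu> (f b)"
    then show "f a \<sqsubseteq>\<^bsub>L\<^esub> \<mu> \<bottom>\<^bsub>L\<^esub>" using f_bottom by (metis L'.bottom_closed)
  next
    assume le: "f a \<sqsubseteq>\<^bsub>L\<^esub> \<mu> \<bottom>\<^bsub>L\<^esub>"
    show "\<forall>b\<in>carrier L'. f a \<sqsubseteq>\<^bsub>L\<^esub> \<mu> (f b)"
    proof
      fix b assume b: "b \<in> carrier L'"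
      have "\<mu> \<bottom>\<^bsub>L\<^esub> \<sqsubseteq>\<^bsub>L\<^esub> \<mu> (f b)" using b by (intro L.nucleus_mono[OF \<mu>]) auto
      then show "f a \<sqsubseteq>\<^bsub>L\<^esub> \<mu> (f b)" using L.le_trans[OF le] a b L.nucleus_closed[OF \<mu>] by simp
    qed
  qed
  finally show "nucleus_image (closed_nucleus L' a) \<preceq>\<^bsub>L\<^esub> \<mu> \<longleftrightarrow> closed_nucleus L (f a) \<preceq>\<^bsub>L\<^esub> \<mu>"
    using a \<mu> by (simp add: nucleus_image_le_iff L.closed_nucleus_le_iff) (simp add: closed_nucleus_def)
qed (use a in \<open>auto simp: nucleus_image_closed\<close>)

end

text \<open>Frame morphisms preserve complements, and complements are unique.\<close>

lemma (in dissolution) frame_hom_open_nucleus: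
  assumes M: "frame_lattice M" and h: "h \<in> frame_hom (nuclei L) M"
    and a: "a \<in> carrier L" and x: "x \<in> carrier M"
    and "h (closed_nucleus L a) \<sqinter>\<^bsub>M\<^esub> x = \<bottom>\<^bsub>M\<^esub>" "h (closed_nucleus L a) \<squnion>\<^bsub>M\<^esub> x = \<top>\<^bsub>M\<^esub>"
  shows "h (open_nucleus L a) = x"
proof -
  interpret M: frame_lattice M by fact
  have "h (closed_nucleus L a) \<sqinter>\<^bsub>M\<^esub> h (open_nucleus L a) = \<bottom>\<^bsub>M\<^esub>"
    "h (closed_nucleus L a) \<squnion>\<^bsub>M\<^esub> h (open_nucleus L a) = \<top>\<^bsub>M\<^esub>"
    using a frame_homD(3)[OF h, of "closed_nucleus L a" "open_nucleus L a"]
      frame_hom_join[OF h, of "closed_nucleus L a" "open_nucleus L a"]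
      frame_hom_bottom[OF N.complete_lattice_axioms M.complete_lattice_axioms h] frame_homD(2)[OF h]
    by (simp_all add: closed_meet_open closed_join_open)
  then show ?thesis
    by (rule M.complement_unique[OF frame_homD(5)[OF h closed_nucleus[OF a]]
          frame_homD(5)[OF h open_nucleus[OF a]] x _ _ assms(5,6)])
qed

text \<open>Agreement passes from closed nuclei to their complements, then to differences as meets,
  then to arbitrary nuclei as suprema of differences. Identities between induced maps on nuclei,
  functoriality among them, are obtained from it.\<close>

lemma dissolution_hom_unique:
  assumes "dissolution L'" "frame_lattice M"
    and g: "g \<in> frame_hom (nuclei L') M" and h: "h \<in> frame_hom (nuclei L') M"
    and eq: "\<And>a. a \<in> carrier L' \<Longrightarrow> g (closed_nucleus L' a) = h (closed_nucleus L' a)"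
  shows "g = h"
proof -
  interpret L': dissolution L' by fact
  interpret M: frame_lattice M by fact
  have op: "g (open_nucleus L' a) = h (open_nucleus L' a)" if a: "a \<in> carrier L'" for a
    by (rule L'.frame_hom_open_nucleus[OF assms(2) g a])
      (use a frame_homD(3)[OF h, of "closed_nucleus L' a" "open_nucleus L' a"]
      frame_hom_join[OF h, of "closed_nucleus L' a" "open_nucleus L' a"]
      frame_hom_bottom[OF L'.N.complete_lattice_axioms M.complete_lattice_axioms h] frame_homD(2,5)[OF h] in
        \<open>simp_all add: L'.closed_meet_open L'.closed_join_open eq\<close>)
  have diff: "g (diff_nucleus L' b a) = h (diff_nucleus L' b a)" if "a \<in> carrier L'" "b \<in> carrier L'" for a b
    unfolding diff_nucleus_def using that by (simp add: frame_homD(3)[OF g] frame_homD(3)[OF h] eq op)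
  show ?thesis
  proof (rule PiE_ext[OF frame_homD(1)[OF g] frame_homD(1)[OF h]])
    fix \<nu> assume \<nu>: "\<nu> \<in> nucs L'"
    let ?D = "{diff_nucleus L' b a |a b. a \<in> carrier L' \<and> b \<in> carrier L' \<and> b \<sqsubseteq>\<^bsub>L'\<^esub> \<nu> a}"
    have D: "?D \<subseteq> nucs L'" by auto
    have "g (\<Squnion>\<^bsub>nuclei L'\<^esub>?D) = \<Squnion>\<^bsub>M\<^esub>(g ` ?D)" by (rule frame_homD(4)[OF g D])
    also have "g ` ?D = h ` ?D" using diff by (intro image_cong) auto
    also have "\<Squnion>\<^bsub>M\<^esub>(h ` ?D) = h (\<Squnion>\<^bsub>nuclei L'\<^esub>?D)" by (rule frame_homD(4)[OF h D, symmetric])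
    finally show "g \<nu> = h \<nu>" by (simp add: L'.nucleus_Sup_diff[OF \<nu>])
  qed
qed

context dissolution_hom
begin

text \<open>Existence and uniqueness for the description that defines
  \<open>dissolution_map\<close>; the explicit formula is available from here on.\<close>

lemma dissolution_map_eq: "dissolution_map L L' f = nucleus_image"
  unfolding dissolution_map_def
proof (rule the_equality)
  show "nucleus_image \<in> frame_hom (nuclei L') (nuclei L) \<and>
    (\<forall>a\<in>carrier L'. nucleus_image (closed_nucleus L' a) = closed_nucleus L (f a))"
    by (simp add: nucleus_image_frame_hom nucleus_image_closed_nucleus)
  fix k assume k: "k \<in> frame_hom (nuclei L') (nuclei L) \<and>
    (\<forall>a\<in>carrier L'. k (closed_nucleus L' a) = closed_nucleus L (f a))"
  show "k = nucleus_image"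
    by (rule dissolution_hom_unique[OF L'.dissolution_axioms L.nuclei_frame conjunct1[OF k] nucleus_image_frame_hom])
      (use k nucleus_image_closed_nucleus in simp)
qed

lemma dissolution_map_hom: "dissolution_map L L' f \<in> frame_hom (nuclei L') (nuclei L)"
  by (simp add: dissolution_map_eq nucleus_image_frame_hom)

lemma dissolution_map_closed [simp]:
  "a \<in> carrier L' \<Longrightarrow> dissolution_map L L' f (closed_nucleus L' a) = closed_nucleus L (f a)"
  by (simp add: dissolution_map_eq nucleus_image_closed_nucleus)

lemma dissolution_map_open [simp]:
  "a \<in> carrier L' \<Longrightarrow> dissolution_map L L' f (open_nucleus L' a) = open_nucleus L (f a)"
  by (rule L'.frame_hom_open_nucleus[OF L.nuclei_frame dissolution_map_hom])
    (auto simp: L.closed_meet_open L.closed_join_open)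

lemma dissolution_map_diff [simp]:
  "\<lbrakk>a \<in> carrier L'; b \<in> carrier L'\<rbrakk> \<Longrightarrow>
    dissolution_map L L' f (diff_nucleus L' b a) = diff_nucleus L (f b) (f a)"
  unfolding diff_nucleus_def by (simp add: frame_homD(3)[OF dissolution_map_hom])

lemma dissolution_map_in [simp]:
  "\<nu> \<in> nucs L' \<Longrightarrow> dissolution_map L L' f \<nu> \<in> nucs L"
  by (rule frame_homD(5)[OF dissolution_map_hom])

lemma dissolution_map_mono:
  "\<lbrakk>\<mu> \<in> nucs L'; \<nu> \<in> nucs L'; \<mu> \<preceq>\<^bsub>L'\<^esub> \<nu>\<rbrakk>
    \<Longrightarrow> dissolution_map L L' f \<mu> \<preceq>\<^bsub>L\<^esub> dissolution_map L L' f \<nu>"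
  by (rule frame_hom_mono[OF L'.N.complete_lattice_axioms L.N.complete_lattice_axioms dissolution_map_hom])

end

lemma dissolution_map_id:
  assumes "dissolution L"
  shows "dissolution_map L L (\<lambda>a\<in>carrier L. a) = (\<lambda>\<nu>\<in>nucs L. \<nu>)"
proof -
  interpret L: dissolution L by fact
  interpret dissolution_hom L L "\<lambda>a\<in>carrier L. a"
    by unfold_locales (rule frame_hom_id[OF L.complete_lattice_axioms])
  show ?thesis
    by (rule dissolution_hom_unique[OF assms L.nuclei_frame dissolution_map_hom
          frame_hom_id[OF L.N.complete_lattice_axioms]]) simp
qed

lemma dissolution_map_compose:
  assumes "dissolution L" "dissolution L'" "dissolution L''"
    and f: "f \<in> frame_hom L' L" and f': "f' \<in> frame_hom L'' L'"
  shows "dissolution_map L L'' (compose (carrier L'') f f') =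
    compose (nucs L'') (dissolution_map L L' f) (dissolution_map L' L'' f')"
proof -
  interpret L: dissolution L by fact
  interpret L': dissolution L' by fact
  interpret L'': dissolution L'' by fact
  interpret f: dissolution_hom L' L f by unfold_locales fact
  interpret f': dissolution_hom L'' L' f' by unfold_locales fact
  interpret ff': dissolution_hom L'' L "compose (carrier L'') f f'"
    by unfold_locales (rule frame_hom_compose[OF f' f L''.complete_lattice_axioms])
  show ?thesis
    by (rule dissolution_hom_unique[OF assms(3) L.nuclei_frame ff'.dissolution_map_hom
          frame_hom_compose[OF f'.dissolution_map_hom f.dissolution_map_hom L''.N.complete_lattice_axioms]])
      (simp add: compose_eq)
qed

section \<open>The spectrum of a frame as a Priestley space\<close>

context frame_lattice
begin

text \<open>Zorn's lemma gives a filter M maximal among those that contain F and avoid I. If a and b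
  lie outside M, the filters generated by M with a and by M with b meet I, so m \<sqinter> a and n
  \<sqinter> b are in I for some m, n in M. By distributivity (m \<sqinter> n) \<sqinter> (a
  \<squnion> b) is then in I, and a \<squnion> b cannot be in M.\<close>

lemma prime_filter_exists:
  assumes F: "F \<subseteq> carrier L" "\<top> \<in> F" "\<And>a b. \<lbrakk>a \<in> F; b \<in> carrier L; a \<sqsubseteq> b\<rbrakk> \<Longrightarrow> b \<in> F"
      "\<And>a b. \<lbrakk>a \<in> F; b \<in> F\<rbrakk> \<Longrightarrow> a \<sqinter> b \<in> F"
    and I: "I \<subseteq> carrier L" "\<bottom> \<in> I" "\<And>a b. \<lbrakk>a \<in> I; b \<in> carrier L; b \<sqsubseteq> a\<rbrakk> \<Longrightarrow> b \<in> I"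
      "\<And>a b. \<lbrakk>a \<in> I; b \<in> I\<rbrakk> \<Longrightarrow> a \<squnion> b \<in> I"
    and disj: "F \<inter> I = {}"
  obtains P where "P \<in> prime_filters L" "F \<subseteq> P" "P \<inter> I = {}"
proof -
  define A where "A = {G. G \<subseteq> carrier L \<and> F \<subseteq> G \<and> G \<inter> I = {} \<and>
    (\<forall>a\<in>G. \<forall>b\<in>carrier L. a \<sqsubseteq> b \<longrightarrow> b \<in> G) \<and> (\<forall>a\<in>G. \<forall>b\<in>G. a \<sqinter> b \<in> G)}"
  have FA: "F \<in> A" using F disj by (auto simp: A_def)
  have "\<exists>M\<in>A. \<forall>X\<in>A. M \<subseteq> X \<longrightarrow> X = M"
  proof (rule subset_Zorn_nonempty)
    show "A \<noteq> {}" using FA by auto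
    fix C assume C: "C \<noteq> {}" "subset.chain A C"
    then have CA: "C \<subseteq> A" and lin: "\<And>X Y. \<lbrakk>X \<in> C; Y \<in> C\<rbrakk> \<Longrightarrow> X \<subseteq> Y \<or> Y \<subseteq> X"
      by (auto simp: subset_chain_def)
    have inter: "a \<sqinter> b \<in> \<Union>C" if a: "X \<in> C" "a \<in> X" and b: "Y \<in> C" "b \<in> Y" for a b X Y
      using lin[OF a(1) b(1)]
    proof
      assume "X \<subseteq> Y" then have "a \<sqinter> b \<in> Y" using a b CA unfolding A_def by blast
      then show ?thesis using b by blast
    next
      assume "Y \<subseteq> X" then have "a \<sqinter> b \<in> X" using a b CA unfolding A_def by blast
      then show ?thesis using a by blast
    qed
    have X: "X \<subseteq> carrier L" "F \<subseteq> X" "X \<inter> I = {}" "\<And>a b. \<lbrakk>a \<in> X; b \<in> carrier L; a \<sqsubseteq> b\<rbrakk> \<Longrightarrow> b \<in> X"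
      if "X \<in> C" for X
      using CA that unfolding A_def by blast+
    show "\<Union>C \<in> A"
      unfolding A_def
    proof (rule CollectI, intro conjI ballI impI)
      show "\<Union>C \<subseteq> carrier L" using X(1) by auto
      show "\<Union>C \<inter> I = {}" using X(3) by blast
      show "F \<subseteq> \<Union>C" using C(1) X(2) by auto
    next
      fix a b assume "a \<in> \<Union>C" "b \<in> carrier L" "a \<sqsubseteq> b"
      then show "b \<in> \<Union>C" using X(4) by auto
    next
      fix a b assume "a \<in> \<Union>C" "b \<in> \<Union>C"
      then show "a \<sqinter> b \<in> \<Union>C" using inter by blast
    qed
  qed
  then obtain M where M: "M \<in> A" and max: "\<And>X. \<lbrakk>X \<in> A; M \<subseteq> X\<rbrakk> \<Longrightarrow> X = M" by blast
  have Mc: "M \<subseteq> carrier L" and FM: "F \<subseteq> M" and MI: "M \<inter> I = {}"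
    and up: "\<And>a b. \<lbrakk>a \<in> M; b \<in> carrier L; a \<sqsubseteq> b\<rbrakk> \<Longrightarrow> b \<in> M"
    and mt: "\<And>a b. \<lbrakk>a \<in> M; b \<in> M\<rbrakk> \<Longrightarrow> a \<sqinter> b \<in> M"
    using M unfolding A_def by blast+
  have ext: "\<exists>m\<in>M. m \<sqinter> a \<in> I" if a: "a \<in> carrier L" "a \<notin> M" for a
  proof (rule ccontr)
    assume no: "\<not> (\<exists>m\<in>M. m \<sqinter> a \<in> I)"
    let ?G = "{x \<in> carrier L. \<exists>m\<in>M. m \<sqinter> a \<sqsubseteq> x}"
    have "M \<subseteq> ?G"
    proof
      fix x assume "x \<in> M"
      then have "x \<in> carrier L" using Mc by auto
      then show "x \<in> ?G" using \<open>x \<in> M\<close> a meet_left[of x a] by blast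
    qed
    have "a \<in> ?G" using F FM Mc a by (auto intro!: bexI[of _ \<top>])
    have "?G \<in> A"
      unfolding A_def
    proof (rule CollectI, intro conjI ballI impI)
      show "?G \<inter> I = {}" using no I(3) Mc a(1) by (auto, meson meet_closed subsetD)
    next
      fix x y assume "x \<in> ?G" "y \<in> ?G"
      then obtain m n where mn: "x \<in> carrier L" "y \<in> carrier L" "m \<in> M" "n \<in> M" "m \<sqinter> a \<sqsubseteq> x" "n \<sqinter> a \<sqsubseteq> y"
        by blast
      have c: "m \<in> carrier L" "n \<in> carrier L" using mn Mc by auto
      have "(m \<sqinter> n) \<sqinter> a \<sqsubseteq> m \<sqinter> a" "(m \<sqinter> n) \<sqinter> a \<sqsubseteq> n \<sqinter> a"
        using c a by (auto intro!: meet_mono meet_left meet_right)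
      then have "(m \<sqinter> n) \<sqinter> a \<sqsubseteq> x" "(m \<sqinter> n) \<sqinter> a \<sqsubseteq> y"
        using le_trans[OF _ mn(5)] le_trans[OF _ mn(6)] c a mn by auto
      then have "(m \<sqinter> n) \<sqinter> a \<sqsubseteq> x \<sqinter> y" using c a mn by (simp add: le_meet_iff)
      then show "x \<sqinter> y \<in> ?G" using mn mt by auto
    next
      fix x y assume "x \<in> ?G" "y \<in> carrier L" "x \<sqsubseteq> y"
      then obtain m where m: "m \<in> M" "m \<sqinter> a \<sqsubseteq> x" "x \<in> carrier L" by blast
      then have "m \<sqinter> a \<sqsubseteq> y" using \<open>x \<sqsubseteq> y\<close> \<open>y \<in> carrier L\<close> a Mc le_trans[of "m \<sqinter> a" x y] by auto
      then show "y \<in> ?G" using m \<open>y \<in> carrier L\<close> by blast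
    qed (use \<open>M \<subseteq> ?G\<close> FM in auto)
    then show False using max[OF _ \<open>M \<subseteq> ?G\<close>] \<open>a \<in> ?G\<close> a by blast
  qed
  have "M \<in> prime_filters L"
    unfolding prime_filters_def
  proof (rule CollectI, intro conjI ballI impI)
    show "a \<in> M \<or> b \<in> M" if ab: "a \<in> carrier L" "b \<in> carrier L" "a \<squnion> b \<in> M" for a b
    proof (rule ccontr)
      assume "\<not> (a \<in> M \<or> b \<in> M)"
      then obtain m n where mn: "m \<in> M" "m \<sqinter> a \<in> I" "n \<in> M" "n \<sqinter> b \<in> I"
        using ext ab by blast
      have c: "m \<in> carrier L" "n \<in> carrier L" using mn Mc by auto
      have "(m \<sqinter> n) \<sqinter> a \<sqsubseteq> m \<sqinter> a" "(m \<sqinter> n) \<sqinter> b \<sqsubseteq> n \<sqinter> b"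
        using c ab by (auto intro!: meet_mono meet_left meet_right)
      then have "(m \<sqinter> n) \<sqinter> a \<in> I" "(m \<sqinter> n) \<sqinter> b \<in> I"
        using I(3) mn c ab by (meson meet_closed)+
      then have "(m \<sqinter> n) \<sqinter> (a \<squnion> b) \<in> I" using I(4) c ab by (simp add: meet_join_distrib)
      moreover have "(m \<sqinter> n) \<sqinter> (a \<squnion> b) \<in> M" using mn ab mt by auto
      ultimately show False using MI by blast
    qed
    show "M \<subseteq> carrier L" by (rule Mc)
    show "\<top> \<in> M" using F(2) FM by blast
    show "\<bottom> \<notin> M" using I(2) MI by blast
  qed (use up mt in simp_all)
  then show thesis using that FM MI by blast
qed

lemma prime_filterD:
  assumes "P \<in> prime_filters L"
  shows "P \<subseteq> carrier L" "\<top> \<in> P" "\<bottom> \<notin> P" "\<lbrakk>a \<in> P; b \<in> carrier L; a \<sqsubseteq> b\<rbrakk> \<Longrightarrow> b \<in> P"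
    "\<lbrakk>a \<in> carrier L; b \<in> carrier L\<rbrakk> \<Longrightarrow> a \<sqinter> b \<in> P \<longleftrightarrow> a \<in> P \<and> b \<in> P"
    "\<lbrakk>a \<in> carrier L; b \<in> carrier L\<rbrakk> \<Longrightarrow> a \<squnion> b \<in> P \<longleftrightarrow> a \<in> P \<or> b \<in> P"
proof -
  show 1: "P \<subseteq> carrier L" "\<top> \<in> P" "\<bottom> \<notin> P" using assms by (auto simp: prime_filters_def)
  show up: "\<lbrakk>a \<in> P; b \<in> carrier L; a \<sqsubseteq> b\<rbrakk> \<Longrightarrow> b \<in> P" for a b
    using assms unfolding prime_filters_def by blast
  assume ab: "a \<in> carrier L" "b \<in> carrier L"
  have "a \<sqinter> b \<in> P" if "a \<in> P" "b \<in> P" using assms that by (simp add: prime_filters_def)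
  then show "a \<sqinter> b \<in> P \<longleftrightarrow> a \<in> P \<and> b \<in> P"
    using up[OF _ ab(1) meet_left[OF ab]] up[OF _ ab(2) meet_right[OF ab]] by auto
  have "a \<in> P \<or> b \<in> P" if "a \<squnion> b \<in> P" using assms that ab by (simp add: prime_filters_def)
  then show "a \<squnion> b \<in> P \<longleftrightarrow> a \<in> P \<or> b \<in> P"
    using up[OF _ join_closed[OF ab] join_left[OF ab]] up[OF _ join_closed[OF ab] join_right[OF ab]] by auto
qed

lemma prime_filter_Sup_iff:
  assumes "P \<in> prime_filters L" "finite S" "S \<subseteq> carrier L"
  shows "\<Squnion>S \<in> P \<longleftrightarrow> (\<exists>a\<in>S. a \<in> P)"
  using assms(2,3)
proof (induction rule: finite_induct)
  case (insert x F)
  have "\<Squnion>insert x F = x \<squnion> \<Squnion>F" using insert.prems weak_sup_insert eq_is_equal by simp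
  then show ?case using insert prime_filterD(6)[OF assms(1), of x "\<Squnion>F"] by simp
qed (simp add: prime_filterD[OF assms(1)])

lemma prime_filter_Inf_iff:
  assumes "P \<in> prime_filters L" "finite S" "S \<subseteq> carrier L"
  shows "\<Sqinter>S \<in> P \<longleftrightarrow> S \<subseteq> P"
  using assms(2,3)
proof (induction rule: finite_induct)
  case empty
  have "\<Sqinter>{} = \<top>" using weak_inf_empty eq_is_equal by simp
  then show ?case by (simp add: prime_filterD[OF assms(1)])
next
  case (insert x F)
  have "\<Sqinter>insert x F = x \<sqinter> \<Sqinter>F" using insert.prems weak_inf_insert eq_is_equal by simp
  then show ?case using insert prime_filterD(5)[OF assms(1), of x "\<Sqinter>F"] by simp
qed

lemma basic_open_top [simp]: "basic_open L \<top> = prime_filters L"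
  by (auto simp: basic_open_def prime_filterD(2))

lemma basic_open_bottom [simp]: "basic_open L \<bottom> = {}"
  by (auto simp: basic_open_def prime_filterD(3))

lemma basic_open_meet:
  "\<lbrakk>a \<in> carrier L; b \<in> carrier L\<rbrakk> \<Longrightarrow> basic_open L (a \<sqinter> b) = basic_open L a \<inter> basic_open L b"
  by (auto simp: basic_open_def prime_filterD(5))

lemma basic_open_join:
  "\<lbrakk>a \<in> carrier L; b \<in> carrier L\<rbrakk> \<Longrightarrow> basic_open L (a \<squnion> b) = basic_open L a \<union> basic_open L b"
  by (auto simp: basic_open_def prime_filterD(6))

lemma basic_open_Sup:
  "\<lbrakk>finite S; S \<subseteq> carrier L\<rbrakk> \<Longrightarrow> basic_open L (\<Squnion>S) = \<Union>(basic_open L ` S)"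
  by (auto simp: basic_open_def prime_filter_Sup_iff)

lemma basic_open_Inf:
  "\<lbrakk>finite S; S \<subseteq> carrier L\<rbrakk> \<Longrightarrow> basic_open L (\<Sqinter>S) = {P \<in> prime_filters L. S \<subseteq> P}"
  by (auto simp: basic_open_def prime_filter_Inf_iff)

lemma basic_open_subset: "basic_open L a \<subseteq> prime_filters L"
  by (auto simp: basic_open_def)

text \<open>If a is not below b, the principal filter of a and the principal ideal of b are
  disjoint, and a prime filter separates them.\<close>

lemma basic_open_subset_iff:
  assumes a: "a \<in> carrier L" and b: "b \<in> carrier L"
  shows "basic_open L a \<subseteq> basic_open L b \<longleftrightarrow> a \<sqsubseteq> b"
proof
  assume "a \<sqsubseteq> b" then show "basic_open L a \<subseteq> basic_open L b"
    using prime_filterD(4)[OF _ _ b] by (auto simp: basic_open_def)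
next
  assume sub: "basic_open L a \<subseteq> basic_open L b"
  show "a \<sqsubseteq> b"
  proof (rule ccontr)
    assume nle: "\<not> a \<sqsubseteq> b"
    obtain P where "P \<in> prime_filters L" "{x \<in> carrier L. a \<sqsubseteq> x} \<subseteq> P" "P \<inter> {x \<in> carrier L. x \<sqsubseteq> b} = {}"
    proof (rule prime_filter_exists[of "{x \<in> carrier L. a \<sqsubseteq> x}" "{x \<in> carrier L. x \<sqsubseteq> b}"])
      show "{x \<in> carrier L. a \<sqsubseteq> x} \<inter> {x \<in> carrier L. x \<sqsubseteq> b} = {}"
        using a b nle by (auto intro: le_trans)
    qed (use a b in \<open>auto simp: le_meet_iff join_le_iff intro: le_trans\<close>)
    then have "P \<in> basic_open L a" "P \<notin> basic_open L b" using a b by (auto simp: basic_open_def)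
    then show False using sub by blast
  qed
qed

lemma basic_open_inj: "inj_on (basic_open L) (carrier L)"
proof (rule inj_onI)
  fix x y assume "x \<in> carrier L" "y \<in> carrier L" "basic_open L x = basic_open L y"
  then show "x = y" using basic_open_subset_iff[of x y] basic_open_subset_iff[of y x] by (auto intro: le_antisym)
qed

end

text \<open>Passage from a subbase to a basis, by induction over the generation of the open set;
  closure of the family under intersections handles the only case where two members have to be
  combined.\<close>

lemma openin_generated_basis:
  assumes "openin (topology_generated_by \<B>) W" "x \<in> W"
    and "\<And>U. U \<in> \<B> \<Longrightarrow> U \<in> \<C>"
    and "\<And>U V. \<lbrakk>U \<in> \<C>; V \<in> \<C>\<rbrakk> \<Longrightarrow> U \<inter> V \<in> \<C>"
  shows "\<exists>U\<in>\<C>. x \<in> U \<and> U \<subseteq> W"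
proof -
  have "generate_topology_on \<B> W" using assms(1) by (rule openin_topology_generated_by)
  then show ?thesis using assms(2)
  proof (induction arbitrary: x rule: generate_topology_on.induct)
    case (Int a b)
    then obtain U V where "U \<in> \<C>" "x \<in> U" "U \<subseteq> a" "V \<in> \<C>" "x \<in> V" "V \<subseteq> b" by blast
    then show ?case using assms(4)[of U V] by blast
  next
    case (UN K)
    then obtain k where k: "k \<in> K" "x \<in> k" by blast
    then obtain U where "U \<in> \<C>" "x \<in> U" "U \<subseteq> k" using UN.IH[OF k] by blast
    then show ?case using k by blast
  next
    case (Basis s) then show ?case using assms(3) by blast
  qed simp
qed

section \<open>The spectral and the patch topology\<close>

context dissolution
begin

abbreviation basic_diff where "basic_diff b a \<equiv> basic_open L b - basic_open L a"

lemma topspace_spec [simp]: "topspace (spec L) = prime_filters L"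
  unfolding spec_def using basic_open_subset basic_open_top by (auto simp del: basic_open_top)

text \<open>Written with basic opens instead of compact opens of \<open>spec L\<close>: that these
  coincide is shown in \<open>compact_opens_spec\<close>, whose proof uses compactness of the
  topology generated here.\<close>

definition patch_subbase where
  "patch_subbase = basic_open L ` carrier L \<union> (\<lambda>a. prime_filters L - basic_open L a) ` carrier L"

lemma Union_patch_subbase: "\<Union>patch_subbase = prime_filters L"
  unfolding patch_subbase_def using basic_open_subset basic_open_top by (auto simp del: basic_open_top)

text \<open>By the Alexander subbase theorem the cover consists of basic opens, indexed by S, and
  complements of basic opens, indexed by R. If the filter generated by R and the ideal generated by
  S were disjoint, a prime filter separating them would be a point outside the cover. So some finite
  infimum of elements of R lies below a finite supremum of elements of S, and the corresponding
  finitely many sets cover.\<close>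

lemma compact_patch_subbase: "compact_space (topology_generated_by patch_subbase)"
proof -
  \<comment> \<open>The topology in the form to which the Alexander subbase theorem applies.
    Compactness is then inherited, since every open set of the generated topology is open in
    X.\<close>
  define X where "X = topology (arbitrary union_of (finite intersection_of (\<lambda>x. x \<in> patch_subbase)
    relative_to \<Union>patch_subbase))"
  have "compact_space X"
  proof (rule Alexander_subbase[OF X_def[symmetric]])
    fix C assume C: "C \<subseteq> patch_subbase" "\<Union>C = topspace X"
    have top: "topspace X = prime_filters L" by (simp add: X_def Union_patch_subbase)
    define S where "S = {a \<in> carrier L. basic_open L a \<in> C}"
    define R where "R = {b \<in> carrier L. prime_filters L - basic_open L b \<in> C}"
    define F where "F = {x \<in> carrier L. \<exists>R'. finite R' \<and> R' \<subseteq> R \<and> \<Sqinter>R' \<sqsubseteq> x}"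
    define I where "I = {x \<in> carrier L. \<exists>S'. finite S' \<and> S' \<subseteq> S \<and> x \<sqsubseteq> \<Squnion>S'}"
    have Sc: "S \<subseteq> carrier L" and Rc: "R \<subseteq> carrier L" by (auto simp: S_def R_def)
    have "F \<inter> I \<noteq> {}"
    proof
      assume disj: "F \<inter> I = {}"
      obtain P where P: "P \<in> prime_filters L" "F \<subseteq> P" "P \<inter> I = {}"
      proof (rule prime_filter_exists[OF _ _ _ _ _ _ _ _ disj])
        show "\<top> \<in> F" by (auto simp: F_def intro!: exI[of _ "{}"])
        show "\<bottom> \<in> I" by (auto simp: I_def intro!: exI[of _ "{}"])
      next
        fix a b assume "a \<in> F" "b \<in> F"
        then obtain R1 R2 where R12: "a \<in> carrier L" "finite R1" "R1 \<subseteq> R" "\<Sqinter>R1 \<sqsubseteq> a"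
          "b \<in> carrier L" "finite R2" "R2 \<subseteq> R" "\<Sqinter>R2 \<sqsubseteq> b" by (auto simp: F_def)
        have c: "R1 \<subseteq> carrier L" "R2 \<subseteq> carrier L" "R1 \<union> R2 \<subseteq> carrier L" using R12 Rc by auto
        have "\<Sqinter>(R1 \<union> R2) \<sqsubseteq> \<Sqinter>R1" "\<Sqinter>(R1 \<union> R2) \<sqsubseteq> \<Sqinter>R2"
          using c by (auto intro!: inf_greatest intro: inf_lower)
        then have "\<Sqinter>(R1 \<union> R2) \<sqsubseteq> a" "\<Sqinter>(R1 \<union> R2) \<sqsubseteq> b"
          using R12 c inf_closed[OF c(1)] inf_closed[OF c(2)] inf_closed[OF c(3)] by (meson le_trans)+
        then have "\<Sqinter>(R1 \<union> R2) \<sqsubseteq> a \<sqinter> b" using R12 c by (simp add: le_meet_iff)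
        then show "a \<sqinter> b \<in> F" using R12 by (auto simp: F_def intro!: exI[of _ "R1 \<union> R2"])
      next
        fix a b assume "a \<in> I" "b \<in> I"
        then obtain R1 R2 where R12: "a \<in> carrier L" "finite R1" "R1 \<subseteq> S" "a \<sqsubseteq> \<Squnion>R1"
          "b \<in> carrier L" "finite R2" "R2 \<subseteq> S" "b \<sqsubseteq> \<Squnion>R2" by (auto simp: I_def)
        have c: "R1 \<subseteq> carrier L" "R2 \<subseteq> carrier L" "R1 \<union> R2 \<subseteq> carrier L" using R12 Sc by auto
        have "\<Squnion>R1 \<sqsubseteq> \<Squnion>(R1 \<union> R2)" "\<Squnion>R2 \<sqsubseteq> \<Squnion>(R1 \<union> R2)"
          using c by (auto intro!: sup_least intro: sup_upper)
        then have "a \<sqsubseteq> \<Squnion>(R1 \<union> R2)" "b \<sqsubseteq> \<Squnion>(R1 \<union> R2)"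
          using R12 c sup_closed[OF c(1)] sup_closed[OF c(2)] sup_closed[OF c(3)] by (meson le_trans)+
        then have "a \<squnion> b \<sqsubseteq> \<Squnion>(R1 \<union> R2)" using R12 c by (simp add: join_le_iff)
        then show "a \<squnion> b \<in> I" using R12 by (auto simp: I_def intro!: exI[of _ "R1 \<union> R2"])
      next
        fix a b assume "a \<in> F" "b \<in> carrier L" "a \<sqsubseteq> b"
        then obtain R1 where "finite R1" "R1 \<subseteq> R" "\<Sqinter>R1 \<sqsubseteq> a" "a \<in> carrier L" by (auto simp: F_def)
        moreover have "\<Sqinter>R1 \<in> carrier L" by (rule inf_closed[OF subset_trans[OF \<open>R1 \<subseteq> R\<close> Rc]])
        ultimately show "b \<in> F" using \<open>a \<sqsubseteq> b\<close> \<open>b \<in> carrier L\<close> le_trans[of "\<Sqinter>R1" a b] unfolding F_def by blast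
      next
        fix a b assume "a \<in> I" "b \<in> carrier L" "b \<sqsubseteq> a"
        then obtain R1 where "finite R1" "R1 \<subseteq> S" "a \<sqsubseteq> \<Squnion>R1" "a \<in> carrier L" by (auto simp: I_def)
        moreover have "\<Squnion>R1 \<in> carrier L" by (rule sup_closed[OF subset_trans[OF \<open>R1 \<subseteq> S\<close> Sc]])
        ultimately show "b \<in> I" using \<open>b \<sqsubseteq> a\<close> \<open>b \<in> carrier L\<close> le_trans[of b a "\<Squnion>R1"] unfolding I_def by blast
      qed (auto simp: F_def I_def)
      have "S \<subseteq> I"
      proof
        fix x assume "x \<in> S"
        then show "x \<in> I" using Sc by (auto simp: I_def intro!: exI[of _ "{x}"])
      qed
      moreover have "R \<subseteq> F"
      proof
        fix x assume "x \<in> R"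
        then show "x \<in> F" using Rc by (auto simp: F_def intro!: exI[of _ "{x}"])
      qed
      moreover obtain c where c: "c \<in> C" "P \<in> c" using C(2) P(1) top by blast
      then consider a where "a \<in> carrier L" "c = basic_open L a"
        | a where "a \<in> carrier L" "c = prime_filters L - basic_open L a"
        using C(1) by (auto simp: patch_subbase_def)
      then have "(\<exists>a\<in>S. a \<in> P) \<or> (\<exists>b\<in>R. b \<notin> P)"
        using c by cases (auto simp: S_def R_def basic_open_def)
      ultimately show False using P by blast
    qed
    then obtain x R' S' where RS: "x \<in> carrier L" "finite R'" "R' \<subseteq> R" "\<Sqinter>R' \<sqsubseteq> x" "finite S'" "S' \<subseteq> S" "x \<sqsubseteq> \<Squnion>S'"
      by (auto simp: F_def I_def)
    define C' where "C' = basic_open L ` S' \<union> (\<lambda>b. prime_filters L - basic_open L b) ` R'"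
    have R'c: "R' \<subseteq> carrier L" and S'c: "S' \<subseteq> carrier L" using RS Rc Sc by auto
    have "\<Union>C' = prime_filters L"
    proof
      show "\<Union>C' \<subseteq> prime_filters L" using basic_open_subset by (auto simp: C'_def)
      show "prime_filters L \<subseteq> \<Union>C'"
      proof
        fix P assume P: "P \<in> prime_filters L"
        show "P \<in> \<Union>C'"
        proof (cases "R' \<subseteq> P")
          case True
          then have "\<Sqinter>R' \<in> P" using prime_filter_Inf_iff[OF P RS(2) R'c] by simp
          then have "\<Squnion>S' \<in> P" using RS R'c S'c prime_filterD(4)[OF P] by (meson sup_closed)
          then obtain a where "a \<in> S'" "a \<in> P" using prime_filter_Sup_iff[OF P RS(5) S'c] by auto
          then show ?thesis using P by (auto simp: C'_def basic_open_def)
        next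
          case False then show ?thesis using P by (auto simp: C'_def basic_open_def)
        qed
      qed
    qed
    moreover have "finite C'" "C' \<subseteq> C" using RS by (auto simp: C'_def S_def R_def)
    ultimately show "\<exists>C'. finite C' \<and> C' \<subseteq> C \<and> \<Union>C' = topspace X" using top by auto
  qed
  moreover have "topspace X = topspace (topology_generated_by patch_subbase)" by (simp add: X_def)
  moreover have "openin X U" if "openin (topology_generated_by patch_subbase) U" for U
  proof -
    have "openin X V" if "V \<in> patch_subbase" for V
      unfolding X_def openin_subbase
      using that by (intro arbitrary_union_of_inc relative_to_subset_inc finite_intersection_of_inc) auto
    then show ?thesis
      using generate_topology_on_coarsest[of "openin X" patch_subbase U] that
      by (auto simp: openin_topology_generated_by_iff)
  qed
  ultimately show ?thesis
    unfolding compact_space_def by (metis compactin_contractive)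
qed

lemma openin_spec_basis:
  assumes "openin (spec L) W" "P \<in> W"
  obtains a where "a \<in> carrier L" "P \<in> basic_open L a" "basic_open L a \<subseteq> W"
proof -
  have "\<exists>U\<in>basic_open L ` carrier L. P \<in> U \<and> U \<subseteq> W"
    using assms unfolding spec_def by (rule openin_generated_basis) (auto simp flip: basic_open_meet)
  then show thesis using that by auto
qed

lemma openin_spec_basic [simp]: "a \<in> carrier L \<Longrightarrow> openin (spec L) (basic_open L a)"
  unfolding spec_def by (rule topology_generated_by_Basis) (rule imageI)

text \<open>A basic open is closed in the patch topology, hence compact there, hence compact in the
  coarser spectral topology. Conversely a compact open is a finite union of basic opens, which is
  the basic open of a join.\<close>

lemma compact_opens_spec: "compact_opens (spec L) = basic_open L ` carrier L"
proof (intro subset_antisym subsetI)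
  fix U assume "U \<in> basic_open L ` carrier L"
  then obtain a where a: "a \<in> carrier L" "U = basic_open L a" by auto
  let ?T = "topology_generated_by patch_subbase"
  have top: "topspace ?T = prime_filters L" by (simp add: Union_patch_subbase)
  have "openin ?T (prime_filters L - basic_open L a)"
    using a by (intro topology_generated_by_Basis) (auto simp: patch_subbase_def)
  then have "closedin ?T (basic_open L a)"
    using basic_open_subset by (simp add: closedin_def top del: topology_generated_by_topspace)
  then have "compactin ?T (basic_open L a)" by (rule closedin_compact_space[OF compact_patch_subbase])
  moreover have "openin ?T V" if V: "openin (spec L) V" for V
  proof -
    have "\<Union>{basic_open L a |a. a \<in> carrier L \<and> basic_open L a \<subseteq> V} = V"
    proof
      show "V \<subseteq> \<Union>{basic_open L a |a. a \<in> carrier L \<and> basic_open L a \<subseteq> V}"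
      proof
        fix P assume "P \<in> V"
        then obtain a where "a \<in> carrier L" "P \<in> basic_open L a" "basic_open L a \<subseteq> V"
          using openin_spec_basis[OF V] by metis
        then show "P \<in> \<Union>{basic_open L a |a. a \<in> carrier L \<and> basic_open L a \<subseteq> V}" by auto
      qed
    qed auto
    moreover have "openin ?T (\<Union>{basic_open L a |a. a \<in> carrier L \<and> basic_open L a \<subseteq> V})"
      by (rule openin_Union) (auto intro!: topology_generated_by_Basis simp: patch_subbase_def)
    ultimately show ?thesis by simp
  qed
  ultimately have "compactin (spec L) (basic_open L a)"
    by (intro compactin_contractive[of ?T "basic_open L a" "spec L"]) (auto simp: top simp del: topology_generated_by_topspace)
  then show "U \<in> compact_opens (spec L)" using a by (simp add: compact_opens_def)
next
  fix U assume "U \<in> compact_opens (spec L)"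
  then have U: "openin (spec L) U" "compactin (spec L) U" by (auto simp: compact_opens_def)
  let ?B = "basic_open L ` {a \<in> carrier L. basic_open L a \<subseteq> U}"
  have "U \<subseteq> \<Union>?B"
  proof
    fix P assume "P \<in> U"
    then obtain a where "a \<in> carrier L" "P \<in> basic_open L a" "basic_open L a \<subseteq> U"
      using openin_spec_basis[OF U(1)] by metis
    then show "P \<in> \<Union>?B" by auto
  qed
  moreover have "openin (spec L) V" if "V \<in> ?B" for V using that by auto
  ultimately obtain C where C: "finite C" "C \<subseteq> ?B" "U \<subseteq> \<Union>C"
    using compactinD[OF U(2), of ?B] by blast
  then obtain S where S: "S \<subseteq> {a \<in> carrier L. basic_open L a \<subseteq> U}" "finite S" "C = basic_open L ` S"
    using finite_subset_image[OF C(1,2)] by blast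
  have "S \<subseteq> carrier L" using S by auto
  then have "basic_open L (\<Squnion>S) = U" using S C by (auto simp: basic_open_Sup)
  then show "U \<in> basic_open L ` carrier L" using \<open>S \<subseteq> carrier L\<close> by (metis imageI sup_closed)
qed

lemma patch_spec: "patch (spec L) = topology_generated_by patch_subbase"
  by (simp add: patch_def compact_opens_spec patch_subbase_def image_image)

lemma topspace_patch [simp]: "topspace (patch (spec L)) = prime_filters L"
  by (simp add: patch_spec Union_patch_subbase)

lemma compact_patch: "compact_space (patch (spec L))"
  by (simp add: patch_spec compact_patch_subbase)

lemma openin_patch_basic [simp]: "a \<in> carrier L \<Longrightarrow> openin (patch (spec L)) (basic_open L a)"
  unfolding patch_spec by (rule topology_generated_by_Basis) (auto simp: patch_subbase_def)

lemma closedin_patch_basic [simp]: "a \<in> carrier L \<Longrightarrow> closedin (patch (spec L)) (basic_open L a)"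
  unfolding closedin_def
  by (auto simp: basic_open_def) (auto simp: patch_spec patch_subbase_def basic_open_def intro!: topology_generated_by_Basis)

lemma openin_patch_diff [simp]:
  "\<lbrakk>a \<in> carrier L; b \<in> carrier L\<rbrakk> \<Longrightarrow> openin (patch (spec L)) (basic_diff b a)"
  by (simp add: openin_diff)

lemma openin_patch_compl [simp]:
  "a \<in> carrier L \<Longrightarrow> openin (patch (spec L)) (prime_filters L - basic_open L a)"
  using openin_patch_diff[of a \<top>] by simp

lemma compactin_patch_diff:
  "\<lbrakk>a \<in> carrier L; b \<in> carrier L\<rbrakk> \<Longrightarrow> compactin (patch (spec L)) (basic_diff b a)"
  by (intro closedin_compact_space[OF compact_patch] closedin_diff) auto

lemma openin_patch_basis:
  assumes "openin (patch (spec L)) W" "P \<in> W"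
  obtains a b where "a \<in> carrier L" "b \<in> carrier L" "P \<in> basic_diff b a" "basic_diff b a \<subseteq> W"
proof -
  let ?C = "{basic_diff b a |a b. a \<in> carrier L \<and> b \<in> carrier L}"
  have "\<exists>U\<in>?C. P \<in> U \<and> U \<subseteq> W"
    using assms unfolding patch_spec
  proof (rule openin_generated_basis)
    fix U assume "U \<in> patch_subbase"
    then consider a where "a \<in> carrier L" "U = basic_diff a \<bottom>" | a where "a \<in> carrier L" "U = basic_diff \<top> a"
      by (auto simp: patch_subbase_def)
    then show "U \<in> ?C" by cases (metis (mono_tags, lifting) bottom_closed mem_Collect_eq,
        metis (mono_tags, lifting) top_closed mem_Collect_eq)
  next
    fix U V assume "U \<in> ?C" "V \<in> ?C"
    then obtain a b a' b' where ab: "a \<in> carrier L" "b \<in> carrier L" "a' \<in> carrier L" "b' \<in> carrier L"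
      "U = basic_diff b a" "V = basic_diff b' a'" by auto
    then have "U \<inter> V = basic_diff (b \<sqinter> b') (a \<squnion> a')" by (auto simp: basic_open_meet basic_open_join)
    then show "U \<inter> V \<in> ?C"
      using ab by - (rule CollectI, rule exI[of _ "a \<squnion> a'"], rule exI[of _ "b \<sqinter> b'"], simp)
  qed
  then show thesis using that by blast
qed

text \<open>Total order disconnectedness is witnessed by basic opens: an element of P outside Q
  gives a clopen up-set that contains P and misses Q.\<close>

lemma priestley_space_spec: "priestley_space (patch (spec L)) (spec_order L)"
  unfolding priestley_space_def
proof (intro conjI ballI impI)
  show "partial_order_on (topspace (patch (spec L))) (spec_order L)"
    by (auto simp: spec_order_def partial_order_on_def preorder_on_def refl_on_def trans_def antisym_def)
  fix P Q assume PQ: "P \<in> topspace (patch (spec L))" "Q \<in> topspace (patch (spec L))" "(P, Q) \<notin> spec_order L"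
  then obtain a where a: "a \<in> P" "a \<notin> Q" by (auto simp: spec_order_def)
  then have "a \<in> carrier L" using PQ prime_filterD(1) by auto
  moreover have "upset (patch (spec L)) (spec_order L) (basic_open L a)"
    by (auto simp: upset_def basic_open_def spec_order_def)
  ultimately show "\<exists>U. openin (patch (spec L)) U \<and> closedin (patch (spec L)) U \<and>
      upset (patch (spec L)) (spec_order L) U \<and> P \<in> U \<and> Q \<notin> U"
    using a PQ by (intro exI[of _ "basic_open L a"]) (simp, simp add: basic_open_def)
qed (rule compact_patch)

text \<open>Let P be a point of a compact open up-set U. A prime filter outside U cannot contain P,
  so the complements of the basic opens of elements of P cover the complement of U. Finitely many
  suffice, and the basic open of the infimum of these elements is a neighbourhood of P inside U.
  Compactness of U then leaves finitely many such neighbourhoods.\<close>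

lemma compact_open_upsets:
  "U \<in> compact_opens (patch (spec L)) \<and> upset (patch (spec L)) (spec_order L) U \<longleftrightarrow>
    U \<in> basic_open L ` carrier L"
proof
  assume "U \<in> basic_open L ` carrier L"
  then obtain a where a: "a \<in> carrier L" "U = basic_open L a" by auto
  then have "compactin (patch (spec L)) U" using compactin_patch_diff[of \<bottom> a] by simp
  then show "U \<in> compact_opens (patch (spec L)) \<and> upset (patch (spec L)) (spec_order L) U"
    using a unfolding compact_opens_def upset_def
    by (simp add: basic_open_subset) (auto simp: spec_order_def basic_open_def)
next
  assume "U \<in> compact_opens (patch (spec L)) \<and> upset (patch (spec L)) (spec_order L) U"
  then have U: "openin (patch (spec L)) U" "compactin (patch (spec L)) U"
    and up: "\<And>P Q. \<lbrakk>P \<in> U; Q \<in> prime_filters L; P \<subseteq> Q\<rbrakk> \<Longrightarrow> Q \<in> U" and sub: "U \<subseteq> prime_filters L"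
    by (auto simp: compact_opens_def upset_def spec_order_def)
  have cover: "\<exists>a\<in>carrier L. P \<in> basic_open L a \<and> basic_open L a \<subseteq> U" if P: "P \<in> U" for P
  proof -
    let ?B = "(\<lambda>a. prime_filters L - basic_open L a) ` P"
    have Pc: "P \<subseteq> carrier L" using P sub prime_filterD(1) by auto
    have comp: "compactin (patch (spec L)) (prime_filters L - U)"
      using U(1) by (intro closedin_compact_space[OF compact_patch]) (auto simp: closedin_def double_diff sub)
    have "prime_filters L - U \<subseteq> \<Union>?B"
      using up[OF P] by (auto simp: basic_open_def)
    moreover have "openin (patch (spec L)) V" if "V \<in> ?B" for V
      using that Pc openin_patch_diff[of _ \<top>] by auto
    ultimately obtain C where C: "finite C" "C \<subseteq> ?B" "prime_filters L - U \<subseteq> \<Union>C"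
      using compactinD[OF comp, of ?B] by blast
    then obtain S where S: "S \<subseteq> P" "finite S" "C = (\<lambda>a. prime_filters L - basic_open L a) ` S"
      using finite_subset_image[OF C(1,2)] by blast
    have Sc: "S \<subseteq> carrier L" using S Pc by auto
    have "P \<in> basic_open L (\<Sqinter>S)" using S Sc P sub by (auto simp: basic_open_Inf)
    moreover have "basic_open L (\<Sqinter>S) \<subseteq> U"
      using S C(3) by (auto simp: basic_open_Inf[OF S(2) Sc]) (auto simp: basic_open_def)
    ultimately show ?thesis using Sc by (intro bexI[of _ "\<Sqinter>S"]) auto
  qed
  let ?B = "basic_open L ` {a \<in> carrier L. basic_open L a \<subseteq> U}"
  have "U \<subseteq> \<Union>?B" using cover by blast
  moreover have "openin (patch (spec L)) V" if "V \<in> ?B" for V using that by auto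
  ultimately obtain C where C: "finite C" "C \<subseteq> ?B" "U \<subseteq> \<Union>C"
    using compactinD[OF U(2), of ?B] by blast
  then obtain S where S: "S \<subseteq> {a \<in> carrier L. basic_open L a \<subseteq> U}" "finite S" "C = basic_open L ` S"
    using finite_subset_image[OF C(1,2)] by blast
  have "S \<subseteq> carrier L" using S by auto
  then have "basic_open L (\<Squnion>S) = U" using S C by (auto simp: basic_open_Sup)
  then show "U \<in> basic_open L ` carrier L" using \<open>S \<subseteq> carrier L\<close> by (metis imageI sup_closed)
qed

end


section \<open>The frame morphism from patch-open sets to nuclei\<close>

lemma carrier_opens [simp]: "carrier (opens T) = {U. openin T U}"
  and le_opens [simp]: "U \<sqsubseteq>\<^bsub>opens T\<^esub> V \<longleftrightarrow> U \<subseteq> V"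
  by (simp_all add: opens_def)

lemma opens_partial_order: "partial_order (opens T)"
  by unfold_locales (auto simp: opens_def)

lemma opens_complete_lattice: "complete_lattice (opens T)"
proof -
  interpret partial_order "opens T" by (rule opens_partial_order)
  show ?thesis
  proof (rule complete_latticeI)
    fix A assume "A \<subseteq> carrier (opens T)"
    then show "\<exists>s. is_lub (opens T) s A"
      by (intro exI[of _ "\<Union>A"] least_UpperI) (auto simp: Upper_def)
    show "\<exists>s. is_glb (opens T) s A"
      using \<open>A \<subseteq> carrier (opens T)\<close>
      by (intro exI[of _ "\<Union>{U. openin T U \<and> (\<forall>V\<in>A. U \<subseteq> V)}"] greatest_LowerI) (auto simp: Lower_def)
  qed
qed

lemma opens_Sup: "A \<subseteq> carrier (opens T) \<Longrightarrow> \<Squnion>\<^bsub>opens T\<^esub> A = \<Union>A"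
proof -
  assume A: "A \<subseteq> carrier (opens T)"
  interpret complete_lattice "opens T" by (rule opens_complete_lattice)
  have "\<Union>A \<in> carrier (opens T)" using A by auto
  then have "\<Squnion>\<^bsub>opens T\<^esub> A \<sqsubseteq>\<^bsub>opens T\<^esub> \<Union>A" unfolding Sup_le_iff[OF A \<open>\<Union>A \<in> carrier (opens T)\<close>] by auto
  moreover have "\<Union>A \<subseteq> \<Squnion>\<^bsub>opens T\<^esub> A" using sup_upper[OF A] by auto
  ultimately show ?thesis by simp
qed

lemma opens_meet: "\<lbrakk>openin T U; openin T V\<rbrakk> \<Longrightarrow> U \<sqinter>\<^bsub>opens T\<^esub> V = U \<inter> V"
proof -
  assume UV: "openin T U" "openin T V"
  interpret complete_lattice "opens T" by (rule opens_complete_lattice)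
  have "U \<inter> V \<sqsubseteq>\<^bsub>opens T\<^esub> U \<sqinter>\<^bsub>opens T\<^esub> V" using UV by (intro meet_le) auto
  moreover have "U \<sqinter>\<^bsub>opens T\<^esub> V \<subseteq> U" "U \<sqinter>\<^bsub>opens T\<^esub> V \<subseteq> V"
    using UV meet_left[of U V] meet_right[of U V] by auto
  ultimately show ?thesis by auto
qed

lemma opens_top [simp]: "\<top>\<^bsub>opens T\<^esub> = topspace T"
proof -
  interpret complete_lattice "opens T" by (rule opens_complete_lattice)
  show ?thesis
    using top_closed top_higher[of "topspace T"] by (auto dest: openin_subset)
qed

lemma frame_hom_opens_iff:
  "h \<in> frame_hom (opens T) M \<longleftrightarrow> h \<in> {U. openin T U} \<rightarrow>\<^sub>E carrier M \<and> h (topspace T) = \<top>\<^bsub>M\<^esub> \<and>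
     (\<forall>U V. openin T U \<longrightarrow> openin T V \<longrightarrow> h (U \<inter> V) = h U \<sqinter>\<^bsub>M\<^esub> h V) \<and>
     (\<forall>S. (\<forall>U\<in>S. openin T U) \<longrightarrow> h (\<Union>S) = \<Squnion>\<^bsub>M\<^esub> (h ` S))"
  unfolding frame_hom_def using opens_Sup[of _ T] by (auto simp: opens_meet subset_iff)

lemma frame_hom_opensD:
  assumes h: "h \<in> frame_hom (opens T) M"
  shows "openin T U \<Longrightarrow> h U \<in> carrier M" "h (topspace T) = \<top>\<^bsub>M\<^esub>"
    "\<lbrakk>openin T U; openin T V\<rbrakk> \<Longrightarrow> h (U \<inter> V) = h U \<sqinter>\<^bsub>M\<^esub> h V"
    "(\<And>U. U \<in> S \<Longrightarrow> openin T U) \<Longrightarrow> h (\<Union>S) = \<Squnion>\<^bsub>M\<^esub> (h ` S)"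
    "\<lbrakk>openin T U; openin T V\<rbrakk> \<Longrightarrow> h (U \<union> V) = h U \<squnion>\<^bsub>M\<^esub> h V"
    "complete_lattice M \<Longrightarrow> h {} = \<bottom>\<^bsub>M\<^esub>"
proof -
  show "openin T U \<Longrightarrow> h U \<in> carrier M" "h (topspace T) = \<top>\<^bsub>M\<^esub>"
    "\<lbrakk>openin T U; openin T V\<rbrakk> \<Longrightarrow> h (U \<inter> V) = h U \<sqinter>\<^bsub>M\<^esub> h V"
    using h unfolding frame_hom_opens_iff by auto
  show Sup: "(\<And>U. U \<in> S \<Longrightarrow> openin T U) \<Longrightarrow> h (\<Union>S) = \<Squnion>\<^bsub>M\<^esub> (h ` S)" for S
    using h unfolding frame_hom_opens_iff by auto
  show "\<lbrakk>openin T U; openin T V\<rbrakk> \<Longrightarrow> h (U \<union> V) = h U \<squnion>\<^bsub>M\<^esub> h V"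
    using Sup[of "{U, V}"] by (auto simp: join_def)
  show "h {} = \<bottom>\<^bsub>M\<^esub>" if "complete_lattice M"
  proof -
    interpret complete_lattice M by fact
    show ?thesis using Sup[of "{}"] by simp
  qed
qed

context dissolution
begin

text \<open>Induction on the number of differences. Removing the difference of c and d, the
  hypothesis for b and a \<squnion> c gives b \<sqsubseteq> \<mu> (a \<squnion> c), hence b
  \<sqsubseteq> \<mu> (a \<squnion> d) because c \<sqsubseteq> \<mu> d; the hypothesis for b
  \<sqinter> d and a gives b \<sqinter> d \<sqsubseteq> \<mu> a. As \<mu> preserves meets, b
  \<sqsubseteq> \<mu> (b \<sqinter> (a \<squnion> d)), and distributivity ends in \<mu> (\<mu> a) =
  \<mu> a.\<close>

lemma basic_diff_cover:
  assumes "finite K" "a \<in> carrier L" "b \<in> carrier L" "\<mu> \<in> nucs L"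
    and "\<And>c d. (c, d) \<in> K \<Longrightarrow> c \<in> carrier L \<and> d \<in> carrier L \<and> c \<sqsubseteq> \<mu> d"
    and "basic_open L b \<subseteq> basic_open L a \<union> (\<Union>(c, d)\<in>K. basic_diff c d)"
  shows "b \<sqsubseteq> \<mu> a"
  using assms(1,2,3,5,6)
proof (induction K arbitrary: a b rule: finite_induct)
  case empty
  then have "b \<sqsubseteq> a" by (simp add: basic_open_subset_iff)
  then show ?case using empty nucleus_inflationary[OF assms(4)] nucleus_closed[OF assms(4)] by (meson le_trans)
next
  case (insert k K)
  obtain c d where k: "k = (c, d)" by (metis surj_pair)
  have cd: "c \<in> carrier L" "d \<in> carrier L" "c \<sqsubseteq> \<mu> d" using insert.prems(3)[of c d] k by auto
  note ab = insert.prems(1,2) and mc = nucleus_closed[OF assms(4)]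
  have "b \<sqsubseteq> \<mu> (a \<squnion> c)"
    using ab cd insert.prems(3,4) by (intro insert.IH) (auto simp: basic_open_join k)
  also have "\<mu> (a \<squnion> c) \<sqsubseteq> \<mu> (\<mu> (a \<squnion> d))"
  proof (rule nucleus_mono[OF assms(4)])
    have "a \<sqsubseteq> \<mu> (a \<squnion> d)" "\<mu> d \<sqsubseteq> \<mu> (a \<squnion> d)"
      using ab cd mc nucleus_inflationary[OF assms(4), of "a \<squnion> d"]
      by (auto intro: le_trans[OF join_left] nucleus_mono[OF assms(4)] join_right)
    then show "a \<squnion> c \<sqsubseteq> \<mu> (a \<squnion> d)" using ab cd mc by (simp add: join_le_iff) (meson le_trans join_closed)
  qed (use ab cd mc in auto)
  finally have 1: "b \<sqsubseteq> \<mu> (a \<squnion> d)" using ab cd mc by (simp add: nucleus_idem[OF assms(4)])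
  have 2: "b \<sqinter> d \<sqsubseteq> \<mu> a"
    using ab cd insert.prems(3,4) by (intro insert.IH) (auto simp: basic_open_meet k)
  have "b \<sqsubseteq> \<mu> b \<sqinter> \<mu> (a \<squnion> d)" using 1 ab cd mc by (simp add: le_meet_iff nucleus_inflationary[OF assms(4)])
  also have "\<dots> = \<mu> ((b \<sqinter> a) \<squnion> (b \<sqinter> d))"
    using ab cd by (simp add: meet_join_distrib flip: nucleus_meet[OF assms(4)])
  also have "\<dots> \<sqsubseteq> \<mu> (\<mu> a)"
  proof (rule nucleus_mono[OF assms(4)])
    have "b \<sqinter> a \<sqsubseteq> \<mu> a" using ab mc nucleus_inflationary[OF assms(4) ab(1)] le_trans[OF meet_right] by simp
    then show "(b \<sqinter> a) \<squnion> (b \<sqinter> d) \<sqsubseteq> \<mu> a" using 2 ab cd mc by (simp add: join_le_iff)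
  qed (use ab cd mc in auto)
  finally show ?case using ab cd mc by (simp add: nucleus_idem[OF assms(4)])
qed

text \<open>The only possible inverse image of j: an open set is the union of the basic differences
  inside it, and each of these has to go to the corresponding difference of nuclei.\<close>

definition patch_nucleus where
  "patch_nucleus = (\<lambda>W\<in>carrier (opens (patch (spec L))).
     \<Squnion>\<^bsub>nuclei L\<^esub>{diff_nucleus L b a |a b. a \<in> carrier L \<and> b \<in> carrier L \<and> basic_diff b a \<subseteq> W})"

lemma patch_nucleus_set:
  "{diff_nucleus L b a |a b. a \<in> carrier L \<and> b \<in> carrier L \<and> basic_diff b a \<subseteq> W} \<subseteq> nucs L"
  by auto

lemma patch_nucleus_closed: "openin (patch (spec L)) W \<Longrightarrow> patch_nucleus W \<in> nucs L"
  by (simp add: patch_nucleus_def N.sup_closed[OF patch_nucleus_set])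

lemma patch_nucleus_le_iff:
  assumes "openin (patch (spec L)) W" "\<mu> \<in> nucs L"
  shows "patch_nucleus W \<preceq> \<mu> \<longleftrightarrow>
    (\<forall>a\<in>carrier L. \<forall>b\<in>carrier L. basic_diff b a \<subseteq> W \<longrightarrow> b \<sqsubseteq> \<mu> a)"
proof -
  let ?I = "{(a, b). a \<in> carrier L \<and> b \<in> carrier L \<and> basic_diff b a \<subseteq> W}"
  have eq: "{diff_nucleus L b a |a b. a \<in> carrier L \<and> b \<in> carrier L \<and> basic_diff b a \<subseteq> W} =
    (\<lambda>(a, b). diff_nucleus L b a) ` ?I" by auto
  have "(\<lambda>(a, b). diff_nucleus L b a) ` ?I \<subseteq> nucs L" by auto
  then have "patch_nucleus W \<preceq> \<mu> \<longleftrightarrow> (\<forall>(a, b)\<in>?I. diff_nucleus L b a \<preceq> \<mu>)"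
    using assms by (simp add: patch_nucleus_def eq N.Sup_le_iff case_prod_unfold)
  then show ?thesis using assms(2) by (auto simp: diff_nucleus_le_iff)
qed

text \<open>By \<open>basic_open_subset_iff\<close> the difference of c and d is contained in the
  basic open of a iff c \<sqsubseteq> d \<squnion> a; for fixed d the best c is d \<squnion> a
  itself, the value of the closed nucleus at d.\<close>

lemma patch_nucleus_basic:
  assumes a: "a \<in> carrier L"
  shows "patch_nucleus (basic_open L a) = closed_nucleus L a"
proof (rule N.eq_if_same_upper_bounds)
  fix \<mu> assume \<mu>: "\<mu> \<in> nucs L"
  have "basic_diff c d \<subseteq> basic_open L a \<longleftrightarrow> c \<sqsubseteq> d \<squnion> a" if "c \<in> carrier L" "d \<in> carrier L" for c d
    using that a by (subst basic_open_subset_iff[symmetric]) (auto simp: basic_open_join)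
  then have "patch_nucleus (basic_open L a) \<preceq> \<mu> \<longleftrightarrow>
      (\<forall>d\<in>carrier L. \<forall>c\<in>carrier L. c \<sqsubseteq> d \<squnion> a \<longrightarrow> c \<sqsubseteq> \<mu> d)"
    using a \<mu> by (simp add: patch_nucleus_le_iff)
  also have "\<dots> \<longleftrightarrow> (\<forall>d\<in>carrier L. d \<squnion> a \<sqsubseteq> \<mu> d)"
    using a nucleus_closed[OF \<mu>] by (meson join_closed le_refl le_trans)
  also have "\<dots> \<longleftrightarrow> closed_nucleus L a \<preceq> \<mu>"
    using a by (simp add: nuclei_le closed_nucleus_def join_comm[of L a])
  finally show "patch_nucleus (basic_open L a) \<preceq> \<mu> \<longleftrightarrow> closed_nucleus L a \<preceq> \<mu>" .
qed (use a in \<open>auto simp: patch_nucleus_closed\<close>)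

text \<open>Meets are those of differences. For a union, a basic difference covered by the members
  of S is covered by finitely many smaller differences, each inside one member, by compactness in
  the patch topology; \<open>basic_diff_cover\<close> turns this into the required inequality in
  L.\<close>

lemma patch_nucleus_frame_hom: "patch_nucleus \<in> frame_hom (opens (patch (spec L))) (nuclei L)"
  unfolding frame_hom_opens_iff
proof (intro conjI allI impI)
  show "patch_nucleus \<in> {U. openin (patch (spec L)) U} \<rightarrow>\<^sub>E nucs L"
    using patch_nucleus_closed by (auto simp: PiE_def) (simp add: patch_nucleus_def)
  show "patch_nucleus (topspace (patch (spec L))) = \<top>\<^bsub>nuclei L\<^esub>"
    using patch_nucleus_basic[of \<top>] by simp
next
  fix U V assume U: "openin (patch (spec L)) U" and V: "openin (patch (spec L)) V"
  then have UV: "openin (patch (spec L)) (U \<inter> V)" by auto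
  show "patch_nucleus (U \<inter> V) = patch_nucleus U \<sqinter>\<^bsub>nuclei L\<^esub> patch_nucleus V"
  proof (rule N.le_antisym)
    have mono: "patch_nucleus W \<preceq> patch_nucleus W'"
      if W: "openin (patch (spec L)) W" "openin (patch (spec L)) W'" "W \<subseteq> W'" for W W'
    proof -
      have "\<forall>a\<in>carrier L. \<forall>b\<in>carrier L. basic_diff b a \<subseteq> W' \<longrightarrow> b \<sqsubseteq> patch_nucleus W' a"
        using patch_nucleus_le_iff[OF W(2) patch_nucleus_closed[OF W(2)]] W(2)
        by (simp add: patch_nucleus_closed)
      then show ?thesis
        using W by (subst patch_nucleus_le_iff) (auto simp: patch_nucleus_closed)
    qed
    show "patch_nucleus (U \<inter> V) \<preceq> patch_nucleus U \<sqinter>\<^bsub>nuclei L\<^esub> patch_nucleus V"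
      using U V UV by (simp add: N.le_meet_iff patch_nucleus_closed mono)
    have UVs: "patch_nucleus (U \<inter> V) \<in> nucs L" by (rule patch_nucleus_closed[OF UV])
    have ap: "\<forall>a\<in>carrier L. \<forall>b\<in>carrier L. basic_diff b a \<subseteq> U \<inter> V \<longrightarrow> b \<sqsubseteq> patch_nucleus (U \<inter> V) a"
      using patch_nucleus_le_iff[OF UV UVs] UVs by simp
    let ?S = "\<lambda>W. {diff_nucleus L b a |a b. a \<in> carrier L \<and> b \<in> carrier L \<and> basic_diff b a \<subseteq> W}"
    have "\<Squnion>\<^bsub>nuclei L\<^esub>(?S U) \<sqinter>\<^bsub>nuclei L\<^esub> \<Squnion>\<^bsub>nuclei L\<^esub>(?S V) \<preceq> patch_nucleus (U \<inter> V)"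
    proof (rule N.Sup_meet_Sup_le[OF patch_nucleus_set patch_nucleus_set UVs])
      fix s t assume "s \<in> ?S U" "t \<in> ?S V"
      then obtain a b a' b' where ab: "a \<in> carrier L" "b \<in> carrier L" "a' \<in> carrier L" "b' \<in> carrier L"
        "s = diff_nucleus L b a" "t = diff_nucleus L b' a'" "basic_diff b a \<subseteq> U" "basic_diff b' a' \<subseteq> V" by auto
      have "basic_diff (b \<sqinter> b') (a \<squnion> a') \<subseteq> U \<inter> V" using ab by (auto simp: basic_open_meet basic_open_join)
      then have "diff_nucleus L (b \<sqinter> b') (a \<squnion> a') \<preceq> patch_nucleus (U \<inter> V)"
        using ap ab UVs by (simp add: diff_nucleus_le_iff)
      then show "s \<sqinter>\<^bsub>nuclei L\<^esub> t \<preceq> patch_nucleus (U \<inter> V)"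
        using ab UVs N.le_trans[OF diff_meet_diff[OF ab(1-4)]] by simp
    qed
    then show "patch_nucleus U \<sqinter>\<^bsub>nuclei L\<^esub> patch_nucleus V \<preceq> patch_nucleus (U \<inter> V)"
      using U V by (simp add: patch_nucleus_def)
  qed (use U V UV in \<open>auto simp: patch_nucleus_closed\<close>)
next
  fix S assume "\<forall>U\<in>S. openin (patch (spec L)) U"
  then have S: "\<And>U. U \<in> S \<Longrightarrow> openin (patch (spec L)) U" by blast
  then have SU: "openin (patch (spec L)) (\<Union>S)" by auto
  have im: "patch_nucleus ` S \<subseteq> nucs L" using S patch_nucleus_closed by auto
  show "patch_nucleus (\<Union>S) = \<Squnion>\<^bsub>nuclei L\<^esub>(patch_nucleus ` S)"
  proof (rule N.eq_if_same_upper_bounds)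
    fix \<mu> assume \<mu>: "\<mu> \<in> nucs L"
    have "(\<forall>a\<in>carrier L. \<forall>b\<in>carrier L. basic_diff b a \<subseteq> \<Union>S \<longrightarrow> b \<sqsubseteq> \<mu> a) \<longleftrightarrow>
      (\<forall>U\<in>S. \<forall>a\<in>carrier L. \<forall>b\<in>carrier L. basic_diff b a \<subseteq> U \<longrightarrow> b \<sqsubseteq> \<mu> a)" (is "?l \<longleftrightarrow> ?r")
    proof
      assume l: ?l
      show ?r
      proof (intro ballI impI)
        fix U a b assume "U \<in> S" "a \<in> carrier L" "b \<in> carrier L" "basic_diff b a \<subseteq> U"
        then have "basic_diff b a \<subseteq> \<Union>S" by auto
        then show "b \<sqsubseteq> \<mu> a" using l \<open>a \<in> carrier L\<close> \<open>b \<in> carrier L\<close> by simp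
      qed
    next
      assume r: ?r
      show ?l
      proof (intro ballI impI)
        fix a b assume ab: "a \<in> carrier L" "b \<in> carrier L" "basic_diff b a \<subseteq> \<Union>S"
        \<comment> \<open>The differences contained in a single member of S. They cover the union,
          and they are the pieces to which the assumption on \<mu> applies.\<close>
        define I where "I = {(c, d). c \<in> carrier L \<and> d \<in> carrier L \<and> (\<exists>U\<in>S. basic_diff c d \<subseteq> U)}"
        let ?B = "(\<lambda>(c, d). basic_diff c d) ` I"
        have "basic_diff b a \<subseteq> \<Union>?B"
        proof
          fix P assume "P \<in> basic_diff b a"
          then obtain U where "U \<in> S" "P \<in> U" using ab by blast
          then obtain c d where "c \<in> carrier L" "d \<in> carrier L" "P \<in> basic_diff c d" "basic_diff c d \<subseteq> U"
            using openin_patch_basis[OF S] by metis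
          then show "P \<in> \<Union>?B" using \<open>U \<in> S\<close> by (intro UnionI[of "basic_diff c d"]) (auto simp: I_def)
        qed
        moreover have "openin (patch (spec L)) V" if "V \<in> ?B" for V using that by (auto simp: I_def)
        ultimately obtain C where C: "finite C" "C \<subseteq> ?B" "basic_diff b a \<subseteq> \<Union>C"
          using compactinD[OF compactin_patch_diff[OF ab(1,2)], of ?B] by blast
        then obtain K where K: "K \<subseteq> I" "finite K" "C = (\<lambda>(c, d). basic_diff c d) ` K"
          using finite_subset_image[OF C(1,2)] by blast
        show "b \<sqsubseteq> \<mu> a"
        proof (rule basic_diff_cover[OF K(2) ab(1,2) \<mu>])
          fix c d assume "(c, d) \<in> K"
          then have "(c, d) \<in> I" using K by auto
          then show "c \<in> carrier L \<and> d \<in> carrier L \<and> c \<sqsubseteq> \<mu> d" using r by (auto simp: I_def)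
        next
          show "basic_open L b \<subseteq> basic_open L a \<union> (\<Union>(c, d)\<in>K. basic_diff c d)" using C K by auto
        qed
      qed
    qed
    then show "patch_nucleus (\<Union>S) \<preceq> \<mu> \<longleftrightarrow> \<Squnion>\<^bsub>nuclei L\<^esub>(patch_nucleus ` S) \<preceq> \<mu>"
      using \<mu> S unfolding N.Sup_le_iff[OF im \<mu>] by (simp add: patch_nucleus_le_iff SU)
  qed (use im SU in \<open>auto simp: patch_nucleus_closed\<close>)
qed

text \<open>Frame morphisms out of the patch topology are determined on the basic opens, since
  they preserve complements.\<close>

lemma patch_hom_unique:
  assumes M: "frame_lattice M"
    and g: "g \<in> frame_hom (opens (patch (spec L))) M" and h: "h \<in> frame_hom (opens (patch (spec L))) M"
    and eq: "\<And>a. a \<in> carrier L \<Longrightarrow> g (basic_open L a) = h (basic_open L a)"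
  shows "g = h"
proof -
  interpret M: frame_lattice M by fact
  let ?T = "patch (spec L)"

  have compl: "k (basic_open L a) \<sqinter>\<^bsub>M\<^esub> k (basic_diff \<top> a) = \<bottom>\<^bsub>M\<^esub>"
      "k (basic_open L a) \<squnion>\<^bsub>M\<^esub> k (basic_diff \<top> a) = \<top>\<^bsub>M\<^esub>" "k (basic_diff \<top> a) \<in> carrier M"
      "k (basic_open L a) \<in> carrier M"
    if k: "k \<in> frame_hom (opens ?T) M" and a: "a \<in> carrier L" for k a
  proof -
    note o = openin_patch_basic[OF a] openin_patch_diff[OF a top_closed]
    have "basic_open L a \<inter> basic_diff \<top> a = {}" by auto
    then show "k (basic_open L a) \<sqinter>\<^bsub>M\<^esub> k (basic_diff \<top> a) = \<bottom>\<^bsub>M\<^esub>"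
      using frame_hom_opensD(3)[OF k o] frame_hom_opensD(6)[OF k M.complete_lattice_axioms] by simp
    have "basic_open L a \<union> basic_diff \<top> a = topspace ?T" using basic_open_subset by auto
    then show "k (basic_open L a) \<squnion>\<^bsub>M\<^esub> k (basic_diff \<top> a) = \<top>\<^bsub>M\<^esub>"
      using frame_hom_opensD(5)[OF k o] frame_hom_opensD(2)[OF k] by simp
    show "k (basic_diff \<top> a) \<in> carrier M" "k (basic_open L a) \<in> carrier M"
      using frame_hom_opensD(1)[OF k] o by auto
  qed
  have eq': "g (basic_diff \<top> a) = h (basic_diff \<top> a)" if a: "a \<in> carrier L" for a
    by (rule M.complement_unique[OF compl(4)[OF g a] compl(3)[OF g a] compl(3)[OF h a] compl(1,2)[OF g a]])
      (simp_all only: eq[OF a] compl[OF h a])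
  have diff: "g (basic_diff b a) = h (basic_diff b a)" if a: "a \<in> carrier L" and b: "b \<in> carrier L" for a b
  proof -
    have "k (basic_open L b \<inter> basic_diff \<top> a) = k (basic_open L b) \<sqinter>\<^bsub>M\<^esub> k (basic_diff \<top> a)"
      if "k \<in> frame_hom (opens ?T) M" for k
      by (rule frame_hom_opensD(3)[OF that openin_patch_basic[OF b] openin_patch_diff[OF a top_closed]])
    note meet = this
    have "basic_diff b a = basic_open L b \<inter> basic_diff \<top> a" using basic_open_subset by auto
    then show ?thesis by (simp only: meet[OF g] meet[OF h] eq[OF b] eq'[OF a])
  qed
  show ?thesis
  proof (rule PiE_ext[OF frame_homD(1)[OF g] frame_homD(1)[OF h]])
    fix W assume "W \<in> carrier (opens ?T)"
    then have W: "openin ?T W" by simp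
    let ?D = "{basic_diff b a |a b. a \<in> carrier L \<and> b \<in> carrier L \<and> basic_diff b a \<subseteq> W}"
    have UD: "\<Union>?D = W"
    proof
      show "W \<subseteq> \<Union>?D"
      proof
        fix P assume "P \<in> W"
        then obtain a b where "a \<in> carrier L" "b \<in> carrier L" "P \<in> basic_diff b a" "basic_diff b a \<subseteq> W"
          using openin_patch_basis[OF W] by metis
        then show "P \<in> \<Union>?D" by (intro UnionI[of "basic_diff b a"]) auto
      qed
    qed auto
    have "g ` ?D = h ` ?D" using diff by (intro image_cong) auto
    moreover have Sup: "k (\<Union>?D) = \<Squnion>\<^bsub>M\<^esub> (k ` ?D)" if "k \<in> frame_hom (opens ?T) M" for k
      using that by (rule frame_hom_opensD(4)) auto
    ultimately show "g W = h W" using Sup[OF g] Sup[OF h] by (simp only: UD)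
  qed
qed

lemma i_inv_basic: "a \<in> carrier L \<Longrightarrow> i_inv L (basic_open L a) = a"
  unfolding i_inv_def
  by (rule eq_if_same_upper_bounds) (auto simp: basic_open_subset_iff Sup_le_iff intro: le_trans)

text \<open>Existence and uniqueness for the description that defines \<open>j_inv\<close>. On an
  open set of the spectral topology both sides are suprema over the basic opens it contains.\<close>

lemma j_inv_eq: "j_inv L = patch_nucleus"
  unfolding j_inv_def
proof (rule the_equality)
  have "patch_nucleus W = closed_nucleus L (i_inv L W)" if W: "openin (spec L) W" for W
  proof -
    let ?S = "{a \<in> carrier L. basic_open L a \<subseteq> W}"
    have S: "?S \<subseteq> carrier L" by auto
    have "W = \<Union>(basic_open L ` ?S)" using openin_spec_basis[OF W] by blast
    also have "patch_nucleus \<dots> = \<Squnion>\<^bsub>nuclei L\<^esub> (patch_nucleus ` (basic_open L ` ?S))"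
      by (rule frame_hom_opensD(4)[OF patch_nucleus_frame_hom]) auto
    also have "patch_nucleus ` (basic_open L ` ?S) = closed_nucleus L ` ?S"
      by (auto simp: image_image patch_nucleus_basic intro!: image_cong)
    finally show ?thesis using closed_Sup[OF S] by (simp add: i_inv_def)
  qed
  then show "patch_nucleus \<in> frame_hom (opens (patch (spec L))) (nuclei L) \<and>
    (\<forall>W. openin (spec L) W \<longrightarrow> patch_nucleus W = closed_nucleus L (i_inv L W))"
    by (simp add: patch_nucleus_frame_hom)
  fix h assume h: "h \<in> frame_hom (opens (patch (spec L))) (nuclei L) \<and>
    (\<forall>W. openin (spec L) W \<longrightarrow> h W = closed_nucleus L (i_inv L W))"
  show "h = patch_nucleus"
    by (rule patch_hom_unique[OF nuclei_frame conjunct1[OF h] patch_nucleus_frame_hom])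
      (use h in \<open>simp add: patch_nucleus_basic i_inv_basic\<close>)
qed

lemma j_inv_hom: "j_inv L \<in> frame_hom (opens (patch (spec L))) (nuclei L)"
  by (simp add: j_inv_eq patch_nucleus_frame_hom)

lemma j_inv_closed [simp]: "openin (patch (spec L)) W \<Longrightarrow> j_inv L W \<in> nucs L"
  by (simp add: j_inv_eq patch_nucleus_closed)

lemma j_inv_basic [simp]: "a \<in> carrier L \<Longrightarrow> j_inv L (basic_open L a) = closed_nucleus L a"
  by (simp add: j_inv_eq patch_nucleus_basic)

lemma j_inv_diff [simp]:
  assumes "a \<in> carrier L" "b \<in> carrier L"
  shows "j_inv L (basic_diff b a) = diff_nucleus L b a"
proof -
  note o = openin_patch_basic[OF assms(1)] openin_patch_diff[OF assms(1) top_closed]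
  have op: "j_inv L (basic_diff \<top> a) = open_nucleus L a"
  proof (rule N.complement_unique[of "closed_nucleus L a"])
    have "basic_open L a \<inter> basic_diff \<top> a = {}" by auto
    then show "closed_nucleus L a \<sqinter>\<^bsub>nuclei L\<^esub> j_inv L (basic_diff \<top> a) = \<bottom>\<^bsub>nuclei L\<^esub>"
      using frame_hom_opensD(3)[OF j_inv_hom o] frame_hom_opensD(6)[OF j_inv_hom N.complete_lattice_axioms] assms
      by simp
    have "basic_open L a \<union> basic_diff \<top> a = topspace (patch (spec L))" using basic_open_subset by auto
    then show "closed_nucleus L a \<squnion>\<^bsub>nuclei L\<^esub> j_inv L (basic_diff \<top> a) = \<top>\<^bsub>nuclei L\<^esub>"
      using frame_hom_opensD(5)[OF j_inv_hom o] frame_hom_opensD(2)[OF j_inv_hom] assms by simp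
  qed (use assms o in \<open>auto simp: closed_meet_open closed_join_open simp del: basic_open_top\<close>)
  have "basic_diff b a = basic_open L b \<inter> basic_diff \<top> a" using basic_open_subset by auto
  moreover have "j_inv L (basic_open L b \<inter> basic_diff \<top> a) = j_inv L (basic_open L b) \<sqinter>\<^bsub>nuclei L\<^esub> j_inv L (basic_diff \<top> a)"
    by (rule frame_hom_opensD(3)[OF j_inv_hom openin_patch_basic[OF assms(2)] o(2)])
  ultimately show ?thesis using assms by (simp only: diff_nucleus_def op j_inv_basic)
qed

end

section \<open>Sheaves on frames\<close>

locale sheaf_frame = frame_lattice P for P :: "'o gorder" (structure) +
  fixes F :: "('o, 's) presheaf"
  assumes sheaf: "sheaf P F"
begin

lemma res_closed:
  "\<lbrakk>U \<in> carrier P; V \<in> carrier P; V \<sqsubseteq> U; s \<in> sections F U\<rbrakk> \<Longrightarrow> res F U V s \<in> sections F V"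
proof -
  assume *: "U \<in> carrier P" "V \<in> carrier P" "V \<sqsubseteq> U" "s \<in> sections F U"
  have "\<forall>U\<in>carrier P. \<forall>V\<in>carrier P. V \<sqsubseteq> U \<longrightarrow> res F U V \<in> sections F U \<rightarrow> sections F V"
    using sheaf unfolding sheaf_def by (elim conjE)
  then have "res F U V \<in> sections F U \<rightarrow> sections F V" using * by simp
  then show ?thesis using *(4) by (rule funcset_mem)
qed

lemma res_id: "\<lbrakk>U \<in> carrier P; s \<in> sections F U\<rbrakk> \<Longrightarrow> res F U U s = s"
  using sheaf unfolding sheaf_def by simp

lemma res_res:
  "\<lbrakk>U \<in> carrier P; V \<in> carrier P; W \<in> carrier P; V \<sqsubseteq> U; W \<sqsubseteq> V; s \<in> sections F U\<rbrakk>
    \<Longrightarrow> res F V W (res F U V s) = res F U W s"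
  using sheaf unfolding sheaf_def by simp

text \<open>The sheaf axiom speaks of families indexed by the covering elements themselves. An
  arbitrary index set is reduced to it by choosing one index \<open>i0 V\<close> for each V;
  compatibility of i and j with U i = U j makes the choice immaterial.\<close>

lemma glue:
  assumes U: "\<And>i. i \<in> I \<Longrightarrow> U i \<in> carrier P" and s: "\<And>i. i \<in> I \<Longrightarrow> s i \<in> sections F (U i)"
    and compat: "\<And>i j. \<lbrakk>i \<in> I; j \<in> I\<rbrakk> \<Longrightarrow> res F (U i) (U i \<sqinter> U j) (s i) = res F (U j) (U i \<sqinter> U j) (s j)"
  shows "\<exists>!t. t \<in> sections F (\<Squnion>(U ` I)) \<and> (\<forall>i\<in>I. res F (\<Squnion>(U ` I)) (U i) t = s i)"
proof -
  define i0 where "i0 V = (SOME i. i \<in> I \<and> U i = V)" for V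
  have i0: "i0 (U i) \<in> I \<and> U (i0 (U i)) = U i" if "i \<in> I" for i
    unfolding i0_def by (rule someI[of _ i]) (simp add: that)
  have s_i0: "s (i0 (U i)) = s i" if "i \<in> I" for i
    using compat[of "i0 (U i)" i] i0[OF that] that U[OF that] s[OF that] s[of "i0 (U i)"] by (simp add: res_id)
  have "\<exists>!t. t \<in> sections F (\<Squnion>(U ` I)) \<and> (\<forall>V\<in>U ` I. res F (\<Squnion>(U ` I)) V t = s (i0 V))"
  proof -
    have "U ` I \<subseteq> carrier P" using U by auto
    moreover have "\<forall>V\<in>U ` I. s (i0 V) \<in> sections F V" using s i0 s_i0 by auto
    moreover have "\<forall>V\<in>U ` I. \<forall>W\<in>U ` I. res F V (V \<sqinter> W) (s (i0 V)) = res F W (V \<sqinter> W) (s (i0 W))"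
      using compat by (auto simp: s_i0)
    moreover have gl: "\<forall>C\<subseteq>carrier P. \<forall>s. (\<forall>U\<in>C. s U \<in> sections F U) \<longrightarrow>
        (\<forall>U\<in>C. \<forall>V\<in>C. res F U (U \<sqinter> V) (s U) = res F V (U \<sqinter> V) (s V)) \<longrightarrow>
        (\<exists>!t. t \<in> sections F (\<Squnion>C) \<and> (\<forall>U\<in>C. res F (\<Squnion>C) U t = s U))"
      using sheaf unfolding sheaf_def by (elim conjE)
    ultimately show ?thesis
      using gl[THEN spec[of _ "U ` I"], THEN mp, THEN spec[of _ "\<lambda>V. s (i0 V)"], THEN mp, THEN mp] by simp
  qed
  then show ?thesis by (simp add: s_i0)
qed

lemma locality:
  assumes U: "\<And>i. i \<in> I \<Longrightarrow> U i \<in> carrier P" and W: "W = \<Squnion>(U ` I)"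
    and s: "s \<in> sections F W" and t: "t \<in> sections F W"
    and eq: "\<And>i. i \<in> I \<Longrightarrow> res F W (U i) s = res F W (U i) t"
  shows "s = t"
proof -
  have Wc: "W \<in> carrier P" using U W by (auto intro: sup_closed)
  have le: "U i \<sqsubseteq> W" if "i \<in> I" for i using that U W by (auto intro: sup_upper)
  have "\<exists>!t. t \<in> sections F W \<and> (\<forall>i\<in>I. res F W (U i) t = res F W (U i) s)"
    unfolding W
  proof (rule glue[OF U], unfold W[symmetric])
    show "i \<in> I \<Longrightarrow> res F W (U i) s \<in> sections F (U i)" for i using res_closed[OF Wc U le s] .
    fix i j assume ij: "i \<in> I" "j \<in> I"
    have m: "U i \<sqinter> U j \<in> carrier P" "U i \<sqinter> U j \<sqsubseteq> U i" "U i \<sqinter> U j \<sqsubseteq> U j"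
      using U[OF ij(1)] U[OF ij(2)] by (auto intro: meet_left meet_right)
    show "res F (U i) (U i \<sqinter> U j) (res F W (U i) s) = res F (U j) (U i \<sqinter> U j) (res F W (U j) s)"
      using res_res[OF Wc U[OF ij(1)] m(1) le[OF ij(1)] m(2) s] res_res[OF Wc U[OF ij(2)] m(1) le[OF ij(2)] m(3) s]
      by simp
  qed
  then show ?thesis using s t eq by metis
qed

text \<open>The bottom is covered by the empty family, on which any two sections agree.\<close>

lemma bottom_section_unique: "\<lbrakk>s \<in> sections F \<bottom>; t \<in> sections F \<bottom>\<rbrakk> \<Longrightarrow> s = t"
  by (rule locality[where I = "{}" and U = id]) auto

lemma bottom_section_exists: "\<exists>!s. s \<in> sections F \<bottom>"
  using glue[where I = "{}" and U = id] by simp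

text \<open>Over the bottom compatibility is automatic. Indexing by truth values, not by the set of
  U and V, keeps the two sections apart even when U = V, which happens when both are the
  bottom.\<close>

lemma glue2:
  assumes "U \<in> carrier P" "V \<in> carrier P" "U \<sqinter> V = \<bottom>" "s \<in> sections F U" "t \<in> sections F V"
  shows "\<exists>!w. w \<in> sections F (U \<squnion> V) \<and> res F (U \<squnion> V) U w = s \<and> res F (U \<squnion> V) V w = t"
proof -
  let ?U = "\<lambda>b. if b then U else V" and ?s = "\<lambda>b. if b then s else t"
  have "\<exists>!w. w \<in> sections F (\<Squnion>(?U ` {True, False})) \<and> (\<forall>i\<in>{True, False}. res F (\<Squnion>(?U ` {True, False})) (?U i) w = ?s i)"
  proof (rule glue)
    fix i j :: bool
    have 1: "x = y" if "x \<in> sections F \<bottom>" "y \<in> sections F \<bottom>" for x y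
      using that by (rule bottom_section_unique)
    show "res F (?U i) (?U i \<sqinter> ?U j) (?s i) = res F (?U j) (?U i \<sqinter> ?U j) (?s j)"
    proof (cases "i = j")
      case False
      then have "?U i \<sqinter> ?U j = \<bottom>" using assms(3) by (auto simp: meet_comm[of P V U])
      moreover have "?U i \<in> carrier P" "?U j \<in> carrier P" "?s i \<in> sections F (?U i)" "?s j \<in> sections F (?U j)"
        using assms by auto
      ultimately show ?thesis by (intro 1) (simp_all only: res_closed bottom_closed bottom_lower)
    qed simp
  qed (use assms in auto)
  moreover have "\<exists>i. \<not> i" by blast
  ultimately show ?thesis by (simp add: join_def insert_commute[of V])
qed

lemma locality2:
  assumes "U \<in> carrier P" "V \<in> carrier P" "W = U \<squnion> V" "s \<in> sections F W" "t \<in> sections F W"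
    and "res F W U s = res F W U t" "res F W V s = res F W V t"
  shows "s = t"
  by (rule locality[where I = "{U, V}" and U = id and W = W]) (use assms in \<open>auto simp: join_def\<close>)

definition agreement where
  "agreement U s t = \<Squnion>{V \<in> carrier P. V \<sqsubseteq> U \<and> res F U V s = res F U V t}"

lemma agreement_closed: "agreement U s t \<in> carrier P"
  unfolding agreement_def by (rule sup_closed) auto

text \<open>By locality the two sections agree on the supremum of all places where they agree, so
  these places form a principal ideal.\<close>

lemma le_agreement_iff:
  assumes U: "U \<in> carrier P" and V: "V \<in> carrier P" "V \<sqsubseteq> U" and s: "s \<in> sections F U" "t \<in> sections F U"
  shows "V \<sqsubseteq> agreement U s t \<longleftrightarrow> res F U V s = res F U V t"
proof
  assume "res F U V s = res F U V t"
  then show "V \<sqsubseteq> agreement U s t" unfolding agreement_def using V by (intro sup_upper) auto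
next
  let ?A = "{V \<in> carrier P. V \<sqsubseteq> U \<and> res F U V s = res F U V t}" and ?a = "agreement U s t"
  assume le: "V \<sqsubseteq> agreement U s t"
  have A: "?A \<subseteq> carrier P" by auto
  have ac: "?a \<in> carrier P" by (rule agreement_closed)
  have aU: "?a \<sqsubseteq> U" unfolding agreement_def using U by (intro sup_least) auto
  have "res F U ?a s = res F U ?a t"
  proof (rule locality[where I = ?A and U = id and W = ?a])
    show "?a = \<Squnion>(id ` ?A)" by (simp add: agreement_def)
    show "res F U ?a s \<in> sections F ?a" "res F U ?a t \<in> sections F ?a" using res_closed[OF U ac aU] s by auto
    fix i assume i: "i \<in> ?A"
    then have "i \<sqsubseteq> ?a" unfolding agreement_def by (intro sup_upper) auto
    then show "res F ?a (id i) (res F U ?a s) = res F ?a (id i) (res F U ?a t)"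
      using i res_res[OF U ac _ aU, of i] s by simp
  qed auto
  then show "res F U V s = res F U V t"
    using res_res[OF U ac V(1) aU le] s by metis
qed

end

text \<open>A cover C of P goes to the family of all g U, indexed by C. Since g need not be
  injective, the gluing lemma for indexed families is what applies.\<close>

lemma pushforward_sheaf:
  assumes "sheaf_frame Q F" "frame_lattice P" "g \<in> frame_hom P Q"
  shows "sheaf P (pushforward g F)"
proof -
  interpret Q: sheaf_frame Q F by fact
  interpret P: frame_lattice P by fact
  note g = frame_homD[OF assms(3)]
  note mono = frame_hom_mono[OF P.complete_lattice_axioms Q.complete_lattice_axioms assms(3)]
  show ?thesis
    unfolding sheaf_def
  proof (intro conjI ballI allI impI)
    fix C s assume C: "C \<subseteq> carrier P" and s: "\<forall>U\<in>C. s U \<in> sections (pushforward g F) U"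
      and compat: "\<forall>U\<in>C. \<forall>V\<in>C. res (pushforward g F) U (U \<sqinter>\<^bsub>P\<^esub> V) (s U) = res (pushforward g F) V (U \<sqinter>\<^bsub>P\<^esub> V) (s V)"
    have gC: "g (\<Squnion>\<^bsub>P\<^esub>C) = \<Squnion>\<^bsub>Q\<^esub>(g ` C)" by (rule g(4)[OF C])
    have "\<exists>!t. t \<in> sections F (\<Squnion>\<^bsub>Q\<^esub>(g ` C)) \<and> (\<forall>i\<in>C. res F (\<Squnion>\<^bsub>Q\<^esub>(g ` C)) (g i) t = s i)"
    proof (rule Q.glue)
      fix i j assume ij: "i \<in> C" "j \<in> C"
      then have "i \<in> carrier P" "j \<in> carrier P" using C by auto
      from g(3)[OF this] show "res F (g i) (g i \<sqinter>\<^bsub>Q\<^esub> g j) (s i) = res F (g j) (g i \<sqinter>\<^bsub>Q\<^esub> g j) (s j)"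
        using compat[rule_format, OF ij] by (simp add: pushforward_def)
    next
      show "i \<in> C \<Longrightarrow> g i \<in> carrier Q" for i using C g(5) by auto
      show "i \<in> C \<Longrightarrow> s i \<in> sections F (g i)" for i using s by (simp add: pushforward_def)
    qed
    then show "\<exists>!t. t \<in> sections (pushforward g F) (\<Squnion>\<^bsub>P\<^esub>C) \<and>
        (\<forall>U\<in>C. res (pushforward g F) (\<Squnion>\<^bsub>P\<^esub>C) U t = s U)"
      by (simp add: pushforward_def gC)
  qed (use g(5) mono in \<open>auto simp: pushforward_def Q.res_closed Q.res_id Q.res_res\<close>)
qed


section \<open>Skew lattices and their natural order\<close>

context skew_lattice
begin

lemma natural_order_simps [simp]: "carrier (natural_order A) = carrier A"
  "x \<sqsubseteq>\<^bsub>natural_order A\<^esub> y \<longleftrightarrow> x \<curlywedge> y = x \<and> y \<curlywedge> x = x"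
  by (auto simp: natural_order_def)

lemma natural_partial_order: "partial_order (natural_order A)"
proof -
  have eq: "(.=\<^bsub>natural_order A\<^esub>) = (=)" by (simp add: natural_order_def)
  show ?thesis
  proof (unfold_locales, unfold eq natural_order_simps)
    fix x y z assume "x \<curlywedge> y = x \<and> y \<curlywedge> x = x" "y \<curlywedge> z = y \<and> z \<curlywedge> y = y"
      and c: "x \<in> carrier A" "y \<in> carrier A" "z \<in> carrier A"
    then show "x \<curlywedge> z = x \<and> z \<curlywedge> x = x" using smeet_assoc[OF c] smeet_assoc[OF c(3,2,1)] by metis
  next
    fix x assume "x \<in> carrier A" then show "x \<curlywedge> x = x \<and> x \<curlywedge> x = x" by (simp add: smeet_idem)
  qed auto
qed

text \<open>\<open>sup\<close> is a choice among least upper bounds; antisymmetry of the natural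
  order identifies it with any given one.\<close>

lemma natural_sup_eq:
  assumes "least (natural_order A) z (Upper (natural_order A) C)"
  shows "\<Squnion>\<^bsub>natural_order A\<^esub> C = z"
proof -
  interpret partial_order "natural_order A" by (rule natural_partial_order)
  show ?thesis
    unfolding sup_def using assms least_unique by (intro some_equality) auto
qed

end

text \<open>Only the operations are mentioned: the natural order, commuting suprema and \<D>-classes
  are all defined from them, so a bijection of this kind is an isomorphism of noncommutative
  frames.\<close>

definition skew_iso :: "'a skew_lat \<Rightarrow> 'b skew_lat \<Rightarrow> ('a \<Rightarrow> 'b) \<Rightarrow> bool" where
  "skew_iso A B \<phi> \<longleftrightarrow> bij_betw \<phi> (carrier A) (carrier B) \<and>
     (\<forall>x\<in>carrier A. \<forall>y\<in>carrier A. \<phi> (x \<curlywedge>\<^bsub>A\<^esub> y) = \<phi> x \<curlywedge>\<^bsub>B\<^esub> \<phi> y \<and> \<phi> (x \<curlyvee>\<^bsub>A\<^esub> y) = \<phi> x \<curlyvee>\<^bsub>B\<^esub> \<phi> y) \<and>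
     \<phi> (zer A) = zer B"

lemma skew_iso_inv:
  assumes "skew_iso A B \<phi>" "skew_lattice A" "zer A \<in> carrier A"
  shows "skew_iso B A (inv_into (carrier A) \<phi>)"
proof -
  interpret A: skew_lattice A by fact
  let ?\<psi> = "inv_into (carrier A) \<phi>"
  have bij: "bij_betw \<phi> (carrier A) (carrier B)" and hom: "\<And>x y. \<lbrakk>x \<in> carrier A; y \<in> carrier A\<rbrakk> \<Longrightarrow>
      \<phi> (x \<curlywedge>\<^bsub>A\<^esub> y) = \<phi> x \<curlywedge>\<^bsub>B\<^esub> \<phi> y \<and> \<phi> (x \<curlyvee>\<^bsub>A\<^esub> y) = \<phi> x \<curlyvee>\<^bsub>B\<^esub> \<phi> y" and z: "\<phi> (zer A) = zer B"
    using assms(1) by (auto simp: skew_iso_def)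
  have im: "\<phi> ` carrier A = carrier B" and inj: "inj_on \<phi> (carrier A)" using bij by (auto simp: bij_betw_def)
  have inv: "?\<psi> (\<phi> x) = x" if "x \<in> carrier A" for x using inj that by (rule inv_into_f_f)
  show ?thesis
    unfolding skew_iso_def im[symmetric]
    using bij_betw_inv_into[OF bij] hom z inv[OF assms(3)]
    by (auto simp: im[symmetric] inv simp flip: hom simp: A.smeet_closed A.sjoin_closed)
qed

lemma skew_iso_skew_lattice:
  assumes "skew_iso A B \<phi>" "skew_lattice A"
  shows "skew_lattice B"
proof -
  interpret A: skew_lattice A by fact
  have im: "carrier B = \<phi> ` carrier A" and hom: "\<And>x y. \<lbrakk>x \<in> carrier A; y \<in> carrier A\<rbrakk> \<Longrightarrow>
      \<phi> x \<curlywedge>\<^bsub>B\<^esub> \<phi> y = \<phi> (x \<curlywedge>\<^bsub>A\<^esub> y) \<and> \<phi> x \<curlyvee>\<^bsub>B\<^esub> \<phi> y = \<phi> (x \<curlyvee>\<^bsub>A\<^esub> y)"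
    using assms(1) by (auto simp: skew_iso_def bij_betw_def)
  show ?thesis
    by unfold_locales (auto simp: im hom A.smeet_closed A.sjoin_closed A.smeet_idem A.sjoin_idem
        A.smeet_assoc A.sjoin_assoc A.absorb)
qed

lemma skew_iso_order:
  assumes "skew_iso A B \<phi>" "skew_lattice A" "x \<in> carrier A" "y \<in> carrier A"
  shows "\<phi> x \<sqsubseteq>\<^bsub>natural_order B\<^esub> \<phi> y \<longleftrightarrow> x \<sqsubseteq>\<^bsub>natural_order A\<^esub> y"
proof -
  interpret A: skew_lattice A by fact
  have inj: "inj_on \<phi> (carrier A)" and hom: "\<And>x y. \<lbrakk>x \<in> carrier A; y \<in> carrier A\<rbrakk> \<Longrightarrow> \<phi> x \<curlywedge>\<^bsub>B\<^esub> \<phi> y = \<phi> (x \<curlywedge>\<^bsub>A\<^esub> y)"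
    using assms(1) by (auto simp: skew_iso_def bij_betw_def)
  show ?thesis using assms(3,4) inj
    by (simp add: natural_order_def hom inj_on_eq_iff[OF inj] A.smeet_closed)
qed

lemma skew_iso_least:
  assumes iso: "skew_iso A B \<phi>" and A: "skew_lattice A" and C: "C \<subseteq> carrier A"
    and l: "least (natural_order A) z (Upper (natural_order A) C)"
  shows "least (natural_order B) (\<phi> z) (Upper (natural_order B) (\<phi> ` C))"
proof -
  interpret A: skew_lattice A by fact
  interpret B: skew_lattice B by (rule skew_iso_skew_lattice[OF iso A])
  have im: "\<phi> ` carrier A = carrier B" using iso by (auto simp: skew_iso_def bij_betw_def)
  note ord = skew_iso_order[OF iso A]
  have z: "z \<in> carrier A" using least_closed[OF l] by simp
  show ?thesis
  proof (rule least_UpperI)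
    fix y assume "y \<in> \<phi> ` C"
    then obtain x where x: "x \<in> C" "y = \<phi> x" by auto
    then have "x \<sqsubseteq>\<^bsub>natural_order A\<^esub> z" using least_Upper_above[OF l x(1)] C by simp
    then show "y \<sqsubseteq>\<^bsub>natural_order B\<^esub> \<phi> z" using x ord[of x z] z C by (auto simp del: A.natural_order_simps B.natural_order_simps)
  next
    fix y assume y: "y \<in> Upper (natural_order B) (\<phi> ` C)"
    then have "y \<in> carrier B" by (auto simp: Upper_def)
    then obtain u where u: "u \<in> carrier A" "y = \<phi> u" using im by auto
    have "u \<in> Upper (natural_order A) C"
      unfolding Upper_def
    proof (intro IntI CollectI allI impI)
      fix x assume "x \<in> C \<inter> carrier (natural_order A)"
      then have x: "x \<in> C" "x \<in> carrier A" by auto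
      then have "\<phi> x \<sqsubseteq>\<^bsub>natural_order B\<^esub> y" using y im by (auto simp: Upper_def simp del: B.natural_order_simps(2))
      then show "x \<sqsubseteq>\<^bsub>natural_order A\<^esub> u" using ord[OF x(2) u(1)] u by simp
    qed (use u in simp)
    then have "z \<sqsubseteq>\<^bsub>natural_order A\<^esub> u" by (rule least_le[OF l])
    then show "\<phi> z \<sqsubseteq>\<^bsub>natural_order B\<^esub> y" using ord[OF z u(1)] u by simp
  qed (use C im z in auto)
qed

lemma skew_iso_commuting:
  assumes iso: "skew_iso A B \<phi>" and A: "skew_lattice A" and C: "C \<subseteq> carrier A"
  shows "commuting_subset B (\<phi> ` C) \<longleftrightarrow> commuting_subset A C"
proof -
  interpret A: skew_lattice A by fact
  have im: "\<phi> ` carrier A = carrier B" and inj: "inj_on \<phi> (carrier A)"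
    and hom: "\<And>x y. \<lbrakk>x \<in> carrier A; y \<in> carrier A\<rbrakk> \<Longrightarrow>
      \<phi> x \<curlywedge>\<^bsub>B\<^esub> \<phi> y = \<phi> (x \<curlywedge>\<^bsub>A\<^esub> y) \<and> \<phi> x \<curlyvee>\<^bsub>B\<^esub> \<phi> y = \<phi> (x \<curlyvee>\<^bsub>A\<^esub> y)"
    using iso by (auto simp: skew_iso_def bij_betw_def)
  have "\<phi> x \<curlywedge>\<^bsub>B\<^esub> \<phi> y = \<phi> y \<curlywedge>\<^bsub>B\<^esub> \<phi> x \<and> \<phi> x \<curlyvee>\<^bsub>B\<^esub> \<phi> y = \<phi> y \<curlyvee>\<^bsub>B\<^esub> \<phi> x \<longleftrightarrow>
      x \<curlywedge>\<^bsub>A\<^esub> y = y \<curlywedge>\<^bsub>A\<^esub> x \<and> x \<curlyvee>\<^bsub>A\<^esub> y = y \<curlyvee>\<^bsub>A\<^esub> x" if "x \<in> C" "y \<in> C" for x y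
  proof -
    have "x \<in> carrier A" "y \<in> carrier A" using C that by auto
    then show ?thesis by (simp add: hom inj_on_eq_iff[OF inj] A.smeet_closed A.sjoin_closed)
  qed
  moreover have "\<phi> ` C \<subseteq> carrier B" using C im by auto
  ultimately show ?thesis using C by (auto simp: commuting_subset_def)
qed

text \<open>The supremum is a choice operator, so it can be transported only where a least upper
  bound exists. The hypotheses \<open>supL\<close> and \<open>supR\<close> provide this for the two
  families that occur on the right of the infinite distributive laws.\<close>

lemma skew_iso_noncommutative_frame:
  assumes iso: "skew_iso A B \<phi>" and A: "noncommutative_frame A"
    and supL: "\<And>C u. \<lbrakk>commuting_subset A C; u \<in> carrier A\<rbrakk> \<Longrightarrow>
      \<exists>s. least (natural_order A) s (Upper (natural_order A) ((\<lambda>x. x \<curlywedge>\<^bsub>A\<^esub> u) ` C))"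
    and supR: "\<And>C u. \<lbrakk>commuting_subset A C; u \<in> carrier A\<rbrakk> \<Longrightarrow>
      \<exists>s. least (natural_order A) s (Upper (natural_order A) ((\<lambda>x. u \<curlywedge>\<^bsub>A\<^esub> x) ` C))"
  shows "noncommutative_frame B"
proof -
  interpret A: noncommutative_frame A by fact
  interpret B: skew_lattice B by (rule skew_iso_skew_lattice[OF iso A.skew_lattice_axioms])
  have im: "carrier B = \<phi> ` carrier A"
    and hom: "\<And>x y. \<lbrakk>x \<in> carrier A; y \<in> carrier A\<rbrakk> \<Longrightarrow>
      \<phi> x \<curlywedge>\<^bsub>B\<^esub> \<phi> y = \<phi> (x \<curlywedge>\<^bsub>A\<^esub> y) \<and> \<phi> x \<curlyvee>\<^bsub>B\<^esub> \<phi> y = \<phi> (x \<curlyvee>\<^bsub>A\<^esub> y)"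
    and z: "zer B = \<phi> (zer A)"
    using iso by (auto simp: skew_iso_def bij_betw_def)
  have comm: "\<exists>C'. commuting_subset A C' \<and> C = \<phi> ` C'" if C: "commuting_subset B C" for C
  proof -
    have "C \<subseteq> \<phi> ` carrier A" using C im by (auto simp: commuting_subset_def)
    then obtain C' where C': "C' \<subseteq> carrier A" "C = \<phi> ` C'" by (meson subset_imageE)
    then show ?thesis using skew_iso_commuting[OF iso A.skew_lattice_axioms C'(1)] C by blast
  qed
  have sup: "\<Squnion>\<^bsub>natural_order B\<^esub> (\<phi> ` C) = \<phi> (\<Squnion>\<^bsub>natural_order A\<^esub> C)"
    if C: "C \<subseteq> carrier A" and ex: "\<exists>s. least (natural_order A) s (Upper (natural_order A) C)" for C
  proof -
    obtain s where s: "least (natural_order A) s (Upper (natural_order A) C)" using ex by blast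
    from B.natural_sup_eq[OF skew_iso_least[OF iso A.skew_lattice_axioms C s]] A.natural_sup_eq[OF s]
    show ?thesis by simp
  qed
  show ?thesis
  proof (intro noncommutative_frame.intro noncommutative_frame_axioms.intro B.skew_lattice_axioms)
    fix C assume "commuting_subset B C"
    then obtain C' where C': "commuting_subset A C'" "C = \<phi> ` C'" using comm by blast
    then obtain s where s: "least (natural_order A) s (Upper (natural_order A) C')" using A.join_complete by blast
    have sub: "C' \<subseteq> carrier A" using C' by (auto simp: commuting_subset_def)
    have sc: "\<Squnion>\<^bsub>natural_order A\<^esub> C' \<in> carrier A"
      using A.natural_sup_eq[OF s] least_closed[OF s] by simp
    show "\<exists>s. least (natural_order B) s (Upper (natural_order B) C)"
      using skew_iso_least[OF iso A.skew_lattice_axioms sub s] C' by blast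
    fix y assume "y \<in> carrier B"
    then obtain u where u: "u \<in> carrier A" "y = \<phi> u" using im by auto
    have 1: "(\<lambda>x. x \<curlywedge>\<^bsub>B\<^esub> y) ` C = \<phi> ` ((\<lambda>x. x \<curlywedge>\<^bsub>A\<^esub> u) ` C')"
      "(\<lambda>x. y \<curlywedge>\<^bsub>B\<^esub> x) ` C = \<phi> ` ((\<lambda>x. u \<curlywedge>\<^bsub>A\<^esub> x) ` C')"
      unfolding C'(2) u(2) image_image using hom sub u(1) by (auto intro!: image_cong)
    have 2: "(\<lambda>x. x \<curlywedge>\<^bsub>A\<^esub> u) ` C' \<subseteq> carrier A" "(\<lambda>x. u \<curlywedge>\<^bsub>A\<^esub> x) ` C' \<subseteq> carrier A"
      using sub u(1) by (auto simp: A.smeet_closed)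
    have 3: "\<Squnion>\<^bsub>natural_order B\<^esub> C = \<phi> (\<Squnion>\<^bsub>natural_order A\<^esub> C')"
      unfolding C'(2) using sup[OF sub] s by blast
    show "\<Squnion>\<^bsub>natural_order B\<^esub> C \<curlywedge>\<^bsub>B\<^esub> y = \<Squnion>\<^bsub>natural_order B\<^esub> ((\<lambda>x. x \<curlywedge>\<^bsub>B\<^esub> y) ` C)"
      using A.Sup_smeet[OF C'(1) u(1)] hom[OF sc u(1)]
      by (simp only: 1(1) 3 sup[OF 2(1) supL[OF C'(1) u(1)]]) (simp add: u(2))
    show "y \<curlywedge>\<^bsub>B\<^esub> \<Squnion>\<^bsub>natural_order B\<^esub> C = \<Squnion>\<^bsub>natural_order B\<^esub> ((\<lambda>x. y \<curlywedge>\<^bsub>B\<^esub> x) ` C)"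
      using A.smeet_Sup[OF u(1) C'(1)] hom[OF u(1) sc]
      by (simp only: 1(2) 3 sup[OF 2(2) supR[OF C'(1) u(1)]]) (simp add: u(2))
  qed (use A.zer_closed A.zer_sjoin A.strongly_distributive in \<open>auto simp: im hom z A.smeet_closed A.sjoin_closed\<close>)
qed

lemma skew_iso_left_handed:
  assumes iso: "skew_iso A B \<phi>" and A: "skew_lattice A" "left_handed A"
  shows "left_handed B"
proof -
  interpret A: skew_lattice A by fact
  have im: "carrier B = \<phi> ` carrier A"
    and hom: "\<And>x y. \<lbrakk>x \<in> carrier A; y \<in> carrier A\<rbrakk> \<Longrightarrow> \<phi> x \<curlywedge>\<^bsub>B\<^esub> \<phi> y = \<phi> (x \<curlywedge>\<^bsub>A\<^esub> y)"
    using iso by (auto simp: skew_iso_def bij_betw_def)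
  show ?thesis using A(2) by (auto simp: left_handed_def im hom A.smeet_closed)
qed

lemma skew_iso_max_D_class:
  assumes iso: "skew_iso A B \<phi>" and A: "skew_lattice A" and t: "in_max_D_class A t"
  shows "in_max_D_class B (\<phi> t)"
proof -
  interpret A: skew_lattice A by fact
  have im: "carrier B = \<phi> ` carrier A" and inj: "inj_on \<phi> (carrier A)"
    and hom: "\<And>x y. \<lbrakk>x \<in> carrier A; y \<in> carrier A\<rbrakk> \<Longrightarrow> \<phi> x \<curlywedge>\<^bsub>B\<^esub> \<phi> y = \<phi> (x \<curlywedge>\<^bsub>A\<^esub> y)"
    using iso by (auto simp: skew_iso_def bij_betw_def)
  have cls: "D_class B (\<phi> x) = \<phi> ` D_class A x" if "x \<in> carrier A" for x
    using that by (auto simp: D_class_def im hom A.smeet_closed inj_on_eq_iff[OF inj])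
  have cls_sub: "D_class A x \<subseteq> carrier A" for x by (auto simp: D_class_def)
  have eq: "D_class B (\<phi> x) = D_class B (\<phi> y) \<longleftrightarrow> D_class A x = D_class A y"
    if "x \<in> carrier A" "y \<in> carrier A" for x y
    using that inj_on_image_eq_iff[OF inj cls_sub cls_sub] by (simp add: cls)
  have "D_le B (\<phi> x) (\<phi> y) \<longleftrightarrow> D_le A x y" if "x \<in> carrier A" "y \<in> carrier A" for x y
    using that by (simp add: D_le_def hom eq A.smeet_closed)
  then show ?thesis using t by (auto simp: in_max_D_class_def im eq)
qed

lemma skew_iso_ncframe_hom:
  assumes iso: "skew_iso A B \<phi>" and A: "noncommutative_frame A" and ext: "\<phi> \<in> extensional (carrier A)"
  shows "\<phi> \<in> ncframe_hom A B"
proof -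
  interpret A: noncommutative_frame A by fact
  interpret B: skew_lattice B by (rule skew_iso_skew_lattice[OF iso A.skew_lattice_axioms])
  have "\<phi> (\<Squnion>\<^bsub>natural_order A\<^esub> C) = \<Squnion>\<^bsub>natural_order B\<^esub> (\<phi> ` C)" if C: "commuting_subset A C" for C
  proof -
    obtain s where s: "least (natural_order A) s (Upper (natural_order A) C)" using A.join_complete[OF C] by blast
    have "C \<subseteq> carrier A" using C by (auto simp: commuting_subset_def)
    from B.natural_sup_eq[OF skew_iso_least[OF iso A.skew_lattice_axioms this s]] A.natural_sup_eq[OF s]
    show ?thesis by simp
  qed
  then show ?thesis
    using iso ext skew_iso_max_D_class[OF iso A.skew_lattice_axioms]
    by (auto simp: ncframe_hom_def skew_iso_def bij_betw_def PiE_def)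
qed

lemma skew_iso_restrict: "skew_lattice A \<Longrightarrow> zer A \<in> carrier A \<Longrightarrow>
    skew_iso A B \<phi> \<Longrightarrow> skew_iso A B (restrict \<phi> (carrier A))"
  unfolding skew_iso_def by (auto simp: skew_lattice.smeet_closed skew_lattice.sjoin_closed cong: bij_betw_cong)

lemma skew_iso_ncframe_iso:
  assumes iso: "skew_iso A B \<phi>" and A: "noncommutative_frame A" and B: "noncommutative_frame B"
    and ext: "\<phi> \<in> extensional (carrier A)"
  shows "\<phi> \<in> ncframe_iso A B"
    and "restrict (inv_into (carrier A) \<phi>) (carrier B) \<in> ncframe_hom B A"
    and "compose (carrier A) (restrict (inv_into (carrier A) \<phi>) (carrier B)) \<phi> = ncframe_id A"
    and "compose (carrier B) \<phi> (restrict (inv_into (carrier A) \<phi>) (carrier B)) = ncframe_id B"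
proof -
  interpret A: noncommutative_frame A by fact
  interpret B: noncommutative_frame B by fact
  let ?\<psi> = "restrict (inv_into (carrier A) \<phi>) (carrier B)"
  have bij: "bij_betw \<phi> (carrier A) (carrier B)" using iso by (simp add: skew_iso_def)
  have "skew_iso B A ?\<psi>"
    by (intro skew_iso_restrict skew_iso_inv iso B.skew_lattice_axioms A.skew_lattice_axioms A.zer_closed B.zer_closed)
  then show \<psi>: "?\<psi> \<in> ncframe_hom B A" by (rule skew_iso_ncframe_hom[OF _ B]) simp
  show 1: "compose (carrier A) ?\<psi> \<phi> = ncframe_id A"
    unfolding ncframe_id_def compose_def using bij by (intro restrict_ext) (auto simp: bij_betw_def)
  show 2: "compose (carrier B) \<phi> ?\<psi> = ncframe_id B"
    unfolding ncframe_id_def compose_def using bij by (intro restrict_ext) (auto simp: bij_betw_def f_inv_into_f)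
  show "\<phi> \<in> ncframe_iso A B"
    unfolding ncframe_iso_def using \<psi> 1 2 skew_iso_ncframe_hom[OF iso A ext] by blast
qed


section \<open>Sheaves on dissolution locales and their skew lattices of pairs\<close>

text \<open>The skew lattice of \<open>star_ob\<close> with compact open up-sets replaced by
  elements of L and set differences by difference nuclei.\<close>

definition pair_ob :: "'l gorder \<Rightarrow> ('l \<Rightarrow> 'l, 's) presheaf \<Rightarrow> ('l \<times> 's) skew_lat" where
  "pair_ob L F =
     \<lparr>carrier = {(b, s). b \<in> carrier L \<and> s \<in> sections F (closed_nucleus L b)},
      smeet = (\<lambda>(b, s) (c, t). (b \<sqinter>\<^bsub>L\<^esub> c, res F (closed_nucleus L b) (closed_nucleus L (b \<sqinter>\<^bsub>L\<^esub> c)) s)),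
      sjoin = (\<lambda>(b, s) (c, t). (b \<squnion>\<^bsub>L\<^esub> c, THE w. w \<in> sections F (closed_nucleus L (b \<squnion>\<^bsub>L\<^esub> c)) \<and>
         res F (closed_nucleus L (b \<squnion>\<^bsub>L\<^esub> c)) (diff_nucleus L b c) w = res F (closed_nucleus L b) (diff_nucleus L b c) s \<and>
         res F (closed_nucleus L (b \<squnion>\<^bsub>L\<^esub> c)) (closed_nucleus L c) w = t)),
      zer = (\<bottom>\<^bsub>L\<^esub>, THE s. s \<in> sections F (closed_nucleus L \<bottom>\<^bsub>L\<^esub>))\<rparr>"

locale dsheaf = dissolution L for L :: "'l gorder" (structure) +
  fixes F :: "('l \<Rightarrow> 'l, 's) presheaf"
  assumes nsheaf: "sheaf (nuclei L) F" and global: "sections F \<top>\<^bsub>nuclei L\<^esub> \<noteq> {}"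

sublocale dsheaf \<subseteq> N: sheaf_frame "nuclei L" F
  by unfold_locales (rule nsheaf)

context dsheaf
begin

abbreviation cn where "cn \<equiv> closed_nucleus L"
abbreviation D where "D \<equiv> pair_ob L F"

lemma carrier_pair_ob: "x \<in> carrier D \<longleftrightarrow> fst x \<in> carrier L \<and> snd x \<in> sections F (cn (fst x))"
  by (cases x) (simp add: pair_ob_def)

definition rst where "rst p x = res F (cn (fst x)) p (snd x)"

text \<open>Below a nonzero \<open>p\<close> deciding the domains involved, \<open>x \<and> y\<close> restricts to \<open>x\<close> and \<open>x \<or> y\<close> to \<open>y\<close> where
  \<open>y\<close> is defined and to \<open>x\<close> elsewhere; since such \<open>p\<close> cover, identities can be checked on them.\<close>

definition decided where
  "decided p b \<longleftrightarrow> b \<in> carrier L \<and> (p \<preceq> cn b \<or> p \<preceq> open_nucleus L b)"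

lemma fst_closed [simp]: "x \<in> carrier D \<Longrightarrow> fst x \<in> carrier L"
  by (simp add: carrier_pair_ob)

lemma snd_closed [simp]: "x \<in> carrier D \<Longrightarrow> snd x \<in> sections F (cn (fst x))"
  by (simp add: carrier_pair_ob)

lemma rst_closed: "\<lbrakk>x \<in> carrier D; p \<in> nucs L; p \<preceq> cn (fst x)\<rbrakk> \<Longrightarrow> rst p x \<in> sections F p"
  unfolding rst_def by (rule N.res_closed) auto

lemma rst_self: "x \<in> carrier D \<Longrightarrow> rst (cn (fst x)) x = snd x"
  unfolding rst_def by (rule N.res_id) auto

lemma res_rst:
  "\<lbrakk>x \<in> carrier D; p \<in> nucs L; q \<in> nucs L; p \<preceq> cn (fst x); q \<preceq> p\<rbrakk>
    \<Longrightarrow> res F p q (rst p x) = rst q x"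
  unfolding rst_def by (rule N.res_res) auto

lemma split_by:
  assumes p: "p \<in> nucs L" and d: "d \<in> carrier L"
  shows "p = (p \<sqinter>\<^bsub>nuclei L\<^esub> cn d) \<squnion>\<^bsub>nuclei L\<^esub> (p \<sqinter>\<^bsub>nuclei L\<^esub> open_nucleus L d)"
  using N.meet_join_distrib[OF p, of "cn d" "open_nucleus L d"] p d by (simp add: closed_join_open)

lemma rst_split:
  assumes x: "x \<in> carrier D" "y \<in> carrier D" and d: "d \<in> carrier L"
    and p: "p \<in> nucs L" "p \<preceq> cn (fst x)" "p \<preceq> cn (fst y)"
    and eq: "\<And>q. \<lbrakk>q \<in> nucs L; q \<preceq> p; decided q d\<rbrakk> \<Longrightarrow> rst q x = rst q y"
  shows "rst p x = rst p y"
proof (rule N.locality2[OF _ _ split_by[OF p(1) d]])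
  show c: "p \<sqinter>\<^bsub>nuclei L\<^esub> cn d \<in> nucs L" "p \<sqinter>\<^bsub>nuclei L\<^esub> open_nucleus L d \<in> nucs L"
    using p d by auto
  have "decided (p \<sqinter>\<^bsub>nuclei L\<^esub> cn d) d" "decided (p \<sqinter>\<^bsub>nuclei L\<^esub> open_nucleus L d) d"
    using p d by (auto simp: decided_def N.meet_right)
  then show "res F p (p \<sqinter>\<^bsub>nuclei L\<^esub> cn d) (rst p x) = res F p (p \<sqinter>\<^bsub>nuclei L\<^esub> cn d) (rst p y)"
    "res F p (p \<sqinter>\<^bsub>nuclei L\<^esub> open_nucleus L d) (rst p x) = res F p (p \<sqinter>\<^bsub>nuclei L\<^esub> open_nucleus L d) (rst p y)"
    using x p c d eq by (simp_all add: res_rst N.meet_left)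
qed (use x p in \<open>simp_all add: rst_closed\<close>)

lemma decided_mono: "\<lbrakk>decided p b; q \<preceq> p; p \<in> nucs L; q \<in> nucs L\<rbrakk> \<Longrightarrow> decided q b"
  unfolding decided_def using N.le_trans[of q p] by auto

lemma decided_closed: "decided p b \<Longrightarrow> b \<in> carrier L"
  by (simp add: decided_def)

text \<open>A nonzero p cannot lie below both of two complements. On nonzero p deciding b, the
  relation to \<open>cn b\<close> therefore behaves like a truth value, and the next lemmas let
  meets and joins act on it as conjunction and disjunction.\<close>

lemma decided_open_iff:
  assumes p: "p \<in> nucs L" "p \<noteq> \<bottom>\<^bsub>nuclei L\<^esub>" and b: "decided p b"
  shows "p \<preceq> open_nucleus L b \<longleftrightarrow> \<not> p \<preceq> cn b"
proof -
  have bc: "b \<in> carrier L" using b by (rule decided_closed)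
  have "\<not> (p \<preceq> cn b \<and> p \<preceq> open_nucleus L b)"
  proof
    assume "p \<preceq> cn b \<and> p \<preceq> open_nucleus L b"
    then have "p \<preceq> cn b \<sqinter>\<^bsub>nuclei L\<^esub> open_nucleus L b" using p bc by (simp add: N.le_meet_iff)
    then show False using p bc by (simp add: closed_meet_open N.bottom_unique)
  qed
  then show ?thesis using b by (auto simp: decided_def)
qed

lemma open_join_le: "\<lbrakk>b \<in> carrier L; c \<in> carrier L; p \<in> nucs L; p \<preceq> open_nucleus L b; p \<preceq> open_nucleus L c\<rbrakk>
    \<Longrightarrow> p \<preceq> open_nucleus L (b \<squnion> c)"
  using diff_meet_diff[of b \<top> c \<top>] N.le_trans[of p "open_nucleus L b \<sqinter>\<^bsub>nuclei L\<^esub> open_nucleus L c"]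
  by (simp add: diff_top N.le_meet_iff)

lemma open_antimono: "\<lbrakk>b \<in> carrier L; c \<in> carrier L; b \<sqsubseteq> c\<rbrakk> \<Longrightarrow> open_nucleus L c \<preceq> open_nucleus L b"
proof -
  assume *: "b \<in> carrier L" "c \<in> carrier L" "b \<sqsubseteq> c"
  let ?o = "open_nucleus L b"
  have "?o b = \<top>" using open_nucleus_le_iff[of b ?o] * by simp
  then have "\<top> \<sqsubseteq> ?o c" using nucleus_mono[of ?o b c] * by simp
  then show ?thesis using * by (simp add: open_nucleus_le_iff top_unique nucleus_closed)
qed

lemma decided_meet:
  assumes p: "p \<in> nucs L" "p \<noteq> \<bottom>\<^bsub>nuclei L\<^esub>" and b: "decided p b" and c: "decided p c"
  shows "decided p (b \<sqinter> c)" and "p \<preceq> cn (b \<sqinter> c) \<longleftrightarrow> p \<preceq> cn b \<and> p \<preceq> cn c"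
proof -
  have bc: "b \<in> carrier L" "c \<in> carrier L" using b c by (auto dest: decided_closed)
  show on: "p \<preceq> cn (b \<sqinter> c) \<longleftrightarrow> p \<preceq> cn b \<and> p \<preceq> cn c" using bc p by (simp add: closed_meet N.le_meet_iff)
  have "p \<preceq> open_nucleus L (b \<sqinter> c)" if "p \<preceq> open_nucleus L b \<or> p \<preceq> open_nucleus L c"
    using that open_antimono[of "b \<sqinter> c" b] open_antimono[of "b \<sqinter> c" c] bc p
      N.le_trans[of p "open_nucleus L b" "open_nucleus L (b \<sqinter> c)"]
      N.le_trans[of p "open_nucleus L c" "open_nucleus L (b \<sqinter> c)"]
    by (auto simp: meet_left meet_right)
  then show "decided p (b \<sqinter> c)" using b c bc on by (auto simp: decided_def)
qed

lemma decided_join: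
  assumes p: "p \<in> nucs L" "p \<noteq> \<bottom>\<^bsub>nuclei L\<^esub>" and b: "decided p b" and c: "decided p c"
  shows "decided p (b \<squnion> c)" and "p \<preceq> cn (b \<squnion> c) \<longleftrightarrow> p \<preceq> cn b \<or> p \<preceq> cn c"
proof -
  have bc: "b \<in> carrier L" "c \<in> carrier L" using b c by (auto dest: decided_closed)
  have on: "p \<preceq> cn (b \<squnion> c)" if "p \<preceq> cn b \<or> p \<preceq> cn c"
    using that bc p N.le_trans[of p "cn b" "cn (b \<squnion> c)"] N.le_trans[of p "cn c" "cn (b \<squnion> c)"]
    by (auto simp: closed_mono_iff join_left join_right)
  have off: "p \<preceq> open_nucleus L (b \<squnion> c)" if "\<not> p \<preceq> cn b" "\<not> p \<preceq> cn c"
    using that bc p b c by (intro open_join_le) (auto simp: decided_def)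
  show d: "decided p (b \<squnion> c)" using bc on off by (auto simp: decided_def)
  show "p \<preceq> cn (b \<squnion> c) \<longleftrightarrow> p \<preceq> cn b \<or> p \<preceq> cn c" using on off decided_open_iff[OF p d] by blast
qed

text \<open>Splitting the domain along b, c and d in turn leaves pieces that decide all three; a
  piece equal to the bottom has only one section. Three parameters serve identities in three
  variables; with fewer variables one is repeated or the bottom is inserted.\<close>

lemma pair_eqI:
  assumes x: "x \<in> carrier D" "y \<in> carrier D" and fst: "fst x = fst y"
    and d: "b \<in> carrier L" "c \<in> carrier L" "d \<in> carrier L"
    and eq: "\<And>p. \<lbrakk>p \<in> nucs L; p \<noteq> \<bottom>\<^bsub>nuclei L\<^esub>; p \<preceq> cn (fst x);
      decided p b; decided p c; decided p d\<rbrakk> \<Longrightarrow> rst p x = rst p y"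
  shows "x = y"
proof -
  have "rst (cn (fst x)) x = rst (cn (fst x)) y"
  proof (rule rst_split[OF x d(1)])
    fix p assume p: "p \<in> nucs L" "p \<preceq> cn (fst x)" "decided p b"
    show "rst p x = rst p y"
    proof (rule rst_split[OF x d(2)])
      fix q assume q: "q \<in> nucs L" "q \<preceq> p" "decided q c"
      have qx: "q \<preceq> cn (fst x)" using N.le_trans[OF q(2) p(2)] p q x by simp
      show "rst q x = rst q y"
      proof (rule rst_split[OF x d(3)])
        fix r assume r: "r \<in> nucs L" "r \<preceq> q" "decided r d"
        have rx: "r \<preceq> cn (fst x)" "r \<preceq> p" using N.le_trans[OF r(2)] q r p qx x by auto
        show "rst r x = rst r y"
        proof (cases "r = \<bottom>\<^bsub>nuclei L\<^esub>")
          case True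
          then show ?thesis using rst_closed[OF x(1) r(1)] rst_closed[OF x(2) r(1)] rx fst
            by (auto intro: N.bottom_section_unique)
        next
          case False
          then show ?thesis using eq[OF r(1) False rx(1)] decided_mono[OF p(3) rx(2) p(1) r(1)]
              decided_mono[OF q(3) r(2) q(1) r(1)] r(3) by blast
        qed
      qed (use q qx fst in auto)
    qed (use p fst in auto)
  qed (use x fst in auto)
  then have "snd x = snd y" using rst_self[OF x(1)] rst_self[OF x(2)] fst by simp
  then show ?thesis using fst by (simp add: prod_eq_iff)
qed

lemma smeet_pair: "x \<curlywedge>\<^bsub>D\<^esub> y = (fst x \<sqinter> fst y, rst (cn (fst x \<sqinter> fst y)) x)"
  by (cases x; cases y) (simp add: pair_ob_def rst_def)

lemma smeet_pair_closed [simp]: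
  assumes "x \<in> carrier D" "y \<in> carrier D"
  shows "x \<curlywedge>\<^bsub>D\<^esub> y \<in> carrier D"
proof -
  have "rst (cn (fst x \<sqinter> fst y)) x \<in> sections F (cn (fst x \<sqinter> fst y))"
    using assms by (intro rst_closed) (simp_all add: closed_mono_iff meet_left)
  then show ?thesis using fst_closed[OF assms(1)] fst_closed[OF assms(2)]
    unfolding carrier_pair_ob smeet_pair fst_conv snd_conv by simp
qed

lemma fst_smeet [simp]: "fst (x \<curlywedge>\<^bsub>D\<^esub> y) = fst x \<sqinter> fst y"
  by (simp add: smeet_pair)

lemma rst_smeet [simp]:
  assumes "x \<in> carrier D" "y \<in> carrier D" "p \<in> nucs L" "p \<preceq> cn (fst x \<sqinter> fst y)"
  shows "rst p (x \<curlywedge>\<^bsub>D\<^esub> y) = rst p x"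
  using assms res_rst[of x "cn (fst x \<sqinter> fst y)" p] by (simp add: smeet_pair closed_mono_iff meet_left) (simp add: rst_def)

text \<open>The two disjoint pieces over which a join of pairs is glued. Both equations are
  distributivity together with complementarity of the closed and the open nucleus of c.\<close>

lemma diff_join_closed:
  assumes "b \<in> carrier L" "c \<in> carrier L"
  shows "diff_nucleus L b c \<squnion>\<^bsub>nuclei L\<^esub> cn c = cn (b \<squnion> c)" "diff_nucleus L b c \<sqinter>\<^bsub>nuclei L\<^esub> cn c = \<bottom>\<^bsub>nuclei L\<^esub>"
proof -
  have "diff_nucleus L b c \<squnion>\<^bsub>nuclei L\<^esub> cn c = cn c \<squnion>\<^bsub>nuclei L\<^esub> (cn b \<sqinter>\<^bsub>nuclei L\<^esub> open_nucleus L c)"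
    by (simp add: diff_nucleus_def join_comm)
  also have "\<dots> = (cn c \<squnion>\<^bsub>nuclei L\<^esub> cn b) \<sqinter>\<^bsub>nuclei L\<^esub> \<top>\<^bsub>nuclei L\<^esub>"
    using assms by (simp add: N.join_meet_distrib closed_join_open)
  also have "\<dots> = cn (b \<squnion> c)" using assms by (simp add: closed_join join_comm)
  finally show "diff_nucleus L b c \<squnion>\<^bsub>nuclei L\<^esub> cn c = cn (b \<squnion> c)" .
  have "diff_nucleus L b c \<sqinter>\<^bsub>nuclei L\<^esub> cn c = cn b \<sqinter>\<^bsub>nuclei L\<^esub> (open_nucleus L c \<sqinter>\<^bsub>nuclei L\<^esub> cn c)"
    using assms by (simp add: diff_nucleus_def N.meet_assoc)
  then show "diff_nucleus L b c \<sqinter>\<^bsub>nuclei L\<^esub> cn c = \<bottom>\<^bsub>nuclei L\<^esub>"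
    using assms closed_meet_open[of c] by (simp add: meet_comm[of "nuclei L" "open_nucleus L c"])
qed

lemma sjoin_pair_eq:
  "x \<curlyvee>\<^bsub>D\<^esub> y = (fst x \<squnion> fst y, THE w. w \<in> sections F (cn (fst x \<squnion> fst y)) \<and>
     res F (cn (fst x \<squnion> fst y)) (diff_nucleus L (fst x) (fst y)) w =
     res F (cn (fst x)) (diff_nucleus L (fst x) (fst y)) (snd x) \<and>
     res F (cn (fst x \<squnion> fst y)) (cn (fst y)) w = snd y)"
  by (cases x; cases y) (simp add: pair_ob_def)

text \<open>The description in the definition of the join denotes the unique section glued from x
  outside y and from y itself, the two pieces being disjoint.\<close>

lemma sjoin_pair:
  assumes x: "x \<in> carrier D" and y: "y \<in> carrier D"
  shows "x \<curlyvee>\<^bsub>D\<^esub> y \<in> carrier D" "fst (x \<curlyvee>\<^bsub>D\<^esub> y) = fst x \<squnion> fst y"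
    "rst (diff_nucleus L (fst x) (fst y)) (x \<curlyvee>\<^bsub>D\<^esub> y) = rst (diff_nucleus L (fst x) (fst y)) x"
    "rst (cn (fst y)) (x \<curlyvee>\<^bsub>D\<^esub> y) = snd y"
proof -
  let ?b = "fst x" and ?c = "fst y"
  let ?P = "\<lambda>w. w \<in> sections F (cn (?b \<squnion> ?c)) \<and>
     res F (cn (?b \<squnion> ?c)) (diff_nucleus L ?b ?c) w = rst (diff_nucleus L ?b ?c) x \<and>
     res F (cn (?b \<squnion> ?c)) (cn ?c) w = snd y"
  have le: "diff_nucleus L ?b ?c \<preceq> cn ?b" using x y by (simp add: diff_nucleus_def N.meet_left)
  have "\<exists>!w. ?P w"
    using N.glue2[of "diff_nucleus L ?b ?c" "cn ?c" "rst (diff_nucleus L ?b ?c) x" "snd y"] x y le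
    by (simp add: diff_join_closed rst_closed)
  then have P: "?P (THE w. ?P w)" by (rule theI')
  have eq: "x \<curlyvee>\<^bsub>D\<^esub> y = (?b \<squnion> ?c, THE w. ?P w)"
    by (simp add: sjoin_pair_eq rst_def)
  show "x \<curlyvee>\<^bsub>D\<^esub> y \<in> carrier D"
    unfolding eq carrier_pair_ob fst_conv snd_conv using P fst_closed[OF x] fst_closed[OF y] by simp
  show "fst (x \<curlyvee>\<^bsub>D\<^esub> y) = fst x \<squnion> fst y" by (simp add: eq)
  show "rst (diff_nucleus L ?b ?c) (x \<curlyvee>\<^bsub>D\<^esub> y) = rst (diff_nucleus L ?b ?c) x" "rst (cn ?c) (x \<curlyvee>\<^bsub>D\<^esub> y) = snd y"
    using P by (simp_all add: eq rst_def)
qed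

lemma rst_sjoin:
  assumes x: "x \<in> carrier D" and y: "y \<in> carrier D" and p: "p \<in> nucs L" "p \<noteq> \<bottom>\<^bsub>nuclei L\<^esub>"
    and d: "decided p (fst x)" "decided p (fst y)" and le: "p \<preceq> cn (fst x) \<or> p \<preceq> cn (fst y)"
  shows "rst p (x \<curlyvee>\<^bsub>D\<^esub> y) = (if p \<preceq> cn (fst y) then rst p y else rst p x)"
proof -
  note j = sjoin_pair[OF x y]
  show ?thesis
  proof (cases "p \<preceq> cn (fst y)")
    case True
    have "rst p (x \<curlyvee>\<^bsub>D\<^esub> y) = res F (cn (fst y)) p (rst (cn (fst y)) (x \<curlyvee>\<^bsub>D\<^esub> y))"
      using j x y p True by (intro res_rst[symmetric]) (auto simp: closed_mono_iff join_right)
    also have "\<dots> = rst p y" by (simp only: j(4)) (simp add: rst_def)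
    finally show ?thesis using True by simp
  next
    case False
    then have pd: "p \<preceq> diff_nucleus L (fst x) (fst y)"
      using le d x y p by (simp add: diff_nucleus_def N.le_meet_iff decided_def)
    have dl: "diff_nucleus L (fst x) (fst y) \<preceq> cn (fst x)" using x y by (simp add: diff_nucleus_def N.meet_left)
    have dl': "diff_nucleus L (fst x) (fst y) \<preceq> cn (fst x \<squnion> fst y)"
      using N.le_trans[OF dl, of "cn (fst x \<squnion> fst y)"] x y by (simp add: closed_mono_iff join_left)
    have "rst p (x \<curlyvee>\<^bsub>D\<^esub> y) = res F (diff_nucleus L (fst x) (fst y)) p (rst (diff_nucleus L (fst x) (fst y)) (x \<curlyvee>\<^bsub>D\<^esub> y))"
      using j x y p pd dl' by (intro res_rst[symmetric]) auto
    also have "\<dots> = rst p x" using x y p pd dl by (simp add: j res_rst)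
    finally show ?thesis using False by simp
  qed
qed

lemma zer_pair: "zer D \<in> carrier D" "fst (zer D) = \<bottom>"
proof -
  have "(THE s. s \<in> sections F (cn \<bottom>)) \<in> sections F (cn \<bottom>)"
    using theI'[OF N.bottom_section_exists] by simp
  then show "zer D \<in> carrier D" "fst (zer D) = \<bottom>" by (simp_all add: pair_ob_def)
qed

lemma pair_left_handed: "left_handed D"
  unfolding left_handed_def
proof (intro ballI)
  fix x y assume x: "x \<in> carrier D" "y \<in> carrier D"
  show "x \<curlywedge>\<^bsub>D\<^esub> y \<curlywedge>\<^bsub>D\<^esub> x = x \<curlywedge>\<^bsub>D\<^esub> y"
  proof (rule pair_eqI[of _ _ "fst x" "fst y" \<bottom>])
    show fe: "fst (x \<curlywedge>\<^bsub>D\<^esub> y \<curlywedge>\<^bsub>D\<^esub> x) = fst (x \<curlywedge>\<^bsub>D\<^esub> y)"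
      using x by (simp add: meet_absorb1 meet_left)
    fix p assume "p \<in> nucs L" "p \<preceq> cn (fst (x \<curlywedge>\<^bsub>D\<^esub> y \<curlywedge>\<^bsub>D\<^esub> x))"
    then show "rst p (x \<curlywedge>\<^bsub>D\<^esub> y \<curlywedge>\<^bsub>D\<^esub> x) = rst p (x \<curlywedge>\<^bsub>D\<^esub> y)"
      using x fe by simp
  qed (use x in auto)
qed

lemma pair_skew_lattice: "skew_lattice D"
proof
  note dec = decided_meet decided_join rst_sjoin sjoin_pair(1,2)
  fix x y assume x: "x \<in> carrier D" and y: "y \<in> carrier D"
  show "x \<curlywedge>\<^bsub>D\<^esub> y \<in> carrier D" "x \<curlyvee>\<^bsub>D\<^esub> y \<in> carrier D" using x y by (auto simp: sjoin_pair)
  show "x \<curlywedge>\<^bsub>D\<^esub> x = x" by (rule pair_eqI[of _ _ "fst x" "fst x" "fst x"]) (use x in \<open>auto simp: dec\<close>)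
  show "x \<curlyvee>\<^bsub>D\<^esub> x = x" by (rule pair_eqI[of _ _ "fst x" "fst x" "fst x"]) (use x in \<open>auto simp: dec\<close>)
  show "x \<curlywedge>\<^bsub>D\<^esub> (x \<curlyvee>\<^bsub>D\<^esub> y) = x \<and> x \<curlyvee>\<^bsub>D\<^esub> (x \<curlywedge>\<^bsub>D\<^esub> y) = x \<and>
      (x \<curlywedge>\<^bsub>D\<^esub> y) \<curlyvee>\<^bsub>D\<^esub> y = y \<and> (x \<curlyvee>\<^bsub>D\<^esub> y) \<curlywedge>\<^bsub>D\<^esub> y = y"
  proof (intro conjI)
    have l: "fst x \<sqinter> (fst x \<squnion> fst y) = fst x" "fst x \<squnion> (fst x \<sqinter> fst y) = fst x"
      "(fst x \<sqinter> fst y) \<squnion> fst y = fst y" "(fst x \<squnion> fst y) \<sqinter> fst y = fst y"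
      using x y by (auto simp: meet_absorb1 meet_absorb2 join_absorb1 join_absorb2 join_left join_right meet_left meet_right)
    show "x \<curlywedge>\<^bsub>D\<^esub> (x \<curlyvee>\<^bsub>D\<^esub> y) = x"
      by (rule pair_eqI[of _ _ "fst x" "fst y" "fst y"]) (use x y l in \<open>auto simp: dec\<close>)
    show "x \<curlyvee>\<^bsub>D\<^esub> (x \<curlywedge>\<^bsub>D\<^esub> y) = x"
      by (rule pair_eqI[of _ _ "fst x" "fst y" "fst y"]) (use x y l in \<open>auto simp: dec\<close>)
    show "(x \<curlywedge>\<^bsub>D\<^esub> y) \<curlyvee>\<^bsub>D\<^esub> y = y"
      by (rule pair_eqI[of _ _ "fst x" "fst y" "fst y"]) (use x y l in \<open>auto simp: dec\<close>)
    show "(x \<curlyvee>\<^bsub>D\<^esub> y) \<curlywedge>\<^bsub>D\<^esub> y = y"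
      by (rule pair_eqI[of _ _ "fst x" "fst y" "fst y"]) (use x y l in \<open>auto simp: dec\<close>)
  qed
  fix z assume z: "z \<in> carrier D"
  show "(x \<curlywedge>\<^bsub>D\<^esub> y) \<curlywedge>\<^bsub>D\<^esub> z = x \<curlywedge>\<^bsub>D\<^esub> (y \<curlywedge>\<^bsub>D\<^esub> z)"
    by (rule pair_eqI[of _ _ "fst x" "fst y" "fst z"]) (use x y z in \<open>auto simp: dec meet_assoc\<close>)
  show "(x \<curlyvee>\<^bsub>D\<^esub> y) \<curlyvee>\<^bsub>D\<^esub> z = x \<curlyvee>\<^bsub>D\<^esub> (y \<curlyvee>\<^bsub>D\<^esub> z)"
    by (rule pair_eqI[of _ _ "fst x" "fst y" "fst z"]) (use x y z in \<open>auto simp: dec join_assoc\<close>)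
qed

end

sublocale dsheaf \<subseteq> D: skew_lattice "pair_ob L F"
  by (rule pair_skew_lattice)

context dsheaf
begin

lemma pair_distributive:
  assumes x: "x \<in> carrier D" and y: "y \<in> carrier D" and z: "z \<in> carrier D"
  shows "(x \<curlyvee>\<^bsub>D\<^esub> y) \<curlywedge>\<^bsub>D\<^esub> z = (x \<curlywedge>\<^bsub>D\<^esub> z) \<curlyvee>\<^bsub>D\<^esub> (y \<curlywedge>\<^bsub>D\<^esub> z)"
    and "x \<curlywedge>\<^bsub>D\<^esub> (y \<curlyvee>\<^bsub>D\<^esub> z) = (x \<curlywedge>\<^bsub>D\<^esub> y) \<curlyvee>\<^bsub>D\<^esub> (x \<curlywedge>\<^bsub>D\<^esub> z)"
proof -
  note dec = decided_meet decided_join rst_sjoin sjoin_pair(1,2)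
  have l: "(fst x \<squnion> fst y) \<sqinter> fst z = (fst x \<sqinter> fst z) \<squnion> (fst y \<sqinter> fst z)"
    using x y z by (simp add: meet_comm[of L _ "fst z"] meet_join_distrib)
  show "(x \<curlyvee>\<^bsub>D\<^esub> y) \<curlywedge>\<^bsub>D\<^esub> z = (x \<curlywedge>\<^bsub>D\<^esub> z) \<curlyvee>\<^bsub>D\<^esub> (y \<curlywedge>\<^bsub>D\<^esub> z)"
    by (rule pair_eqI[of _ _ "fst x" "fst y" "fst z"]) (use x y z l in \<open>auto simp: dec\<close>)
  show "x \<curlywedge>\<^bsub>D\<^esub> (y \<curlyvee>\<^bsub>D\<^esub> z) = (x \<curlywedge>\<^bsub>D\<^esub> y) \<curlyvee>\<^bsub>D\<^esub> (x \<curlywedge>\<^bsub>D\<^esub> z)"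
    by (rule pair_eqI[of _ _ "fst x" "fst y" "fst z"]) (use x y z in \<open>auto simp: dec meet_join_distrib\<close>)
qed

lemma pair_zer: "x \<in> carrier D \<Longrightarrow> x \<curlyvee>\<^bsub>D\<^esub> zer D = x \<and> zer D \<curlyvee>\<^bsub>D\<^esub> x = x"
proof (intro conjI)
  note dec = decided_meet decided_join rst_sjoin sjoin_pair(1,2) zer_pair
  assume x: "x \<in> carrier D"
  have nb: "\<not> p \<preceq> \<bottom>\<^bsub>nuclei L\<^esub>" if "p \<in> nucs L" "p \<noteq> \<bottom>\<^bsub>nuclei L\<^esub>" for p
    using that N.bottom_unique by blast
  show "x \<curlyvee>\<^bsub>D\<^esub> zer D = x"
    by (rule pair_eqI[of _ _ "fst x" "fst (zer D)" \<bottom>]) (use x in \<open>auto simp: dec nb\<close>)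
  show "zer D \<curlyvee>\<^bsub>D\<^esub> x = x"
    by (rule pair_eqI[of _ _ "fst x" "fst (zer D)" \<bottom>]) (use x in \<open>auto simp: dec\<close>)
qed

text \<open>The two halves of the natural order say different things: the meet with x on the left
  only compares domains, the meet with y on the left compares the sections.\<close>

lemma pair_le_iff:
  assumes x: "x \<in> carrier D" and y: "y \<in> carrier D"
  shows "x \<sqsubseteq>\<^bsub>natural_order D\<^esub> y \<longleftrightarrow> fst x \<sqsubseteq> fst y \<and> rst (cn (fst x)) y = snd x"
proof -
  have "x \<curlywedge>\<^bsub>D\<^esub> y = x \<longleftrightarrow> fst x \<sqsubseteq> fst y"
  proof
    assume "x \<curlywedge>\<^bsub>D\<^esub> y = x"
    then have "fst x \<sqinter> fst y = fst x" by (metis fst_smeet)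
    then show "fst x \<sqsubseteq> fst y" using x y meet_right[of "fst x" "fst y"] by simp
  next
    assume "fst x \<sqsubseteq> fst y"
    then show "x \<curlywedge>\<^bsub>D\<^esub> y = x" using x y by (simp add: smeet_pair meet_absorb1 rst_self)
  qed
  moreover have "y \<curlywedge>\<^bsub>D\<^esub> x = x \<longleftrightarrow> rst (cn (fst x)) y = snd x" if "fst x \<sqsubseteq> fst y"
    using that x y by (simp add: smeet_pair meet_absorb2 prod_eq_iff)
  ultimately show ?thesis by auto
qed

text \<open>The closed nuclei of the domains in C cover that of their supremum, because the
  embedding of L preserves suprema. An upper bound y restricts to every member of C, hence agrees
  with z on the cover, and locality applies.\<close>

lemma glueing_least:
  assumes C: "C \<subseteq> carrier D" and z: "z \<in> carrier D" "fst z = \<Squnion>(fst ` C)"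
    and at: "\<And>x. x \<in> C \<Longrightarrow> rst (cn (fst x)) z = snd x"
  shows "least (natural_order D) z (Upper (natural_order D) C)"
proof (rule least_UpperI)
  have fC: "fst ` C \<subseteq> carrier L" by (intro image_subsetI) (simp add: subsetD[OF C])
  fix x assume x: "x \<in> C"
  then show "x \<sqsubseteq>\<^bsub>natural_order D\<^esub> z" using C z at fC
    by (subst pair_le_iff) (auto intro: sup_upper)
next
  have fC: "fst ` C \<subseteq> carrier L" by (intro image_subsetI) (simp add: subsetD[OF C])
  fix y assume "y \<in> Upper (natural_order D) C"
  then have y: "y \<in> carrier D" and ub: "\<And>x. x \<in> C \<Longrightarrow> x \<sqsubseteq>\<^bsub>natural_order D\<^esub> y"
    using C by (auto simp: Upper_def)
  have uby: "fst x \<sqsubseteq> fst y \<and> rst (cn (fst x)) y = snd x" if "x \<in> C" for x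
    using ub[OF that] pair_le_iff[of x y] C y that by auto
  have le: "fst z \<sqsubseteq> fst y" unfolding z(2) using uby fC y by (intro sup_least) auto
  have "rst (cn (fst z)) y = rst (cn (fst z)) z"
  proof (rule N.locality[where I = C and U = "\<lambda>x. cn (fst x)"])
    show "cn (fst z) = \<Squnion>\<^bsub>nuclei L\<^esub> ((\<lambda>x. cn (fst x)) ` C)"
      unfolding z(2) using closed_Sup[OF fC] by (simp add: image_image)
    fix x assume x: "x \<in> C"
    have xc: "fst x \<in> carrier L" "fst x \<sqsubseteq> fst z" using x C fC z(2) by (auto intro: sup_upper)
    show "cn (fst x) \<in> nucs L" using xc by simp
    show "res F (cn (fst z)) (cn (fst x)) (rst (cn (fst z)) y) = res F (cn (fst z)) (cn (fst x)) (rst (cn (fst z)) z)"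
      using x xc y z(1) le uby at by (simp add: res_rst closed_mono_iff)
  qed (use y z(1) le in \<open>auto simp: rst_closed closed_mono_iff\<close>)
  then show "z \<sqsubseteq>\<^bsub>natural_order D\<^esub> y" using y z(1) le by (simp add: pair_le_iff rst_self del: D.natural_order_simps)
qed (use C z in auto)

lemma glueing_exists:
  assumes C: "C \<subseteq> carrier D"
    and compat: "\<And>x y. \<lbrakk>x \<in> C; y \<in> C\<rbrakk> \<Longrightarrow> rst (cn (fst x \<sqinter> fst y)) x = rst (cn (fst x \<sqinter> fst y)) y"
  obtains z where "z \<in> carrier D" "fst z = \<Squnion>(fst ` C)" "\<And>x. x \<in> C \<Longrightarrow> rst (cn (fst x)) z = snd x"
proof -
  have fC: "fst ` C \<subseteq> carrier L" by (intro image_subsetI) (simp add: subsetD[OF C])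
  have eq: "\<Squnion>\<^bsub>nuclei L\<^esub> ((\<lambda>x. cn (fst x)) ` C) = cn (\<Squnion>(fst ` C))"
    using closed_Sup[OF fC] by (simp add: image_image)
  have "\<exists>!t. t \<in> sections F (\<Squnion>\<^bsub>nuclei L\<^esub> ((\<lambda>x. cn (fst x)) ` C)) \<and>
    (\<forall>x\<in>C. res F (\<Squnion>\<^bsub>nuclei L\<^esub> ((\<lambda>x. cn (fst x)) ` C)) (cn (fst x)) t = snd x)"
  proof (rule N.glue)
    fix x y assume xy: "x \<in> C" "y \<in> C"
    then have "fst x \<in> carrier L" "fst y \<in> carrier L" using C by auto
    then show "res F (cn (fst x)) (cn (fst x) \<sqinter>\<^bsub>nuclei L\<^esub> cn (fst y)) (snd x) =
        res F (cn (fst y)) (cn (fst x) \<sqinter>\<^bsub>nuclei L\<^esub> cn (fst y)) (snd y)"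
      using compat[OF xy] by (simp add: closed_meet rst_def)
  qed (simp_all add: subsetD[OF C])
  then obtain t where "t \<in> sections F (cn (\<Squnion>(fst ` C)))"
    "\<And>x. x \<in> C \<Longrightarrow> res F (cn (\<Squnion>(fst ` C))) (cn (fst x)) t = snd x"
    unfolding eq by blast
  then show thesis using that[of "(\<Squnion>(fst ` C), t)"] fC by (auto simp: carrier_pair_ob rst_def)
qed

text \<open>Commuting meets say that the sections agree on the common domain, which is the
  compatibility condition for gluing.\<close>

lemma commuting_glueing:
  assumes "commuting_subset D C"
  obtains z where "z \<in> carrier D" "fst z = \<Squnion>(fst ` C)" "\<And>x. x \<in> C \<Longrightarrow> rst (cn (fst x)) z = snd x"
proof -
  have C: "C \<subseteq> carrier D" using assms by (simp add: commuting_subset_def)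
  have compat: "rst (cn (fst x \<sqinter> fst y)) x = rst (cn (fst x \<sqinter> fst y)) y" if "x \<in> C" "y \<in> C" for x y
  proof -
    have "x \<curlywedge>\<^bsub>D\<^esub> y = y \<curlywedge>\<^bsub>D\<^esub> x" using assms that by (simp add: commuting_subset_def)
    then show ?thesis by (simp add: smeet_pair meet_comm[of L "fst y"])
  qed
  show thesis by (rule glueing_exists[OF C compat], assumption, assumption, rule that, auto)
qed

text \<open>Meets with u are again glueings: the domains distribute over the supremum since L is a
  frame, and restricting a glued section gives the glueing of the restrictions. This yields the
  infinite distributive laws and the existence of the suprema in them.\<close>

lemma glueing_smeet:
  assumes C: "C \<subseteq> carrier D" and z: "z \<in> carrier D" "fst z = \<Squnion>(fst ` C)"
    and at: "\<And>x. x \<in> C \<Longrightarrow> rst (cn (fst x)) z = snd x" and u: "u \<in> carrier D"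
  shows "least (natural_order D) (z \<curlywedge>\<^bsub>D\<^esub> u) (Upper (natural_order D) ((\<lambda>x. x \<curlywedge>\<^bsub>D\<^esub> u) ` C))"
    and "least (natural_order D) (u \<curlywedge>\<^bsub>D\<^esub> z) (Upper (natural_order D) ((\<lambda>x. u \<curlywedge>\<^bsub>D\<^esub> x) ` C))"
proof -
  have fC: "fst ` C \<subseteq> carrier L" by (intro image_subsetI) (simp add: subsetD[OF C])
  have lez: "fst x \<sqsubseteq> fst z" if "x \<in> C" for x unfolding z(2) using that fC by (intro sup_upper) auto
  have dist: "fst u \<sqinter> \<Squnion>(fst ` C) = \<Squnion>((\<lambda>x. fst u \<sqinter> fst x) ` C)"
    using Sup_distrib[OF _ fC, of "fst u"] u by (simp add: image_image)
  have le: "cn (a \<sqinter> b) \<preceq> cn a" "cn (a \<sqinter> b) \<preceq> cn b" if "a \<in> carrier L" "b \<in> carrier L" for a b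
    using that by (simp_all add: closed_mono_iff meet_left meet_right)
  have mono: "fst x \<sqinter> fst u \<sqsubseteq> fst z \<sqinter> fst u" if "x \<in> C" for x
    using that u lez[OF that] fst_closed[OF z(1)] fst_closed[OF subsetD[OF C that]] by (intro meet_mono) auto
  show "least (natural_order D) (z \<curlywedge>\<^bsub>D\<^esub> u) (Upper (natural_order D) ((\<lambda>x. x \<curlywedge>\<^bsub>D\<^esub> u) ` C))"
  proof (rule glueing_least)
    show "fst (z \<curlywedge>\<^bsub>D\<^esub> u) = \<Squnion>(fst ` (\<lambda>x. x \<curlywedge>\<^bsub>D\<^esub> u) ` C)"
      using dist by (simp add: z(2) image_image meet_comm[of L _ "fst u"])
    fix y assume "y \<in> (\<lambda>x. x \<curlywedge>\<^bsub>D\<^esub> u) ` C"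
    then obtain x where x: "x \<in> C" "x \<in> carrier D" "y = x \<curlywedge>\<^bsub>D\<^esub> u" using C by auto
    have "rst (cn (fst x \<sqinter> fst u)) z = res F (cn (fst x)) (cn (fst x \<sqinter> fst u)) (rst (cn (fst x)) z)"
      using x z(1) u lez[OF x(1)] by (intro res_rst[symmetric]) (auto simp: closed_mono_iff meet_left)
    also have "\<dots> = rst (cn (fst x \<sqinter> fst u)) x" using at[OF x(1)] by (simp add: rst_def)
    finally show "rst (cn (fst y)) (z \<curlywedge>\<^bsub>D\<^esub> u) = snd y"
      using x z(1) u mono[OF x(1)] by (simp add: closed_mono_iff) (simp add: smeet_pair)
  qed (use C z u in auto)
  show "least (natural_order D) (u \<curlywedge>\<^bsub>D\<^esub> z) (Upper (natural_order D) ((\<lambda>x. u \<curlywedge>\<^bsub>D\<^esub> x) ` C))"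
  proof (rule glueing_least)
    show "fst (u \<curlywedge>\<^bsub>D\<^esub> z) = \<Squnion>(fst ` (\<lambda>x. u \<curlywedge>\<^bsub>D\<^esub> x) ` C)"
      using dist by (simp add: z(2) image_image)
    fix y assume "y \<in> (\<lambda>x. u \<curlywedge>\<^bsub>D\<^esub> x) ` C"
    then obtain x where x: "x \<in> C" "x \<in> carrier D" "y = u \<curlywedge>\<^bsub>D\<^esub> x" using C by auto
    have "fst u \<sqinter> fst x \<sqsubseteq> fst u \<sqinter> fst z" using mono[OF x(1)] by (simp add: meet_comm[of L _ "fst u"])
    then show "rst (cn (fst y)) (u \<curlywedge>\<^bsub>D\<^esub> z) = snd y"
      using x z(1) u by (simp add: closed_mono_iff) (simp add: smeet_pair)
  qed (use C z u in auto)
qed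

lemma pair_noncommutative_frame: "noncommutative_frame D"
proof (intro noncommutative_frame.intro noncommutative_frame_axioms.intro D.skew_lattice_axioms)
  fix C assume C: "commuting_subset D C"
  then have Cc: "C \<subseteq> carrier D" by (simp add: commuting_subset_def)
  obtain z where z: "z \<in> carrier D" "fst z = \<Squnion>(fst ` C)" "\<And>x. x \<in> C \<Longrightarrow> rst (cn (fst x)) z = snd x"
    using commuting_glueing[OF C] by blast
  note least = glueing_least[OF Cc z]
  show "\<exists>s. least (natural_order D) s (Upper (natural_order D) C)" using least by blast
  fix y assume y: "y \<in> carrier D"
  note l2 = glueing_smeet[OF Cc z y]
  show "\<Squnion>\<^bsub>natural_order D\<^esub> C \<curlywedge>\<^bsub>D\<^esub> y = \<Squnion>\<^bsub>natural_order D\<^esub> ((\<lambda>x. x \<curlywedge>\<^bsub>D\<^esub> y) ` C)"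
    by (simp only: D.natural_sup_eq[OF least] D.natural_sup_eq[OF l2(1)])
  show "y \<curlywedge>\<^bsub>D\<^esub> \<Squnion>\<^bsub>natural_order D\<^esub> C = \<Squnion>\<^bsub>natural_order D\<^esub> ((\<lambda>x. y \<curlywedge>\<^bsub>D\<^esub> x) ` C)"
    by (simp only: D.natural_sup_eq[OF least] D.natural_sup_eq[OF l2(2)])
qed (simp_all add: zer_pair pair_zer pair_distributive)

lemma section_exists: "\<nu> \<in> nucs L \<Longrightarrow> sections F \<nu> \<noteq> {}"
  using global N.res_closed[of "\<top>\<^bsub>nuclei L\<^esub>" \<nu>] by fastforce

text \<open>By left-handedness the product of x, y, x is the meet of x and y, and this is x exactly
  when the domain of x is below that of y.\<close>

lemma D_class_pair:
  assumes "x \<in> carrier D"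
  shows "D_class D x = {y \<in> carrier D. fst y = fst x}"
proof -
  have key: "x \<curlywedge>\<^bsub>D\<^esub> y \<curlywedge>\<^bsub>D\<^esub> x = x \<longleftrightarrow> fst x \<sqsubseteq> fst y" if x: "x \<in> carrier D" and y: "y \<in> carrier D" for x y
  proof -
    have "x \<curlywedge>\<^bsub>D\<^esub> y \<curlywedge>\<^bsub>D\<^esub> x = x \<curlywedge>\<^bsub>D\<^esub> y" using pair_left_handed x y by (simp add: left_handed_def)
    also have "\<dots> = x \<longleftrightarrow> fst x \<sqsubseteq> fst y"
    proof
      assume "x \<curlywedge>\<^bsub>D\<^esub> y = x"
      then have "fst x \<sqinter> fst y = fst x" by (metis fst_smeet)
      then show "fst x \<sqsubseteq> fst y" using x y meet_right[of "fst x" "fst y"] by simp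
    next
      assume "fst x \<sqsubseteq> fst y"
      then show "x \<curlywedge>\<^bsub>D\<^esub> y = x" using x y by (simp add: smeet_pair meet_absorb1 rst_self)
    qed
    finally show ?thesis .
  qed
  show ?thesis
    unfolding D_class_def
  proof (rule Collect_cong, rule conj_cong[OF HOL.refl])
    fix y assume y: "y \<in> carrier D"
    show "(x \<curlywedge>\<^bsub>D\<^esub> y \<curlywedge>\<^bsub>D\<^esub> x = x \<and> y \<curlywedge>\<^bsub>D\<^esub> x \<curlywedge>\<^bsub>D\<^esub> y = y) = (fst y = fst x)"
      unfolding key[OF assms y] key[OF y assms]
      using le_antisym[of "fst x" "fst y"] fst_closed[OF assms] fst_closed[OF y] by auto
  qed
qed

text \<open>\<D>-classes of pairs are compared by their domains. A global section of F gives a pair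
  with domain \<top>, so a maximal class has to have domain \<top>.\<close>

lemma in_max_D_class_pair: "in_max_D_class D t \<longleftrightarrow> t \<in> carrier D \<and> fst t = \<top>"
proof -
  have eq: "D_class D x = D_class D y \<longleftrightarrow> fst x = fst y" if "x \<in> carrier D" "y \<in> carrier D" for x y
    using that by (auto simp: D_class_pair)
  have le: "D_le D x y \<longleftrightarrow> fst x \<sqsubseteq> fst y" if "x \<in> carrier D" "y \<in> carrier D" for x y
    using that by (simp add: D_le_def eq) (metis fst_closed le_iff_join meet_absorb1)
  obtain s where s: "s \<in> sections F (cn \<top>)" using global by auto
  have top: "(\<top>, s) \<in> carrier D" using s by (simp add: carrier_pair_ob)
  show ?thesis
  proof
    assume t: "in_max_D_class D t"
    then have "t \<in> carrier D" by (simp add: in_max_D_class_def)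
    moreover have "D_class D (\<top>, s) = D_class D t"
      using t top le[OF \<open>t \<in> carrier D\<close> top] by (simp add: in_max_D_class_def)
    ultimately show "t \<in> carrier D \<and> fst t = \<top>" using eq[OF top] by simp
  next
    assume t: "t \<in> carrier D \<and> fst t = \<top>"
    show "in_max_D_class D t"
      unfolding in_max_D_class_def
    proof (intro conjI ballI impI)
      fix x assume x: "x \<in> carrier D" "D_le D t x"
      then have "\<top> \<sqsubseteq> fst x" using le[of t x] t by simp
      then have "fst x = fst t" using x t top_unique[OF fst_closed] by simp
      then show "D_class D x = D_class D t" using eq x t by simp
    qed (use t in simp)
  qed
qed

subsection \<open>Comparison with the skew lattice of compact open up-sets\<close>

definition basic_pair where "basic_pair = (\<lambda>(b, s)\<in>carrier D. (basic_open L b, s))"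

text \<open>\<open>basic_open L\<close> is an isomorphism from L onto the lattice of compact open
  up-sets, and \<open>j_inv L\<close> takes basic opens to closed nuclei and their differences to
  difference nuclei; the two sets of formulas then coincide.\<close>

lemma basic_pair_iso: "skew_iso D (dual_ob (L, F)) basic_pair"
proof -
  let ?B = "dual_ob (L, F)"
  have B: "?B = star_ob (patch (spec L), spec_order L, pushforward (j_inv L) F)"
    by (simp add: dual_ob_def spec_ob_def)
  have carrier: "carrier ?B = {(U, s). U \<in> basic_open L ` carrier L \<and> s \<in> sections F (j_inv L U)}"
    unfolding B star_ob_def using compact_open_upsets by (auto simp: pushforward_def)
  have app: "basic_pair x = (basic_open L (fst x), snd x)" if "x \<in> carrier D" for x
    using that by (cases x) (simp add: basic_pair_def)
  have bij: "bij_betw basic_pair (carrier D) (carrier ?B)"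
  proof (rule bij_betw_imageI)
    show "inj_on basic_pair (carrier D)"
      using basic_open_inj by (auto simp: inj_on_def app prod_eq_iff)
    have "basic_pair ` carrier D = (\<lambda>x. (basic_open L (fst x), snd x)) ` carrier D"
      using app by (intro image_cong) auto
    also have "\<dots> = carrier ?B"
    proof
      show "(\<lambda>x. (basic_open L (fst x), snd x)) ` carrier D \<subseteq> carrier ?B"
      proof (rule image_subsetI)
        fix x assume x: "x \<in> carrier D"
        then show "(basic_open L (fst x), snd x) \<in> carrier ?B" unfolding carrier by auto
      qed
      show "carrier ?B \<subseteq> (\<lambda>x. (basic_open L (fst x), snd x)) ` carrier D"
      proof
        fix y assume "y \<in> carrier ?B"
        then obtain b s where bs: "b \<in> carrier L" "s \<in> sections F (cn b)" "y = (basic_open L b, s)"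
          unfolding carrier by auto
        then have "(b, s) \<in> carrier D" by (simp add: pair_ob_def)
        then show "y \<in> (\<lambda>x. (basic_open L (fst x), snd x)) ` carrier D"
          by (rule rev_image_eqI) (simp add: bs)
      qed
    qed
    finally show "basic_pair ` carrier D = carrier ?B" .
  qed
  have meet: "basic_pair (x \<curlywedge>\<^bsub>D\<^esub> y) = basic_pair x \<curlywedge>\<^bsub>?B\<^esub> basic_pair y"
    if x: "x \<in> carrier D" and y: "y \<in> carrier D" for x y
  proof -
    have "basic_pair x \<curlywedge>\<^bsub>?B\<^esub> basic_pair y = (basic_open L (fst x) \<inter> basic_open L (fst y),
        res F (j_inv L (basic_open L (fst x))) (j_inv L (basic_open L (fst x) \<inter> basic_open L (fst y))) (snd x))"
      using x y by (simp add: app B star_ob_def pushforward_def)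
    also have "basic_open L (fst x) \<inter> basic_open L (fst y) = basic_open L (fst x \<sqinter> fst y)"
      using x y by (simp add: basic_open_meet)
    finally show ?thesis using x y by (simp add: app) (simp add: smeet_pair rst_def)
  qed
  have join: "basic_pair (x \<curlyvee>\<^bsub>D\<^esub> y) = basic_pair x \<curlyvee>\<^bsub>?B\<^esub> basic_pair y"
    if x: "x \<in> carrier D" and y: "y \<in> carrier D" for x y
  proof -
    have "basic_pair x \<curlyvee>\<^bsub>?B\<^esub> basic_pair y = (basic_open L (fst x) \<union> basic_open L (fst y),
        THE w. w \<in> sections F (j_inv L (basic_open L (fst x) \<union> basic_open L (fst y))) \<and>
         res F (j_inv L (basic_open L (fst x) \<union> basic_open L (fst y))) (j_inv L (basic_diff (fst x) (fst y))) w =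
         res F (j_inv L (basic_open L (fst x))) (j_inv L (basic_diff (fst x) (fst y))) (snd x) \<and>
         res F (j_inv L (basic_open L (fst x) \<union> basic_open L (fst y))) (j_inv L (basic_open L (fst y))) w = snd y)"
      using x y by (simp add: app B star_ob_def pushforward_def)
    also have "basic_open L (fst x) \<union> basic_open L (fst y) = basic_open L (fst x \<squnion> fst y)"
      using x y by (simp add: basic_open_join)
    finally show ?thesis
      unfolding app[OF sjoin_pair(1)[OF x y]] using x y by (simp add: sjoin_pair_eq)
  qed
  have "j_inv L {} = cn \<bottom>" using j_inv_basic[of \<bottom>] by simp
  then have "basic_pair (zer D) = zer ?B"
    using app[OF zer_pair(1)] by (simp add: B star_ob_def pushforward_def) (simp add: pair_ob_def)
  then show ?thesis using bij meet join by (simp add: skew_iso_def)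
qed

lemma dual_ob_noncommutative_frame:
  "noncommutative_frame (dual_ob (L, F))" "left_handed (dual_ob (L, F))"
proof -
  have ex: "\<exists>s. least (natural_order D) s (Upper (natural_order D) ((\<lambda>x. x \<curlywedge>\<^bsub>D\<^esub> u) ` C))"
      "\<exists>s. least (natural_order D) s (Upper (natural_order D) ((\<lambda>x. u \<curlywedge>\<^bsub>D\<^esub> x) ` C))"
    if C: "commuting_subset D C" and u: "u \<in> carrier D" for C u
  proof -
    obtain z where z: "z \<in> carrier D" "fst z = \<Squnion>(fst ` C)" "\<And>x. x \<in> C \<Longrightarrow> rst (cn (fst x)) z = snd x"
      using commuting_glueing[OF C] by blast
    have "C \<subseteq> carrier D" using C by (simp add: commuting_subset_def)
    from glueing_smeet[OF this z u] show "\<exists>s. least (natural_order D) s (Upper (natural_order D) ((\<lambda>x. x \<curlywedge>\<^bsub>D\<^esub> u) ` C))"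
      "\<exists>s. least (natural_order D) s (Upper (natural_order D) ((\<lambda>x. u \<curlywedge>\<^bsub>D\<^esub> x) ` C))" by blast+
  qed
  show "noncommutative_frame (dual_ob (L, F))"
    by (rule skew_iso_noncommutative_frame[OF basic_pair_iso pair_noncommutative_frame ex])
  show "left_handed (dual_ob (L, F))"
    by (rule skew_iso_left_handed[OF basic_pair_iso D.skew_lattice_axioms pair_left_handed])
qed

end

section \<open>The category of sheaves on dissolution locales\<close>

lemma Obj_Sh_Loc\<^sub>d: "(L, F) \<in> Obj Sh_Loc\<^sub>d \<longleftrightarrow> dsheaf L F"
  by (auto simp: Sh_Loc\<^sub>d_def dsheaf_def dsheaf_axioms_def dissolution_iff)

lemma dsheaf_dissolution: "dsheaf L F \<Longrightarrow> dissolution L"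
  by (simp add: dsheaf_def)

lemma sheaf_homD:
  assumes "\<alpha> \<in> sheaf_hom P F G"
  shows "\<alpha> \<in> extensional (carrier P)" "U \<in> carrier P \<Longrightarrow> \<alpha> U \<in> sections F U \<rightarrow>\<^sub>E sections G U"
    "\<lbrakk>U \<in> carrier P; s \<in> sections F U\<rbrakk> \<Longrightarrow> \<alpha> U s \<in> sections G U"
    "\<lbrakk>U \<in> carrier P; V \<in> carrier P; V \<sqsubseteq>\<^bsub>P\<^esub> U; s \<in> sections F U\<rbrakk> \<Longrightarrow> \<alpha> V (res F U V s) = res G U V (\<alpha> U s)"
proof -
  have PiE: "\<alpha> \<in> (\<Pi>\<^sub>E U\<in>carrier P. sections F U \<rightarrow>\<^sub>E sections G U)" using assms by (simp add: sheaf_hom_def)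
  then show "\<alpha> \<in> extensional (carrier P)" by (simp add: PiE_def)
  show "U \<in> carrier P \<Longrightarrow> \<alpha> U \<in> sections F U \<rightarrow>\<^sub>E sections G U" using PiE by (rule PiE_mem)
  then show "\<lbrakk>U \<in> carrier P; s \<in> sections F U\<rbrakk> \<Longrightarrow> \<alpha> U s \<in> sections G U" by (auto dest: PiE_mem)
  show "\<lbrakk>U \<in> carrier P; V \<in> carrier P; V \<sqsubseteq>\<^bsub>P\<^esub> U; s \<in> sections F U\<rbrakk> \<Longrightarrow> \<alpha> V (res F U V s) = res G U V (\<alpha> U s)"
    using assms by (simp add: sheaf_hom_def)
qed

lemma sheaf_homI:
  assumes "\<alpha> \<in> extensional (carrier P)"
    and "\<And>U. U \<in> carrier P \<Longrightarrow> \<alpha> U \<in> extensional (sections F U)"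
    and "\<And>U s. \<lbrakk>U \<in> carrier P; s \<in> sections F U\<rbrakk> \<Longrightarrow> \<alpha> U s \<in> sections G U"
    and "\<And>U V s. \<lbrakk>U \<in> carrier P; V \<in> carrier P; V \<sqsubseteq>\<^bsub>P\<^esub> U; s \<in> sections F U\<rbrakk>
      \<Longrightarrow> \<alpha> V (res F U V s) = res G U V (\<alpha> U s)"
  shows "\<alpha> \<in> sheaf_hom P F G"
  using assms by (auto simp: sheaf_hom_def PiE_def)

lemma sheaf_hom_eqI:
  assumes a: "\<alpha> \<in> sheaf_hom P F G" and b: "\<beta> \<in> sheaf_hom P F G'"
    and eq: "\<And>U s. \<lbrakk>U \<in> carrier P; s \<in> sections F U\<rbrakk> \<Longrightarrow> \<alpha> U s = \<beta> U s"
  shows "\<alpha> = \<beta>"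
proof (rule extensionalityI[OF sheaf_homD(1)[OF a] sheaf_homD(1)[OF b]])
  fix U assume U: "U \<in> carrier P"
  show "\<alpha> U = \<beta> U"
    using sheaf_homD(2)[OF a U] sheaf_homD(2)[OF b U] eq[OF U]
    by (intro extensionalityI[of _ "sections F U"]) (auto simp: PiE_def)
qed

abbreviation (in dissolution_hom) g where "g \<equiv> dissolution_map L L' f"

locale dsheaf_hom = dissolution_hom L' L f + X': dsheaf L' F' + X: dsheaf L F
  for L' :: "'m gorder" and L :: "'l gorder" and f :: "'m \<Rightarrow> 'l"
    and F' :: "('m \<Rightarrow> 'm, 't) presheaf" and F :: "('l \<Rightarrow> 'l, 's) presheaf" +
  fixes \<alpha> assumes \<alpha>: "\<alpha> \<in> sheaf_hom (nuclei L') F' (pushforward (dissolution_map L L' f) F)"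
begin

lemma \<alpha>_closed: "\<lbrakk>\<nu> \<in> nucs L'; s \<in> sections F' \<nu>\<rbrakk> \<Longrightarrow> \<alpha> \<nu> s \<in> sections F (g \<nu>)"
  using sheaf_homD(3)[OF \<alpha>] by (simp add: pushforward_def)

lemma \<alpha>_res:
  "\<lbrakk>\<nu> \<in> nucs L'; \<mu> \<in> nucs L'; \<mu> \<preceq>\<^bsub>L'\<^esub> \<nu>; s \<in> sections F' \<nu>\<rbrakk>
    \<Longrightarrow> \<alpha> \<mu> (res F' \<nu> \<mu> s) = res F (g \<nu>) (g \<mu>) (\<alpha> \<nu> s)"
  using sheaf_homD(4)[OF \<alpha>] by (simp add: pushforward_def)

end

lemma sh_loc_hom_iff:
  assumes "dsheaf L F" "dsheaf L' F'"
  shows "(f, \<alpha>) \<in> sh_loc_hom (L, F) (L', F') \<longleftrightarrow> dsheaf_hom L' L f F' F \<alpha>"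
  using assms
  by (auto simp: sh_loc_hom_def dsheaf_hom_def dsheaf_hom_axioms_def dissolution_hom_def dissolution_hom_axioms_def dsheaf_def)

lemma sh_loc_id_hom:
  assumes "dsheaf L F" shows "sh_loc_id (L, F) \<in> sh_loc_hom (L, F) (L, F)"
proof -
  interpret dsheaf L F by fact
  show ?thesis
    unfolding sh_loc_id_def sh_loc_hom_def prod.case mem_Collect_eq
  proof (intro conjI)
    show "(\<lambda>a\<in>carrier L. a) \<in> frame_hom L L" by (rule frame_hom_id[OF complete_lattice_axioms])
    show "(\<lambda>\<nu>\<in>nucs L. \<lambda>s\<in>sections F \<nu>. s)
      \<in> sheaf_hom (nuclei L) F (pushforward (dissolution_map L L (\<lambda>a\<in>carrier L. a)) F)"
      by (rule sheaf_homI)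
        (auto simp: dissolution_map_id[OF dissolution_axioms] pushforward_def N.res_closed)
  qed
qed

lemma sh_loc_comp_hom:
  assumes "dsheaf L F" "dsheaf L' F'" "dsheaf L'' F''"
    and m: "m \<in> sh_loc_hom (L, F) (L', F')" and n: "n \<in> sh_loc_hom (L', F') (L'', F'')"
  shows "sh_loc_comp (L, F) (L', F') (L'', F'') n m \<in> sh_loc_hom (L, F) (L'', F'')"
proof -
  obtain f \<alpha> f' \<alpha>' where mn: "m = (f, \<alpha>)" "n = (f', \<alpha>')" by fastforce
  interpret m: dsheaf_hom L' L f F' F \<alpha> using m sh_loc_hom_iff[OF assms(1,2)] by (simp add: mn)
  interpret n: dsheaf_hom L'' L' f' F'' F' \<alpha>' using n sh_loc_hom_iff[OF assms(2,3)] by (simp add: mn)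
  have comp: "dissolution_map L L'' (compose (carrier L'') f f') = compose (nucs L'') m.g n.g"
    by (rule dissolution_map_compose[OF assms(1-3)[THEN dsheaf_dissolution] m.f n.f])
  show ?thesis
    unfolding mn sh_loc_comp_def sh_loc_hom_def prod.case mem_Collect_eq
  proof (intro conjI sheaf_homI)
    show "compose (carrier L'') f f' \<in> frame_hom L'' L"
      by (rule frame_hom_compose[OF n.f m.f n.L'.complete_lattice_axioms])
    fix \<nu> \<mu> s assume "\<nu> \<in> nucs L''" "\<mu> \<in> nucs L''" "\<mu> \<preceq>\<^bsub>L''\<^esub> \<nu>" "s \<in> sections F'' \<nu>"
    then show "(\<lambda>\<nu>\<in>nucs L''. \<lambda>s\<in>sections F'' \<nu>. \<alpha> (n.g \<nu>) (\<alpha>' \<nu> s)) \<mu> (res F'' \<nu> \<mu> s) =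
        res (pushforward (dissolution_map L L'' (compose (carrier L'') f f')) F) \<nu> \<mu>
          ((\<lambda>\<nu>\<in>nucs L''. \<lambda>s\<in>sections F'' \<nu>. \<alpha> (n.g \<nu>) (\<alpha>' \<nu> s)) \<nu> s)"
      by (simp add: pushforward_def comp compose_eq n.X'.N.res_closed n.\<alpha>_res m.\<alpha>_res n.\<alpha>_closed n.dissolution_map_mono)
  qed (auto simp: pushforward_def comp compose_eq m.\<alpha>_closed n.\<alpha>_closed)
qed

lemma sh_loc_comp_id:
  assumes "dsheaf L F" "dsheaf L' F'" and m: "m \<in> sh_loc_hom (L, F) (L', F')"
  shows "sh_loc_comp (L, F) (L, F) (L', F') m (sh_loc_id (L, F)) = m"
    and "sh_loc_comp (L, F) (L', F') (L', F') (sh_loc_id (L', F')) m = m"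
proof -
  obtain f \<alpha> where m': "m = (f, \<alpha>)" by fastforce
  interpret m: dsheaf_hom L' L f F' F \<alpha> using m sh_loc_hom_iff[OF assms(1,2)] by (simp add: m')
  note f = frame_homD(1)[OF m.f]
  show "sh_loc_comp (L, F) (L, F) (L', F') m (sh_loc_id (L, F)) = m"
    unfolding m' sh_loc_comp_def sh_loc_id_def prod.case
  proof (intro arg_cong2[where f = Pair])
    show "compose (carrier L') (\<lambda>a\<in>carrier L. a) f = f"
      using f by (intro extensionalityI[of _ "carrier L'"]) (auto simp: compose_def PiE_def)
    show "(\<lambda>\<nu>\<in>nucs L'. \<lambda>s\<in>sections F' \<nu>.
        (\<lambda>\<nu>\<in>nucs L. \<lambda>s\<in>sections F \<nu>. s) (dissolution_map L L' f \<nu>) (\<alpha> \<nu> s)) = \<alpha>" (is "?l = _")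
    proof (rule sheaf_hom_eqI[OF _ m.\<alpha>])
      show "?l \<in> sheaf_hom (nuclei L') F' (pushforward m.g F)"
        by (rule sheaf_homI) (auto simp: m.\<alpha>_closed m.\<alpha>_res pushforward_def m.X'.N.res_closed
            m.X.N.res_closed m.dissolution_map_mono)
    qed (simp add: m.\<alpha>_closed)
  qed
  show "sh_loc_comp (L, F) (L', F') (L', F') (sh_loc_id (L', F')) m = m"
    unfolding m' sh_loc_comp_def sh_loc_id_def prod.case
  proof (intro arg_cong2[where f = Pair])
    show "compose (carrier L') f (\<lambda>a\<in>carrier L'. a) = f"
      using f by (intro extensionalityI[of _ "carrier L'"]) (auto simp: compose_def PiE_def)
    show "(\<lambda>\<nu>\<in>nucs L'. \<lambda>s\<in>sections F' \<nu>.
        \<alpha> (dissolution_map L' L' (\<lambda>a\<in>carrier L'. a) \<nu>)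
         ((\<lambda>\<nu>\<in>nucs L'. \<lambda>s\<in>sections F' \<nu>. s) \<nu> s)) = \<alpha>" (is "?l = _")
    proof (rule sheaf_hom_eqI[OF _ m.\<alpha>])
      show "?l \<in> sheaf_hom (nuclei L') F' (pushforward m.g F)"
        by (rule sheaf_homI) (auto simp: m.\<alpha>_closed m.\<alpha>_res pushforward_def m.X'.N.res_closed
            dissolution_map_id[OF m.L'.dissolution_axioms])
    qed (simp add: dissolution_map_id[OF m.L'.dissolution_axioms])
  qed
qed

lemma sh_loc_comp_assoc:
  assumes "dsheaf L1 F1" "dsheaf L2 F2" "dsheaf L3 F3" "dsheaf L4 F4"
    and m: "m \<in> sh_loc_hom (L1, F1) (L2, F2)" and n: "n \<in> sh_loc_hom (L2, F2) (L3, F3)"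
    and k: "k \<in> sh_loc_hom (L3, F3) (L4, F4)"
  shows "sh_loc_comp (L1, F1) (L3, F3) (L4, F4) k (sh_loc_comp (L1, F1) (L2, F2) (L3, F3) n m) =
    sh_loc_comp (L1, F1) (L2, F2) (L4, F4) (sh_loc_comp (L2, F2) (L3, F3) (L4, F4) k n) m"
proof -
  obtain f \<alpha> f' \<alpha>' f'' \<alpha>'' where mn: "m = (f, \<alpha>)" "n = (f', \<alpha>')" "k = (f'', \<alpha>'')" by (metis surj_pair)
  interpret m: dsheaf_hom L2 L1 f F2 F1 \<alpha> using m sh_loc_hom_iff[OF assms(1,2)] by (simp add: mn)
  interpret n: dsheaf_hom L3 L2 f' F3 F2 \<alpha>' using n sh_loc_hom_iff[OF assms(2,3)] by (simp add: mn)
  interpret k: dsheaf_hom L4 L3 f'' F4 F3 \<alpha>'' using k sh_loc_hom_iff[OF assms(3,4)] by (simp add: mn)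
  have comp: "dissolution_map L2 L4 (compose (carrier L4) f' f'') = compose (carrier (nuclei L4)) n.g k.g"
    by (rule dissolution_map_compose[OF assms(2-4)[THEN dsheaf_dissolution] n.f k.f])
  show ?thesis
    unfolding mn sh_loc_comp_def prod.case
  proof (intro arg_cong2[where f = Pair] restrict_ext)
    show "compose (carrier L4) (compose (carrier L3) f f') f'' = compose (carrier L4) f (compose (carrier L4) f' f'')"
      by (auto simp: compose_def intro!: restrict_ext)
  qed (simp add: comp compose_eq k.\<alpha>_closed)
qed

lemma Sh_Loc\<^sub>d_simps [simp]: "Hom Sh_Loc\<^sub>d = sh_loc_hom" "Ident Sh_Loc\<^sub>d = sh_loc_id" "Comp Sh_Loc\<^sub>d = sh_loc_comp"
  by (simp_all add: Sh_Loc\<^sub>d_def)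

lemma is_category_Sh_Loc\<^sub>d: "is_category (Sh_Loc\<^sub>d :: (('l, 's) sh_loc, _) category)"
  unfolding is_category_def Sh_Loc\<^sub>d_simps split_paired_Ball_Sigma
  by (auto simp: Obj_Sh_Loc\<^sub>d sh_loc_id_hom sh_loc_comp_id intro: sh_loc_comp_hom sh_loc_comp_assoc)

lemma opposite_simps: "Obj (opposite C) = Obj C" "Hom (opposite C) = (\<lambda>X Y. Hom C Y X)"
  "Ident (opposite C) = Ident C" "Comp (opposite C) = (\<lambda>X Y Z g f. Comp C Z Y X f g)"
  by (simp_all add: opposite_def)

lemma is_category_opposite: "is_category C \<Longrightarrow> is_category (opposite C)"
  by (auto simp: is_category_def opposite_def)


section \<open>The category of left-handed noncommutative frames\<close>

lemma ncframe_homD: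
  assumes "\<phi> \<in> ncframe_hom A B"
  shows "\<phi> \<in> carrier A \<rightarrow>\<^sub>E carrier B" "x \<in> carrier A \<Longrightarrow> \<phi> x \<in> carrier B"
    "\<lbrakk>x \<in> carrier A; y \<in> carrier A\<rbrakk> \<Longrightarrow> \<phi> (x \<curlywedge>\<^bsub>A\<^esub> y) = \<phi> x \<curlywedge>\<^bsub>B\<^esub> \<phi> y"
    "\<lbrakk>x \<in> carrier A; y \<in> carrier A\<rbrakk> \<Longrightarrow> \<phi> (x \<curlyvee>\<^bsub>A\<^esub> y) = \<phi> x \<curlyvee>\<^bsub>B\<^esub> \<phi> y"
    "\<phi> (zer A) = zer B"
    "commuting_subset A C \<Longrightarrow> \<phi> (\<Squnion>\<^bsub>natural_order A\<^esub> C) = \<Squnion>\<^bsub>natural_order B\<^esub> (\<phi> ` C)"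
    "in_max_D_class A t \<Longrightarrow> in_max_D_class B (\<phi> t)"
  using assms by (auto simp: ncframe_hom_def)

lemma commuting_subset_image:
  assumes "\<phi> \<in> ncframe_hom A B" "commuting_subset A C"
  shows "commuting_subset B (\<phi> ` C)"
proof -
  have C: "x \<in> carrier A" if "x \<in> C" for x using assms(2) that by (auto simp: commuting_subset_def)
  have "\<phi> x \<curlywedge>\<^bsub>B\<^esub> \<phi> y = \<phi> y \<curlywedge>\<^bsub>B\<^esub> \<phi> x \<and> \<phi> x \<curlyvee>\<^bsub>B\<^esub> \<phi> y = \<phi> y \<curlyvee>\<^bsub>B\<^esub> \<phi> x" if "x \<in> C" "y \<in> C" for x y
    using assms(2) that C[OF that(1)] C[OF that(2)]
    by (simp add: commuting_subset_def flip: ncframe_homD(3,4)[OF assms(1)])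
  then show ?thesis using assms(2) C ncframe_homD(2)[OF assms(1)] by (auto simp: commuting_subset_def)
qed

lemma ncframe_hom_compose:
  assumes \<phi>: "\<phi> \<in> ncframe_hom A B" and \<psi>: "\<psi> \<in> ncframe_hom B C" and A: "noncommutative_frame A"
  shows "compose (carrier A) \<psi> \<phi> \<in> ncframe_hom A C"
proof -
  interpret A: noncommutative_frame A by fact
  have "compose (carrier A) \<psi> \<phi> (\<Squnion>\<^bsub>natural_order A\<^esub> S) = \<Squnion>\<^bsub>natural_order C\<^esub> (compose (carrier A) \<psi> \<phi> ` S)"
    if S: "commuting_subset A S" for S
  proof -
    have "\<Squnion>\<^bsub>natural_order A\<^esub> S \<in> carrier A"
      using A.join_complete[OF S] A.natural_sup_eq least_closed by force
    moreover have "compose (carrier A) \<psi> \<phi> ` S = \<psi> ` \<phi> ` S"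
      using S by (force simp: commuting_subset_def compose_def image_image intro!: image_cong)
    ultimately show ?thesis
      using ncframe_homD(6)[OF \<phi> S] ncframe_homD(6)[OF \<psi> commuting_subset_image[OF \<phi> S]] by (simp add: compose_eq)
  qed
  moreover have "compose (carrier A) \<psi> \<phi> \<in> carrier A \<rightarrow>\<^sub>E carrier C"
    using ncframe_homD(2)[OF \<phi>] ncframe_homD(2)[OF \<psi>] by (auto simp: compose_def)
  moreover have "t \<in> carrier A" if "in_max_D_class A t" for t using that by (simp add: in_max_D_class_def)
  ultimately show ?thesis
    unfolding ncframe_hom_def
    using ncframe_homD(2-5,7)[OF \<phi>] ncframe_homD(2-5,7)[OF \<psi>]
    by (simp add: compose_eq A.smeet_closed A.sjoin_closed A.zer_closed)
qed

lemma ncframe_id_hom: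
  assumes "noncommutative_frame A" shows "ncframe_id A \<in> ncframe_hom A A"
proof -
  interpret A: noncommutative_frame A by fact
  have "ncframe_id A (\<Squnion>\<^bsub>natural_order A\<^esub> S) = \<Squnion>\<^bsub>natural_order A\<^esub> (ncframe_id A ` S)" if S: "commuting_subset A S" for S
  proof -
    have "\<Squnion>\<^bsub>natural_order A\<^esub> S \<in> carrier A"
      using A.join_complete[OF S] A.natural_sup_eq least_closed by force
    moreover have "ncframe_id A ` S = S" using S by (auto simp: commuting_subset_def ncframe_id_def image_def)
    ultimately show ?thesis by (simp add: ncframe_id_def)
  qed
  then show ?thesis
    unfolding ncframe_hom_def
    by (auto simp: ncframe_id_def A.smeet_closed A.sjoin_closed A.zer_closed in_max_D_class_def)
qed

lemma ncframe_hom_ext: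
  assumes "\<phi> \<in> ncframe_hom A B" "\<psi> \<in> ncframe_hom A B" "\<And>x. x \<in> carrier A \<Longrightarrow> \<phi> x = \<psi> x"
  shows "\<phi> = \<psi>"
  by (rule PiE_ext[OF ncframe_homD(1)[OF assms(1)] ncframe_homD(1)[OF assms(2)] assms(3)])

lemma compose_ncframe_id:
  assumes "\<phi> \<in> ncframe_hom A B"
  shows "compose (carrier A) \<phi> (ncframe_id A) = \<phi>" "compose (carrier A) (ncframe_id B) \<phi> = \<phi>"
  using ncframe_homD(1,2)[OF assms] unfolding ncframe_id_def
  by (auto simp: compose_def PiE_def intro!: extensionalityI[of _ "carrier A"])

lemma LNFrm_simps [simp]: "Hom LNFrm = ncframe_hom" "Ident LNFrm = ncframe_id"
  "Comp LNFrm = (\<lambda>A B C \<psi> \<phi>. compose (carrier A) \<psi> \<phi>)"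
  "A \<in> Obj LNFrm \<longleftrightarrow> noncommutative_frame A \<and> left_handed A"
  by (simp_all add: LNFrm_def)

lemma is_category_LNFrm: "is_category LNFrm"
  unfolding is_category_def LNFrm_simps
proof (intro conjI ballI)
  fix W X Y Z \<phi> \<psi> \<chi> assume "\<phi> \<in> ncframe_hom W X" "\<psi> \<in> ncframe_hom X Y" "\<chi> \<in> ncframe_hom Y Z"
  then show "compose (carrier W) \<chi> (compose (carrier W) \<psi> \<phi>) = compose (carrier W) (compose (carrier X) \<chi> \<psi>) \<phi>"
    by (intro compose_assoc) (auto dest: ncframe_homD(2))
qed (auto simp: ncframe_id_hom compose_ncframe_id intro: ncframe_hom_compose)


section \<open>The dual of a morphism\<close>

text \<open>The same formula as \<open>dual_arr\<close>, for objects over different types.\<close>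

definition hdual_arr ::
  "('m, 't) sh_loc \<Rightarrow> ('l, 's) sh_loc \<Rightarrow> ('l, 's, 'm, 't) sh_loc_arr \<Rightarrow> 'm set set \<times> 't \<Rightarrow> 'l set set \<times> 's" where
  "hdual_arr = (\<lambda>(L', F') (L, F) (f, \<alpha>). \<lambda>(U, s)\<in>carrier (dual_ob (L', F')).
     (preimg (patch (spec L)) (\<lambda>P\<in>prime_filters L. {a \<in> carrier L'. f a \<in> P}) U, \<alpha> (j_inv L' U) s))"

context dsheaf
begin

lemma carrier_dual_ob: "(U, s) \<in> carrier (dual_ob (L, F)) \<longleftrightarrow> U \<in> basic_open L ` carrier L \<and> s \<in> sections F (j_inv L U)"
  unfolding dual_ob_def spec_ob_def star_ob_def using compact_open_upsets by (auto simp: pushforward_def)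

lemma dual_arr_eq:
  "dual_arr (L, F) (L1, F1) (f, \<alpha>) = hdual_arr (L, F) (L1, F1) (f, \<alpha>)"
proof -
  have c: "carrier (star_ob (spec_ob (L, F))) = carrier (dual_ob (L, F))" by (simp add: dual_ob_def)
  have "openin (patch (spec L)) U \<and> s \<in> sections F (j_inv L U)" if "(U, s) \<in> carrier (dual_ob (L, F))" for U s
    using that carrier_dual_ob by auto
  then show ?thesis
    unfolding dual_arr_def star_arr_def hdual_arr_def spec_arr_def prod.case c
    by (intro restrict_ext) (auto simp: spec_ob_def)
qed

lemma basic_pair_apply: "x \<in> carrier D \<Longrightarrow> basic_pair x = (basic_open L (fst x), snd x)"
  by (cases x) (simp add: basic_pair_def)

lemma basic_pair_image: "basic_pair ` carrier D = carrier (dual_ob (L, F))"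
  using basic_pair_iso by (simp add: skew_iso_def bij_betw_def)

lemma basic_pair_hom: "basic_pair \<in> ncframe_hom D (dual_ob (L, F))"
  by (rule skew_iso_ncframe_hom[OF basic_pair_iso pair_noncommutative_frame]) (simp add: basic_pair_def)

definition unbasic where
  "unbasic = restrict (inv_into (carrier D) basic_pair) (carrier (dual_ob (L, F)))"

lemma unbasic: "unbasic \<in> ncframe_hom (dual_ob (L, F)) D"
  "x \<in> carrier D \<Longrightarrow> unbasic (basic_pair x) = x"
  "y \<in> carrier (dual_ob (L, F)) \<Longrightarrow> basic_pair (unbasic y) = y"
proof -
  note iso = skew_iso_ncframe_iso[OF basic_pair_iso pair_noncommutative_frame dual_ob_noncommutative_frame(1)]
  have ext: "basic_pair \<in> extensional (carrier D)" by (simp add: basic_pair_def)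
  show "unbasic \<in> ncframe_hom (dual_ob (L, F)) D" unfolding unbasic_def by (rule iso(2)[OF ext])
  show "unbasic (basic_pair x) = x" if "x \<in> carrier D"
    using fun_cong[OF iso(3)[OF ext], of x] that by (simp add: unbasic_def compose_eq ncframe_id_def)
  show "basic_pair (unbasic y) = y" if "y \<in> carrier (dual_ob (L, F))"
    using fun_cong[OF iso(4)[OF ext], of y] that by (simp add: unbasic_def compose_eq ncframe_id_def)
qed

end

lemma (in dissolution_hom) preimage_prime_filter:
  assumes "P \<in> prime_filters L"
  shows "{a \<in> carrier L'. f a \<in> P} \<in> prime_filters L'"
proof -
  note P = L.prime_filterD[OF assms]
  show ?thesis
    unfolding prime_filters_def
  proof (rule CollectI, intro conjI ballI impI)
    show "\<top>\<^bsub>L'\<^esub> \<in> {a \<in> carrier L'. f a \<in> P}" "\<bottom>\<^bsub>L'\<^esub> \<notin> {a \<in> carrier L'. f a \<in> P}"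
      using P frame_homD(2)[OF f] f_bottom by auto
    fix a b assume a: "a \<in> {a \<in> carrier L'. f a \<in> P}"
    { assume "b \<in> carrier L'" "a \<sqsubseteq>\<^bsub>L'\<^esub> b"
      then show "b \<in> {a \<in> carrier L'. f a \<in> P}" using a P(4)[of "f a" "f b"] f_mono[of a b] by auto
    }
    assume "b \<in> {a \<in> carrier L'. f a \<in> P}"
    then show "a \<sqinter>\<^bsub>L'\<^esub> b \<in> {a \<in> carrier L'. f a \<in> P}"
      using a P(5)[of "f a" "f b"] frame_homD(3)[OF f, of a b] by auto
  next
    fix a b assume "a \<in> carrier L'" "b \<in> carrier L'" "a \<squnion>\<^bsub>L'\<^esub> b \<in> {a \<in> carrier L'. f a \<in> P}"
    then show "a \<in> {a \<in> carrier L'. f a \<in> P} \<or> b \<in> {a \<in> carrier L'. f a \<in> P}"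
      using P(6)[of "f a" "f b"] frame_hom_join[OF f, of a b] by auto
  qed auto
qed

lemma (in dissolution_hom) preimg_basic:
  assumes "a \<in> carrier L'"
  shows "preimg (patch (spec L)) (\<lambda>P\<in>prime_filters L. {a \<in> carrier L'. f a \<in> P}) (basic_open L' a) = basic_open L (f a)"
  using assms preimage_prime_filter by (auto simp: preimg_def basic_open_def)

context dsheaf_hom
begin

definition pair_arr where "pair_arr = (\<lambda>x\<in>carrier X'.D. (f (fst x), \<alpha> (X'.cn (fst x)) (snd x)))"

lemma pair_arr_closed: "x \<in> carrier X'.D \<Longrightarrow> pair_arr x \<in> carrier X.D"
proof -
  assume x: "x \<in> carrier X'.D"
  have "\<alpha> (X'.cn (fst x)) (snd x) \<in> sections F (X.cn (f (fst x)))"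
    using \<alpha>_closed[of "X'.cn (fst x)" "snd x"] x by simp
  then show ?thesis using x by (simp add: pair_arr_def pair_ob_def[of L F])
qed

lemma fst_pair_arr [simp]: "x \<in> carrier X'.D \<Longrightarrow> fst (pair_arr x) = f (fst x)"
  by (simp add: pair_arr_def)

lemma rst_pair_arr:
  assumes "x \<in> carrier X'.D" "p \<in> nucs L'" "p \<preceq>\<^bsub>L'\<^esub> X'.cn (fst x)"
  shows "X.rst (g p) (pair_arr x) = \<alpha> p (X'.rst p x)"
  using assms \<alpha>_res[of "X'.cn (fst x)" p "snd x"] by (simp add: X.rst_def X'.rst_def pair_arr_def)

lemma snd_pair_arr: "x \<in> carrier X'.D \<Longrightarrow> snd (pair_arr x) = \<alpha> (X'.cn (fst x)) (snd x)"
  by (simp add: pair_arr_def)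

text \<open>\<alpha> commutes with restriction along g, and g takes closed and difference nuclei to
  closed and difference nuclei. So the pieces that characterise a meet or a join are mapped to the
  pieces that characterise the image, and a glueing goes to a glueing because f preserves suprema of
  domains.\<close>

lemma pair_arr_hom: "pair_arr \<in> ncframe_hom X'.D X.D"
proof -
  have meet: "pair_arr (x \<curlywedge>\<^bsub>X'.D\<^esub> y) = pair_arr x \<curlywedge>\<^bsub>X.D\<^esub> pair_arr y"
    if x: "x \<in> carrier X'.D" and y: "y \<in> carrier X'.D" for x y
  proof -
    let ?m = "fst x \<sqinter>\<^bsub>L'\<^esub> fst y"
    have mc: "?m \<in> carrier L'" "X'.cn ?m \<preceq>\<^bsub>L'\<^esub> X'.cn (fst x)" using x y by (simp_all add: L'.closed_mono_iff L'.meet_left)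
    have fm: "f ?m = f (fst x) \<sqinter>\<^bsub>L\<^esub> f (fst y)" using x y by (simp add: frame_homD(3)[OF f])
    have xy: "x \<curlywedge>\<^bsub>X'.D\<^esub> y \<in> carrier X'.D" using x y by simp
    have "snd (pair_arr (x \<curlywedge>\<^bsub>X'.D\<^esub> y)) = \<alpha> (X'.cn ?m) (X'.rst (X'.cn ?m) x)"
      unfolding snd_pair_arr[OF xy] by (simp add: X'.smeet_pair)
    also have "\<dots> = X.rst (g (X'.cn ?m)) (pair_arr x)"
      using x mc by (intro rst_pair_arr[symmetric]) auto
    also have "g (X'.cn ?m) = X.cn (f (fst x) \<sqinter>\<^bsub>L\<^esub> f (fst y))" using mc fm by simp
    finally show ?thesis using x y xy fm by (simp add: prod_eq_iff) (simp add: X.smeet_pair)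
  qed
  have join: "pair_arr (x \<curlyvee>\<^bsub>X'.D\<^esub> y) = pair_arr x \<curlyvee>\<^bsub>X.D\<^esub> pair_arr y"
    if x: "x \<in> carrier X'.D" and y: "y \<in> carrier X'.D" for x y
  proof -
    note j' = X'.sjoin_pair[OF x y] and j = X.sjoin_pair[OF pair_arr_closed[OF x] pair_arr_closed[OF y]]
    let ?j = "fst x \<squnion>\<^bsub>L'\<^esub> fst y" and ?d = "diff_nucleus L' (fst x) (fst y)"
    have c: "fst x \<in> carrier L'" "fst y \<in> carrier L'" "?j \<in> carrier L'" "?d \<in> nucs L'" using x y by auto
    have fst: "fst (pair_arr (x \<curlyvee>\<^bsub>X'.D\<^esub> y)) = fst (pair_arr x \<curlyvee>\<^bsub>X.D\<^esub> pair_arr y)"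
      using x y j j' by (simp add: frame_hom_join[OF f])
    have dle: "?d \<preceq>\<^bsub>L'\<^esub> X'.cn (fst x)" using c by (simp add: diff_nucleus_def L'.N.meet_left)
    have dle': "?d \<preceq>\<^bsub>L'\<^esub> X'.cn ?j"
      using L'.N.le_trans[OF dle, of "X'.cn ?j"] c by (simp add: L'.closed_mono_iff L'.join_left)
    have "X.rst (X.cn (f ?j)) (pair_arr (x \<curlyvee>\<^bsub>X'.D\<^esub> y)) = X.rst (X.cn (f ?j)) (pair_arr x \<curlyvee>\<^bsub>X.D\<^esub> pair_arr y)"
    proof (rule X.N.locality2)
      have fj: "f ?j = f (fst x) \<squnion>\<^bsub>L\<^esub> f (fst y)" using c by (simp add: frame_hom_join[OF f])
      show cov: "X.cn (f ?j) = diff_nucleus L (f (fst x)) (f (fst y)) \<squnion>\<^bsub>nuclei L\<^esub> X.cn (f (fst y))"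
        using c fj by (simp add: X.diff_join_closed)
      have le: "diff_nucleus L (f (fst x)) (f (fst y)) \<preceq>\<^bsub>L\<^esub> X.cn (f ?j)" "X.cn (f (fst y)) \<preceq>\<^bsub>L\<^esub> X.cn (f ?j)"
        unfolding cov using c by (auto intro: L.N.join_left L.N.join_right)
      have rs: "res F (X.cn (f ?j)) q (X.rst (X.cn (f ?j)) z) = X.rst q z"
        if "z \<in> carrier X.D" "fst z = f ?j" "q \<in> nucs L" "q \<preceq>\<^bsub>L\<^esub> X.cn (f ?j)" for z q
        using that c by (intro X.res_rst) auto
      have A: "pair_arr (x \<curlyvee>\<^bsub>X'.D\<^esub> y) \<in> carrier X.D" "fst (pair_arr (x \<curlyvee>\<^bsub>X'.D\<^esub> y)) = f ?j"
        using j' by (simp_all add: pair_arr_closed)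
      have B: "pair_arr x \<curlyvee>\<^bsub>X.D\<^esub> pair_arr y \<in> carrier X.D" "fst (pair_arr x \<curlyvee>\<^bsub>X.D\<^esub> pair_arr y) = f ?j"
        using j x y fj by simp_all
      show "X.rst (X.cn (f ?j)) (pair_arr (x \<curlyvee>\<^bsub>X'.D\<^esub> y)) \<in> sections F (X.cn (f ?j))"
        using A c by (intro X.rst_closed) auto
      show "X.rst (X.cn (f ?j)) (pair_arr x \<curlyvee>\<^bsub>X.D\<^esub> pair_arr y) \<in> sections F (X.cn (f ?j))"
        using B c by (intro X.rst_closed) auto
      have "X.rst (g ?d) (pair_arr (x \<curlyvee>\<^bsub>X'.D\<^esub> y)) = \<alpha> ?d (X'.rst ?d (x \<curlyvee>\<^bsub>X'.D\<^esub> y))"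
        using j' c dle' by (intro rst_pair_arr) auto
      also have "\<dots> = X.rst (g ?d) (pair_arr x)"
        unfolding j'(3) using x c dle by (intro rst_pair_arr[symmetric]) auto
      finally show "res F (X.cn (f ?j)) (diff_nucleus L (f (fst x)) (f (fst y))) (X.rst (X.cn (f ?j)) (pair_arr (x \<curlyvee>\<^bsub>X'.D\<^esub> y))) =
          res F (X.cn (f ?j)) (diff_nucleus L (f (fst x)) (f (fst y))) (X.rst (X.cn (f ?j)) (pair_arr x \<curlyvee>\<^bsub>X.D\<^esub> pair_arr y))"
        using j(3) x y c by (simp add: rs[OF A _ le(1)] rs[OF B _ le(1)])
      have "X.rst (g (X'.cn (fst y))) (pair_arr (x \<curlyvee>\<^bsub>X'.D\<^esub> y)) = \<alpha> (X'.cn (fst y)) (X'.rst (X'.cn (fst y)) (x \<curlyvee>\<^bsub>X'.D\<^esub> y))"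
        using j' c by (intro rst_pair_arr) (auto simp: L'.closed_mono_iff L'.join_right)
      also have "\<dots> = snd (pair_arr y)" unfolding j'(4) using y by (simp add: snd_pair_arr)
      finally show "res F (X.cn (f ?j)) (X.cn (f (fst y))) (X.rst (X.cn (f ?j)) (pair_arr (x \<curlyvee>\<^bsub>X'.D\<^esub> y))) =
          res F (X.cn (f ?j)) (X.cn (f (fst y))) (X.rst (X.cn (f ?j)) (pair_arr x \<curlyvee>\<^bsub>X.D\<^esub> pair_arr y))"
        using j(4) x y c by (simp add: rs[OF A _ le(2)] rs[OF B _ le(2)])
    qed (use c in auto)
    moreover have "fst (pair_arr (x \<curlyvee>\<^bsub>X'.D\<^esub> y)) = f ?j" using j' by simp
    ultimately have "snd (pair_arr (x \<curlyvee>\<^bsub>X'.D\<^esub> y)) = snd (pair_arr x \<curlyvee>\<^bsub>X.D\<^esub> pair_arr y)"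
      using X.rst_self[OF pair_arr_closed[OF j'(1)]] X.rst_self[OF j(1)] fst by simp
    then show ?thesis using fst by (simp add: prod_eq_iff)
  qed
  have zer: "pair_arr (zer X'.D) = zer X.D"
  proof -
    have "fst (pair_arr (zer X'.D)) = \<bottom>\<^bsub>L\<^esub>" using X'.zer_pair f_bottom by simp
    moreover have "snd (pair_arr (zer X'.D)) = snd (zer X.D)"
      using X.snd_closed[OF pair_arr_closed[OF X'.zer_pair(1)]] X.snd_closed[OF X.zer_pair(1)] X.zer_pair(2) calculation
      by (intro X.N.bottom_section_unique) auto
    ultimately show ?thesis using X.zer_pair(2) by (simp add: prod_eq_iff)
  qed
  have Sup: "pair_arr (\<Squnion>\<^bsub>natural_order X'.D\<^esub> C) = \<Squnion>\<^bsub>natural_order X.D\<^esub> (pair_arr ` C)"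
    if C: "commuting_subset X'.D C" for C
  proof -
    have Cc: "C \<subseteq> carrier X'.D" using C by (simp add: commuting_subset_def)
    then have fC: "fst ` C \<subseteq> carrier L'" by (intro image_subsetI) (simp add: subsetD)
    obtain z where z: "z \<in> carrier X'.D" "fst z = \<Squnion>\<^bsub>L'\<^esub>(fst ` C)" "\<And>x. x \<in> C \<Longrightarrow> X'.rst (X'.cn (fst x)) z = snd x"
      using X'.commuting_glueing[OF C] by blast
    have "least (natural_order X.D) (pair_arr z) (Upper (natural_order X.D) (pair_arr ` C))"
    proof (rule X.glueing_least)
      show "pair_arr ` C \<subseteq> carrier X.D" using Cc pair_arr_closed by auto
      show "pair_arr z \<in> carrier X.D" using z pair_arr_closed by auto
      have "fst ` pair_arr ` C = f ` fst ` C" using Cc by (auto simp: image_image subsetD intro!: image_cong)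
      then show "fst (pair_arr z) = \<Squnion>\<^bsub>L\<^esub>(fst ` pair_arr ` C)"
        using z(1) by (simp add: z(2) frame_homD(4)[OF f fC])
      fix y assume "y \<in> pair_arr ` C"
      then obtain x where x: "x \<in> C" "x \<in> carrier X'.D" "y = pair_arr x" using Cc by auto
      have "fst x \<sqsubseteq>\<^bsub>L'\<^esub> fst z" unfolding z(2) using x fC by (intro L'.sup_upper) auto
      then have "X.rst (g (X'.cn (fst x))) (pair_arr z) = \<alpha> (X'.cn (fst x)) (X'.rst (X'.cn (fst x)) z)"
        using x(2) z(1) by (intro rst_pair_arr) (auto simp: L'.closed_mono_iff)
      then show "X.rst (X.cn (fst y)) (pair_arr z) = snd y" using x z(3) by (simp add: snd_pair_arr)
    qed
    then show ?thesis using X.D.natural_sup_eq X'.D.natural_sup_eq[OF X'.glueing_least[OF Cc z]] by simp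
  qed
  show ?thesis
    unfolding ncframe_hom_def
    using meet join zer Sup pair_arr_closed frame_homD(2)[OF f]
    by (auto simp: X.in_max_D_class_pair X'.in_max_D_class_pair) (auto simp: pair_arr_def)
qed

lemma hdual_basic:
  assumes "x \<in> carrier X'.D"
  shows "hdual_arr (L', F') (L, F) (f, \<alpha>) (X'.basic_pair x) = X.basic_pair (pair_arr x)"
proof -
  have bx: "(basic_open L' (fst x), snd x) \<in> carrier (dual_ob (L', F'))"
    using imageI[OF assms, of X'.basic_pair] by (simp only: X'.basic_pair_image X'.basic_pair_apply[OF assms])
  show ?thesis
    using assms bx pair_arr_closed[OF assms] preimg_basic[of "fst x"]
    by (simp add: hdual_arr_def X'.basic_pair_apply X.basic_pair_apply snd_pair_arr)
qed

lemma hdual_arr_eq: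
  "hdual_arr (L', F') (L, F) (f, \<alpha>) =
    compose (carrier (dual_ob (L', F'))) X.basic_pair (compose (carrier (dual_ob (L', F'))) pair_arr X'.unbasic)"
proof (rule extensionalityI[of _ "carrier (dual_ob (L', F'))"])
  fix y assume y: "y \<in> carrier (dual_ob (L', F'))"
  then have "hdual_arr (L', F') (L, F) (f, \<alpha>) y = X.basic_pair (pair_arr (X'.unbasic y))"
    using hdual_basic[OF ncframe_homD(2)[OF X'.unbasic(1) y]] X'.unbasic(3) by simp
  then show "hdual_arr (L', F') (L, F) (f, \<alpha>) y =
      compose (carrier (dual_ob (L', F'))) X.basic_pair (compose (carrier (dual_ob (L', F'))) pair_arr X'.unbasic) y"
    using y by (simp add: compose_eq)
qed (auto simp: hdual_arr_def)

lemma hdual_arr_hom: "hdual_arr (L', F') (L, F) (f, \<alpha>) \<in> ncframe_hom (dual_ob (L', F')) (dual_ob (L, F))"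
  unfolding hdual_arr_eq
  by (intro ncframe_hom_compose[OF _ X.basic_pair_hom] ncframe_hom_compose[OF X'.unbasic(1) pair_arr_hom]
      X'.dual_ob_noncommutative_frame(1))

end

lemma hdual_arr_closed:
  assumes "dsheaf L F" "dsheaf L' F'" "m \<in> sh_loc_hom (L, F) (L', F')"
  shows "hdual_arr (L', F') (L, F) m \<in> ncframe_hom (dual_ob (L', F')) (dual_ob (L, F))"
proof -
  obtain f \<alpha> where m: "m = (f, \<alpha>)" by fastforce
  interpret dsheaf_hom L' L f F' F \<alpha> using assms sh_loc_hom_iff[OF assms(1,2)] by (simp add: m)
  show ?thesis unfolding m by (rule hdual_arr_hom)
qed

lemma hdual_arr_id:
  assumes "dsheaf L F"
  shows "hdual_arr (L, F) (L, F) (sh_loc_id (L, F)) = ncframe_id (dual_ob (L, F))"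
proof -
  interpret dsheaf L F by fact
  have hom: "sh_loc_id (L, F) \<in> sh_loc_hom (L, F) (L, F)" by (rule sh_loc_id_hom[OF assms])
  interpret i: dsheaf_hom L L "\<lambda>a\<in>carrier L. a" F F "\<lambda>\<nu>\<in>nucs L. \<lambda>s\<in>sections F \<nu>. s"
    using hom sh_loc_hom_iff[OF assms assms] by (simp add: sh_loc_id_def)
  show ?thesis
  proof (rule ncframe_hom_ext[OF hdual_arr_closed[OF assms assms hom] ncframe_id_hom[OF dual_ob_noncommutative_frame(1)]])
    fix y assume y: "y \<in> carrier (dual_ob (L, F))"
    obtain x where x: "y = basic_pair x" "x \<in> carrier D"
      using y unfolding basic_pair_image[symmetric] by (metis imageE)
    then have "i.pair_arr x = x" by (simp add: i.pair_arr_def)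
    then show "hdual_arr (L, F) (L, F) (sh_loc_id (L, F)) y = ncframe_id (dual_ob (L, F)) y"
      using i.hdual_basic[OF x(2)] x y by (simp add: ncframe_id_def sh_loc_id_def)
  qed
qed

lemma hdual_arr_comp:
  assumes "dsheaf L F" "dsheaf L' F'" "dsheaf L'' F''"
    and m: "m \<in> sh_loc_hom (L, F) (L', F')" and n: "n \<in> sh_loc_hom (L', F') (L'', F'')"
  shows "hdual_arr (L'', F'') (L, F) (sh_loc_comp (L, F) (L', F') (L'', F'') n m) =
    compose (carrier (dual_ob (L'', F''))) (hdual_arr (L', F') (L, F) m) (hdual_arr (L'', F'') (L', F') n)"
proof -
  obtain f \<alpha> f' \<alpha>' where mn: "m = (f, \<alpha>)" "n = (f', \<alpha>')" by fastforce
  interpret m: dsheaf_hom L' L f F' F \<alpha> using m sh_loc_hom_iff[OF assms(1,2)] by (simp add: mn)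
  interpret n: dsheaf_hom L'' L' f' F'' F' \<alpha>' using n sh_loc_hom_iff[OF assms(2,3)] by (simp add: mn)
  have hom: "sh_loc_comp (L, F) (L', F') (L'', F'') n m \<in> sh_loc_hom (L, F) (L'', F'')"
    by (rule sh_loc_comp_hom[OF assms])
  define f2 \<alpha>2 where f2: "f2 = compose (carrier L'') f f'" and
    \<alpha>2: "\<alpha>2 = (\<lambda>\<nu>\<in>nucs L''. \<lambda>s\<in>sections F'' \<nu>. \<alpha> (n.g \<nu>) (\<alpha>' \<nu> s))"
  have eq: "sh_loc_comp (L, F) (L', F') (L'', F'') n m = (f2, \<alpha>2)" by (simp add: mn sh_loc_comp_def f2 \<alpha>2)
  interpret c: dsheaf_hom L'' L f2 F'' F \<alpha>2
    using hom sh_loc_hom_iff[OF assms(1,3)] by (simp add: eq)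
  show ?thesis
    unfolding eq unfolding mn
  proof (rule ncframe_hom_ext[OF c.hdual_arr_hom ncframe_hom_compose[OF n.hdual_arr_hom m.hdual_arr_hom n.X'.dual_ob_noncommutative_frame(1)]])
    fix y assume y: "y \<in> carrier (dual_ob (L'', F''))"
    then obtain x where x: "x \<in> carrier n.X'.D" "y = n.X'.basic_pair x"
      unfolding n.X'.basic_pair_image[symmetric] by (metis imageE)
    have "c.pair_arr x = m.pair_arr (n.pair_arr x)"
      using x n.pair_arr_closed[OF x(1)]
      by (simp add: c.pair_arr_def m.pair_arr_def n.snd_pair_arr) (simp add: f2 \<alpha>2 compose_eq)
    then show "hdual_arr (L'', F'') (L, F) (f2, \<alpha>2) y =
        compose (carrier (dual_ob (L'', F''))) (hdual_arr (L', F') (L, F) (f, \<alpha>)) (hdual_arr (L'', F'') (L', F') (f', \<alpha>')) y"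
      using y x c.hdual_basic[OF x(1)] n.hdual_basic[OF x(1)] m.hdual_basic[OF n.pair_arr_closed[OF x(1)]]
      by (simp add: compose_eq)
  qed
qed

lemma is_functor_dual:
  "is_functor (opposite (Sh_Loc\<^sub>d :: (('l, 's) sh_loc, _) category)) LNFrm dual_ob dual_arr"
proof -
  have arr: "dual_arr (L', F') (L, F) m = hdual_arr (L', F') (L, F) m" if "dsheaf L' F'"
    for L' L :: "'l gorder" and F' F :: "('l \<Rightarrow> 'l, 's) presheaf" and m
  proof -
    obtain f \<alpha> where m: "m = (f, \<alpha>)" by fastforce
    show ?thesis unfolding m by (rule dsheaf.dual_arr_eq[OF that])
  qed
  show ?thesis
    unfolding is_functor_def opposite_simps Sh_Loc\<^sub>d_simps LNFrm_simps
  proof (intro conjI ballI)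
    show "is_category (opposite (Sh_Loc\<^sub>d :: (('l, 's) sh_loc, _) category))"
      by (intro is_category_opposite is_category_Sh_Loc\<^sub>d)
  next
    fix X Y :: "('l, 's) sh_loc" and m assume "X \<in> Obj Sh_Loc\<^sub>d" "Y \<in> Obj Sh_Loc\<^sub>d" "m \<in> sh_loc_hom Y X"
    then show "dual_arr X Y m \<in> ncframe_hom (dual_ob X) (dual_ob Y)"
      by (cases X; cases Y) (simp add: Obj_Sh_Loc\<^sub>d arr hdual_arr_closed)
  next
    fix X Y Z :: "('l, 's) sh_loc" and m n assume "X \<in> Obj Sh_Loc\<^sub>d" "Y \<in> Obj Sh_Loc\<^sub>d" "Z \<in> Obj Sh_Loc\<^sub>d"
      "m \<in> sh_loc_hom Y X" "n \<in> sh_loc_hom Z Y"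
    then show "dual_arr X Z (sh_loc_comp Z Y X m n) = compose (carrier (dual_ob X)) (dual_arr Y Z n) (dual_arr X Y m)"
      by (cases X; cases Y; cases Z) (simp add: Obj_Sh_Loc\<^sub>d arr hdual_arr_comp)
  next
    fix X :: "('l, 's) sh_loc" assume "X \<in> Obj Sh_Loc\<^sub>d"
    then show "noncommutative_frame (dual_ob X)" "left_handed (dual_ob X)"
      "dual_arr X X (sh_loc_id X) = ncframe_id (dual_ob X)"
      by (cases X; simp add: Obj_Sh_Loc\<^sub>d arr hdual_arr_id dsheaf.dual_ob_noncommutative_frame)+
  qed (rule is_category_LNFrm)
qed


section \<open>Full faithfulness\<close>

context dsheaf
begin

text \<open>A difference p is complemented, by q = the join of the open nucleus of b and the closed
  nucleus of a. Since F has global sections there is some section over q; gluing it to the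
  restriction of s over p gives a global section.\<close>

lemma locally_global:
  assumes \<nu>: "\<nu> \<in> nucs L" and ab: "a \<in> carrier L" "b \<in> carrier L" "diff_nucleus L b a \<preceq> \<nu>"
    and s: "s \<in> sections F \<nu>"
  obtains s' where "s' \<in> sections F \<top>\<^bsub>nuclei L\<^esub>"
    "res F \<nu> (diff_nucleus L b a) s = res F \<top>\<^bsub>nuclei L\<^esub> (diff_nucleus L b a) s'"
proof -
  let ?p = "diff_nucleus L b a" and ?q = "open_nucleus L b \<squnion>\<^bsub>nuclei L\<^esub> cn a"
  have c: "?p \<in> nucs L" "?q \<in> nucs L" using ab by auto
  have "?p \<sqinter>\<^bsub>nuclei L\<^esub> open_nucleus L b \<preceq> cn b \<sqinter>\<^bsub>nuclei L\<^esub> open_nucleus L b"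
    using ab by (intro N.meet_mono) (auto simp: diff_nucleus_def N.meet_left)
  then have 1: "?p \<sqinter>\<^bsub>nuclei L\<^esub> open_nucleus L b = \<bottom>\<^bsub>nuclei L\<^esub>" using ab by (simp add: closed_meet_open N.bottom_unique)
  have 2: "?p \<sqinter>\<^bsub>nuclei L\<^esub> cn a = \<bottom>\<^bsub>nuclei L\<^esub>" using ab by (simp add: diff_join_closed)
  have meet: "?p \<sqinter>\<^bsub>nuclei L\<^esub> ?q = \<bottom>\<^bsub>nuclei L\<^esub>"
    using ab N.meet_join_distrib[of ?p "open_nucleus L b" "cn a"] 1 2 by simp
  have "?p \<squnion>\<^bsub>nuclei L\<^esub> ?q = (?p \<squnion>\<^bsub>nuclei L\<^esub> cn a) \<squnion>\<^bsub>nuclei L\<^esub> open_nucleus L b"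
    using ab by (simp add: N.join_assoc join_comm[of "nuclei L" "open_nucleus L b"])
  also have "\<dots> = (cn b \<squnion>\<^bsub>nuclei L\<^esub> open_nucleus L b) \<squnion>\<^bsub>nuclei L\<^esub> cn a"
    using ab by (simp add: diff_join_closed closed_join N.join_assoc join_comm[of "nuclei L" "cn a"])
  also have "\<dots> = \<top>\<^bsub>nuclei L\<^esub>" using ab by (simp add: closed_join_open N.join_absorb1)
  finally have join: "?p \<squnion>\<^bsub>nuclei L\<^esub> ?q = \<top>\<^bsub>nuclei L\<^esub>" .
  obtain t where t: "t \<in> sections F ?q" using section_exists[OF c(2)] by auto
  have "\<exists>!w. w \<in> sections F (?p \<squnion>\<^bsub>nuclei L\<^esub> ?q) \<and> res F (?p \<squnion>\<^bsub>nuclei L\<^esub> ?q) ?p w = res F \<nu> ?p s \<and>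
      res F (?p \<squnion>\<^bsub>nuclei L\<^esub> ?q) ?q w = t"
    by (rule N.glue2[OF c meet N.res_closed[OF \<nu> c(1) ab(3) s] t])
  then obtain w where "w \<in> sections F \<top>\<^bsub>nuclei L\<^esub>" "res F \<top>\<^bsub>nuclei L\<^esub> ?p w = res F \<nu> ?p s"
    unfolding join by blast
  then show thesis by (intro that[of w]) auto
qed

definition cut where "cut b t = (b, res F \<top>\<^bsub>nuclei L\<^esub> (cn b) t)"

lemma cut_closed [simp]: "\<lbrakk>b \<in> carrier L; t \<in> sections F \<top>\<^bsub>nuclei L\<^esub>\<rbrakk> \<Longrightarrow> cut b t \<in> carrier D"
  by (simp add: cut_def pair_ob_def N.res_closed)

lemma fst_cut [simp]: "fst (cut b t) = b"
  by (simp add: cut_def)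

lemma rst_cut:
  "\<lbrakk>b \<in> carrier L; t \<in> sections F \<top>\<^bsub>nuclei L\<^esub>; p \<in> nucs L; p \<preceq> cn b\<rbrakk>
    \<Longrightarrow> rst p (cut b t) = res F \<top>\<^bsub>nuclei L\<^esub> p t"
  by (simp add: rst_def cut_def N.res_res)

lemma smeet_cut:
  "\<lbrakk>b \<in> carrier L; c \<in> carrier L; t \<in> sections F \<top>\<^bsub>nuclei L\<^esub>\<rbrakk> \<Longrightarrow> cut b t \<curlywedge>\<^bsub>D\<^esub> cut c t = cut (b \<sqinter> c) t"
  by (simp add: smeet_pair rst_cut closed_mono_iff meet_left) (simp add: cut_def)

lemma sjoin_cut:
  assumes "b \<in> carrier L" "c \<in> carrier L" "t \<in> sections F \<top>\<^bsub>nuclei L\<^esub>"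
  shows "cut b t \<curlyvee>\<^bsub>D\<^esub> cut c t = cut (b \<squnion> c) t"
proof (rule pair_eqI[of _ _ b c \<bottom>])
  fix p assume p: "p \<in> nucs L" "p \<noteq> \<bottom>\<^bsub>nuclei L\<^esub>" "p \<preceq> cn (fst (cut b t \<curlyvee>\<^bsub>D\<^esub> cut c t))" "decided p b" "decided p c"
  then have "p \<preceq> cn (b \<squnion> c)" using assms by (simp add: sjoin_pair)
  then show "rst p (cut b t \<curlyvee>\<^bsub>D\<^esub> cut c t) = rst p (cut (b \<squnion> c) t)"
    using p assms decided_join(2)[OF p(1,2,4,5)] by (auto simp: rst_sjoin rst_cut)
qed (use assms in \<open>auto simp: sjoin_pair\<close>)

text \<open>The restrictions of one global section form a copy of L inside the skew lattice of
  pairs. Its suprema are commuting suprema, so a morphism of noncommutative frames induces a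
  morphism of frames on it.\<close>

lemma commuting_cuts:
  assumes "S \<subseteq> carrier L" "S \<noteq> {}" "t \<in> sections F \<top>\<^bsub>nuclei L\<^esub>"
  shows "commuting_subset D ((\<lambda>b. cut b t) ` S)"
    and "least (natural_order D) (cut (\<Squnion>S) t) (Upper (natural_order D) ((\<lambda>b. cut b t) ` S))"
proof -
  have "b \<in> carrier L" if "b \<in> S" for b using assms that by auto
  then show "commuting_subset D ((\<lambda>b. cut b t) ` S)"
    using assms
    by (auto simp: commuting_subset_def smeet_cut sjoin_cut meet_comm[of L] join_comm[of L] simp del: fst_closed
        intro: arg_cong2[where f = cut] meet_comm join_comm)
  have sub: "(\<lambda>b. cut b t) ` S \<subseteq> carrier D" using assms by auto
  show "least (natural_order D) (cut (\<Squnion>S) t) (Upper (natural_order D) ((\<lambda>b. cut b t) ` S))"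
  proof (rule glueing_least[OF sub])
    show "cut (\<Squnion>S) t \<in> carrier D" using assms by simp
    show "fst (cut (\<Squnion>S) t) = \<Squnion>(fst ` (\<lambda>b. cut b t) ` S)" by (simp add: image_image)
    fix x assume "x \<in> (\<lambda>b. cut b t) ` S"
    then obtain b where b: "b \<in> S" "b \<in> carrier L" "x = cut b t" using assms by auto
    then have "b \<sqsubseteq> \<Squnion>S" using assms by (intro sup_upper)
    then show "rst (cn (fst x)) (cut (\<Squnion>S) t) = snd x"
      using b assms by (simp add: rst_cut closed_mono_iff) (simp add: cut_def)
  qed
qed

text \<open>A closed nucleus is the difference of b and the bottom, so \<open>locally_global\<close>
  applies to the whole domain.\<close>

lemma pair_is_cut:
  assumes x: "x \<in> carrier D"
  obtains t where "t \<in> sections F \<top>\<^bsub>nuclei L\<^esub>" "x = cut (fst x) t"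
proof -
  obtain s' where "s' \<in> sections F \<top>\<^bsub>nuclei L\<^esub>"
    "res F (cn (fst x)) (diff_nucleus L (fst x) \<bottom>) (snd x) = res F \<top>\<^bsub>nuclei L\<^esub> (diff_nucleus L (fst x) \<bottom>) s'"
    using locally_global[of "cn (fst x)" \<bottom> "fst x" "snd x"] x by (auto simp: diff_bottom)
  then show thesis using x by (intro that[of s']) (auto simp: cut_def diff_bottom N.res_id prod_eq_iff)
qed

end

text \<open>Every domain carries a section, so f is visible in the first components. The pairs with
  domain \<top> show \<alpha> on global sections; over a general \<nu> the two transformations agree
  on each difference below \<nu>, where the section comes from a global one, and locality
  finishes.\<close>

lemma hdual_arr_faithful:
  assumes "dsheaf L F" "dsheaf L' F'" and m: "m \<in> sh_loc_hom (L, F) (L', F')" and n: "n \<in> sh_loc_hom (L, F) (L', F')"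
    and eq: "hdual_arr (L', F') (L, F) m = hdual_arr (L', F') (L, F) n"
  shows "m = n"
proof -
  obtain f \<alpha> f' \<alpha>' where mn: "m = (f, \<alpha>)" "n = (f', \<alpha>')" by fastforce
  interpret m: dsheaf_hom L' L f F' F \<alpha> using m sh_loc_hom_iff[OF assms(1,2)] by (simp add: mn)
  interpret n: dsheaf_hom L' L f' F' F \<alpha>' using n sh_loc_hom_iff[OF assms(1,2)] by (simp add: mn)
  have pair: "m.pair_arr x = n.pair_arr x" if x: "x \<in> carrier m.X'.D" for x
  proof -
    have "m.X.basic_pair (m.pair_arr x) = m.X.basic_pair (n.pair_arr x)"
      using m.hdual_basic[OF x] n.hdual_basic[OF x] eq by (simp add: mn)
    then show ?thesis
      using m.X.unbasic(2)[OF m.pair_arr_closed[OF x]] m.X.unbasic(2)[OF n.pair_arr_closed[OF x]] by metis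
  qed
  have f: "f = f'"
  proof (rule PiE_ext[OF frame_homD(1)[OF m.f] frame_homD(1)[OF n.f]])
    fix b assume b: "b \<in> carrier L'"
    then obtain s where "s \<in> sections F' (m.X'.cn b)" using m.X'.section_exists[of "m.X'.cn b"] by auto
    then have "(b, s) \<in> carrier m.X'.D" using b by (simp add: pair_ob_def)
    then show "f b = f' b" using pair[of "(b, s)"] m.fst_pair_arr[of "(b, s)"] n.fst_pair_arr[of "(b, s)"] by simp
  qed
  have top: "\<alpha> \<top>\<^bsub>nuclei L'\<^esub> s = \<alpha>' \<top>\<^bsub>nuclei L'\<^esub> s" if "s \<in> sections F' \<top>\<^bsub>nuclei L'\<^esub>" for s
  proof -
    have "(\<top>\<^bsub>L'\<^esub>, s) \<in> carrier m.X'.D" using that by (simp add: pair_ob_def)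
    then show ?thesis using pair[of "(\<top>\<^bsub>L'\<^esub>, s)"] m.snd_pair_arr[of "(\<top>\<^bsub>L'\<^esub>, s)"] n.snd_pair_arr[of "(\<top>\<^bsub>L'\<^esub>, s)"] by simp
  qed
  have "\<alpha> = \<alpha>'"
  proof (rule sheaf_hom_eqI[OF m.\<alpha> n.\<alpha>])
    fix \<nu> s assume \<nu>: "\<nu> \<in> nucs L'" and s: "s \<in> sections F' \<nu>"
    let ?I = "{(a, b). a \<in> carrier L' \<and> b \<in> carrier L' \<and> b \<sqsubseteq>\<^bsub>L'\<^esub> \<nu> a}" and ?d = "\<lambda>(a, b). diff_nucleus L' b a"
    have I: "?d i \<in> nucs L'" if "i \<in> ?I" for i using that by auto
    have cover: "\<Squnion>\<^bsub>nuclei L'\<^esub>(?d ` ?I) = \<nu>"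
      using m.L'.nucleus_Sup_diff[OF \<nu>] by (simp add: image_def) (simp add: conj_commute conj_left_commute Bex_def)
    show "\<alpha> \<nu> s = \<alpha>' \<nu> s"
    proof (rule m.X.N.locality[where I = ?I and U = "\<lambda>i. m.g (?d i)"])
      show "m.g \<nu> = \<Squnion>\<^bsub>nuclei L\<^esub>((\<lambda>i. m.g (?d i)) ` ?I)"
      proof -
        have "?d ` ?I \<subseteq> nucs L'" using I by blast
        from frame_homD(4)[OF m.dissolution_map_hom this] show ?thesis unfolding cover image_image .
      qed
      fix i assume i: "i \<in> ?I"
      then obtain a b where ab: "i = (a, b)" "a \<in> carrier L'" "b \<in> carrier L'" "b \<sqsubseteq>\<^bsub>L'\<^esub> \<nu> a" by auto
      let ?p = "diff_nucleus L' b a"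
      have p: "?p \<in> nucs L'" "?p \<preceq>\<^bsub>L'\<^esub> \<nu>" using ab \<nu> by (auto simp: m.L'.diff_nucleus_le_iff)
      obtain s' where s': "s' \<in> sections F' \<top>\<^bsub>nuclei L'\<^esub>" "res F' \<nu> ?p s = res F' \<top>\<^bsub>nuclei L'\<^esub> ?p s'"
        using m.X'.locally_global[OF \<nu> ab(2,3) p(2) s] by blast
      have "res F (m.g \<nu>) (m.g ?p) (\<alpha> \<nu> s) = \<alpha> ?p (res F' \<top>\<^bsub>nuclei L'\<^esub> ?p s')"
        using m.\<alpha>_res[OF \<nu> p s] s' by simp
      also have "\<dots> = res F (m.g \<top>\<^bsub>nuclei L'\<^esub>) (m.g ?p) (\<alpha> \<top>\<^bsub>nuclei L'\<^esub> s')" using p s' by (intro m.\<alpha>_res) auto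
      also have "\<dots> = res F (n.g \<top>\<^bsub>nuclei L'\<^esub>) (n.g ?p) (\<alpha>' \<top>\<^bsub>nuclei L'\<^esub> s')" using top[OF s'(1)] f by simp
      also have "\<dots> = \<alpha>' ?p (res F' \<top>\<^bsub>nuclei L'\<^esub> ?p s')" using p s' by (intro n.\<alpha>_res[symmetric]) auto
      also have "\<dots> = res F (n.g \<nu>) (n.g ?p) (\<alpha>' \<nu> s)" using n.\<alpha>_res[OF \<nu> p s] s' by simp
      finally show "res F (m.g \<nu>) (m.g (?d i)) (\<alpha> \<nu> s) = res F (m.g \<nu>) (m.g (?d i)) (\<alpha>' \<nu> s)"
        using f ab by simp
    qed (use I \<nu> s m.\<alpha>_closed n.\<alpha>_closed[folded f] in auto)
  qed
  then show ?thesis using f mn by simp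
qed

text \<open>In terms of pairs the given morphism is a map \<psi>. It yields f on domains and a map
  \<theta> on global sections. The point is that agreement of global sections over a nucleus n, not
  just over a closed one, is inherited by their images under \<theta>; then \<theta> extends to all
  sections by gluing.\<close>

lemma hdual_arr_full:
  assumes "dsheaf L F" "dsheaf L' F'" and \<phi>: "\<phi> \<in> ncframe_hom (dual_ob (L', F')) (dual_ob (L, F))"
  obtains m where "m \<in> sh_loc_hom (L, F) (L', F')" "hdual_arr (L', F') (L, F) m = \<phi>"
proof -
  interpret X: dsheaf L F by fact
  interpret X': dsheaf L' F' by fact
  let ?T' = "\<top>\<^bsub>nuclei L'\<^esub>" and ?T = "\<top>\<^bsub>nuclei L\<^esub>"
  define \<psi> where "\<psi> = compose (carrier X'.D) X.unbasic (compose (carrier X'.D) \<phi> X'.basic_pair)"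
  have \<psi>: "\<psi> \<in> ncframe_hom X'.D X.D"
    unfolding \<psi>_def
    by (intro ncframe_hom_compose[OF _ X.unbasic(1)] ncframe_hom_compose[OF X'.basic_pair_hom \<phi>] X'.pair_noncommutative_frame)
  note \<psi>D = ncframe_homD[OF \<psi>]
  obtain t where t: "t \<in> sections F' ?T'" using X'.global by auto
  define f where "f = (\<lambda>b\<in>carrier L'. fst (\<psi> (X'.cut b t)))"
  \<comment> \<open>Pairs with the same domain satisfy the two meet equations of \<D>-related
    elements, and \<psi> preserves these. Hence f does not depend on the global section t used in
    its definition.\<close>
  have fst_eq: "fst (\<psi> x) = fst (\<psi> y)" if x: "x \<in> carrier X'.D" and y: "y \<in> carrier X'.D" and "fst x = fst y" for x y
  proof -
    have 1: "x \<curlywedge>\<^bsub>X'.D\<^esub> y = x" "y \<curlywedge>\<^bsub>X'.D\<^esub> x = y"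
      using that X'.rst_self[OF x] X'.rst_self[OF y] by (simp_all add: X'.smeet_pair prod_eq_iff)
    have "fst (\<psi> x) = fst (\<psi> x) \<sqinter>\<^bsub>L\<^esub> fst (\<psi> y)" using arg_cong[OF 1(1), of "\<lambda>z. fst (\<psi> z)"] x y by (simp add: \<psi>D)
    moreover have "fst (\<psi> y) = fst (\<psi> y) \<sqinter>\<^bsub>L\<^esub> fst (\<psi> x)" using arg_cong[OF 1(2), of "\<lambda>z. fst (\<psi> z)"] x y by (simp add: \<psi>D)
    ultimately show ?thesis by (simp add: meet_comm[of L "fst (\<psi> y)"])
  qed
  have fst_\<psi>: "fst (\<psi> x) = f (fst x)" if x: "x \<in> carrier X'.D" for x
    using fst_eq[OF x, of "X'.cut (fst x) t"] x t by (simp add: f_def)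
  have f_top: "f \<top>\<^bsub>L'\<^esub> = \<top>\<^bsub>L\<^esub>"
  proof -
    have "in_max_D_class X'.D (X'.cut \<top>\<^bsub>L'\<^esub> t)" using t by (simp add: X'.in_max_D_class_pair)
    then have "in_max_D_class X.D (\<psi> (X'.cut \<top>\<^bsub>L'\<^esub> t))" by (rule \<psi>D(7))
    then show ?thesis by (simp add: X.in_max_D_class_pair f_def)
  qed
  have f: "f \<in> frame_hom L' L"
    unfolding frame_hom_def
  proof (rule CollectI, intro conjI ballI allI impI)
    show "f \<in> carrier L' \<rightarrow>\<^sub>E carrier L" using t \<psi>D(2) by (auto simp: f_def)
    show "f \<top>\<^bsub>L'\<^esub> = \<top>\<^bsub>L\<^esub>" by (rule f_top)
    fix a b assume ab: "a \<in> carrier L'" "b \<in> carrier L'"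
    have "fst (\<psi> (X'.cut a t \<curlywedge>\<^bsub>X'.D\<^esub> X'.cut b t)) = fst (\<psi> (X'.cut a t)) \<sqinter>\<^bsub>L\<^esub> fst (\<psi> (X'.cut b t))"
      using ab t by (simp add: \<psi>D)
    then show "f (a \<sqinter>\<^bsub>L'\<^esub> b) = f a \<sqinter>\<^bsub>L\<^esub> f b" using ab t by (simp add: X'.smeet_cut f_def)
  next
    fix S assume S: "S \<subseteq> carrier L'"
    show "f (\<Squnion>\<^bsub>L'\<^esub>S) = \<Squnion>\<^bsub>L\<^esub>(f ` S)"
    \<comment> \<open>Commuting subsets are nonempty, so the empty supremum is taken care of by
      preservation of zero.\<close>
    proof (cases "S = {}")
      case True
      have "f \<bottom>\<^bsub>L'\<^esub> = fst (\<psi> (zer X'.D))" using fst_\<psi>[OF X'.zer_pair(1)] X'.zer_pair(2) by simp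
      then show ?thesis using True X.zer_pair by (simp add: \<psi>D)
    next
      case False
      let ?C = "(\<lambda>b. X'.cut b t) ` S"
      note C = X'.commuting_cuts[OF S False t]
      obtain z where z: "z \<in> carrier X.D" "fst z = \<Squnion>\<^bsub>L\<^esub>(fst ` \<psi> ` ?C)"
          "\<And>x. x \<in> \<psi> ` ?C \<Longrightarrow> X.rst (X.cn (fst x)) z = snd x"
        using X.commuting_glueing[OF commuting_subset_image[OF \<psi> C(1)]] by blast
      have sub: "\<psi> ` ?C \<subseteq> carrier X.D" using commuting_subset_image[OF \<psi> C(1)] by (simp add: commuting_subset_def)
      have "\<psi> (X'.cut (\<Squnion>\<^bsub>L'\<^esub>S) t) = \<psi> (\<Squnion>\<^bsub>natural_order X'.D\<^esub> ?C)"
        using X'.D.natural_sup_eq[OF C(2)] by simp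
      also have "\<dots> = \<Squnion>\<^bsub>natural_order X.D\<^esub> (\<psi> ` ?C)" by (rule \<psi>D(6)[OF C(1)])
      also have "\<dots> = z" by (rule X.D.natural_sup_eq[OF X.glueing_least[OF sub z]])
      finally have "f (\<Squnion>\<^bsub>L'\<^esub>S) = fst z" using S by (simp add: f_def)
      also have "fst ` \<psi> ` ?C = f ` S" using S by (auto simp: f_def image_image subsetD intro!: image_cong)
      ultimately show ?thesis using z(2) by simp
    qed
  qed
  interpret f: dissolution_hom L' L f
    using f X.dissolution_axioms X'.dissolution_axioms by (simp add: dissolution_hom_def dissolution_hom_axioms_def)
  define \<theta> where "\<theta> s = snd (\<psi> (X'.cut \<top>\<^bsub>L'\<^esub> s))" for s
  have \<theta>_eq: "\<psi> (X'.cut \<top>\<^bsub>L'\<^esub> s) = (\<top>\<^bsub>L\<^esub>, \<theta> s)" if s: "s \<in> sections F' ?T'" for s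
    using fst_\<psi>[of "X'.cut \<top>\<^bsub>L'\<^esub> s"] s f_top by (simp add: \<theta>_def prod_eq_iff)
  have \<theta>: "\<theta> s \<in> sections F ?T" if s: "s \<in> sections F' ?T'" for s
    using X.snd_closed[OF \<psi>D(2)[of "X'.cut \<top>\<^bsub>L'\<^esub> s"]] s by (simp add: \<theta>_eq)
  \<comment> \<open>A meet takes its section from the left factor. Writing the restriction of s to b
    as a meet with the global pair of s on the left shows that \<psi> on it is determined by
    \<theta> s and f b.\<close>
  have \<psi>_cut: "\<psi> (X'.cut b s) = X.cut (f b) (\<theta> s)" if b: "b \<in> carrier L'" and s: "s \<in> sections F' ?T'" for b s
  proof -
    have "X'.cut b s = X'.cut \<top>\<^bsub>L'\<^esub> s \<curlywedge>\<^bsub>X'.D\<^esub> X'.cut b s" using b s by (simp add: X'.smeet_cut)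
    then have "\<psi> (X'.cut b s) = (\<top>\<^bsub>L\<^esub>, \<theta> s) \<curlywedge>\<^bsub>X.D\<^esub> \<psi> (X'.cut b s)"
      using \<psi>D(3)[of "X'.cut \<top>\<^bsub>L'\<^esub> s" "X'.cut b s"] b s by (simp add: \<theta>_eq)
    also have "\<dots> = X.cut (f b) (\<theta> s)"
      using fst_\<psi>[of "X'.cut b s"] b s by (simp add: X.smeet_pair X.rst_def X.cut_def)
    finally show ?thesis .
  qed
  \<comment> \<open>The join with a pair over a on the right overwrites both sections on a. If s1
    and s2 agree on the difference of b and a, the two joins are therefore equal, and so are their
    images; outside f a these still show \<theta> s1 and \<theta> s2.\<close>
  have diff: "res F ?T (diff_nucleus L (f b) (f a)) (\<theta> s1) = res F ?T (diff_nucleus L (f b) (f a)) (\<theta> s2)"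
    if ab: "a \<in> carrier L'" "b \<in> carrier L'" and s: "s1 \<in> sections F' ?T'" "s2 \<in> sections F' ?T'"
      and eq: "res F' ?T' (diff_nucleus L' b a) s1 = res F' ?T' (diff_nucleus L' b a) s2" for a b s1 s2
  proof -
    let ?x = "X'.cut b s1" and ?y = "X'.cut b s2" and ?z = "X'.cut a t" and ?d = "diff_nucleus L' b a"
    have "?x \<curlyvee>\<^bsub>X'.D\<^esub> ?z = ?y \<curlyvee>\<^bsub>X'.D\<^esub> ?z"
    proof (rule X'.pair_eqI[of _ _ b a "\<bottom>\<^bsub>L'\<^esub>"])
      fix p assume p: "p \<in> nucs L'" "p \<noteq> \<bottom>\<^bsub>nuclei L'\<^esub>" "p \<preceq>\<^bsub>L'\<^esub> X'.cn (fst (?x \<curlyvee>\<^bsub>X'.D\<^esub> ?z))"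
        "X'.decided p b" "X'.decided p a"
      have pj: "p \<preceq>\<^bsub>L'\<^esub> X'.cn b \<or> p \<preceq>\<^bsub>L'\<^esub> X'.cn a"
        using p(3) X'.decided_join(2)[OF p(1,2,4,5)] ab s t by (simp add: X'.sjoin_pair)
      have "res F' ?T' p s1 = res F' ?T' p s2" if "\<not> p \<preceq>\<^bsub>L'\<^esub> X'.cn a"
      proof -
        have "p \<preceq>\<^bsub>L'\<^esub> ?d"
          using that pj p ab X'.decided_open_iff[OF p(1,2,5)] by (simp add: diff_nucleus_def X'.N.le_meet_iff)
        then show ?thesis
          using X'.N.res_res[of ?T' ?d p s1] X'.N.res_res[of ?T' ?d p s2] eq p ab s by simp
      qed
      then show "X'.rst p (?x \<curlyvee>\<^bsub>X'.D\<^esub> ?z) = X'.rst p (?y \<curlyvee>\<^bsub>X'.D\<^esub> ?z)"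
        using p pj ab s t by (auto simp: X'.rst_sjoin X'.rst_cut)
    qed (use ab s t in \<open>auto simp: X'.sjoin_pair\<close>)
    then have "\<psi> ?x \<curlyvee>\<^bsub>X.D\<^esub> \<psi> ?z = \<psi> ?y \<curlyvee>\<^bsub>X.D\<^esub> \<psi> ?z" using ab s t by (simp flip: \<psi>D(4))
    then have *: "X.rst (diff_nucleus L (f b) (f a)) (X.cut (f b) (\<theta> s1)) = X.rst (diff_nucleus L (f b) (f a)) (X.cut (f b) (\<theta> s2))"
      using X.sjoin_pair(3)[of "X.cut (f b) (\<theta> s1)" "X.cut (f a) (\<theta> t)"]
        X.sjoin_pair(3)[of "X.cut (f b) (\<theta> s2)" "X.cut (f a) (\<theta> t)"] ab s t \<theta>
      by (simp add: \<psi>_cut)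
    have "diff_nucleus L (f b) (f a) \<preceq>\<^bsub>L\<^esub> X.cn (f b)" using ab by (simp add: diff_nucleus_def X.N.meet_left)
    then show ?thesis using * ab s \<theta> by (simp add: X.rst_cut)
  qed
  \<comment> \<open>The nucleus n is the supremum of differences and g preserves it. The previous
    step puts the image of each of these differences below the agreement of \<theta> s1 and \<theta>
    s2, hence also g n.\<close>
  have agree: "res F ?T (f.g n) (\<theta> s1) = res F ?T (f.g n) (\<theta> s2)"
    if n: "n \<in> nucs L'" and s: "s1 \<in> sections F' ?T'" "s2 \<in> sections F' ?T'"
      and eq: "res F' ?T' n s1 = res F' ?T' n s2" for n s1 s2
  proof -
    let ?D = "{diff_nucleus L' b a |a b. a \<in> carrier L' \<and> b \<in> carrier L' \<and> b \<sqsubseteq>\<^bsub>L'\<^esub> n a}"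
    have D: "?D \<subseteq> nucs L'" by auto
    have gD: "f.g ` ?D \<subseteq> nucs L" by auto
    have ac: "X.N.agreement ?T (\<theta> s1) (\<theta> s2) \<in> nucs L" by (rule X.N.agreement_closed)
    have gn: "f.g n = \<Squnion>\<^bsub>nuclei L\<^esub>(f.g ` ?D)"
      using frame_homD(4)[OF f.dissolution_map_hom D] by (simp only: X'.nucleus_Sup_diff[OF n])
    have "\<Squnion>\<^bsub>nuclei L\<^esub>(f.g ` ?D) \<preceq>\<^bsub>L\<^esub> X.N.agreement ?T (\<theta> s1) (\<theta> s2)"
    proof (rule X.N.sup_least[OF gD ac])
      fix q assume "q \<in> f.g ` ?D"
      then obtain a b where ab: "a \<in> carrier L'" "b \<in> carrier L'" "b \<sqsubseteq>\<^bsub>L'\<^esub> n a" "q = diff_nucleus L (f b) (f a)" by auto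
      let ?d = "diff_nucleus L' b a"
      have d: "?d \<in> nucs L'" "?d \<preceq>\<^bsub>L'\<^esub> n" using ab n by (auto simp: X'.diff_nucleus_le_iff)
      have "res F' ?T' ?d s1 = res F' ?T' ?d s2"
        using X'.N.res_res[of ?T' n ?d s1] X'.N.res_res[of ?T' n ?d s2] d n s eq by simp
      then show "q \<preceq>\<^bsub>L\<^esub> X.N.agreement ?T (\<theta> s1) (\<theta> s2)"
        using diff[OF ab(1,2) s] ab s \<theta> by (subst X.N.le_agreement_iff) auto
    qed
    then have "f.g n \<preceq>\<^bsub>L\<^esub> X.N.agreement ?T (\<theta> s1) (\<theta> s2)" by (simp only: gn)
    then show ?thesis using n s \<theta> X.N.le_agreement_iff[of ?T "f.g n" "\<theta> s1" "\<theta> s2"] by simp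
  qed
  \<comment> \<open>every section is locally the restriction of a global one, so \<open>\<theta>\<close> on global sections determines \<open>\<alpha>\<close>\<close>
  define P where "P \<nu> s w \<longleftrightarrow> w \<in> sections F (f.g \<nu>) \<and> (\<forall>n\<in>nucs L'. \<forall>s'\<in>sections F' ?T'.
    n \<preceq>\<^bsub>L'\<^esub> \<nu> \<longrightarrow> res F' \<nu> n s = res F' ?T' n s' \<longrightarrow> res F (f.g \<nu>) (f.g n) w = res F ?T (f.g n) (\<theta> s'))" for \<nu> s w
  have P_unique: "\<exists>!w. P \<nu> s w" if \<nu>: "\<nu> \<in> nucs L'" and s: "s \<in> sections F' \<nu>" for \<nu> s
  proof -
    \<comment> \<open>All ways in which s comes from a global section on some part n of \<nu>. By
      \<open>locally_global\<close> the parts cover \<nu>, and \<open>agree\<close> makes the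
      prescribed values compatible.\<close>
    let ?I = "{(n, s'). n \<in> nucs L' \<and> s' \<in> sections F' ?T' \<and> n \<preceq>\<^bsub>L'\<^esub> \<nu> \<and> res F' \<nu> n s = res F' ?T' n s'}"
    have I: "fst i \<in> nucs L'" "snd i \<in> sections F' ?T'" "fst i \<preceq>\<^bsub>L'\<^esub> \<nu>"
      "res F' \<nu> (fst i) s = res F' ?T' (fst i) (snd i)" if "i \<in> ?I" for i using that by auto
    have fI: "fst ` ?I \<subseteq> nucs L'" by auto
    have "\<Squnion>\<^bsub>nuclei L'\<^esub>(fst ` ?I) = \<nu>"
    proof (rule X'.N.le_antisym)
      show "\<Squnion>\<^bsub>nuclei L'\<^esub>(fst ` ?I) \<preceq>\<^bsub>L'\<^esub> \<nu>" using fI \<nu> by (intro X'.N.sup_least) auto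
      let ?D = "{diff_nucleus L' b a |a b. a \<in> carrier L' \<and> b \<in> carrier L' \<and> b \<sqsubseteq>\<^bsub>L'\<^esub> \<nu> a}"
      have D: "?D \<subseteq> nucs L'" by auto
      have "\<Squnion>\<^bsub>nuclei L'\<^esub>?D \<preceq>\<^bsub>L'\<^esub> \<Squnion>\<^bsub>nuclei L'\<^esub>(fst ` ?I)"
      proof (rule X'.N.sup_least[OF D])
        fix d assume "d \<in> ?D"
        then obtain a b where ab: "a \<in> carrier L'" "b \<in> carrier L'" "b \<sqsubseteq>\<^bsub>L'\<^esub> \<nu> a" "d = diff_nucleus L' b a" by blast
        have d: "diff_nucleus L' b a \<preceq>\<^bsub>L'\<^esub> \<nu>" using ab \<nu> by (simp add: X'.diff_nucleus_le_iff)
        obtain s' where "s' \<in> sections F' ?T'" "res F' \<nu> (diff_nucleus L' b a) s = res F' ?T' (diff_nucleus L' b a) s'"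
          using X'.locally_global[OF \<nu> ab(1,2) d s] by blast
        then have "(d, s') \<in> ?I" using ab d by auto
        then have "d \<in> fst ` ?I" using imageI[of "(d, s')" ?I fst] by simp
        then show "d \<preceq>\<^bsub>L'\<^esub> \<Squnion>\<^bsub>nuclei L'\<^esub>(fst ` ?I)" by (rule X'.N.sup_upper[OF fI])
      qed (rule X'.N.sup_closed[OF fI])
      then show "\<nu> \<preceq>\<^bsub>L'\<^esub> \<Squnion>\<^bsub>nuclei L'\<^esub>(fst ` ?I)" by (simp only: X'.nucleus_Sup_diff[OF \<nu>])
    qed (use fI \<nu> in auto)
    then have cover: "\<Squnion>\<^bsub>nuclei L\<^esub>((\<lambda>i. f.g (fst i)) ` ?I) = f.g \<nu>"
      using frame_homD(4)[OF f.dissolution_map_hom fI] by (simp add: image_image)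
    have "\<exists>!w. w \<in> sections F (\<Squnion>\<^bsub>nuclei L\<^esub>((\<lambda>i. f.g (fst i)) ` ?I)) \<and>
      (\<forall>i\<in>?I. res F (\<Squnion>\<^bsub>nuclei L\<^esub>((\<lambda>i. f.g (fst i)) ` ?I)) (f.g (fst i)) w = res F ?T (f.g (fst i)) (\<theta> (snd i)))"
    proof (rule X.N.glue)
      fix i assume i: "i \<in> ?I"
      show "f.g (fst i) \<in> nucs L" using I[OF i] by simp
      show "res F ?T (f.g (fst i)) (\<theta> (snd i)) \<in> sections F (f.g (fst i))"
        using I[OF i] \<theta> by (intro X.N.res_closed) auto
      fix j assume j: "j \<in> ?I"
      let ?n = "fst i \<sqinter>\<^bsub>nuclei L'\<^esub> fst j"
      have n: "?n \<in> nucs L'" "?n \<preceq>\<^bsub>L'\<^esub> fst i" "?n \<preceq>\<^bsub>L'\<^esub> fst j"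
        using I[OF i] I[OF j] by (auto simp: X'.N.meet_left X'.N.meet_right)
      have gn: "f.g (fst i) \<sqinter>\<^bsub>nuclei L\<^esub> f.g (fst j) = f.g ?n"
        using I[OF i] I[OF j] by (simp add: frame_homD(3)[OF f.dissolution_map_hom])
      have "res F' ?T' ?n (snd i) = res F' \<nu> ?n s"
        using X'.N.res_res[of ?T' "fst i" ?n "snd i"] X'.N.res_res[of \<nu> "fst i" ?n s] I[OF i] n \<nu> s by simp
      also have "\<dots> = res F' ?T' ?n (snd j)"
        using X'.N.res_res[of ?T' "fst j" ?n "snd j"] X'.N.res_res[of \<nu> "fst j" ?n s] I[OF j] n \<nu> s by simp
      finally have "res F ?T (f.g ?n) (\<theta> (snd i)) = res F ?T (f.g ?n) (\<theta> (snd j))"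
        using agree[OF n(1)] I[OF i] I[OF j] by blast
      then show "res F (f.g (fst i)) (f.g (fst i) \<sqinter>\<^bsub>nuclei L\<^esub> f.g (fst j)) (res F ?T (f.g (fst i)) (\<theta> (snd i))) =
          res F (f.g (fst j)) (f.g (fst i) \<sqinter>\<^bsub>nuclei L\<^esub> f.g (fst j)) (res F ?T (f.g (fst j)) (\<theta> (snd j)))"
        unfolding gn using I[OF i] I[OF j] n \<theta> by (simp add: X.N.res_res f.dissolution_map_mono)
    qed
    moreover have "P \<nu> s w \<longleftrightarrow> w \<in> sections F (f.g \<nu>) \<and>
      (\<forall>i\<in>?I. res F (f.g \<nu>) (f.g (fst i)) w = res F ?T (f.g (fst i)) (\<theta> (snd i)))" for w
      by (auto simp: P_def)
    ultimately show ?thesis unfolding cover by simp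
  qed
  define \<alpha> where "\<alpha> = (\<lambda>\<nu>\<in>nucs L'. \<lambda>s\<in>sections F' \<nu>. THE w. P \<nu> s w)"
  have \<alpha>P: "P \<nu> s (\<alpha> \<nu> s)" if "\<nu> \<in> nucs L'" "s \<in> sections F' \<nu>" for \<nu> s
    using theI'[OF P_unique[OF that]] that by (simp add: \<alpha>_def)
  have \<alpha>_eq: "\<alpha> \<nu> s = w" if "\<nu> \<in> nucs L'" "s \<in> sections F' \<nu>" "P \<nu> s w" for \<nu> s w
    using P_unique[OF that(1,2)] \<alpha>P[OF that(1,2)] that(3) by blast
  have \<alpha>: "\<alpha> \<in> sheaf_hom (nuclei L') F' (pushforward f.g F)"
  proof (rule sheaf_homI)
    fix \<nu> s assume \<nu>: "\<nu> \<in> nucs L'" and s: "s \<in> sections F' \<nu>"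
    note Ps = \<alpha>P[OF \<nu> s]
    then show "\<alpha> \<nu> s \<in> sections (pushforward f.g F) \<nu>" by (simp add: P_def pushforward_def)
    fix \<mu> assume \<mu>: "\<mu> \<in> nucs L'" "\<mu> \<preceq>\<^bsub>L'\<^esub> \<nu>"
    have "P \<mu> (res F' \<nu> \<mu> s) (res F (f.g \<nu>) (f.g \<mu>) (\<alpha> \<nu> s))"
      unfolding P_def
    proof (intro conjI ballI impI)
      show "res F (f.g \<nu>) (f.g \<mu>) (\<alpha> \<nu> s) \<in> sections F (f.g \<mu>)"
        using Ps \<nu> \<mu> by (intro X.N.res_closed) (auto simp: P_def f.dissolution_map_mono)
      fix n s' assume n: "n \<in> nucs L'" "s' \<in> sections F' ?T'" "n \<preceq>\<^bsub>L'\<^esub> \<mu>"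
        "res F' \<mu> n (res F' \<nu> \<mu> s) = res F' ?T' n s'"
      have n\<nu>: "n \<preceq>\<^bsub>L'\<^esub> \<nu>" using X'.N.le_trans[OF n(3) \<mu>(2)] n \<mu> \<nu> by simp
      have "res F' \<nu> n s = res F' ?T' n s'" using n \<nu> \<mu> s by (simp add: X'.N.res_res)
      then have "res F (f.g \<nu>) (f.g n) (\<alpha> \<nu> s) = res F ?T (f.g n) (\<theta> s')" using Ps n n\<nu> by (simp add: P_def)
      then show "res F (f.g \<mu>) (f.g n) (res F (f.g \<nu>) (f.g \<mu>) (\<alpha> \<nu> s)) = res F ?T (f.g n) (\<theta> s')"
        using Ps n \<nu> \<mu> by (simp add: X.N.res_res P_def f.dissolution_map_mono)
    qed
    then show "\<alpha> \<mu> (res F' \<nu> \<mu> s) = res (pushforward f.g F) \<nu> \<mu> (\<alpha> \<nu> s)"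
      using \<alpha>_eq[OF \<mu>(1) X'.N.res_closed[OF \<nu> \<mu> s]] by (simp add: pushforward_def)
  qed (auto simp: \<alpha>_def)
  interpret m: dsheaf_hom L' L f F' F \<alpha>
    using \<alpha> f.dissolution_hom_axioms assms by (simp add: dsheaf_hom_def dsheaf_hom_axioms_def)
  have hom: "(f, \<alpha>) \<in> sh_loc_hom (L, F) (L', F')"
    using sh_loc_hom_iff[OF assms(1,2)] m.dsheaf_hom_axioms by simp
  have pair: "m.pair_arr x = \<psi> x" if x: "x \<in> carrier X'.D" for x
  proof -
    obtain s where s: "s \<in> sections F' ?T'" "x = X'.cut (fst x) s" using X'.pair_is_cut[OF x] by blast
    let ?b = "fst x"
    have b: "?b \<in> carrier L'" using x by simp
    have "snd x = res F' ?T' (X'.cn ?b) s" using arg_cong[OF s(2), of snd] by (simp add: X'.cut_def)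
    moreover have "res F' (X'.cn ?b) (X'.cn ?b) (snd x) = snd x"
      using x by (intro X'.N.res_id) simp_all
    ultimately have "res F' (X'.cn ?b) (X'.cn ?b) (snd x) = res F' ?T' (X'.cn ?b) s" by (rule trans[rotated])
    moreover have "X'.cn ?b \<in> nucs L'" "snd x \<in> sections F' (X'.cn ?b)" using x by simp_all
    ultimately have "res F (f.g (X'.cn ?b)) (f.g (X'.cn ?b)) (\<alpha> (X'.cn ?b) (snd x)) = res F ?T (f.g (X'.cn ?b)) (\<theta> s)"
      using \<alpha>P[of "X'.cn ?b" "snd x"] s(1) X'.N.le_refl unfolding P_def by blast
    moreover have "\<alpha> (X'.cn ?b) (snd x) \<in> sections F (X.cn (f ?b))" using m.\<alpha>_closed[of "X'.cn ?b" "snd x"] x by simp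
    ultimately have "\<alpha> (X'.cn ?b) (snd x) = res F ?T (X.cn (f ?b)) (\<theta> s)" using b by (simp add: X.N.res_id)
    then have "m.pair_arr x = X.cut (f ?b) (\<theta> s)" using x by (simp add: m.pair_arr_def X.cut_def)
    also have "\<dots> = \<psi> x" using \<psi>_cut[OF b s(1)] s(2) by simp
    finally show ?thesis .
  qed
  have "hdual_arr (L', F') (L, F) (f, \<alpha>) = \<phi>"
  proof (rule ncframe_hom_ext[OF m.hdual_arr_hom \<phi>])
    fix y assume y: "y \<in> carrier (dual_ob (L', F'))"
    have u: "X'.unbasic y \<in> carrier X'.D" using ncframe_homD(2)[OF X'.unbasic(1) y] .
    have "hdual_arr (L', F') (L, F) (f, \<alpha>) y = X.basic_pair (\<psi> (X'.unbasic y))"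
      using m.hdual_basic[OF u] pair[OF u] X'.unbasic(3)[OF y] by simp
    also have "\<dots> = \<phi> y"
      using u X.unbasic(3)[OF ncframe_homD(2)[OF \<phi> y]] X'.unbasic(3)[OF y] by (simp add: \<psi>_def compose_eq)
    finally show "hdual_arr (L', F') (L, F) (f, \<alpha>) y = \<phi> y" .
  qed
  then show thesis using that hom by blast
qed

section \<open>Sheaves of singletons\<close>

text \<open>A Heyting-valued set, E x y being the truth value of x = y, in which every element has
  full extent.\<close>

locale valued_set = frame_lattice P for P :: "'p gorder" (structure) +
  fixes T :: "'x set" and E :: "'x \<Rightarrow> 'x \<Rightarrow> 'p"
  assumes E_closed: "\<lbrakk>x \<in> T; y \<in> T\<rbrakk> \<Longrightarrow> E x y \<in> carrier P"
    and E_refl: "x \<in> T \<Longrightarrow> E x x = \<top>"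
    and E_sym: "\<lbrakk>x \<in> T; y \<in> T\<rbrakk> \<Longrightarrow> E x y = E y x"
    and E_trans: "\<lbrakk>x \<in> T; y \<in> T; z \<in> T\<rbrakk> \<Longrightarrow> E x y \<sqinter> E y z \<sqsubseteq> E x z"
begin

text \<open>\<sigma> x is the truth value of x being the element singled out. The first condition
  says that at most one element is, the second that this respects equality. The supremum of the
  values is the extent on which there is such an element, and over \<nu> it is required to be
  \<nu>.\<close>

definition singletons :: "('p, 'x \<Rightarrow> 'p) presheaf" where
  "singletons = \<lparr>sections = (\<lambda>\<nu>. {\<sigma> \<in> T \<rightarrow>\<^sub>E carrier P. (\<forall>x\<in>T. \<forall>y\<in>T. \<sigma> x \<sqinter> \<sigma> y \<sqsubseteq> E x y) \<and>
       (\<forall>x\<in>T. \<forall>y\<in>T. \<sigma> x \<sqinter> E x y \<sqsubseteq> \<sigma> y) \<and> \<Squnion>(\<sigma> ` T) = \<nu>}),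
     res = (\<lambda>\<nu> \<mu> \<sigma>. \<lambda>x\<in>T. \<sigma> x \<sqinter> \<mu>)\<rparr>"

lemma singletonsD:
  assumes "\<sigma> \<in> sections singletons \<nu>"
  shows "\<sigma> \<in> extensional T" "x \<in> T \<Longrightarrow> \<sigma> x \<in> carrier P" "\<Squnion>(\<sigma> ` T) = \<nu>"
    "\<lbrakk>x \<in> T; y \<in> T\<rbrakk> \<Longrightarrow> \<sigma> x \<sqinter> \<sigma> y \<sqsubseteq> E x y" "\<lbrakk>x \<in> T; y \<in> T\<rbrakk> \<Longrightarrow> \<sigma> x \<sqinter> E x y \<sqsubseteq> \<sigma> y"
    "\<sigma> ` T \<subseteq> carrier P" "x \<in> T \<Longrightarrow> \<sigma> x \<sqsubseteq> \<nu>"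
proof -
  show A: "\<sigma> \<in> extensional T" "x \<in> T \<Longrightarrow> \<sigma> x \<in> carrier P" "\<Squnion>(\<sigma> ` T) = \<nu>" "\<sigma> ` T \<subseteq> carrier P" for x
    using assms by (auto simp: singletons_def PiE_def)
  show "\<lbrakk>x \<in> T; y \<in> T\<rbrakk> \<Longrightarrow> \<sigma> x \<sqinter> \<sigma> y \<sqsubseteq> E x y" "\<lbrakk>x \<in> T; y \<in> T\<rbrakk> \<Longrightarrow> \<sigma> x \<sqinter> E x y \<sqsubseteq> \<sigma> y"
    using assms by (simp_all add: singletons_def)
  show "x \<in> T \<Longrightarrow> \<sigma> x \<sqsubseteq> \<nu>" using A sup_upper[of "\<sigma> ` T" "\<sigma> x"] by simp
qed

lemma singletonsI:
  assumes "\<sigma> \<in> extensional T" "\<And>x. x \<in> T \<Longrightarrow> \<sigma> x \<in> carrier P" "\<Squnion>(\<sigma> ` T) = \<nu>"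
    "\<And>x y. \<lbrakk>x \<in> T; y \<in> T\<rbrakk> \<Longrightarrow> \<sigma> x \<sqinter> \<sigma> y \<sqsubseteq> E x y" "\<And>x y. \<lbrakk>x \<in> T; y \<in> T\<rbrakk> \<Longrightarrow> \<sigma> x \<sqinter> E x y \<sqsubseteq> \<sigma> y"
  shows "\<sigma> \<in> sections singletons \<nu>"
  using assms by (simp add: singletons_def PiE_def)

lemma singletons_res: "res singletons \<nu> \<mu> \<sigma> = (\<lambda>x\<in>T. \<sigma> x \<sqinter> \<mu>)"
  by (simp add: singletons_def)

lemma singletons_res_closed:
  assumes "\<nu> \<in> carrier P" "\<mu> \<in> carrier P" "\<mu> \<sqsubseteq> \<nu>" and \<sigma>: "\<sigma> \<in> sections singletons \<nu>"
  shows "res singletons \<nu> \<mu> \<sigma> \<in> sections singletons \<mu>"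
  unfolding singletons_res
proof (rule singletonsI)
  note \<sigma>D = singletonsD[OF \<sigma>]
  have "\<Squnion>((\<lambda>x\<in>T. \<sigma> x \<sqinter> \<mu>) ` T) = \<Squnion>((\<lambda>s. \<mu> \<sqinter> s) ` (\<sigma> ` T))"
    unfolding image_image by (intro arg_cong[where f = "\<lambda>X. \<Squnion>X"] image_cong) (auto simp: meet_comm)
  also have "\<dots> = \<mu> \<sqinter> \<nu>" using Sup_distrib[OF assms(2) \<sigma>D(6)] \<sigma>D(3) by simp
  finally show "\<Squnion>((\<lambda>x\<in>T. \<sigma> x \<sqinter> \<mu>) ` T) = \<mu>" using meet_absorb1[OF assms(2,1,3)] by simp
  fix x y assume xy: "x \<in> T" "y \<in> T"
  note c = \<sigma>D(2)[OF xy(1)] \<sigma>D(2)[OF xy(2)] E_closed[OF xy]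
  have "(\<sigma> x \<sqinter> \<mu>) \<sqinter> (\<sigma> y \<sqinter> \<mu>) \<sqsubseteq> \<sigma> x \<sqinter> \<sigma> y"
    using c assms by (intro meet_mono meet_left) auto
  then show "(\<lambda>x\<in>T. \<sigma> x \<sqinter> \<mu>) x \<sqinter> (\<lambda>x\<in>T. \<sigma> x \<sqinter> \<mu>) y \<sqsubseteq> E x y"
    using \<sigma>D(4)[OF xy] xy c assms le_trans[OF _ \<sigma>D(4)[OF xy]] by simp
  have "(\<sigma> x \<sqinter> \<mu>) \<sqinter> E x y = (\<sigma> x \<sqinter> E x y) \<sqinter> \<mu>"
    using c assms by (metis meet_assoc meet_comm)
  also have "\<dots> \<sqsubseteq> \<sigma> y \<sqinter> \<mu>" using c assms \<sigma>D(5)[OF xy] by (intro meet_mono) auto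
  finally show "(\<lambda>x\<in>T. \<sigma> x \<sqinter> \<mu>) x \<sqinter> E x y \<sqsubseteq> (\<lambda>x\<in>T. \<sigma> x \<sqinter> \<mu>) y" using xy by simp
qed (use singletonsD[OF \<sigma>] assms in auto)

text \<open>Glueing is by pointwise suprema: compatibility gives s U x \<sqinter> V \<sqsubseteq> s
  V x, so the supremum over all U cuts back to s V x on V. Uniqueness is distributivity, since the
  value of a section over the supremum of C is the supremum of its meets with the members of
  C.\<close>

lemma singletons_sheaf: "sheaf P singletons"
proof -
  have glue: "\<exists>!t. t \<in> sections singletons (\<Squnion>C) \<and> (\<forall>U\<in>C. res singletons (\<Squnion>C) U t = s U)"
    if C: "C \<subseteq> carrier P" and s: "\<forall>U\<in>C. s U \<in> sections singletons U"
      and compat: "\<forall>U\<in>C. \<forall>V\<in>C. res singletons U (U \<sqinter> V) (s U) = res singletons V (U \<sqinter> V) (s V)" for C s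
  proof -
    have sD: "U \<in> C \<Longrightarrow> s U \<in> sections singletons U" for U using s by blast
    note sc = singletonsD[OF sD]
    have UC: "U \<in> C \<Longrightarrow> U \<in> carrier P" for U using C by blast
    have key: "s U x \<sqinter> V \<sqsubseteq> s V x" if "U \<in> C" "V \<in> C" "x \<in> T" for U V x
    proof -
      note c = UC[OF that(1)] UC[OF that(2)] sc(2)[OF that(1,3)] sc(2)[OF that(2,3)]
      have "s U x \<sqinter> V = (s U x \<sqinter> U) \<sqinter> V" using sc(7)[OF that(1,3)] c by (simp add: meet_absorb1)
      also have "\<dots> = s U x \<sqinter> (U \<sqinter> V)" using c by (simp add: meet_assoc)
      also have "\<dots> = s V x \<sqinter> (U \<sqinter> V)"
        using compat[rule_format, OF that(1,2), THEN fun_cong, of x] that(3) by (simp add: singletons_res)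
      also have "\<dots> \<sqsubseteq> s V x" using c by (simp add: meet_left)
      finally show ?thesis .
    qed
    define t where "t = (\<lambda>x\<in>T. \<Squnion>((\<lambda>U. s U x) ` C))"
    have sub: "x \<in> T \<Longrightarrow> (\<lambda>U. s U x) ` C \<subseteq> carrier P" for x using sc(2) by blast
    have tc: "x \<in> T \<Longrightarrow> t x \<in> carrier P" for x by (simp add: t_def sub sup_closed)
    have st: "\<lbrakk>U \<in> C; x \<in> T\<rbrakk> \<Longrightarrow> s U x \<sqsubseteq> t x" for U x
      using sup_upper[OF sub] by (simp add: t_def)
    have tm: "t x \<sqinter> U = s U x" if "U \<in> C" "x \<in> T" for U x
    proof (rule le_antisym)
      show "s U x \<sqsubseteq> t x \<sqinter> U" using st[OF that] sc(7)[OF that] UC that tc sc(2) by (intro meet_le) auto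
      have "U \<sqinter> \<Squnion>((\<lambda>U. s U x) ` C) \<sqsubseteq> s U x"
        using that sub UC sc(2) key by (intro meet_Sup_le) (auto simp: meet_comm)
      then show "t x \<sqinter> U \<sqsubseteq> s U x" using that by (simp add: t_def meet_comm)
    qed (use that tc UC sc(2) in auto)
    have tim: "t ` T \<subseteq> carrier P" using tc by blast
    have ts: "t \<in> sections singletons (\<Squnion>C)"
    proof (rule singletonsI)
      show "t \<in> extensional T" by (simp add: t_def)
      show "x \<in> T \<Longrightarrow> t x \<in> carrier P" for x by (rule tc)
      show "\<Squnion>(t ` T) = \<Squnion>C"
      proof (rule le_antisym)
        have "t x \<sqsubseteq> \<Squnion>C" if "x \<in> T" for x
        proof -
          have "s U x \<sqsubseteq> \<Squnion>C" if "U \<in> C" for U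
            using le_trans[OF sc(7)[OF that \<open>x \<in> T\<close>] sup_upper[OF C that]] sc(2)[OF that \<open>x \<in> T\<close>] UC[OF that] C
            by (simp add: sup_closed)
          then show ?thesis using that sub[OF that] C by (simp add: t_def Sup_le_iff)
        qed
        then show "\<Squnion>(t ` T) \<sqsubseteq> \<Squnion>C" using tim C by (simp add: Sup_le_iff)
        have "U \<sqsubseteq> \<Squnion>(t ` T)" if U: "U \<in> C" for U
        proof -
          have "s U x \<sqsubseteq> \<Squnion>(t ` T)" if "x \<in> T" for x
            using le_trans[OF st[OF U that] sup_upper[OF tim imageI[OF that]]] sc(2)[OF U that] tc[OF that] tim
            by (simp add: sup_closed)
          then have "\<Squnion>(s U ` T) \<sqsubseteq> \<Squnion>(t ` T)" using sc(6)[OF U] tim by (simp add: Sup_le_iff)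
          then show ?thesis using sc(3)[OF U] by simp
        qed
        then show "\<Squnion>C \<sqsubseteq> \<Squnion>(t ` T)" using tim C by (simp add: Sup_le_iff)
      qed (use tim C in auto)
      fix x y assume xy: "x \<in> T" "y \<in> T"
      have le: "s U x \<sqinter> s V y \<sqsubseteq> E x y" if "U \<in> C" "V \<in> C" for U V
      proof -
        note c = UC[OF that(1)] UC[OF that(2)] sc(2)[OF that(1) xy(1)] sc(2)[OF that(2) xy(2)] sc(2)[OF that(2) xy(1)]
        have "s U x \<sqinter> s V y = (s U x \<sqinter> V) \<sqinter> s V y"
          using c sc(7)[OF that(2) xy(2)] by (metis meet_absorb1 meet_assoc meet_comm)
        also have "\<dots> \<sqsubseteq> s V x \<sqinter> s V y" using c key[OF that xy(1)] by (intro meet_mono) auto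
        finally show ?thesis using le_trans[OF _ sc(4)[OF that(2) xy]] c E_closed[OF xy] by simp
      qed
      have "\<Squnion>((\<lambda>U. s U x) ` C) \<sqinter> \<Squnion>((\<lambda>U. s U y) ` C) \<sqsubseteq> E x y"
        by (rule Sup_meet_Sup_le[OF sub[OF xy(1)] sub[OF xy(2)] E_closed[OF xy]]) (use le in blast)
      then show "t x \<sqinter> t y \<sqsubseteq> E x y" using xy by (simp add: t_def)
      have "s U x \<sqinter> E x y \<sqsubseteq> t y" if "U \<in> C" for U
        using le_trans[OF sc(5)[OF that xy] st[OF that xy(2)]] sc(2)[OF that] xy tc E_closed by simp
      then have "E x y \<sqinter> \<Squnion>((\<lambda>U. s U x) ` C) \<sqsubseteq> t y"
        using sub[OF xy(1)] E_closed[OF xy] tc[OF xy(2)] by (intro meet_Sup_le) (auto simp: meet_comm)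
      then show "t x \<sqinter> E x y \<sqsubseteq> t y" using xy by (simp add: t_def meet_comm)
    qed
    show ?thesis
    proof (rule ex1I[of _ t])
      have "res singletons (\<Squnion>C) U t = s U" if "U \<in> C" for U
        unfolding singletons_res using sc(1)[OF that] tm[OF that] by (intro extensionalityI[of _ T]) auto
      then show "t \<in> sections singletons (\<Squnion>C) \<and> (\<forall>U\<in>C. res singletons (\<Squnion>C) U t = s U)" using ts by simp
      fix u assume u: "u \<in> sections singletons (\<Squnion>C) \<and> (\<forall>U\<in>C. res singletons (\<Squnion>C) U u = s U)"
      note uD = singletonsD[OF conjunct1[OF u]]
      show "u = t"
      proof (rule extensionalityI[of _ T])
        fix x assume x: "x \<in> T"
        have "u x = u x \<sqinter> \<Squnion>C" using uD(7)[OF x] uD(2)[OF x] C by (simp add: meet_absorb1)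
        also have "\<dots> = \<Squnion>((\<lambda>U. u x \<sqinter> U) ` C)" by (rule Sup_distrib[OF uD(2)[OF x] C])
        also have "(\<lambda>U. u x \<sqinter> U) ` C = (\<lambda>U. s U x) ` C"
        proof (rule image_cong)
          show "u x \<sqinter> U = s U x" if "U \<in> C" for U
          proof -
            have "res singletons (\<Squnion>C) U u x = s U x" using u that by simp
            then show ?thesis using x by (simp add: singletons_res)
          qed
        qed simp
        finally show "u x = t x" using x by (simp add: t_def)
      qed (use uD in \<open>auto simp: t_def\<close>)
    qed
  qed
  show ?thesis
    unfolding sheaf_def
  proof (intro conjI)
    show "\<forall>U\<in>carrier P. \<forall>s\<in>sections singletons U. res singletons U U s = s"
    proof (intro ballI)
      fix U \<sigma> assume U: "U \<in> carrier P" and \<sigma>: "\<sigma> \<in> sections singletons U"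
      show "res singletons U U \<sigma> = \<sigma>"
        unfolding singletons_res using singletonsD[OF \<sigma>] U
        by (intro extensionalityI[of _ T]) (auto simp: meet_absorb1)
    qed
    show "\<forall>U\<in>carrier P. \<forall>V\<in>carrier P. \<forall>W\<in>carrier P. V \<sqsubseteq> U \<longrightarrow> W \<sqsubseteq> V \<longrightarrow>
        (\<forall>s\<in>sections singletons U. res singletons V W (res singletons U V s) = res singletons U W s)"
    proof (intro ballI impI)
      fix U V W \<sigma> assume c: "U \<in> carrier P" "V \<in> carrier P" "W \<in> carrier P" "W \<sqsubseteq> V" and \<sigma>: "\<sigma> \<in> sections singletons U"
      have "(\<sigma> x \<sqinter> V) \<sqinter> W = \<sigma> x \<sqinter> W" if "x \<in> T" for x
        using c singletonsD(2)[OF \<sigma> that] by (metis meet_absorb2 meet_assoc)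
      then show "res singletons V W (res singletons U V \<sigma>) = res singletons U W \<sigma>"
        unfolding singletons_res by (intro restrict_ext) simp
    qed
    show "\<forall>U\<in>carrier P. \<forall>V\<in>carrier P. V \<sqsubseteq> U \<longrightarrow> res singletons U V \<in> sections singletons U \<rightarrow> sections singletons V"
      by (intro ballI impI funcsetI) (rule singletons_res_closed)
  qed (intro allI impI, rule glue)
qed

text \<open>The singleton represented by x, cut down to the extent \<nu>.\<close>

definition singleton :: "'x \<Rightarrow> 'p \<Rightarrow> 'x \<Rightarrow> 'p" where
  "singleton x \<nu> = (\<lambda>y\<in>T. E x y \<sqinter> \<nu>)"

lemma singleton_section:
  assumes x: "x \<in> T" and \<nu>: "\<nu> \<in> carrier P"
  shows "singleton x \<nu> \<in> sections singletons \<nu>"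
  unfolding singleton_def
proof (rule singletonsI)
  have im: "(\<lambda>y\<in>T. E x y \<sqinter> \<nu>) ` T \<subseteq> carrier P" using E_closed[OF x] \<nu> by auto
  show "\<Squnion>((\<lambda>y\<in>T. E x y \<sqinter> \<nu>) ` T) = \<nu>"
  proof (rule le_antisym)
    show "\<Squnion>((\<lambda>y\<in>T. E x y \<sqinter> \<nu>) ` T) \<sqsubseteq> \<nu>"
      using im \<nu> E_closed[OF x] by (auto simp: Sup_le_iff meet_right)
    have "\<nu> = (\<lambda>y\<in>T. E x y \<sqinter> \<nu>) x" using x \<nu> E_refl[OF x] by simp
    then show "\<nu> \<sqsubseteq> \<Squnion>((\<lambda>y\<in>T. E x y \<sqinter> \<nu>) ` T)" using sup_upper[OF im imageI[OF x]] by simp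
  qed (use im \<nu> in auto)
  fix y z assume yz: "y \<in> T" "z \<in> T"
  note c = E_closed[OF x yz(1)] E_closed[OF x yz(2)] E_closed[OF yz] \<nu>
  have "(E x y \<sqinter> \<nu>) \<sqinter> (E x z \<sqinter> \<nu>) \<sqsubseteq> E x y \<sqinter> E x z" using c by (intro meet_mono meet_left) auto
  then show "(\<lambda>y\<in>T. E x y \<sqinter> \<nu>) y \<sqinter> (\<lambda>y\<in>T. E x y \<sqinter> \<nu>) z \<sqsubseteq> E y z"
    using le_trans[OF _ E_trans[OF yz(1) x yz(2)]] c yz by (simp add: E_sym[OF yz(1) x])
  have "(E x y \<sqinter> \<nu>) \<sqinter> E y z = (E x y \<sqinter> E y z) \<sqinter> \<nu>" using c by (metis meet_assoc meet_comm)
  also have "\<dots> \<sqsubseteq> E x z \<sqinter> \<nu>" using c E_trans[OF x yz] by (intro meet_mono) auto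
  finally show "(\<lambda>y\<in>T. E x y \<sqinter> \<nu>) y \<sqinter> E y z \<sqsubseteq> (\<lambda>y\<in>T. E x y \<sqinter> \<nu>) z" using yz by simp
qed (use E_closed[OF x] \<nu> in auto)

lemma singleton_res:
  assumes "x \<in> T" "\<nu> \<in> carrier P" "\<mu> \<in> carrier P" "\<mu> \<sqsubseteq> \<nu>"
  shows "res singletons \<nu> \<mu> (singleton x \<nu>) = singleton x \<mu>"
proof -
  have "(E x y \<sqinter> \<nu>) \<sqinter> \<mu> = E x y \<sqinter> \<mu>" if "y \<in> T" for y
    using assms E_closed[OF assms(1) that] by (metis meet_absorb2 meet_assoc)
  then show ?thesis unfolding singletons_res singleton_def by (intro restrict_ext) simp
qed

text \<open>All values of \<sigma> lie below \<nu> and hence below \<sigma> x. So \<sigma> y =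
  \<sigma> x \<sqinter> \<sigma> y is below E x y by the first condition on singletons, and the
  second one gives the converse inequality.\<close>

lemma singleton_eqI:
  assumes \<sigma>: "\<sigma> \<in> sections singletons \<nu>" and x: "x \<in> T" and le: "\<nu> \<sqsubseteq> \<sigma> x" and \<nu>: "\<nu> \<in> carrier P"
  shows "\<sigma> = singleton x \<nu>"
proof (rule extensionalityI[of _ T])
  note \<sigma>D = singletonsD[OF \<sigma>]
  show "\<sigma> \<in> extensional T" "singleton x \<nu> \<in> extensional T" using \<sigma>D(1) by (auto simp: singleton_def)
  fix y assume y: "y \<in> T"
  note c = \<sigma>D(2)[OF x] \<sigma>D(2)[OF y] E_closed[OF x y] \<nu>
  have "\<sigma> y \<sqsubseteq> \<sigma> x" using le_trans[OF \<sigma>D(7)[OF y] le] c by simp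
  then have "\<sigma> y = \<sigma> x \<sqinter> \<sigma> y" using c by (simp add: meet_absorb2)
  then have "\<sigma> y \<sqsubseteq> E x y" using \<sigma>D(4)[OF x y] by simp
  then have 1: "\<sigma> y \<sqsubseteq> E x y \<sqinter> \<nu>" using \<sigma>D(7)[OF y] c by (intro meet_le) auto
  have "E x y \<sqinter> \<nu> \<sqsubseteq> \<sigma> x \<sqinter> E x y" using le c by (subst meet_comm) (intro meet_mono, auto)
  then have "E x y \<sqinter> \<nu> \<sqsubseteq> \<sigma> y" using le_trans[OF _ \<sigma>D(5)[OF x y]] c by simp
  then show "\<sigma> y = singleton x \<nu> y" using 1 y c by (simp add: singleton_def le_antisym)
qed

lemma singleton_eq_iff:
  assumes x: "x \<in> T" and y: "y \<in> T" and \<nu>: "\<nu> \<in> carrier P"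
  shows "singleton x \<nu> = singleton y \<nu> \<longleftrightarrow> \<nu> \<sqsubseteq> E x y"
proof
  assume "singleton x \<nu> = singleton y \<nu>"
  from fun_cong[OF this, of y] have "E x y \<sqinter> \<nu> = \<nu>" using y \<nu> E_refl[OF y] by (simp add: singleton_def)
  then show "\<nu> \<sqsubseteq> E x y" using meet_left[OF E_closed[OF x y] \<nu>] by simp
next
  assume "\<nu> \<sqsubseteq> E x y"
  then have "\<nu> \<sqsubseteq> singleton x \<nu> y" using y \<nu> E_closed[OF x y] by (simp add: singleton_def meet_le)
  then show "singleton x \<nu> = singleton y \<nu>" using singleton_eqI[OF singleton_section[OF x \<nu>] y _ \<nu>] by simp
qed

end

text \<open>A copy of F with its sections recoded by e, which is assumed to be injective on each set
  of sections. It moves the sheaf of singletons into the type of sections prescribed for the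
  quasi-inverse.\<close>

definition presheaf_image :: "('s \<Rightarrow> 't) \<Rightarrow> ('o, 's) presheaf \<Rightarrow> ('o, 't) presheaf" where
  "presheaf_image e F = \<lparr>sections = (\<lambda>U. e ` sections F U),
     res = (\<lambda>U V s. e (res F U V (inv_into (sections F U) e s)))\<rparr>"

lemma presheaf_image_res:
  "\<lbrakk>inj_on e (sections F U); s \<in> sections F U\<rbrakk> \<Longrightarrow> res (presheaf_image e F) U V (e s) = e (res F U V s)"
  by (simp add: presheaf_image_def)

lemma presheaf_image_sheaf:
  assumes "sheaf_frame P F" and inj: "\<And>U. U \<in> carrier P \<Longrightarrow> inj_on e (sections F U)"
  shows "sheaf P (presheaf_image e F)"
proof -
  interpret sheaf_frame P F by fact
  let ?G = "presheaf_image e F"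
  have sec: "sections ?G U = e ` sections F U" for U by (simp add: presheaf_image_def)
  note r = presheaf_image_res[OF inj]
  show ?thesis
    unfolding sheaf_def
  proof (intro conjI)
    show "\<forall>U\<in>carrier P. \<forall>V\<in>carrier P. V \<sqsubseteq>\<^bsub>P\<^esub> U \<longrightarrow> res ?G U V \<in> sections ?G U \<rightarrow> sections ?G V"
      by (auto simp: sec r res_closed)
    show "\<forall>U\<in>carrier P. \<forall>s\<in>sections ?G U. res ?G U U s = s" by (auto simp: sec r res_id)
    show "\<forall>U\<in>carrier P. \<forall>V\<in>carrier P. \<forall>W\<in>carrier P. V \<sqsubseteq>\<^bsub>P\<^esub> U \<longrightarrow> W \<sqsubseteq>\<^bsub>P\<^esub> V \<longrightarrow>
        (\<forall>s\<in>sections ?G U. res ?G V W (res ?G U V s) = res ?G U W s)"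
      by (auto simp: sec r res_closed res_res)
    show "\<forall>C\<subseteq>carrier P. \<forall>s. (\<forall>U\<in>C. s U \<in> sections ?G U) \<longrightarrow>
        (\<forall>U\<in>C. \<forall>V\<in>C. res ?G U (U \<sqinter>\<^bsub>P\<^esub> V) (s U) = res ?G V (U \<sqinter>\<^bsub>P\<^esub> V) (s V)) \<longrightarrow>
        (\<exists>!t. t \<in> sections ?G (\<Squnion>\<^bsub>P\<^esub> C) \<and> (\<forall>U\<in>C. res ?G (\<Squnion>\<^bsub>P\<^esub> C) U t = s U))"
    proof (intro allI impI)
      fix C s assume C: "C \<subseteq> carrier P" and s: "\<forall>U\<in>C. s U \<in> sections ?G U"
        and compat: "\<forall>U\<in>C. \<forall>V\<in>C. res ?G U (U \<sqinter>\<^bsub>P\<^esub> V) (s U) = res ?G V (U \<sqinter>\<^bsub>P\<^esub> V) (s V)"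
      define s' where "s' U = inv_into (sections F U) e (s U)" for U
      have UC: "U \<in> C \<Longrightarrow> U \<in> carrier P" for U using C by blast
      have s': "s' U \<in> sections F U" "e (s' U) = s U" if "U \<in> C" for U
        using s that unfolding s'_def sec by (auto intro: inv_into_into f_inv_into_f)
      have "res F U (U \<sqinter>\<^bsub>P\<^esub> V) (s' U) = res F V (U \<sqinter>\<^bsub>P\<^esub> V) (s' V)" if UV: "U \<in> C" "V \<in> C" for U V
      proof (rule inj_onD[OF inj[of "U \<sqinter>\<^bsub>P\<^esub> V"]])
        show "e (res F U (U \<sqinter>\<^bsub>P\<^esub> V) (s' U)) = e (res F V (U \<sqinter>\<^bsub>P\<^esub> V) (s' V))"
          using compat UV s'[OF UV(1)] s'[OF UV(2)] r[OF UC[OF UV(1)], of "s' U"] r[OF UC[OF UV(2)], of "s' V"] by metis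
      qed (use UC[OF UV(1)] UC[OF UV(2)] s'[OF UV(1)] s'[OF UV(2)] in \<open>auto intro!: res_closed simp: meet_left meet_right\<close>)
      from glue[of C "\<lambda>U. U" s', OF UC s'(1) this]
      have ex1: "\<exists>!t. t \<in> sections F (\<Squnion>\<^bsub>P\<^esub> C) \<and> (\<forall>U\<in>C. res F (\<Squnion>\<^bsub>P\<^esub> C) U t = s' U)" by simp
      define t where "t = (THE t. t \<in> sections F (\<Squnion>\<^bsub>P\<^esub> C) \<and> (\<forall>U\<in>C. res F (\<Squnion>\<^bsub>P\<^esub> C) U t = s' U))"
      note t = theI'[OF ex1, folded t_def]
      have uniq: "u = t" if "u \<in> sections F (\<Squnion>\<^bsub>P\<^esub> C)" "\<And>U. U \<in> C \<Longrightarrow> res F (\<Squnion>\<^bsub>P\<^esub> C) U u = s' U" for u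
        using the1_equality[OF ex1, of u, folded t_def] that by simp
      have SC: "\<Squnion>\<^bsub>P\<^esub> C \<in> carrier P" using C by simp
      show "\<exists>!t. t \<in> sections ?G (\<Squnion>\<^bsub>P\<^esub> C) \<and> (\<forall>U\<in>C. res ?G (\<Squnion>\<^bsub>P\<^esub> C) U t = s U)"
      proof (rule ex1I[of _ "e t"])
        show "e t \<in> sections ?G (\<Squnion>\<^bsub>P\<^esub> C) \<and> (\<forall>U\<in>C. res ?G (\<Squnion>\<^bsub>P\<^esub> C) U (e t) = s U)"
          using t s' by (simp add: sec r[OF SC])
        fix v assume v: "v \<in> sections ?G (\<Squnion>\<^bsub>P\<^esub> C) \<and> (\<forall>U\<in>C. res ?G (\<Squnion>\<^bsub>P\<^esub> C) U v = s U)"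
        then obtain u where u: "v = e u" "u \<in> sections F (\<Squnion>\<^bsub>P\<^esub> C)" by (auto simp: sec)
        have "res F (\<Squnion>\<^bsub>P\<^esub> C) U u = s' U" if U: "U \<in> C" for U
        proof (rule inj_onD[OF inj[OF UC[OF U]]])
          show "e (res F (\<Squnion>\<^bsub>P\<^esub> C) U u) = e (s' U)" using v U u s'(2)[OF U] r[OF SC u(2)] by simp
        qed (use U u s' SC UC sup_upper[OF C U] in \<open>auto intro!: res_closed\<close>)
        from uniq[OF u(2) this] show "v = e t" using u by simp
      qed
    qed
  qed
qed


section \<open>Left-handed noncommutative frames\<close>

locale lnframe = noncommutative_frame A for A :: "'a skew_lat" (structure) +
  assumes left_handed: "left_handed A"
begin

declare smeet_closed [simp] sjoin_closed [simp] zer_closed [simp] smeet_idem [simp] sjoin_idem [simp]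

lemma absorbs [simp]:
  assumes "x \<in> carrier A" "y \<in> carrier A"
  shows "x \<curlywedge> (x \<curlyvee> y) = x" "x \<curlyvee> (x \<curlywedge> y) = x" "(x \<curlywedge> y) \<curlyvee> y = y" "(x \<curlyvee> y) \<curlywedge> y = y"
  using absorb[OF assms] by simp_all

lemma smeet_left: "\<lbrakk>x \<in> carrier A; y \<in> carrier A; z \<in> carrier A\<rbrakk> \<Longrightarrow> x \<curlywedge> (y \<curlyvee> z) = (x \<curlywedge> y) \<curlyvee> (x \<curlywedge> z)"
  and smeet_right: "\<lbrakk>x \<in> carrier A; y \<in> carrier A; z \<in> carrier A\<rbrakk> \<Longrightarrow> (x \<curlyvee> y) \<curlywedge> z = (x \<curlywedge> z) \<curlyvee> (y \<curlywedge> z)"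
  using strongly_distributive by blast+

lemma smeet_zer [simp]: "x \<in> carrier A \<Longrightarrow> x \<curlywedge> zer A = zer A" "x \<in> carrier A \<Longrightarrow> zer A \<curlywedge> x = zer A"
  using absorbs[of x "zer A"] absorbs[of "zer A" x] zer_sjoin[of x] by simp_all

lemma smeet_regular: "\<lbrakk>x \<in> carrier A; y \<in> carrier A\<rbrakk> \<Longrightarrow> x \<curlywedge> (y \<curlywedge> x) = x \<curlywedge> y"
  using left_handed by (simp add: left_handed_def smeet_assoc)

text \<open>Let u and v be the products of x with p, q in the two orders. Left-handedness gives v
  \<curlywedge> u = v, and x \<curlyvee> v = x by absorption; so u = (x \<curlyvee> v) \<curlywedge>
  u = u \<curlyvee> v by strong distributivity, and u \<curlywedge> v = v by absorption. Exchanging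
  the orders gives u \<curlywedge> v = u from the first equation.\<close>

lemma smeet_swap:
  assumes x: "x \<in> carrier A" and y: "y \<in> carrier A" and z: "z \<in> carrier A"
  shows "x \<curlywedge> (y \<curlywedge> z) = x \<curlywedge> (z \<curlywedge> y)"
proof -
  have *: "x \<curlywedge> (p \<curlywedge> q) \<curlyvee> x \<curlywedge> (q \<curlywedge> p) = x \<curlywedge> (p \<curlywedge> q) \<and>
      (x \<curlywedge> (q \<curlywedge> p)) \<curlywedge> (x \<curlywedge> (p \<curlywedge> q)) = x \<curlywedge> (q \<curlywedge> p)" if pq: "p \<in> carrier A" "q \<in> carrier A" for p q
  proof -
    let ?u = "x \<curlywedge> (p \<curlywedge> q)" and ?v = "x \<curlywedge> (q \<curlywedge> p)"
    have vu: "?v \<curlywedge> ?u = ?v"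
    proof -
      have "?v \<curlywedge> ?u = x \<curlywedge> ((q \<curlywedge> p) \<curlywedge> x) \<curlywedge> (p \<curlywedge> q)" using x pq by (simp add: smeet_assoc)
      also have "\<dots> = x \<curlywedge> (q \<curlywedge> p) \<curlywedge> (p \<curlywedge> q)" using x pq smeet_regular[of x "q \<curlywedge> p"] by simp
      also have "\<dots> = x \<curlywedge> (q \<curlywedge> (p \<curlywedge> (p \<curlywedge> q)))" using x pq by (simp add: smeet_assoc)
      also have "p \<curlywedge> (p \<curlywedge> q) = p \<curlywedge> q" using pq by (metis smeet_assoc smeet_idem)
      also have "q \<curlywedge> (p \<curlywedge> q) = q \<curlywedge> p" using pq by (simp add: smeet_regular)
      finally show ?thesis .
    qed
    have "x \<curlyvee> ?v = x" using x pq by simp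
    then have "x \<curlywedge> ?u = (x \<curlyvee> ?v) \<curlywedge> ?u" by simp
    also have "\<dots> = x \<curlywedge> ?u \<curlyvee> ?v" using smeet_right[of x ?v ?u] x pq vu by (simp del: absorbs)
    also have "x \<curlywedge> ?u = ?u" using x pq by (metis smeet_assoc smeet_closed smeet_idem)
    finally show ?thesis using vu by simp
  qed
  have "(x \<curlywedge> (y \<curlywedge> z)) \<curlywedge> (x \<curlywedge> (z \<curlywedge> y)) = (x \<curlywedge> (y \<curlywedge> z) \<curlyvee> x \<curlywedge> (z \<curlywedge> y)) \<curlywedge> (x \<curlywedge> (z \<curlywedge> y))"
    using *[OF y z] by simp
  also have "\<dots> = x \<curlywedge> (z \<curlywedge> y)" using x y z by simp
  finally show ?thesis using *[OF z y] by simp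
qed

lemma sjoin_absorb:
  assumes "x \<in> carrier A" "w \<in> carrier A" "x \<curlywedge> w = x"
  shows "x \<curlyvee> w = w"
  using absorbs(3)[OF assms(1,2)] assms(3) by simp

text \<open>The element p = u \<curlyvee> v satisfies p \<curlywedge> u = u and p \<curlywedge> v =
  v, so p \<curlywedge> (v \<curlyvee> u) = v \<curlyvee> u; distributing on the other side gives p.
  Hence commuting subsets can be recognised by their meets.\<close>

lemma sjoin_commute:
  assumes u: "u \<in> carrier A" and v: "v \<in> carrier A" and uv: "u \<curlywedge> v = v \<curlywedge> u"
  shows "u \<curlyvee> v = v \<curlyvee> u"
proof -
  have absorb': "u \<curlyvee> (v \<curlywedge> u) = u" "v \<curlyvee> (u \<curlywedge> v) = v" using u v uv absorbs(2)[OF u v] absorbs(2)[OF v u] by simp_all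
  let ?p = "u \<curlyvee> v"
  have p: "?p \<curlywedge> u = u" "?p \<curlywedge> v = v" using u v absorb' by (simp_all add: smeet_right)
  have "?p \<curlywedge> (v \<curlyvee> u) = v \<curlyvee> u" using u v p by (simp add: smeet_left)
  moreover have "?p \<curlywedge> (v \<curlyvee> u) = u \<curlywedge> (v \<curlyvee> u) \<curlyvee> v \<curlywedge> (v \<curlyvee> u)" using u v by (simp add: smeet_right)
  moreover have "u \<curlywedge> (v \<curlyvee> u) = u" using u v uv absorbs(3)[OF v u] by (simp add: smeet_left)
  ultimately show ?thesis using u v by simp
qed

lemma commutingI:
  assumes "C \<noteq> {}" "C \<subseteq> carrier A" "\<And>x y. \<lbrakk>x \<in> C; y \<in> C\<rbrakk> \<Longrightarrow> x \<curlywedge> y = y \<curlywedge> x"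
  shows "commuting_subset A C"
  unfolding commuting_subset_def using assms sjoin_commute by blast

lemma natural_Sup:
  assumes "commuting_subset A C"
  shows "least (natural_order A) (\<Squnion>\<^bsub>natural_order A\<^esub> C) (Upper (natural_order A) C)"
  using join_complete[OF assms] natural_sup_eq by auto

lemma natural_SupD:
  assumes C: "commuting_subset A C"
  defines "s \<equiv> \<Squnion>\<^bsub>natural_order A\<^esub> C"
  shows "s \<in> carrier A" "x \<in> C \<Longrightarrow> x \<curlywedge> s = x" "x \<in> C \<Longrightarrow> s \<curlywedge> x = x"
    "\<lbrakk>z \<in> carrier A; \<And>x. x \<in> C \<Longrightarrow> x \<curlywedge> z = x \<and> z \<curlywedge> x = x\<rbrakk> \<Longrightarrow> s \<curlywedge> z = s \<and> z \<curlywedge> s = s"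
proof -
  have C': "C \<subseteq> carrier A" using C by (simp add: commuting_subset_def)
  note l = natural_Sup[OF C, folded s_def]
  show "s \<in> carrier A" using l by (simp add: least_def Upper_def)
  have "x \<in> C \<Longrightarrow> x \<sqsubseteq>\<^bsub>natural_order A\<^esub> s" for x
    using l C' by (auto simp: least_def Upper_def)
  then show "x \<in> C \<Longrightarrow> x \<curlywedge> s = x" "x \<in> C \<Longrightarrow> s \<curlywedge> x = x" for x by simp_all
  show "s \<curlywedge> z = s \<and> z \<curlywedge> s = s" if z: "z \<in> carrier A" "\<And>x. x \<in> C \<Longrightarrow> x \<curlywedge> z = x \<and> z \<curlywedge> x = x"
  proof -
    have "z \<in> Upper (natural_order A) C" using z by (simp add: Upper_def)
    then show ?thesis using l by (simp add: least_def)
  qed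
qed

text \<open>Chains for the natural order are commuting subsets, so join completeness supplies the
  upper bounds for Zorn's lemma; the empty chain is bounded by zero.\<close>

lemma maximal_exists: "\<exists>t\<in>carrier A. \<forall>x\<in>carrier A. t \<curlywedge> x = t \<longrightarrow> x \<curlywedge> t = t \<longrightarrow> x = t"
proof -
  interpret partial_order "natural_order A" by (rule natural_partial_order)
  let ?r = "{(x, y). x \<in> carrier A \<and> y \<in> carrier A \<and> x \<sqsubseteq>\<^bsub>natural_order A\<^esub> y}"
  have f: "Field ?r = carrier A" by (auto simp: Field_def)
  have po: "Partial_order ?r"
    unfolding partial_order_on_def preorder_on_def f
  proof (intro conjI)
    show "refl_on (carrier A) ?r" by (auto simp: refl_on_def)
    show "trans ?r"
    proof (rule transI)
      fix x y z assume "(x, y) \<in> ?r" "(y, z) \<in> ?r"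
      then show "(x, z) \<in> ?r" using le_trans[of x y z] by simp
    qed
    show "antisym ?r" by (rule antisymI) auto
  qed auto
  have "\<exists>t\<in>Field ?r. \<forall>x\<in>Field ?r. (t, x) \<in> ?r \<longrightarrow> x = t"
  proof (rule Zorns_po_lemma[OF po])
    fix C assume C: "C \<in> Chains ?r"
    show "\<exists>u\<in>Field ?r. \<forall>x\<in>C. (x, u) \<in> ?r"
    proof (cases "C = {}")
      case False
      have ch: "(x, y) \<in> ?r \<or> (y, x) \<in> ?r" if "x \<in> C" "y \<in> C" for x y using C that by (auto simp: Chains_def)
      have sub: "C \<subseteq> carrier A" using ch by auto
      have "x \<curlywedge> y = y \<curlywedge> x" if "x \<in> C" "y \<in> C" for x y using ch[OF that] by auto
      from commutingI[OF False sub this] have com: "commuting_subset A C" .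
      then show ?thesis unfolding f using natural_SupD[OF com] sub
        by (intro bexI[of _ "\<Squnion>\<^bsub>natural_order A\<^esub> C"]) auto
    qed (use f in \<open>auto intro: zer_closed\<close>)
  qed
  then obtain t where t: "t \<in> carrier A" "\<forall>x\<in>carrier A. (t, x) \<in> ?r \<longrightarrow> x = t" unfolding f by blast
  show ?thesis
  proof (intro bexI[OF _ t(1)] ballI impI)
    fix x assume "x \<in> carrier A" "t \<curlywedge> x = t" "x \<curlywedge> t = t"
    then show "x = t" using t(2)[rule_format, of x] t(1) by simp
  qed
qed

end

section \<open>The elements below a maximal element\<close>

locale lnframe_top = lnframe +
  fixes t
  assumes t_closed [simp]: "t \<in> carrier A"
    and t_maximal: "\<lbrakk>x \<in> carrier A; t \<curlywedge> x = t; x \<curlywedge> t = t\<rbrakk> \<Longrightarrow> x = t"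
begin

text \<open>Each \<open>\<D>\<close>-class has exactly one element below \<open>t\<close>, so \<open>base\<close> is the commutative shadow, with
  \<open>t \<and> x\<close> as the class of \<open>x\<close>; \<open>full\<close> is the maximal \<open>\<D>\<close>-class.\<close>

definition base where "base = {b \<in> carrier A. t \<curlywedge> b = b}"
definition full where "full = {x \<in> carrier A. t \<curlywedge> x = t}"

lemma baseI: "\<lbrakk>b \<in> carrier A; t \<curlywedge> b = b\<rbrakk> \<Longrightarrow> b \<in> base"
  and top_smeet [simp]: "b \<in> base \<Longrightarrow> t \<curlywedge> b = b"
  and fullI: "\<lbrakk>x \<in> carrier A; t \<curlywedge> x = t\<rbrakk> \<Longrightarrow> x \<in> full"
  and top_smeet_full: "x \<in> full \<Longrightarrow> t \<curlywedge> x = t"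
  and base_closed [simp]: "b \<in> base \<Longrightarrow> b \<in> carrier A"
  and full_closed [simp]: "x \<in> full \<Longrightarrow> x \<in> carrier A"
  by (simp_all add: base_def full_def)

text \<open>An element maximal for the natural order lies in the top \<D>-class: t is naturally
  below x \<curlyvee> t, so the two are equal by maximality, and absorption gives x \<curlywedge> t
  = x.\<close>

lemma smeet_top [simp]: assumes x: "x \<in> carrier A" shows "x \<curlywedge> t = x"
proof -
  have "(t \<curlywedge> x) \<curlyvee> t = t"
    using sjoin_absorb[of "t \<curlywedge> x" t] x by (simp add: smeet_assoc smeet_regular)
  then have "t \<curlywedge> (x \<curlyvee> t) = t" using x by (simp add: smeet_left)
  then have "x \<curlyvee> t = t" using x t_maximal[of "x \<curlyvee> t"] by simp
  then show ?thesis using absorbs(1)[OF x t_closed] by simp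
qed

lemma smeet_full [simp]: assumes "x \<in> carrier A" "y \<in> full" shows "x \<curlywedge> y = x"
proof -
  have "x \<curlywedge> y = (x \<curlywedge> t) \<curlywedge> y" using assms(1) by simp
  also have "\<dots> = x \<curlywedge> (t \<curlywedge> y)" using assms by (simp add: smeet_assoc del: smeet_top)
  also have "t \<curlywedge> y = t" using assms(2) by (rule top_smeet_full)
  finally show ?thesis using assms(1) by simp
qed

lemma top_full [simp]: "t \<in> full" and top_base [simp]: "t \<in> base" and zer_base [simp]: "zer A \<in> base"
  by (auto intro: fullI baseI)

lemma full_sjoin [simp]: "\<lbrakk>x \<in> full; y \<in> carrier A\<rbrakk> \<Longrightarrow> x \<curlyvee> y \<in> full"
proof -
  assume a: "x \<in> full" "y \<in> carrier A"
  have "t \<curlywedge> (x \<curlyvee> y) = t" using a absorbs(2)[OF t_closed a(2)] by (simp add: smeet_left)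
  then show ?thesis using a by (intro fullI) simp_all
qed

lemma top_smeet_base [simp]: "x \<in> carrier A \<Longrightarrow> t \<curlywedge> x \<in> base"
  using smeet_assoc[of t t x] by (intro baseI) simp_all

text \<open>Elements of \<open>base\<close> absorb t on the left, and behind t the other factors may
  be exchanged.\<close>

lemma base_commute: assumes "b \<in> base" "c \<in> base" shows "b \<curlywedge> c = c \<curlywedge> b"
proof -
  have "b \<curlywedge> c = (t \<curlywedge> b) \<curlywedge> c" using assms by simp
  also have "\<dots> = t \<curlywedge> (b \<curlywedge> c)" using assms by (intro smeet_assoc) simp_all
  also have "\<dots> = t \<curlywedge> (c \<curlywedge> b)" using assms by (intro smeet_swap) simp_all
  also have "\<dots> = (t \<curlywedge> c) \<curlywedge> b" using assms by (intro smeet_assoc[symmetric]) simp_all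
  finally show ?thesis using assms by simp
qed

lemma base_smeet [simp]: "\<lbrakk>b \<in> base; c \<in> base\<rbrakk> \<Longrightarrow> b \<curlywedge> c \<in> base"
  using smeet_assoc[of t b c] by (intro baseI) simp_all

lemma base_sjoin [simp]: "\<lbrakk>b \<in> base; c \<in> base\<rbrakk> \<Longrightarrow> b \<curlyvee> c \<in> base"
  by (intro baseI) (simp_all add: smeet_left)

lemma base_commuting: "\<lbrakk>C \<noteq> {}; C \<subseteq> base\<rbrakk> \<Longrightarrow> commuting_subset A C"
  using base_commute by (intro commutingI) (auto dest: subsetD)

lemma base_Sup:
  assumes "C \<noteq> {}" "C \<subseteq> base"
  shows "\<Squnion>\<^bsub>natural_order A\<^esub> C \<in> base"
proof -
  note C = natural_SupD[OF base_commuting[OF assms]]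
  have "\<And>x. x \<in> C \<Longrightarrow> x \<curlywedge> t = x \<and> t \<curlywedge> x = x" using assms(2) by auto
  from C(4)[OF t_closed this] show ?thesis using C(1) by (intro baseI) simp_all
qed

lemma restrict_full:
  assumes "x \<in> full" "b \<in> base" shows "t \<curlywedge> (x \<curlywedge> b) = b"
  using smeet_assoc[of t x b] assms by simp

text \<open>The restrictions of x and y to b are \<D>-related, and in a join the right operand
  prevails wherever it is defined. Computations with joins of partial elements below use this
  rule.\<close>

lemma restrict_sjoin:
  assumes "x \<in> full" "y \<in> full" "b \<in> base" shows "x \<curlywedge> b \<curlyvee> y \<curlywedge> b = y \<curlywedge> b"
proof (rule sjoin_absorb)
  have "(x \<curlywedge> b) \<curlywedge> (y \<curlywedge> b) = x \<curlywedge> (b \<curlywedge> (y \<curlywedge> b))" using assms by (simp add: smeet_assoc)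
  also have "b \<curlywedge> (y \<curlywedge> b) = b" using smeet_swap[of b y b] assms by simp
  finally show "(x \<curlywedge> b) \<curlywedge> (y \<curlywedge> b) = x \<curlywedge> b" .
qed (use assms in simp_all)

lemma restrict_sjoin':
  assumes "y \<in> full" "b \<in> base" shows "b \<curlyvee> y \<curlywedge> b = y \<curlywedge> b"
  using restrict_sjoin[of t y b] assms by simp

lemma restrict_restrict:
  "\<lbrakk>x \<in> carrier A; b \<in> base; c \<in> base\<rbrakk> \<Longrightarrow> (x \<curlywedge> b) \<curlywedge> c = x \<curlywedge> (c \<curlywedge> b)"
  using base_commute[of b c] by (simp add: smeet_assoc)

end

section \<open>The frame of elements below the maximal element\<close>

context lnframe_top
begin

text \<open>Each element b of \<open>base\<close> is wrapped as a one-element set, because the type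
  of the quasi-inverse prescribes a frame on \<open>'a set\<close>.\<close>

definition L :: "'a set gorder" where
  "L = \<lparr>carrier = (\<lambda>b. {b}) ` base, eq = (=), le = (\<lambda>X Y. the_elem X \<curlywedge> the_elem Y = the_elem X)\<rparr>"

abbreviation le_base (infix "\<le>\<^sub>L" 50) where "X \<le>\<^sub>L Y \<equiv> X \<sqsubseteq>\<^bsub>L\<^esub> Y"
abbreviation val :: "'a set \<Rightarrow> 'a" where "val \<equiv> the_elem"

lemma carrier_L: "X \<in> carrier L \<longleftrightarrow> (\<exists>b\<in>base. X = {b})" by (auto simp: L_def)
lemma val_base [simp]: "X \<in> carrier L \<Longrightarrow> val X \<in> base" by (auto simp: carrier_L)
lemma base_L [simp]: "{b} \<in> carrier L \<longleftrightarrow> b \<in> base" by (auto simp: carrier_L)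
lemma val_inverse: "X \<in> carrier L \<Longrightarrow> {val X} = X" by (auto simp: carrier_L)
lemma le_L [simp]: "X \<le>\<^sub>L Y \<longleftrightarrow> val X \<curlywedge> val Y = val X" by (simp add: L_def)
lemma val_inj: "\<lbrakk>X \<in> carrier L; Y \<in> carrier L; val X = val Y\<rbrakk> \<Longrightarrow> X = Y" by (auto simp: carrier_L)

lemma L_partial_order: "partial_order L"
proof
  fix X Y Z assume c: "X \<in> carrier L" "Y \<in> carrier L" "Z \<in> carrier L"
  show "X \<le>\<^sub>L X" using c by simp
  show "\<lbrakk>X \<le>\<^sub>L Y; Y \<le>\<^sub>L Z\<rbrakk> \<Longrightarrow> X \<le>\<^sub>L Z"
    using c smeet_assoc[of "val X" "val Y" "val Z"] by simp
  show "\<lbrakk>X \<le>\<^sub>L Y; Y \<le>\<^sub>L X\<rbrakk> \<Longrightarrow> X .=\<^bsub>L\<^esub> Y"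
    using c base_commute[of "val X" "val Y"] val_inj[of X Y] by (simp add: L_def)
qed (auto simp: L_def)

text \<open>The second clause says that equality of two restrictions passes to suprema; it holds
  because meets distribute over commuting suprema. It is carried along since both the frame law for
  L and the largest place of agreement of two elements depend on it. The empty set is treated apart,
  with zero as supremum, as commuting subsets are nonempty.\<close>

lemma L_lub:
  assumes S: "S \<subseteq> carrier L"
  shows "\<exists>s\<in>base. least L {s} (Upper L S) \<and>
    (\<forall>x\<in>carrier A. \<forall>y\<in>carrier A. (\<forall>X\<in>S. x \<curlywedge> val X = y \<curlywedge> val X) \<longrightarrow> x \<curlywedge> s = y \<curlywedge> s)"
proof (cases "S = {}")
  case True
  show ?thesis by (rule bexI[of _ "zer A"]) (auto simp: least_def Upper_def True)
next
  case False
  let ?C = "val ` S"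
  let ?s = "\<Squnion>\<^bsub>natural_order A\<^esub> ?C"
  have C: "?C \<noteq> {}" "?C \<subseteq> base" using False S by auto
  have SX: "X \<in> S \<Longrightarrow> X \<in> carrier L" for X using S by blast
  note com = base_commuting[OF C]
  note s = natural_SupD[OF com]
  have sb: "?s \<in> base" by (rule base_Sup[OF C])
  have "least L {?s} (Upper L S)"
    unfolding least_def
  proof (intro conjI ballI)
    show "Upper L S \<subseteq> carrier L" by (auto simp: Upper_def)
    show "{?s} \<in> Upper L S" using s(2) sb S by (auto simp: Upper_def)
    fix Y assume "Y \<in> Upper L S"
    then have Y: "Y \<in> carrier L" "\<And>X. X \<in> S \<Longrightarrow> val X \<curlywedge> val Y = val X" using S by (auto simp: Upper_def)
    have "x \<curlywedge> val Y = x \<and> val Y \<curlywedge> x = x" if x: "x \<in> ?C" for x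
    proof -
      obtain X where X: "x = val X" "X \<in> S" using x by blast
      show ?thesis using Y(2)[OF X(2)] base_commute[of "val X" "val Y"] SX[OF X(2)] Y(1) X(1) by simp
    qed
    from s(4)[OF _ this] show "{?s} \<le>\<^sub>L Y" using Y(1) by simp
  qed
  moreover have "x \<curlywedge> ?s = y \<curlywedge> ?s"
    if xy: "x \<in> carrier A" "y \<in> carrier A" and eq: "\<forall>X\<in>S. x \<curlywedge> val X = y \<curlywedge> val X" for x y
  proof -
    have "(\<lambda>b. x \<curlywedge> b) ` ?C = (\<lambda>b. y \<curlywedge> b) ` ?C"
      unfolding image_image using eq by (intro image_cong[OF HOL.refl]) blast
    then show ?thesis using smeet_Sup[OF xy(1) com] smeet_Sup[OF xy(2) com] by simp
  qed
  ultimately show ?thesis using sb by blast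
qed

lemma L_Sup:
  assumes "least L s (Upper L S)"
  shows "\<Squnion>\<^bsub>L\<^esub>S = s"
proof -
  interpret partial_order L by (rule L_partial_order)
  show ?thesis unfolding sup_def using assms least_unique by (intro some_equality) auto
qed

lemma L_complete_lattice: "complete_lattice L"
proof -
  interpret partial_order L by (rule L_partial_order)
  show ?thesis
  proof (rule complete_latticeI)
    fix S assume S: "S \<subseteq> carrier L"
    then show "\<exists>s. is_lub L s S" using L_lub by blast
    have low: "Lower L S \<subseteq> carrier L" by (auto simp: Lower_def)
    obtain s where s: "s \<in> base" "least L {s} (Upper L (Lower L S))" using L_lub[OF low] by blast
    have "S \<subseteq> Upper L (Lower L S)" using S by (auto simp: Upper_def Lower_def)
    then have "{s} \<in> Lower L S" using s S by (auto simp: Lower_def least_def simp del: le_L)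
    moreover have "Y \<le>\<^sub>L {s}" if "Y \<in> Lower L S" for Y
      using s(2) that subsetD[OF low that] by (simp add: least_def Upper_def del: le_L)
    ultimately show "\<exists>s. is_glb L s S" using low by (intro exI[of _ "{s}"]) (simp add: greatest_def del: le_L)
  qed
qed

lemma val_meet_L:
  assumes "X \<in> carrier L" "Y \<in> carrier L"
  shows "X \<sqinter>\<^bsub>L\<^esub> Y = {val X \<curlywedge> val Y}"
proof -
  interpret complete_lattice L by (rule L_complete_lattice)
  have b: "val X \<in> base" "val Y \<in> base" using assms by simp_all
  have xy: "{val X \<curlywedge> val Y} \<in> carrier L" using b by simp
  have "{val X \<curlywedge> val Y} \<le>\<^sub>L X" "{val X \<curlywedge> val Y} \<le>\<^sub>L Y"
    using b base_commute[OF b] smeet_assoc[of "val X" "val Y" "val Y"] smeet_assoc[of "val Y" "val X" "val X"] by simp_all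
  then have 1: "{val X \<curlywedge> val Y} \<le>\<^sub>L X \<sqinter>\<^bsub>L\<^esub> Y" using assms xy by (intro meet_le) auto
  let ?m = "X \<sqinter>\<^bsub>L\<^esub> Y"
  have m: "?m \<in> carrier L" "?m \<le>\<^sub>L X" "?m \<le>\<^sub>L Y" using assms by (auto intro: meet_left meet_right simp del: le_L)
  then have "?m \<le>\<^sub>L {val X \<curlywedge> val Y}" using b smeet_assoc[of "val ?m" "val X" "val Y"] by simp
  then show ?thesis using 1 m xy by (intro le_antisym) auto
qed

lemma L_frame: "frame_lattice L"
proof -
  interpret complete_lattice L by (rule L_complete_lattice)
  show ?thesis
  proof
    fix X S assume X: "X \<in> carrier L" and S: "S \<subseteq> carrier L"
    have im: "(\<lambda>s. X \<sqinter>\<^bsub>L\<^esub> s) ` S \<subseteq> carrier L" using X S by auto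
    have SS: "\<Squnion>\<^bsub>L\<^esub>S \<in> carrier L" "\<Squnion>\<^bsub>L\<^esub>((\<lambda>s. X \<sqinter>\<^bsub>L\<^esub> s) ` S) \<in> carrier L" using S im by simp_all
    show "X \<sqinter>\<^bsub>L\<^esub> \<Squnion>\<^bsub>L\<^esub>S = \<Squnion>\<^bsub>L\<^esub>((\<lambda>s. X \<sqinter>\<^bsub>L\<^esub> s) ` S)" (is "?l = ?r")
    proof (rule le_antisym)
      have "X \<sqinter>\<^bsub>L\<^esub> s \<le>\<^sub>L ?l" if "s \<in> S" for s
        using that S X SS sup_upper[OF S that] by (intro meet_mono) (auto simp del: le_L)
      then show "?r \<le>\<^sub>L ?l" using im X SS by (simp add: Sup_le_iff del: le_L)
      obtain s where s: "s \<in> base" "least L {s} (Upper L S)"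
        "\<forall>x\<in>carrier A. \<forall>y\<in>carrier A. (\<forall>X\<in>S. x \<curlywedge> val X = y \<curlywedge> val X) \<longrightarrow> x \<curlywedge> s = y \<curlywedge> s"
        using L_lub[OF S] by blast
      have Ss: "\<Squnion>\<^bsub>L\<^esub>S = {s}" by (rule L_Sup[OF s(2)])
      \<comment> \<open>The elements X \<sqinter> r and X have the same restriction to every Y in S,
        because X \<sqinter> Y is below r. By \<open>L_lub\<close> they have the same restriction to
        the supremum of S, which is the frame law.\<close>
      have "(val X \<curlywedge> val ?r) \<curlywedge> s = val X \<curlywedge> s"
      proof (rule s(3)[rule_format])
        fix Y assume Y: "Y \<in> S"
        have Yc: "Y \<in> carrier L" using Y S by blast
        have "X \<sqinter>\<^bsub>L\<^esub> Y \<le>\<^sub>L ?r" by (rule sup_upper[OF im imageI[OF Y]])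
        then have "(val X \<curlywedge> val Y) \<curlywedge> val ?r = val X \<curlywedge> val Y" using X Yc by (simp add: val_meet_L)
        then show "(val X \<curlywedge> val ?r) \<curlywedge> val Y = val X \<curlywedge> val Y"
          using X Yc SS restrict_restrict[of "val X" "val Y" "val ?r"] smeet_assoc[of "val X" "val ?r" "val Y"] by simp
      qed (use X SS in simp_all)
      then show "?l \<le>\<^sub>L ?r"
        using X SS s(1) restrict_restrict[of "val X" s "val ?r"] smeet_assoc[of "val X" "val ?r" s]
        by (simp add: val_meet_L Ss)
    qed (use X SS in auto)
  qed
qed

end

sublocale lnframe_top \<subseteq> L: dissolution L
  by (simp add: dissolution_def L_frame)

section \<open>The nucleus of agreement of two full elements\<close>

context lnframe_top
begin

lemma val_meet [simp]: "\<lbrakk>X \<in> carrier L; Y \<in> carrier L\<rbrakk> \<Longrightarrow> val (X \<sqinter>\<^bsub>L\<^esub> Y) = val X \<curlywedge> val Y"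
  by (simp add: val_meet_L)

lemma val_join [simp]:
  assumes "X \<in> carrier L" "Y \<in> carrier L"
  shows "val (X \<squnion>\<^bsub>L\<^esub> Y) = val X \<curlyvee> val Y"
proof -
  have b: "val X \<in> base" "val Y \<in> base" using assms by simp_all
  note bc = base_closed[OF b(1)] base_closed[OF b(2)]
  have com: "val X \<curlyvee> val Y = val Y \<curlyvee> val X" using bc base_commute[OF b] by (rule sjoin_commute)
  have "X \<squnion>\<^bsub>L\<^esub> Y = {val X \<curlyvee> val Y}"
  proof (rule L.eq_if_same_upper_bounds)
    fix Z assume Z: "Z \<in> carrier L"
    have zc: "val Z \<in> base" "val Z \<in> carrier A" using Z by simp_all
    have "(val X \<curlyvee> val Y) \<curlywedge> val Z = val X \<curlyvee> val Y \<longleftrightarrow>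
        val X \<curlywedge> val Z = val X \<and> val Y \<curlywedge> val Z = val Y"
    proof
      assume j: "(val X \<curlyvee> val Y) \<curlywedge> val Z = val X \<curlyvee> val Y"
      have "val X \<curlywedge> val Z = (val X \<curlywedge> (val X \<curlyvee> val Y)) \<curlywedge> val Z" using bc by simp
      also have "\<dots> = val X" using smeet_assoc[of "val X" "val X \<curlyvee> val Y" "val Z"] j bc zc by simp
      finally have x: "val X \<curlywedge> val Z = val X" .
      have "val Y \<curlywedge> val Z = (val Y \<curlywedge> (val X \<curlyvee> val Y)) \<curlywedge> val Z" using bc com by simp
      also have "\<dots> = val Y \<curlywedge> (val X \<curlyvee> val Y)" using smeet_assoc[of "val Y" "val X \<curlyvee> val Y" "val Z"] j bc zc by simp
      finally show "val X \<curlywedge> val Z = val X \<and> val Y \<curlywedge> val Z = val Y" using x bc com by simp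
    qed (use bc zc in \<open>simp add: smeet_right\<close>)
    then show "X \<squnion>\<^bsub>L\<^esub> Y \<le>\<^sub>L Z \<longleftrightarrow> {val X \<curlyvee> val Y} \<le>\<^sub>L Z"
      unfolding L.join_le_iff[OF assms Z] by simp
  qed (use assms b in simp_all)
  then show ?thesis by simp
qed

lemma val_top [simp]: "val \<top>\<^bsub>L\<^esub> = t"
proof -
  have "{t} \<le>\<^sub>L \<top>\<^bsub>L\<^esub>" by (rule L.top_higher) simp
  then show ?thesis by simp
qed

lemma val_bottom [simp]: "val \<bottom>\<^bsub>L\<^esub> = zer A"
proof -
  have "\<bottom>\<^bsub>L\<^esub> \<le>\<^sub>L {zer A}" by (rule L.bottom_lower) simp
  then show ?thesis by simp
qed

definition eqz where "eqz x y = \<Squnion>\<^bsub>L\<^esub>{b \<in> carrier L. x \<curlywedge> val b = y \<curlywedge> val b}"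

lemma eqz_closed [simp]: "eqz x y \<in> carrier L"
  by (simp add: eqz_def L.sup_closed)

text \<open>By the second clause of \<open>L_lub\<close> the supremum of all places of agreement is
  itself a place of agreement.\<close>

lemma le_eqz_iff:
  assumes "x \<in> carrier A" "y \<in> carrier A" "b \<in> carrier L"
  shows "b \<le>\<^sub>L eqz x y \<longleftrightarrow> x \<curlywedge> val b = y \<curlywedge> val b"
proof
  let ?S = "{b \<in> carrier L. x \<curlywedge> val b = y \<curlywedge> val b}"
  have S: "?S \<subseteq> carrier L" by blast
  obtain s where s: "s \<in> base" "least L {s} (Upper L ?S)"
    "\<forall>x\<in>carrier A. \<forall>y\<in>carrier A. (\<forall>X\<in>?S. x \<curlywedge> val X = y \<curlywedge> val X) \<longrightarrow> x \<curlywedge> s = y \<curlywedge> s"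
    using L_lub[OF S] by blast
  have e: "eqz x y = {s}" unfolding eqz_def by (rule L_Sup[OF s(2)])
  have xs: "x \<curlywedge> s = y \<curlywedge> s" by (rule s(3)[rule_format]) (use assms in auto)
  show "x \<curlywedge> val b = y \<curlywedge> val b" if "b \<le>\<^sub>L eqz x y"
  proof -
    have "s \<curlywedge> val b = val b" using that e base_commute[of s "val b"] s(1) assms(3) by simp
    then have "x \<curlywedge> val b = (x \<curlywedge> s) \<curlywedge> val b" "y \<curlywedge> val b = (y \<curlywedge> s) \<curlywedge> val b"
      using assms s(1) by (simp_all add: smeet_assoc)
    then show ?thesis using xs by simp
  qed
  show "b \<le>\<^sub>L eqz x y" if "x \<curlywedge> val b = y \<curlywedge> val b"
    unfolding eqz_def using that assms(3) by (intro L.sup_upper[OF S]) simp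
qed

text \<open>\<open>E x y a\<close> is the largest \<open>b\<close> such that \<open>x\<close> and \<open>y\<close> agree on \<open>b - a\<close>: adding \<open>a\<close> on the right overrides
  both by the same element on \<open>a\<close>.\<close>

definition E where "E x y = (\<lambda>a\<in>carrier L. eqz (x \<curlyvee> val a) (y \<curlyvee> val a))"

lemma le_E_iff:
  assumes "x \<in> full" "y \<in> full" "a \<in> carrier L" "b \<in> carrier L"
  shows "b \<le>\<^sub>L E x y a \<longleftrightarrow> (x \<curlyvee> val a) \<curlywedge> val b = (y \<curlyvee> val a) \<curlywedge> val b"
  using le_eqz_iff[of "x \<curlyvee> val a" "y \<curlyvee> val a" b] assms by (simp add: E_def del: le_L)

text \<open>An override on a is recovered from its part outside the larger c and its part on c. Used
  for idempotence of \<open>E x y\<close>.\<close>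

lemma sjoin_base:
  assumes x: "x \<in> full" and a: "a \<in> base" and c: "c \<in> base" and ac: "a \<curlywedge> c = a"
  shows "(x \<curlyvee> c) \<curlyvee> ((x \<curlyvee> a) \<curlywedge> c) = x \<curlyvee> a"
proof -
  have "(x \<curlyvee> a) \<curlywedge> c = x \<curlywedge> c \<curlyvee> a" using assms by (simp add: smeet_right)
  then have "(x \<curlyvee> c) \<curlyvee> ((x \<curlyvee> a) \<curlywedge> c) = (x \<curlyvee> (c \<curlyvee> x \<curlywedge> c)) \<curlyvee> a" using assms by (simp add: sjoin_assoc)
  then show ?thesis using assms by (simp add: restrict_sjoin')
qed

text \<open>On a the right operand shows x overridden on c, outside a the left one shows x; only a
  \<curlywedge> c ends up overridden. Used for preservation of meets by
  \<open>E x y\<close>.\<close>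

lemma sjoin_meet_base:
  assumes x: "x \<in> full" and a: "a \<in> base" and c: "c \<in> base"
  shows "(x \<curlyvee> a) \<curlyvee> ((x \<curlyvee> c) \<curlywedge> a) = x \<curlyvee> (a \<curlywedge> c)"
proof -
  have "(x \<curlyvee> c) \<curlywedge> a = x \<curlywedge> a \<curlyvee> a \<curlywedge> c" using assms base_commute[OF a c] by (simp add: smeet_right)
  then have "(x \<curlyvee> a) \<curlyvee> ((x \<curlyvee> c) \<curlywedge> a) = (x \<curlyvee> (a \<curlyvee> x \<curlywedge> a)) \<curlyvee> a \<curlywedge> c" using assms by (simp add: sjoin_assoc)
  then show ?thesis using assms by (simp add: restrict_sjoin')
qed

lemma E_apply: "a \<in> carrier L \<Longrightarrow> E x y a \<in> carrier L" by (simp add: E_def)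

text \<open>Inflation: on a both elements have been overridden alike. Idempotence: with c = E x y a
  and d = E x y c, \<open>sjoin_base\<close> splits z \<curlyvee> a, for z = x and z = y, into z
  \<curlyvee> c and its own part on c; the first parts agree on d, the second ones already on c.
  Monotonicity and meets use analogous decompositions.\<close>

lemma E_nucleus:
  assumes x: "x \<in> full" and y: "y \<in> full"
  shows "E x y \<in> nucs L"
proof (rule L.nucleusI)
  note E = le_E_iff[OF x y]
  have self: "(x \<curlyvee> val a) \<curlywedge> val (E x y a) = (y \<curlyvee> val a) \<curlywedge> val (E x y a)" if "a \<in> carrier L" for a
    by (rule E[OF that E_apply[OF that], THEN iffD1, OF L.le_refl[OF E_apply[OF that]]])
  show "E x y \<in> extensional (carrier L)" by (simp add: E_def)
  fix a assume a: "a \<in> carrier L"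
  show "E x y a \<in> carrier L" by (rule E_apply[OF a])
  show infl: "a \<le>\<^sub>L E x y a" unfolding E[OF a a] using a x y by simp
  let ?c = "E x y a" and ?d = "E x y (E x y a)"
  have c: "?c \<in> carrier L" "?d \<in> carrier L" using E_apply[OF a] E_apply[OF E_apply[OF a]] by auto
  have cb: "val ?c \<in> base" "val ?d \<in> base" "val a \<in> base" using c a by auto
  have eq: "(z \<curlyvee> val a) \<curlywedge> val ?d = (z \<curlyvee> val ?c) \<curlywedge> val ?d \<curlyvee> ((z \<curlyvee> val a) \<curlywedge> val ?c) \<curlywedge> val ?d" if z: "z \<in> full" for z
  proof -
    have "z \<curlyvee> val a = (z \<curlyvee> val ?c) \<curlyvee> ((z \<curlyvee> val a) \<curlywedge> val ?c)"
      using sjoin_base[OF z cb(3,1)] infl by simp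
    then have "(z \<curlyvee> val a) \<curlywedge> val ?d = ((z \<curlyvee> val ?c) \<curlyvee> ((z \<curlyvee> val a) \<curlywedge> val ?c)) \<curlywedge> val ?d" by (rule arg_cong)
    also have "\<dots> = (z \<curlyvee> val ?c) \<curlywedge> val ?d \<curlyvee> ((z \<curlyvee> val a) \<curlywedge> val ?c) \<curlywedge> val ?d"
      using z cb by (intro smeet_right) simp_all
    finally show ?thesis .
  qed
  show "?d \<le>\<^sub>L ?c"
    unfolding E[OF a c(2)] eq[OF x] eq[OF y] self[OF a] self[OF c(1)] by (rule HOL.refl)
next
  note E = le_E_iff[OF x y]
  have self: "(x \<curlyvee> val a) \<curlywedge> val (E x y a) = (y \<curlyvee> val a) \<curlywedge> val (E x y a)" if "a \<in> carrier L" for a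
    by (rule E[OF that E_apply[OF that], THEN iffD1, OF L.le_refl[OF E_apply[OF that]]])
  fix a b assume a: "a \<in> carrier L" and b: "b \<in> carrier L"
  let ?c = "E x y a" and ?d = "E x y b"
  have c: "?c \<in> carrier L" "?d \<in> carrier L" using E_apply a b by auto
  have cb: "val ?c \<in> base" "val ?d \<in> base" "val a \<in> base" "val b \<in> base" using c a b by auto
  show "?c \<le>\<^sub>L ?d" if ab: "a \<le>\<^sub>L b"
  proof -
    have j: "val a \<curlyvee> val b = val b" using ab cb by (simp add: sjoin_absorb)
    have eq: "(z \<curlyvee> val b) \<curlywedge> val ?c = (z \<curlyvee> val a) \<curlywedge> val ?c \<curlyvee> val b \<curlywedge> val ?c" if z: "z \<in> full" for z
    proof -
      have "z \<curlyvee> val b = (z \<curlyvee> val a) \<curlyvee> val b" using z cb j by (simp add: sjoin_assoc)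
      then have "(z \<curlyvee> val b) \<curlywedge> val ?c = ((z \<curlyvee> val a) \<curlyvee> val b) \<curlywedge> val ?c" by (rule arg_cong)
      also have "\<dots> = (z \<curlyvee> val a) \<curlywedge> val ?c \<curlyvee> val b \<curlywedge> val ?c" using z cb by (intro smeet_right) simp_all
      finally show ?thesis .
    qed
    show ?thesis unfolding E[OF b c(1)] eq[OF x] eq[OF y] self[OF a] by (rule HOL.refl)
  qed
  let ?m = "?c \<sqinter>\<^bsub>L\<^esub> ?d"
  have m: "?m \<in> carrier L" "val ?m \<in> base" "a \<sqinter>\<^bsub>L\<^esub> b \<in> carrier L" using c a b by auto
  have self': "(x \<curlyvee> val a) \<curlywedge> val ?m = (y \<curlyvee> val a) \<curlywedge> val ?m" "(x \<curlyvee> val b) \<curlywedge> val ?m = (y \<curlyvee> val b) \<curlywedge> val ?m"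
    using E[OF a m(1)] E[OF b m(1)] L.meet_left[OF c] L.meet_right[OF c] by (simp_all del: le_L val_meet)
  have eq: "(z \<curlyvee> val a \<curlywedge> val b) \<curlywedge> val ?m = (z \<curlyvee> val a) \<curlywedge> val ?m \<curlyvee> ((z \<curlyvee> val b) \<curlywedge> val ?m) \<curlywedge> val a" if z: "z \<in> full" for z
  proof -
    have "(z \<curlyvee> val a \<curlywedge> val b) \<curlywedge> val ?m = ((z \<curlyvee> val a) \<curlyvee> ((z \<curlyvee> val b) \<curlywedge> val a)) \<curlywedge> val ?m"
      unfolding sjoin_meet_base[OF z cb(3,4)] by (rule HOL.refl)
    also have "\<dots> = (z \<curlyvee> val a) \<curlywedge> val ?m \<curlyvee> ((z \<curlyvee> val b) \<curlywedge> val a) \<curlywedge> val ?m"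
      using z cb m(2) by (intro smeet_right) simp_all
    also have "((z \<curlyvee> val b) \<curlywedge> val a) \<curlywedge> val ?m = ((z \<curlyvee> val b) \<curlywedge> val ?m) \<curlywedge> val a"
      using z cb m(2) base_commute[OF cb(3) m(2)] by (simp add: smeet_assoc del: val_meet)
    finally show ?thesis .
  qed
  show "?m \<le>\<^sub>L E x y (a \<sqinter>\<^bsub>L\<^esub> b)"
    unfolding E[OF m(3,1)] val_meet[OF a b] eq[OF x] eq[OF y] self' by (rule HOL.refl)
qed

lemma E_valued_set: "valued_set (nuclei L) full E"
proof (intro valued_set.intro valued_set_axioms.intro)
  show "frame_lattice (nuclei L)" by (rule L.nuclei_frame)
  fix x y z assume c: "x \<in> full" "y \<in> full" "z \<in> full"
  show "E x y \<in> nucs L" by (rule E_nucleus[OF c(1,2)])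
  show "E x y = E y x" by (intro L.nucleus_eqI E_nucleus c) (simp add: E_def eqz_def eq_commute)
  have "\<top>\<^bsub>L\<^esub> \<le>\<^sub>L E x x \<bottom>\<^bsub>L\<^esub>" using le_E_iff[OF c(1,1), of "\<bottom>\<^bsub>L\<^esub>" "\<top>\<^bsub>L\<^esub>"] by (simp del: le_L)
  then have "\<top>\<^bsub>nuclei L\<^esub> \<preceq>\<^bsub>L\<^esub> E x x"
    using L.closed_nucleus_le_iff[OF L.top_closed E_nucleus[OF c(1,1)]] by (simp del: le_L)
  then show "E x x = \<top>\<^bsub>nuclei L\<^esub>" by (intro L.N.top_unique E_nucleus c)
  show "E x y \<sqinter>\<^bsub>nuclei L\<^esub> E y z \<preceq>\<^bsub>L\<^esub> E x z"
    unfolding nuclei_le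
  proof
    fix a assume a: "a \<in> carrier L"
    let ?m = "E x y a \<sqinter>\<^bsub>L\<^esub> E y z a"
    have m: "?m \<in> carrier L" using E_apply[OF a] by simp
    have "?m \<le>\<^sub>L E x y a" "?m \<le>\<^sub>L E y z a" using E_apply[OF a] L.meet_left L.meet_right by (simp_all del: le_L)
    then have "?m \<le>\<^sub>L E x z a" using c a m le_E_iff by (simp del: le_L val_meet)
    then show "(E x y \<sqinter>\<^bsub>nuclei L\<^esub> E y z) a \<le>\<^sub>L E x z a"
      using L.meet_nucleus_apply[OF E_nucleus[OF c(1,2)] E_nucleus[OF c(2,3)] a] by simp
  qed
qed

end

sublocale lnframe_top \<subseteq> V: valued_set "nuclei L" full E
  by (rule E_valued_set)

section \<open>Representability of singletons with closed extent\<close>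

context lnframe_top
begin

text \<open>A closed nucleus is tested at the bottom, where overriding by zero changes
  nothing.\<close>

lemma E_top_iff:
  assumes "x \<in> full" "y \<in> full" "b \<in> carrier L"
  shows "closed_nucleus L b \<preceq>\<^bsub>L\<^esub> E x y \<longleftrightarrow> x \<curlywedge> val b = y \<curlywedge> val b"
proof -
  have "z \<curlyvee> zer A = z" if "z \<in> full" for z using zer_sjoin[of z] that by simp
  then show ?thesis
    using L.closed_nucleus_le_iff[OF assms(3) E_nucleus[OF assms(1,2)]]
      le_E_iff[OF assms(1,2) L.bottom_closed assms(3)] assms by (simp del: le_L)
qed

text \<open>The conditions on a singleton of nuclei, evaluated at an argument a and tested against
  elements c of L; meets of nuclei are pointwise, so nothing is lost.\<close>

lemma singletonD:
  assumes \<sigma>: "\<sigma> \<in> sections V.singletons \<nu>" and c: "a \<in> carrier L" "c \<in> carrier L"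
  shows "x \<in> full \<Longrightarrow> \<sigma> x \<in> nucs L" "x \<in> full \<Longrightarrow> \<sigma> x a \<in> carrier L"
    "\<lbrakk>x \<in> full; y \<in> full; c \<le>\<^sub>L \<sigma> x a; c \<le>\<^sub>L \<sigma> y a\<rbrakk> \<Longrightarrow> c \<le>\<^sub>L E x y a"
    "\<lbrakk>x \<in> full; y \<in> full; c \<le>\<^sub>L \<sigma> x a; c \<le>\<^sub>L E x y a\<rbrakk> \<Longrightarrow> c \<le>\<^sub>L \<sigma> y a"
proof -
  note \<sigma>D = V.singletonsD[OF \<sigma>]
  show n: "x \<in> full \<Longrightarrow> \<sigma> x \<in> nucs L" for x by (rule \<sigma>D(2))
  show cl: "x \<in> full \<Longrightarrow> \<sigma> x a \<in> carrier L" for x using L.nucleus_closed[OF n c(1)] .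
  fix x y assume x: "x \<in> full" and y: "y \<in> full" and cx: "c \<le>\<^sub>L \<sigma> x a"
  note En = E_nucleus[OF x y]
  show "c \<le>\<^sub>L E x y a" if "c \<le>\<^sub>L \<sigma> y a"
  proof -
    have "c \<le>\<^sub>L (\<sigma> x \<sqinter>\<^bsub>nuclei L\<^esub> \<sigma> y) a"
      unfolding L.meet_nucleus_apply[OF n[OF x] n[OF y] c(1)] by (rule L.meet_le[OF cx that cl[OF x] cl[OF y] c(2)])
    moreover have "(\<sigma> x \<sqinter>\<^bsub>nuclei L\<^esub> \<sigma> y) a \<le>\<^sub>L E x y a"
      using \<sigma>D(4)[OF x y] c(1) by (simp add: nuclei_le del: le_L)
    ultimately show ?thesis
      using c cl[OF x] cl[OF y] n[OF x] n[OF y] E_apply[OF c(1)] L.nucleus_closed[OF L.N.meet_closed[OF n[OF x] n[OF y]] c(1)]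
      by (blast intro: L.le_trans)
  qed
  show "c \<le>\<^sub>L \<sigma> y a" if "c \<le>\<^sub>L E x y a"
  proof -
    have "c \<le>\<^sub>L (\<sigma> x \<sqinter>\<^bsub>nuclei L\<^esub> E x y) a"
      unfolding L.meet_nucleus_apply[OF n[OF x] En c(1)] by (rule L.meet_le[OF cx that cl[OF x] E_apply[OF c(1)] c(2)])
    moreover have "(\<sigma> x \<sqinter>\<^bsub>nuclei L\<^esub> E x y) a \<le>\<^sub>L \<sigma> y a"
      using \<sigma>D(5)[OF x y] c(1) by (simp add: nuclei_le del: le_L)
    ultimately show ?thesis
      using c cl[OF x] cl[OF y] n[OF x] n[OF y] E_apply[OF c(1)] L.nucleus_closed[OF L.N.meet_closed[OF n[OF x] En] c(1)]
      by (blast intro: L.le_trans)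
  qed
qed

text \<open>Let c x stand for \<sigma> x a. The singleton condition says that x and y agree on c x
  \<curlywedge> c y outside a, so the elements (x \<curlyvee> a) \<curlywedge> c x commute and have
  a supremum s. Extended to a full element w, it agrees with every x on c x outside a; so \<sigma> x
  a lies below E x w a, and then below \<sigma> w a because \<sigma> respects agreement.\<close>

lemma singleton_attained:
  assumes \<sigma>: "\<sigma> \<in> sections V.singletons \<nu>" and a: "a \<in> carrier L"
  obtains w where "w \<in> full" "\<And>x. x \<in> full \<Longrightarrow> \<sigma> x a \<le>\<^sub>L \<sigma> w a"
proof -
  define c where "c x = val (\<sigma> x a)" for x
  \<comment> \<open>The part of x over c x with everything over a replaced by the same element, so
    that only what happens outside a can obstruct commutation.\<close>
  define z where "z x = (x \<curlyvee> val a) \<curlywedge> c x" for x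
  let ?C = "z ` full"
  note \<sigma>D = singletonD[OF \<sigma> a]
  have cl: "\<sigma> x a \<in> carrier L" if "x \<in> full" for x using \<sigma>D(2)[OF a that] .
  have ab: "val a \<in> base" using a by simp
  have cb: "c x \<in> base" if "x \<in> full" for x using cl[OF that] by (simp add: c_def)
  have zc: "z x \<in> carrier A" if "x \<in> full" for x using that cb[OF that] ab by (simp add: z_def)
  have ca: "val a \<curlywedge> c x = val a" if "x \<in> full" for x
    using L.nucleus_inflationary[OF \<sigma>D(1)[OF a that] a] by (simp add: c_def)
  have comm: "z x \<curlywedge> z y = z y \<curlywedge> z x" if x: "x \<in> full" and y: "y \<in> full" for x y
  proof -
    have half: "z x \<curlywedge> z y = (x \<curlyvee> val a) \<curlywedge> (c x \<curlywedge> c y)" if x: "x \<in> full" and y: "y \<in> full" for x y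
    proof -
      have "c x \<curlywedge> ((y \<curlyvee> val a) \<curlywedge> c y) = c x \<curlywedge> c y"
        using smeet_assoc[of "c x" "y \<curlyvee> val a" "c y"] x y ab cb by simp
      then show ?thesis using x y ab cb by (simp add: z_def smeet_assoc)
    qed
    let ?m = "\<sigma> x a \<sqinter>\<^bsub>L\<^esub> \<sigma> y a"
    have m: "?m \<in> carrier L" "?m \<le>\<^sub>L \<sigma> x a" "?m \<le>\<^sub>L \<sigma> y a"
      using cl[OF x] cl[OF y] L.meet_left L.meet_right by (simp_all del: le_L)
    have "?m \<le>\<^sub>L E x y a" by (rule \<sigma>D(3)[OF m(1) x y m(2,3)])
    then have "(x \<curlyvee> val a) \<curlywedge> (c x \<curlywedge> c y) = (y \<curlyvee> val a) \<curlywedge> (c x \<curlywedge> c y)"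
      unfolding le_E_iff[OF x y a m(1)] val_meet[OF cl[OF x] cl[OF y]] c_def .
    then show ?thesis using half[OF x y] half[OF y x] base_commute[OF cb[OF x] cb[OF y]] by simp
  qed
  have C: "?C \<noteq> {}" "?C \<subseteq> carrier A" using top_full zc by blast+
  have "u \<curlywedge> v = v \<curlywedge> u" if "u \<in> ?C" "v \<in> ?C" for u v using that comm by (elim imageE) simp
  from commutingI[OF C this] have com: "commuting_subset A ?C" .
  define s where "s = \<Squnion>\<^bsub>natural_order A\<^esub> ?C"
  note s = natural_SupD[OF com, folded s_def]
  \<comment> \<open>The join with t on the left fills s up to a full element; s prevails wherever it
    is defined.\<close>
  let ?w = "t \<curlyvee> s"
  show thesis
  proof (rule that)
    show w: "?w \<in> full" using s(1) by simp
    fix x assume x: "x \<in> full"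
    note cl[OF x] cb[OF x] zc[OF x]
    have sz: "s \<curlywedge> z x = z x" by (rule s(3)[OF imageI[OF x]])
    have "s \<curlywedge> c x = z x"
      using smeet_assoc[of s "x \<curlyvee> val a" "c x"] sz s(1) x ab cb[OF x] by (simp add: z_def)
    then have "?w \<curlywedge> c x = c x \<curlyvee> z x" using s(1) cb[OF x] by (simp add: smeet_right)
    also have "\<dots> = z x" using x ab cb[OF x] unfolding z_def by (intro restrict_sjoin') simp_all
    finally have wc: "?w \<curlywedge> c x = z x" .
    have "(?w \<curlyvee> val a) \<curlywedge> c x = z x \<curlyvee> val a" using wc s(1) cb[OF x] ab ca[OF x] by (simp add: smeet_right)
    also have "\<dots> = (x \<curlyvee> val a) \<curlywedge> c x" using x cb[OF x] ab ca[OF x] by (simp add: z_def smeet_right sjoin_assoc)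
    finally have "\<sigma> x a \<le>\<^sub>L E x ?w a" unfolding le_E_iff[OF x w a cl[OF x]] c_def by (rule sym)
    then show "\<sigma> x a \<le>\<^sub>L \<sigma> ?w a" using \<sigma>D(4)[OF cl[OF x] x w] L.le_refl[OF cl[OF x]] by blast
  qed
qed

text \<open>The element \<open>v\<close> is \<open>w'\<close> on \<open>a\<close> and \<open>w\<close> elsewhere.\<close>

lemma patch_full:
  assumes w: "w \<in> full" and w': "w' \<in> full" and a: "a \<in> carrier L"
  defines "v \<equiv> w \<curlyvee> w' \<curlywedge> val a"
  shows "v \<in> full" "E w v a = \<top>\<^bsub>L\<^esub>" "a' \<in> carrier L \<Longrightarrow> a \<le>\<^sub>L E w' v a'"
proof -
  have ab: "val a \<in> base" using a by simp
  show v: "v \<in> full" using w w' ab by (simp add: v_def)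
  have "w' \<curlywedge> val a \<curlyvee> val a = val a"
    using w' ab smeet_assoc[of w' "val a" "val a"] by (intro sjoin_absorb) simp_all
  then have "v \<curlyvee> val a = w \<curlyvee> val a" using w w' ab by (simp add: v_def sjoin_assoc)
  then have "\<top>\<^bsub>L\<^esub> \<le>\<^sub>L E w v a" unfolding le_E_iff[OF w v a L.top_closed] by simp
  then show "E w v a = \<top>\<^bsub>L\<^esub>" by (intro L.top_unique E_apply a)
  assume a': "a' \<in> carrier L"
  then have ab': "val a' \<in> base" by simp
  have "v \<curlywedge> val a = w \<curlywedge> val a \<curlyvee> (w' \<curlywedge> val a) \<curlywedge> val a" unfolding v_def using w w' ab by (intro smeet_right) simp_all
  also have "(w' \<curlywedge> val a) \<curlywedge> val a = w' \<curlywedge> val a" using w' ab by (simp add: smeet_assoc)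
  also have "w \<curlywedge> val a \<curlyvee> w' \<curlywedge> val a = w' \<curlywedge> val a" using w w' ab by (intro restrict_sjoin)
  finally show "a \<le>\<^sub>L E w' v a'"
    unfolding le_E_iff[OF w' v a' a] using w w' v ab ab' by (simp add: smeet_right)
qed

text \<open>Suprema of nuclei are not pointwise in general, but here the pointwise maximum \<tau> is
  a nucleus: two maximal elements for different arguments can be patched into one that serves both.
  Then the closed nucleus of b is below \<tau>, and evaluation at \<bottom> gives b \<sqsubseteq>
  \<sigma> (w \<bottom>) \<bottom>. For a closed nucleus this single inequality says that all of it
  is below \<sigma> (w \<bottom>).\<close>

lemma singleton_complete:
  assumes \<sigma>: "\<sigma> \<in> sections V.singletons (closed_nucleus L b)" and b: "b \<in> carrier L"
  obtains w where "w \<in> full" "closed_nucleus L b \<preceq>\<^bsub>L\<^esub> \<sigma> w"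
proof -
  note \<sigma>D = singletonD[OF \<sigma>]
  have n: "x \<in> full \<Longrightarrow> \<sigma> x \<in> nucs L" for x using V.singletonsD(2)[OF \<sigma>] .
  have cl: "\<lbrakk>a \<in> carrier L; x \<in> full\<rbrakk> \<Longrightarrow> \<sigma> x a \<in> carrier L" for a x using \<sigma>D(2) .
  have "\<exists>w. w \<in> full \<and> (\<forall>x\<in>full. \<sigma> x a \<le>\<^sub>L \<sigma> w a)" if "a \<in> carrier L" for a
    using singleton_attained[OF \<sigma> that] by metis
  then obtain w where w: "\<And>a. a \<in> carrier L \<Longrightarrow> w a \<in> full"
    and wmax: "\<And>a x. \<lbrakk>a \<in> carrier L; x \<in> full\<rbrakk> \<Longrightarrow> \<sigma> x a \<le>\<^sub>L \<sigma> (w a) a" by metis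
  \<comment> \<open>as the maximum is attained, \<open>\<tau>\<close> is a nucleus, hence the supremum of all \<open>\<sigma> x\<close>\<close>
  define \<tau> where "\<tau> = (\<lambda>a\<in>carrier L. \<sigma> (w a) a)"
  have \<tau>c: "a \<in> carrier L \<Longrightarrow> \<tau> a \<in> carrier L" for a using cl w by (simp add: \<tau>_def)
  have \<tau>m: "\<lbrakk>a \<in> carrier L; x \<in> full; c \<in> carrier L; c \<le>\<^sub>L \<sigma> x a\<rbrakk> \<Longrightarrow> c \<le>\<^sub>L \<tau> a" for a x c
    using L.le_trans[OF _ wmax] cl w by (simp add: \<tau>_def del: le_L)
  have top: "c \<le>\<^sub>L \<sigma> v a" if "x \<in> full" "v \<in> full" "a \<in> carrier L" "c \<in> carrier L" "E x v a = \<top>\<^bsub>L\<^esub>" "c \<le>\<^sub>L \<sigma> x a" for x v a c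
    using \<sigma>D(4)[OF that(3,4,1,2,6)] that(5) L.top_higher[OF that(4)] by simp
  have "\<tau> \<in> nucs L"
  proof (rule L.nucleusI)
    show "\<tau> \<in> extensional (carrier L)" by (simp add: \<tau>_def)
    show "a \<in> carrier L \<Longrightarrow> \<tau> a \<in> carrier L" for a by (rule \<tau>c)
    show "a \<le>\<^sub>L \<tau> a" if a: "a \<in> carrier L" for a
      using L.nucleus_inflationary[OF n[OF w[OF a]] a] a by (simp add: \<tau>_def del: le_L)
    show "\<tau> a \<le>\<^sub>L \<tau> a'" if a: "a \<in> carrier L" "a' \<in> carrier L" "a \<le>\<^sub>L a'" for a a'
      using L.nucleus_mono[OF n[OF w[OF a(1)]] a] a by (intro \<tau>m[OF a(2) w[OF a(1)] \<tau>c]) (simp_all add: \<tau>_def del: le_L)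
    show "\<tau> (\<tau> a) \<le>\<^sub>L \<tau> a" if a: "a \<in> carrier L" for a
    proof -
      let ?c = "\<tau> a" and ?d = "\<tau> (\<tau> a)" and ?w = "w a" and ?w' = "w (\<tau> a)"
      have c: "?c \<in> carrier L" "?d \<in> carrier L" using \<tau>c a by auto
      have eq: "?c = \<sigma> ?w a" "?d = \<sigma> ?w' ?c" using a c(1) by (auto simp: \<tau>_def)
      \<comment> \<open>Patched so that a single nucleus \<sigma> v does the work of both: outside
        \<tau> a it is the maximal element for \<tau> a, on \<tau> a the one for a. Idempotence of
        \<sigma> v gives that of \<tau>.\<close>
      let ?v = "?w' \<curlyvee> ?w \<curlywedge> val ?c"
      note v = patch_full[OF w[OF c(1)] w[OF a] c(1)]
      have "?d \<le>\<^sub>L \<sigma> ?v ?c" using top[OF w[OF c(1)] v(1) c v(2)] eq(2) L.le_refl[OF c(2)] by simp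
      moreover have "?c \<le>\<^sub>L \<sigma> ?v a"
        using \<sigma>D(4)[OF a c(1) w[OF a] v(1) _ v(3)[OF a]] eq(1) L.le_refl[OF c(1)] by simp
      then have "\<sigma> ?v ?c \<le>\<^sub>L \<sigma> ?v (\<sigma> ?v a)"
        using L.nucleus_mono[OF n[OF v(1)] c(1) cl[OF a v(1)]] by blast
      ultimately have "?d \<le>\<^sub>L \<sigma> ?v a"
        using L.le_trans c cl[OF a v(1)] cl[OF c(1) v(1)] L.nucleus_idem[OF n[OF v(1)] a] by metis
      then show ?thesis by (rule \<tau>m[OF a v(1) c(2)])
    qed
    show "\<tau> a \<sqinter>\<^bsub>L\<^esub> \<tau> a' \<le>\<^sub>L \<tau> (a \<sqinter>\<^bsub>L\<^esub> a')" if a: "a \<in> carrier L" and a': "a' \<in> carrier L" for a a'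
    proof -
      let ?c = "\<tau> a \<sqinter>\<^bsub>L\<^esub> \<tau> a'" and ?w = "w a" and ?w' = "w a'"
      have c: "?c \<in> carrier L" using \<tau>c a a' by simp
      have cle: "?c \<le>\<^sub>L \<sigma> ?w a" "?c \<le>\<^sub>L \<sigma> ?w' a'"
        using L.meet_left[OF \<tau>c[OF a] \<tau>c[OF a']] L.meet_right[OF \<tau>c[OF a] \<tau>c[OF a']] a a' by (simp_all add: \<tau>_def del: le_L)
      \<comment> \<open>This element is as good as w at a, and on a as good as w'. So c
        \<sqsubseteq> \<sigma> v a and c \<sqinter> a \<sqsubseteq> \<sigma> v a'; as \<sigma> v is
        a nucleus, c \<sqsubseteq> \<sigma> v c \<sqinter> \<sigma> v a = \<sigma> v (c \<sqinter>
        a) \<sqsubseteq> \<sigma> v a'.\<close>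
      let ?v = "?w \<curlyvee> ?w' \<curlywedge> val a"
      note v = patch_full[OF w[OF a] w[OF a'] a]
      note vc = cl[OF a v(1)] cl[OF a' v(1)] L.nucleus_closed[OF n[OF v(1)]]
      have 1: "?c \<le>\<^sub>L \<sigma> ?v a" by (rule top[OF w[OF a] v(1) a c v(2) cle(1)])
      have ca: "?c \<sqinter>\<^bsub>L\<^esub> a \<in> carrier L" using c a by simp
      have "?c \<sqinter>\<^bsub>L\<^esub> a \<le>\<^sub>L \<sigma> ?v a'"
      proof (rule \<sigma>D(4)[OF a' ca w[OF a'] v(1)])
        show "?c \<sqinter>\<^bsub>L\<^esub> a \<le>\<^sub>L \<sigma> ?w' a'"
          by (rule L.le_trans[OF L.meet_left[OF c a] cle(2) ca c cl[OF a' w[OF a']]])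
        show "?c \<sqinter>\<^bsub>L\<^esub> a \<le>\<^sub>L E ?w' ?v a'"
          by (rule L.le_trans[OF L.meet_right[OF c a] v(3)[OF a'] ca a E_apply[OF a']])
      qed
      then have "\<sigma> ?v (?c \<sqinter>\<^bsub>L\<^esub> a) \<le>\<^sub>L \<sigma> ?v a'"
        using L.nucleus_mono[OF n[OF v(1)] ca vc(2)] L.nucleus_idem[OF n[OF v(1)] a'] by simp
      moreover have "?c \<le>\<^sub>L \<sigma> ?v (?c \<sqinter>\<^bsub>L\<^esub> a)"
        unfolding L.nucleus_meet[OF n[OF v(1)] c a]
        by (rule L.meet_le[OF L.nucleus_inflationary[OF n[OF v(1)] c] 1 vc(3)[OF c] vc(1) c])
      ultimately have "?c \<le>\<^sub>L \<sigma> ?v a'" using L.le_trans[OF _ _ c vc(3)[OF ca] vc(2)] by blast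
      then have "?c \<le>\<^sub>L \<sigma> ?v (a \<sqinter>\<^bsub>L\<^esub> a')"
        unfolding L.nucleus_meet[OF n[OF v(1)] a a'] by (rule L.meet_le[OF 1 _ vc(1,2) c])
      then show ?thesis using a a' by (intro \<tau>m[OF _ v(1) c]) auto
    qed
  qed
  then have \<tau>n: "\<tau> \<in> nucs L" .
  have "\<sigma> x \<preceq>\<^bsub>L\<^esub> \<tau>" if "x \<in> full" for x
    unfolding nuclei_le using wmax[OF _ that] by (simp add: \<tau>_def del: le_L)
  then have "closed_nucleus L b \<preceq>\<^bsub>L\<^esub> \<tau>"
    using V.singletonsD(3,6)[OF \<sigma>] L.N.Sup_le_iff[of "\<sigma> ` full" \<tau>] \<tau>n by simp
  then have "b \<le>\<^sub>L \<sigma> (w \<bottom>\<^bsub>L\<^esub>) \<bottom>\<^bsub>L\<^esub>"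
    using L.closed_nucleus_le_iff[OF b \<tau>n] by (simp add: \<tau>_def del: le_L)
  then show thesis
    using that[OF w[OF L.bottom_closed]] L.closed_nucleus_le_iff[OF b n[OF w[OF L.bottom_closed]]] by blast
qed

end

section \<open>The sheaf of a noncommutative frame and the isomorphism with its pairs\<close>

context lnframe_top
begin

definition enc :: "('a \<Rightarrow> 'a set \<Rightarrow> 'a set) \<Rightarrow> 'a set \<Rightarrow> 'a set" where
  "enc \<sigma> a = {x \<curlywedge> val c |x c. x \<in> full \<and> c \<in> carrier L \<and> c \<le>\<^sub>L \<sigma> x a}"
  \<comment> \<open>a singleton is a function of type \<open>'a \<Rightarrow> 'a set \<Rightarrow> 'a set\<close>; the code fits it into \<open>'a set \<Rightarrow> 'a set\<close>\<close>

text \<open>The element x \<curlywedge> c in the code of \<sigma>, with c = \<sigma> x a, determines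
  c as t \<curlywedge> (x \<curlywedge> c) and determines x up to agreement on c. If it arises from
  y in the code of \<rho>, then c is below \<rho> y a and below E y x a, hence below \<rho> x
  a.\<close>

lemma enc_le:
  assumes \<sigma>: "\<sigma> \<in> sections V.singletons \<nu>" and \<rho>: "\<rho> \<in> sections V.singletons \<nu>"
    and eq: "enc \<sigma> = enc \<rho>" and x: "x \<in> full" and a: "a \<in> carrier L"
  shows "\<sigma> x a \<le>\<^sub>L \<rho> x a"
proof -
  let ?c = "\<sigma> x a"
  have c: "?c \<in> carrier L" using singletonD(2)[OF \<sigma> a a x] .
  have "x \<curlywedge> val ?c \<in> enc \<sigma> a" unfolding enc_def using x c L.le_refl[OF c] by blast
  then have "x \<curlywedge> val ?c \<in> enc \<rho> a" by (simp only: eq)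
  then obtain y d where yd: "x \<curlywedge> val ?c = y \<curlywedge> val d" "y \<in> full" "d \<in> carrier L" "d \<le>\<^sub>L \<rho> y a"
    unfolding enc_def by blast
  have "val ?c = val d" using restrict_full[OF x, of "val ?c"] restrict_full[OF yd(2), of "val d"] c yd(1,3) by simp
  then have d: "d = ?c" using val_inj c yd(3) by simp
  have "closed_nucleus L ?c \<preceq>\<^bsub>L\<^esub> E x y" using E_top_iff[OF x yd(2) c] yd(1) d by simp
  then have "closed_nucleus L ?c a \<le>\<^sub>L E x y a" using a by (simp add: nuclei_le del: le_L)
  moreover have "?c \<le>\<^sub>L closed_nucleus L ?c a" using a c by (simp add: closed_nucleus_def L.join_left del: le_L)
  ultimately have "?c \<le>\<^sub>L E x y a"
    using L.le_trans[OF _ _ c L.nucleus_closed[OF L.closed_nucleus[OF c] a] E_apply[OF a]] by blast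
  then have "?c \<le>\<^sub>L E y x a" using V.E_sym[OF x yd(2)] by simp
  then show ?thesis using singletonD(4)[OF \<rho> a c yd(2) x] yd(4) d by simp
qed

lemma enc_inj: "inj_on enc (sections V.singletons \<nu>)"
proof (rule inj_onI)
  fix \<sigma> \<rho> assume \<sigma>: "\<sigma> \<in> sections V.singletons \<nu>" and \<rho>: "\<rho> \<in> sections V.singletons \<nu>" and eq: "enc \<sigma> = enc \<rho>"
  show "\<sigma> = \<rho>"
  proof (rule extensionalityI[of _ full])
    fix x assume x: "x \<in> full"
    show "\<sigma> x = \<rho> x"
    proof (rule L.nucleus_eqI)
      fix a assume a: "a \<in> carrier L"
      show "\<sigma> x a = \<rho> x a"
        using L.le_antisym[OF enc_le[OF \<sigma> \<rho> eq x a] enc_le[OF \<rho> \<sigma> eq[symmetric] x a]]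
          singletonD(2)[OF \<sigma> a a x] singletonD(2)[OF \<rho> a a x] by blast
    qed (use V.singletonsD(2)[OF \<sigma> x] V.singletonsD(2)[OF \<rho> x] in auto)
  qed (use V.singletonsD(1)[OF \<sigma>] V.singletonsD(1)[OF \<rho>] in auto)
qed

definition F :: "('a set \<Rightarrow> 'a set, 'a set \<Rightarrow> 'a set) presheaf" where
  "F = presheaf_image enc V.singletons"

definition germs where "germs x \<nu> = enc (V.singleton x \<nu>)"

lemma F_dsheaf: "dsheaf L F"
proof (intro dsheaf.intro dsheaf_axioms.intro)
  show "dissolution L" by (rule L.dissolution_axioms)
  have "sheaf_frame (nuclei L) V.singletons"
    by (simp add: sheaf_frame_def sheaf_frame_axioms_def L.nuclei_frame V.singletons_sheaf)
  then show "sheaf (nuclei L) F" unfolding F_def by (rule presheaf_image_sheaf) (rule enc_inj)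
  show "sections F \<top>\<^bsub>nuclei L\<^esub> \<noteq> {}"
    using V.singleton_section[OF top_full L.N.top_closed] by (auto simp: F_def presheaf_image_def)
qed

lemma germs_section: "\<lbrakk>x \<in> full; \<nu> \<in> nucs L\<rbrakk> \<Longrightarrow> germs x \<nu> \<in> sections F \<nu>"
  by (simp add: germs_def F_def presheaf_image_def V.singleton_section)

lemma germs_res:
  "\<lbrakk>x \<in> full; \<nu> \<in> nucs L; \<mu> \<in> nucs L; \<mu> \<preceq>\<^bsub>L\<^esub> \<nu>\<rbrakk>
    \<Longrightarrow> res F \<nu> \<mu> (germs x \<nu>) = germs x \<mu>"
  unfolding germs_def F_def presheaf_image_res[OF enc_inj V.singleton_section] by (simp only: V.singleton_res)

lemma germs_eq_iff:
  assumes "x \<in> full" "y \<in> full" "\<nu> \<in> nucs L"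
  shows "germs x \<nu> = germs y \<nu> \<longleftrightarrow> \<nu> \<preceq>\<^bsub>L\<^esub> E x y"
  unfolding germs_def
  using inj_on_eq_iff[OF enc_inj V.singleton_section[OF assms(1,3)] V.singleton_section[OF assms(2,3)]]
    V.singleton_eq_iff[OF assms] by simp

text \<open>\<open>singleton_complete\<close> provides a full element whose value exhausts the
  extent, and such an element represents the singleton by \<open>singleton_eqI\<close>.\<close>

lemma section_germs:
  assumes b: "b \<in> carrier L" and s: "s \<in> sections F (closed_nucleus L b)"
  obtains x where "x \<in> full" "s = germs x (closed_nucleus L b)"
proof -
  obtain \<sigma> where \<sigma>: "\<sigma> \<in> sections V.singletons (closed_nucleus L b)" "s = enc \<sigma>"
    using s by (auto simp: F_def presheaf_image_def)
  obtain w where w: "w \<in> full" "closed_nucleus L b \<preceq>\<^bsub>L\<^esub> \<sigma> w"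
    using singleton_complete[OF \<sigma>(1) b] by blast
  have "\<sigma> = V.singleton w (closed_nucleus L b)" by (rule V.singleton_eqI[OF \<sigma>(1) w L.closed_nucleus[OF b]])
  then show thesis using that[OF w(1)] \<sigma>(2) by (simp add: germs_def)
qed

text \<open>The class of a is represented by t \<curlywedge> a. The element t \<curlyvee> a is full
  and restricts to a on t \<curlywedge> a, so it supplies a section; any other full extension of a
  gives the same one.\<close>

definition to_pair :: "'a \<Rightarrow> 'a set \<times> ('a set \<Rightarrow> 'a set)" where
  "to_pair a = ({t \<curlywedge> a}, germs (t \<curlyvee> a) (closed_nucleus L {t \<curlywedge> a}))"

lemma full_part:
  assumes a: "a \<in> carrier A"
  shows "(t \<curlyvee> a) \<curlywedge> (t \<curlywedge> a) = a"
proof -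
  have "(t \<curlyvee> a) \<curlywedge> (t \<curlywedge> a) = ((t \<curlyvee> a) \<curlywedge> t) \<curlywedge> a" using a smeet_assoc[of "t \<curlyvee> a" t a] by (simp del: smeet_top smeet_full)
  also have "(t \<curlyvee> a) \<curlywedge> t = t \<curlyvee> a" using a by simp
  finally show ?thesis using a by simp
qed

text \<open>Two full elements give the same section over the closed nucleus of b exactly when their
  restrictions to b are equal, so a is recovered from its pair. Conversely a section represented by
  x over b is the image of the restriction of x to b.\<close>

lemma to_pair_bij: "bij_betw to_pair (carrier A) (carrier (pair_ob L F))"
proof -
  interpret P: dsheaf L F by (rule F_dsheaf)
  show ?thesis
    unfolding bij_betw_def
  proof
    show "inj_on to_pair (carrier A)"
    proof (rule inj_onI)
      fix a a' assume a: "a \<in> carrier A" and a': "a' \<in> carrier A" and eq: "to_pair a = to_pair a'"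
      have b: "t \<curlywedge> a = t \<curlywedge> a'" using arg_cong[OF eq, of fst] by (simp add: to_pair_def)
      have "germs (t \<curlyvee> a) (closed_nucleus L {t \<curlywedge> a}) = germs (t \<curlyvee> a') (closed_nucleus L {t \<curlywedge> a})"
        using arg_cong[OF eq, of snd] b by (simp add: to_pair_def)
      then have "(t \<curlyvee> a) \<curlywedge> (t \<curlywedge> a) = (t \<curlyvee> a') \<curlywedge> (t \<curlywedge> a)"
        using germs_eq_iff[of "t \<curlyvee> a" "t \<curlyvee> a'"] E_top_iff[of "t \<curlyvee> a" "t \<curlyvee> a'" "{t \<curlywedge> a}"] a a' by simp
      then show "a = a'" using full_part[OF a] full_part[OF a'] by (metis b)
    qed
    show "to_pair ` carrier A = carrier (pair_ob L F)"
    proof (intro equalityI subsetI)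
      fix p assume "p \<in> to_pair ` carrier A"
      then obtain a where a: "p = to_pair a" "a \<in> carrier A" by blast
      show "p \<in> carrier (pair_ob L F)"
        unfolding P.carrier_pair_ob a(1) to_pair_def fst_conv snd_conv using a(2) by (simp add: germs_section)
    next
      fix p assume p: "p \<in> carrier (pair_ob L F)"
      let ?b = "fst p"
      have b: "?b \<in> carrier L" "val ?b \<in> base" using p by auto
      obtain x where x: "x \<in> full" "snd p = germs x (closed_nucleus L ?b)"
        using section_germs[OF b(1) P.snd_closed[OF p]] by blast
      let ?a = "x \<curlywedge> val ?b"
      have a: "?a \<in> carrier A" using x b by simp
      have ta: "t \<curlywedge> ?a = val ?b" using x b by (simp add: restrict_full)
      have "(t \<curlyvee> ?a) \<curlywedge> val ?b = x \<curlywedge> val ?b" using full_part[OF a] ta by simp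
      then have "germs (t \<curlyvee> ?a) (closed_nucleus L ?b) = snd p"
        using germs_eq_iff[of "t \<curlyvee> ?a" x] E_top_iff[of "t \<curlyvee> ?a" x ?b] x a b by simp
      then have "to_pair ?a = p" using ta val_inverse[OF b(1)] by (simp add: to_pair_def prod_eq_iff)
      then show "p \<in> to_pair ` carrier A" using a by (metis imageI)
    qed
  qed
qed

lemma to_pair_rst:
  assumes a: "a \<in> carrier A" and \<nu>: "\<nu> \<in> nucs L" "\<nu> \<preceq>\<^bsub>L\<^esub> closed_nucleus L {t \<curlywedge> a}"
  shows "res F (closed_nucleus L (fst (to_pair a))) \<nu> (snd (to_pair a)) = germs (t \<curlyvee> a) \<nu>"
  using germs_res[of "t \<curlyvee> a" "closed_nucleus L {t \<curlywedge> a}" \<nu>] a \<nu> by (simp add: to_pair_def)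

lemma to_pair_smeet:
  assumes a: "a \<in> carrier A" and c: "c \<in> carrier A"
  shows "to_pair (a \<curlywedge> c) = to_pair a \<curlywedge>\<^bsub>pair_ob L F\<^esub> to_pair c"
proof -
  interpret P: dsheaf L F by (rule F_dsheaf)
  have bc: "(t \<curlywedge> a) \<curlywedge> (t \<curlywedge> c) = t \<curlywedge> (a \<curlywedge> c)"
    using a c smeet_assoc[of t a "t \<curlywedge> c"] smeet_assoc[of a t c] by simp
  have m: "{t \<curlywedge> a} \<sqinter>\<^bsub>L\<^esub> {t \<curlywedge> c} = {t \<curlywedge> (a \<curlywedge> c)}" using a c by (simp add: val_meet_L bc)
  let ?n = "closed_nucleus L {t \<curlywedge> (a \<curlywedge> c)}"
  have le: "?n \<preceq>\<^bsub>L\<^esub> closed_nucleus L {t \<curlywedge> a}"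
    unfolding m[symmetric] using a c L.meet_left[of "{t \<curlywedge> a}" "{t \<curlywedge> c}"] by (simp add: L.closed_mono_iff del: le_L)
  have "(t \<curlyvee> a) \<curlywedge> (t \<curlywedge> (a \<curlywedge> c)) = ((t \<curlyvee> a) \<curlywedge> (t \<curlywedge> a)) \<curlywedge> c"
    using a c smeet_assoc[of "t \<curlyvee> a" "t \<curlywedge> a" c] smeet_assoc[of t a c] by simp
  also have "\<dots> = (t \<curlyvee> a \<curlywedge> c) \<curlywedge> (t \<curlywedge> (a \<curlywedge> c))" using full_part[OF a] full_part[of "a \<curlywedge> c"] a c by simp
  finally have "germs (t \<curlyvee> a) ?n = germs (t \<curlyvee> a \<curlywedge> c) ?n"
    using germs_eq_iff[of "t \<curlyvee> a" "t \<curlyvee> a \<curlywedge> c" ?n] E_top_iff[of "t \<curlyvee> a" "t \<curlyvee> a \<curlywedge> c" "{t \<curlywedge> (a \<curlywedge> c)}"] a c by simp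
  moreover have "res F (closed_nucleus L {t \<curlywedge> a}) ?n (germs (t \<curlyvee> a) (closed_nucleus L {t \<curlywedge> a})) = germs (t \<curlyvee> a) ?n"
    using a c le by (intro germs_res) simp_all
  ultimately show ?thesis
    unfolding P.smeet_pair P.rst_def by (simp add: to_pair_def m)
qed

text \<open>Both sides are compared over the two pieces that make up the domain of the join. On the
  difference, \<open>E\<close> is used at the class of c: overriding by t \<curlywedge> c erases c,
  after which the two full elements are literally equal. On the class of c the right operand c
  prevails.\<close>

lemma to_pair_sjoin:
  assumes a: "a \<in> carrier A" and c: "c \<in> carrier A"
  shows "to_pair (a \<curlyvee> c) = to_pair a \<curlyvee>\<^bsub>pair_ob L F\<^esub> to_pair c"
proof -
  interpret P: dsheaf L F by (rule F_dsheaf)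
  let ?a = "{t \<curlywedge> a}" and ?c = "{t \<curlywedge> c}" and ?s = "a \<curlyvee> c" and ?cn = "closed_nucleus L"
  let ?d = "diff_nucleus L ?a ?c"
  have L: "?a \<in> carrier L" "?c \<in> carrier L" using a c by simp_all
  have D: "to_pair a \<in> carrier (pair_ob L F)" "to_pair c \<in> carrier (pair_ob L F)" "to_pair ?s \<in> carrier (pair_ob L F)"
    using bij_betwE[OF to_pair_bij] a c by simp_all
  note j = P.sjoin_pair[OF D(1,2)]
  have fst: "fst (to_pair a) = ?a" "fst (to_pair c) = ?c" "fst (to_pair ?s) = {t \<curlywedge> ?s}" by (simp_all add: to_pair_def)
  have js: "?a \<squnion>\<^bsub>L\<^esub> ?c = {t \<curlywedge> ?s}"
    using val_join[OF L] val_inverse[OF L.join_closed[OF L]] a c by (simp add: smeet_left)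
  have le: "?d \<preceq>\<^bsub>L\<^esub> ?cn ?a" "?cn ?c \<preceq>\<^bsub>L\<^esub> ?cn {t \<curlywedge> ?s}" "?cn ?a \<preceq>\<^bsub>L\<^esub> ?cn {t \<curlywedge> ?s}"
    using L L.N.meet_left L.join_left[OF L] L.join_right[OF L]
    by (simp_all add: js[symmetric] L.closed_mono_iff diff_nucleus_def del: le_L)
  have dle: "?d \<preceq>\<^bsub>L\<^esub> ?cn {t \<curlywedge> ?s}"
    using L.N.le_trans[OF le(1,3)] L a c by simp
  have cc: "t \<curlywedge> c \<curlyvee> c = c" "c \<curlyvee> t \<curlywedge> c = t \<curlywedge> c"
  proof -
    show "t \<curlywedge> c \<curlyvee> c = c" using c by simp
    have "c \<curlywedge> (t \<curlywedge> c) = c" using smeet_assoc[of c t c] c by simp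
    then show "c \<curlyvee> t \<curlywedge> c = t \<curlywedge> c" using c by (intro sjoin_absorb) simp_all
  qed
  have "(t \<curlyvee> ?s) \<curlyvee> t \<curlywedge> c = (t \<curlyvee> a) \<curlyvee> t \<curlywedge> c" using a c cc(2) by (simp add: sjoin_assoc)
  then have "?a \<le>\<^sub>L E (t \<curlyvee> ?s) (t \<curlyvee> a) ?c"
    using le_E_iff[of "t \<curlyvee> ?s" "t \<curlyvee> a" ?c ?a] a c by simp
  then have g1: "germs (t \<curlyvee> ?s) ?d = germs (t \<curlyvee> a) ?d"
    using germs_eq_iff[of "t \<curlyvee> ?s" "t \<curlyvee> a" ?d] L.diff_nucleus_le_iff[OF L(2,1) E_nucleus[of "t \<curlyvee> ?s" "t \<curlyvee> a"]] a c L
    by (simp del: le_L)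
  have ct: "c \<curlywedge> (t \<curlywedge> c) = c" using c smeet_assoc[of c t c] by simp
  have "(t \<curlyvee> ?s) \<curlywedge> (t \<curlywedge> c) = (t \<curlyvee> a) \<curlywedge> (t \<curlywedge> c) \<curlyvee> c"
    using a c ct smeet_right[of "t \<curlyvee> a" c "t \<curlywedge> c"] by (simp add: sjoin_assoc)
  also have "\<dots> = c"
  proof (rule sjoin_absorb)
    have "((t \<curlyvee> a) \<curlywedge> (t \<curlywedge> c)) \<curlywedge> c = (t \<curlyvee> a) \<curlywedge> ((t \<curlywedge> c) \<curlywedge> c)" using a c by (intro smeet_assoc) simp_all
    also have "(t \<curlywedge> c) \<curlywedge> c = t \<curlywedge> c" using c by (simp add: smeet_assoc)
    finally show "((t \<curlyvee> a) \<curlywedge> (t \<curlywedge> c)) \<curlywedge> c = (t \<curlyvee> a) \<curlywedge> (t \<curlywedge> c)" .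
  qed (use a c in simp_all)
  finally have g2: "germs (t \<curlyvee> ?s) (?cn ?c) = germs (t \<curlyvee> c) (?cn ?c)"
    using germs_eq_iff[of "t \<curlyvee> ?s" "t \<curlyvee> c" "?cn ?c"] E_top_iff[of "t \<curlyvee> ?s" "t \<curlyvee> c" ?c] full_part[OF c] a c L by simp
  show ?thesis
  proof (rule prod_eqI)
    show f: "fst (to_pair ?s) = fst (to_pair a \<curlyvee>\<^bsub>pair_ob L F\<^esub> to_pair c)" using j(2) fst js by simp
    show "snd (to_pair ?s) = snd (to_pair a \<curlyvee>\<^bsub>pair_ob L F\<^esub> to_pair c)"
    proof (rule P.N.locality2[of ?d "?cn ?c" "?cn {t \<curlywedge> ?s}"])
      show "?cn {t \<curlywedge> ?s} = ?d \<squnion>\<^bsub>nuclei L\<^esub> ?cn ?c" using P.diff_join_closed(1)[OF L] js by simp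
      show "snd (to_pair ?s) \<in> sections F (?cn {t \<curlywedge> ?s})" using P.snd_closed[OF D(3)] fst by simp
      show "snd (to_pair a \<curlyvee>\<^bsub>pair_ob L F\<^esub> to_pair c) \<in> sections F (?cn {t \<curlywedge> ?s})"
        using P.snd_closed[OF j(1)] f fst by simp
      have "res F (?cn {t \<curlywedge> ?s}) ?d (snd (to_pair ?s)) = germs (t \<curlyvee> ?s) ?d"
        using to_pair_rst[of ?s ?d] a c dle L fst by simp
      moreover have "res F (?cn ?a) ?d (snd (to_pair a)) = germs (t \<curlyvee> a) ?d"
        using to_pair_rst[of a ?d] a c le L fst by simp
      ultimately show "res F (?cn {t \<curlywedge> ?s}) ?d (snd (to_pair ?s)) =
          res F (?cn {t \<curlywedge> ?s}) ?d (snd (to_pair a \<curlyvee>\<^bsub>pair_ob L F\<^esub> to_pair c))"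
        using j(3) f g1 unfolding P.rst_def fst by simp
      have "res F (?cn {t \<curlywedge> ?s}) (?cn ?c) (snd (to_pair ?s)) = germs (t \<curlyvee> ?s) (?cn ?c)"
        using to_pair_rst[of ?s "?cn ?c"] a c le L fst by simp
      moreover have "snd (to_pair c) = germs (t \<curlyvee> c) (?cn ?c)" by (simp add: to_pair_def)
      ultimately show "res F (?cn {t \<curlywedge> ?s}) (?cn ?c) (snd (to_pair ?s)) =
          res F (?cn {t \<curlywedge> ?s}) (?cn ?c) (snd (to_pair a \<curlyvee>\<^bsub>pair_ob L F\<^esub> to_pair c))"
        using j(4) f g2 unfolding P.rst_def fst by simp
    qed (use L in simp_all)
  qed
qed

lemma to_pair_iso: "skew_iso A (pair_ob L F) to_pair"
proof -
  interpret P: dsheaf L F by (rule F_dsheaf)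
  have D: "to_pair (zer A) \<in> carrier (pair_ob L F)" using bij_betwE[OF to_pair_bij] by simp
  have f: "fst (to_pair (zer A)) = \<bottom>\<^bsub>L\<^esub>"
    using val_inverse[OF L.bottom_closed] by (simp add: to_pair_def)
  have "to_pair (zer A) = zer (pair_ob L F)"
    using P.snd_closed[OF D] f P.snd_closed[OF P.zer_pair(1)] P.zer_pair(2)
    by (intro prod_eqI P.N.bottom_section_unique) simp_all
  then show ?thesis unfolding skew_iso_def using to_pair_bij to_pair_smeet to_pair_sjoin by blast
qed

end

lemma skew_iso_comp:
  assumes f: "skew_iso A B f" and g: "skew_iso B C g"
  shows "skew_iso A C (g \<circ> f)"
proof -
  have "bij_betw (g \<circ> f) (carrier A) (carrier C)"
    using f g by (auto simp: skew_iso_def intro: bij_betw_trans)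
  moreover have "x \<in> carrier A \<Longrightarrow> f x \<in> carrier B" for x using f by (auto simp: skew_iso_def dest: bij_betwE)
  ultimately show ?thesis using f g by (simp add: skew_iso_def)
qed

lemma dual_ob_surjective:
  assumes "noncommutative_frame A" "left_handed A"
  obtains L F \<phi> where "dsheaf (L :: 'a set gorder) (F :: ('a set \<Rightarrow> 'a set, 'a set \<Rightarrow> 'a set) presheaf)"
    "\<phi> \<in> ncframe_iso (dual_ob (L, F)) (A :: 'a skew_lat)"
proof -
  interpret lnframe A using assms by (simp add: lnframe_def lnframe_axioms_def)
  obtain t where t: "t \<in> carrier A" "\<forall>x\<in>carrier A. t \<curlywedge>\<^bsub>A\<^esub> x = t \<longrightarrow> x \<curlywedge>\<^bsub>A\<^esub> t = t \<longrightarrow> x = t"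
    using maximal_exists by blast
  interpret lnframe_top A t by unfold_locales (use t in blast)+
  interpret P: dsheaf L F by (rule F_dsheaf)
  have "skew_iso A (dual_ob (L, F)) (P.basic_pair \<circ> to_pair)"
    by (rule skew_iso_comp[OF to_pair_iso P.basic_pair_iso])
  from skew_iso_inv[OF this skew_lattice_axioms zer_closed]
  have inv: "skew_iso (dual_ob (L, F)) A (inv_into (carrier A) (P.basic_pair \<circ> to_pair))" .
  interpret Q: noncommutative_frame "dual_ob (L, F)" by (rule P.dual_ob_noncommutative_frame)
  have "restrict (inv_into (carrier A) (P.basic_pair \<circ> to_pair)) (carrier (dual_ob (L, F))) \<in> ncframe_iso (dual_ob (L, F)) A"
    by (rule skew_iso_ncframe_iso(1)[OF skew_iso_restrict[OF Q.skew_lattice_axioms Q.zer_closed inv]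
          Q.noncommutative_frame_axioms assms(1)]) simp
  then show thesis by (rule that[OF F_dsheaf])
qed

section \<open>The functor to sheaves on Priestley spaces\<close>

lemma pushforward_simps [simp]: "sections (pushforward g F) U = sections F (g U)"
  "res (pushforward g F) U V = res F (g U) (g V)"
  by (simp_all add: pushforward_def)

lemma opens_frame: "frame_lattice (opens T)"
proof -
  interpret complete_lattice "opens T" by (rule opens_complete_lattice)
  show ?thesis
  proof
    fix U S assume U: "U \<in> carrier (opens T)" and S: "S \<subseteq> carrier (opens T)"
    have "U \<sqinter>\<^bsub>opens T\<^esub> s = U \<inter> s" if "s \<in> S" for s using U S that by (intro opens_meet) auto
    then have "(\<lambda>s. U \<sqinter>\<^bsub>opens T\<^esub> s) ` S = (\<lambda>s. U \<inter> s) ` S" by (rule image_cong[OF HOL.refl])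
    moreover have "(\<lambda>s. U \<inter> s) ` S \<subseteq> carrier (opens T)" using U S by auto
    ultimately have "\<Squnion>\<^bsub>opens T\<^esub>((\<lambda>s. U \<sqinter>\<^bsub>opens T\<^esub> s) ` S) = U \<inter> \<Union>S" by (simp add: opens_Sup)
    moreover have "openin T (\<Union>S)" using S by auto
    ultimately show "U \<sqinter>\<^bsub>opens T\<^esub> \<Squnion>\<^bsub>opens T\<^esub>S = \<Squnion>\<^bsub>opens T\<^esub>((\<lambda>s. U \<sqinter>\<^bsub>opens T\<^esub> s) ` S)"
      using U S by (simp add: opens_Sup opens_meet)
  qed
qed

lemma preimg_id: "openin T U \<Longrightarrow> preimg T (\<lambda>x\<in>topspace T. x) U = U"
  using openin_subset by (fastforce simp: preimg_def)

lemma preimg_compose: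
  "h \<in> topspace T \<rightarrow>\<^sub>E topspace T' \<Longrightarrow> preimg T (compose (topspace T) h' h) U = preimg T h (preimg T' h' U)"
  by (auto simp: preimg_def compose_def)

lemma openin_preimg: "\<lbrakk>continuous_map T T' h; openin T' U\<rbrakk> \<Longrightarrow> openin T (preimg T h U)"
  unfolding preimg_def by (rule openin_continuous_map_preimage)

lemma preimg_mono: "U \<subseteq> V \<Longrightarrow> preimg T h U \<subseteq> preimg T h V"
  by (auto simp: preimg_def)

lemma preimg_frame_hom:
  assumes "continuous_map T T' h"
  shows "(\<lambda>U\<in>carrier (opens T'). preimg T h U) \<in> frame_hom (opens T') (opens T)"
proof -
  have top: "preimg T h (topspace T') = topspace T"
    using continuous_map_image_subset_topspace[OF assms] by (auto simp: preimg_def)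
  have inter: "preimg T h (U \<inter> V) = preimg T h U \<inter> preimg T h V" for U V by (auto simp: preimg_def)
  have union: "preimg T h (\<Union>S) = \<Union>(preimg T h ` S)" for S by (auto simp: preimg_def)
  note op = openin_preimg[OF assms]
  have sup: "\<Squnion>\<^bsub>opens T\<^esub> ((\<lambda>U\<in>carrier (opens T'). preimg T h U) ` S) = \<Union>(preimg T h ` S)"
    if "\<forall>U\<in>S. openin T' U" for S
  proof -
    have "(\<lambda>U\<in>carrier (opens T'). preimg T h U) ` S = preimg T h ` S" using that by (intro image_cong) auto
    moreover have "preimg T h ` S \<subseteq> carrier (opens T)" using that op by auto
    ultimately show ?thesis by (simp add: opens_Sup)
  qed
  show ?thesis
    unfolding frame_hom_opens_iff
    by (intro conjI allI impI) (use op sup in \<open>simp_all add: top inter union opens_meet openin_Union openin_Int\<close>)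
qed

lemma Sh_PS_simps:
  "(T, r, G) \<in> Obj Sh_PS \<longleftrightarrow> priestley_space T r \<and> sheaf (opens T) G \<and> (\<forall>x\<in>topspace T. stalk T G x \<noteq> {})"
  "(h, \<alpha>) \<in> Hom Sh_PS (T, r, G) (T', r', G') \<longleftrightarrow> h \<in> topspace T \<rightarrow>\<^sub>E topspace T' \<and>
    continuous_map T T' h \<and> (\<forall>x y. (x, y) \<in> r \<longrightarrow> (h x, h y) \<in> r') \<and>
    \<alpha> \<in> sheaf_hom (opens T') G' (pushforward (preimg T h) G)"
  "Ident Sh_PS (T, r, G) = (\<lambda>x\<in>topspace T. x, \<lambda>U\<in>carrier (opens T). \<lambda>s\<in>sections G U. s)"
  "Comp Sh_PS (T, r, G) (T', r', G') (T'', r'', G'') (h', \<alpha>') (h, \<alpha>) = (compose (topspace T) h' h,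
     \<lambda>U\<in>carrier (opens T''). \<lambda>s\<in>sections G'' U. \<alpha> (preimg T' h' U) (\<alpha>' U s))"
  by (simp_all add: Sh_PS_def)

lemma priestley_order_topspace: "\<lbrakk>priestley_space T r; (x, y) \<in> r\<rbrakk> \<Longrightarrow> x \<in> topspace T \<and> y \<in> topspace T"
  by (auto simp: priestley_space_def partial_order_on_def preorder_on_def)

lemma Sh_PS_id_hom:
  assumes X: "(T, r, G) \<in> Obj Sh_PS"
  shows "Ident Sh_PS (T, r, G) \<in> Hom Sh_PS (T, r, G) (T, r, G)"
proof -
  interpret sheaf_frame "opens T" G
    using X by (simp add: Sh_PS_simps sheaf_frame_def sheaf_frame_axioms_def opens_frame)
  have ps: "priestley_space T r" using X by (simp add: Sh_PS_simps)
  have "continuous_map T T (\<lambda>x\<in>topspace T. x)" by (rule continuous_map_eq[OF continuous_map_id]) simp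
  moreover have "(\<lambda>U\<in>carrier (opens T). \<lambda>s\<in>sections G U. s) \<in> sheaf_hom (opens T) G (pushforward (preimg T (\<lambda>x\<in>topspace T. x)) G)"
  proof (rule sheaf_homI)
    fix U V s assume "U \<in> carrier (opens T)" "V \<in> carrier (opens T)" "V \<sqsubseteq>\<^bsub>opens T\<^esub> U" "s \<in> sections G U"
    then show "(\<lambda>U\<in>carrier (opens T). \<lambda>s\<in>sections G U. s) V (res G U V s) =
        res (pushforward (preimg T (\<lambda>x\<in>topspace T. x)) G) U V ((\<lambda>U\<in>carrier (opens T). \<lambda>s\<in>sections G U. s) U s)"
      using res_closed[of U V s] by (simp add: preimg_id)
  qed (simp_all add: preimg_id)
  ultimately show ?thesis
    unfolding Sh_PS_simps using priestley_order_topspace[OF ps] by auto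
qed

lemma Sh_PS_comp_hom:
  assumes X: "(T, r, G) \<in> Obj Sh_PS" and X'': "(T'', r'', G'') \<in> Obj Sh_PS"
    and m: "(h, \<alpha>) \<in> Hom Sh_PS (T, r, G) (T', r', G')"
    and n: "(h', \<alpha>') \<in> Hom Sh_PS (T', r', G') (T'', r'', G'')"
  shows "Comp Sh_PS (T, r, G) (T', r', G') (T'', r'', G'') (h', \<alpha>') (h, \<alpha>) \<in> Hom Sh_PS (T, r, G) (T'', r'', G'')"
proof -
  note m' = m[unfolded Sh_PS_simps] and n' = n[unfolded Sh_PS_simps]
  have h: "h \<in> topspace T \<rightarrow>\<^sub>E topspace T'" "continuous_map T T' h" and \<alpha>: "\<alpha> \<in> sheaf_hom (opens T') G' (pushforward (preimg T h) G)"
    and h': "h' \<in> topspace T' \<rightarrow>\<^sub>E topspace T''" "continuous_map T' T'' h'" and \<alpha>': "\<alpha>' \<in> sheaf_hom (opens T'') G'' (pushforward (preimg T' h') G')"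
    using m' n' by blast+
  have ps: "priestley_space T r" using X by (simp add: Sh_PS_simps)
  note pc = preimg_compose[OF h(1)] and op = openin_preimg[OF h'(2)] openin_preimg[OF h(2)]
  let ?\<beta> = "\<lambda>U\<in>carrier (opens T''). \<lambda>s\<in>sections G'' U. \<alpha> (preimg T' h' U) (\<alpha>' U s)"
  have "compose (topspace T) h' h \<in> topspace T \<rightarrow>\<^sub>E topspace T''"
    using h(1) h'(1) by (auto simp: compose_def)
  moreover have "continuous_map T T'' (compose (topspace T) h' h)"
    by (rule continuous_map_eq[OF continuous_map_compose[OF h(2) h'(2)]]) (simp add: compose_def)
  moreover have "\<forall>x y. (x, y) \<in> r \<longrightarrow> (compose (topspace T) h' h x, compose (topspace T) h' h y) \<in> r''"
    using m' n' priestley_order_topspace[OF ps] by (simp add: compose_def)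
  moreover have "?\<beta> \<in> sheaf_hom (opens T'') G'' (pushforward (preimg T (compose (topspace T) h' h)) G)"
  proof (rule sheaf_homI)
    fix U s assume U: "U \<in> carrier (opens T'')" and s: "s \<in> sections G'' U"
    have \<alpha>'s: "\<alpha>' U s \<in> sections G' (preimg T' h' U)" using sheaf_homD(3)[OF \<alpha>' U s] by simp
    then show "?\<beta> U s \<in> sections (pushforward (preimg T (compose (topspace T) h' h)) G) U"
      using sheaf_homD(3)[OF \<alpha> _ \<alpha>'s] U s op by (simp add: pc)
    fix V assume V: "V \<in> carrier (opens T'')" "V \<sqsubseteq>\<^bsub>opens T''\<^esub> U"
    have "preimg T' h' V \<sqsubseteq>\<^bsub>opens T'\<^esub> preimg T' h' U" using V(2) by (simp add: preimg_mono)
    moreover have "sheaf (opens T'') G''" using X'' by (simp add: Sh_PS_simps)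
    then have "res G'' U V s \<in> sections G'' V" using U V s by (auto simp: sheaf_def)
    ultimately show "?\<beta> V (res G'' U V s) = res (pushforward (preimg T (compose (topspace T) h' h)) G) U V (?\<beta> U s)"
      using sheaf_homD(4)[OF \<alpha>' U V s] sheaf_homD(4)[OF \<alpha> _ _ _ \<alpha>'s, of "preimg T' h' V"] U V s op by (simp add: pc)
  qed simp_all
  ultimately show ?thesis unfolding Sh_PS_simps by blast
qed

lemma Sh_PS_hom_eqI:
  assumes "(h, \<alpha>) \<in> Hom Sh_PS (T, r, G) (T', r', G')" "(k, \<beta>) \<in> Hom Sh_PS (T, r, G) (T', r', G')"
    and "\<And>x. x \<in> topspace T \<Longrightarrow> h x = k x"
    and "\<And>U s. \<lbrakk>openin T' U; s \<in> sections G' U\<rbrakk> \<Longrightarrow> \<alpha> U s = \<beta> U s"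
  shows "(h, \<alpha>) = (k, \<beta>)"
proof -
  note 1 = assms(1)[unfolded Sh_PS_simps] and 2 = assms(2)[unfolded Sh_PS_simps]
  have "h = k" by (rule extensionalityI[of _ "topspace T"]) (use 1 2 assms(3) in \<open>auto simp: PiE_def\<close>)
  moreover have "\<alpha> = \<beta>" using sheaf_hom_eqI[of \<alpha> "opens T'" G' _ \<beta>] 1 2 assms(4) by auto
  ultimately show ?thesis by simp
qed

lemma is_category_Sh_PS: "is_category Sh_PS"
  unfolding is_category_def
proof (intro conjI ballI)
  fix W X Y Z and f g k :: "('x \<Rightarrow> 'x) \<times> ('x set \<Rightarrow> 's \<Rightarrow> 's)"
  assume o: "W \<in> Obj Sh_PS" "X \<in> Obj Sh_PS" "Y \<in> Obj Sh_PS" "Z \<in> Obj Sh_PS"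
    and h: "f \<in> Hom Sh_PS W X" "g \<in> Hom Sh_PS X Y" "k \<in> Hom Sh_PS Y Z"
  obtain TW rW GW TX rX GX TY rY GY TZ rZ GZ where
    eq: "W = (TW, rW, GW)" "X = (TX, rX, GX)" "Y = (TY, rY, GY)" "Z = (TZ, rZ, GZ)"
    by (metis prod_cases3)
  obtain f0 f1 g0 g1 k0 k1 where eq': "f = (f0, f1)" "g = (g0, g1)" "k = (k0, k1)" by (metis surj_pair)
  note o = o[unfolded eq] and h = h[unfolded eq eq']
  note comp = Sh_PS_comp_hom[OF o(1,3) h(1,2)] Sh_PS_comp_hom[OF o(2,4) h(2,3)]
  note comp' = comp[unfolded Sh_PS_simps(4)]
  have a: "f0 \<in> topspace TW \<rightarrow>\<^sub>E topspace TX" "f1 \<in> sheaf_hom (opens TX) GX (pushforward (preimg TW f0) GW)"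
    "g0 \<in> topspace TX \<rightarrow>\<^sub>E topspace TY" "continuous_map TX TY g0"
    "g1 \<in> sheaf_hom (opens TY) GY (pushforward (preimg TX g0) GX)" "continuous_map TY TZ k0"
    "k1 \<in> sheaf_hom (opens TZ) GZ (pushforward (preimg TY k0) GY)"
    using h unfolding Sh_PS_simps by blast+
  show "Comp Sh_PS W Y Z k (Comp Sh_PS W X Y g f) = Comp Sh_PS W X Z (Comp Sh_PS X Y Z k g) f"
    unfolding eq eq' Sh_PS_simps(4)
  proof (rule Sh_PS_hom_eqI)
    show "(compose (topspace TW) k0 (compose (topspace TW) g0 f0), \<lambda>U\<in>carrier (opens TZ). \<lambda>s\<in>sections GZ U.
        (\<lambda>U\<in>carrier (opens TY). \<lambda>s\<in>sections GY U. f1 (preimg TX g0 U) (g1 U s)) (preimg TY k0 U) (k1 U s))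
      \<in> Hom Sh_PS (TW, rW, GW) (TZ, rZ, GZ)"
      using Sh_PS_comp_hom[OF o(1,4) comp'(1) h(3)] by (simp only: Sh_PS_simps(4))
    show "(compose (topspace TW) (compose (topspace TX) k0 g0) f0, \<lambda>U\<in>carrier (opens TZ). \<lambda>s\<in>sections GZ U.
        f1 (preimg TX (compose (topspace TX) k0 g0) U)
         ((\<lambda>U\<in>carrier (opens TZ). \<lambda>s\<in>sections GZ U. g1 (preimg TY k0 U) (k1 U s)) U s))
      \<in> Hom Sh_PS (TW, rW, GW) (TZ, rZ, GZ)"
      using Sh_PS_comp_hom[OF o(1,4) h(1) comp'(2)] by (simp only: Sh_PS_simps(4))
  next
    fix U s assume U: "openin TZ U" and s: "s \<in> sections GZ U"
    show "(\<lambda>U\<in>carrier (opens TZ). \<lambda>s\<in>sections GZ U.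
        (\<lambda>U\<in>carrier (opens TY). \<lambda>s\<in>sections GY U. f1 (preimg TX g0 U) (g1 U s)) (preimg TY k0 U) (k1 U s)) U s =
      (\<lambda>U\<in>carrier (opens TZ). \<lambda>s\<in>sections GZ U.
        f1 (preimg TX (compose (topspace TX) k0 g0) U)
         ((\<lambda>U\<in>carrier (opens TZ). \<lambda>s\<in>sections GZ U. g1 (preimg TY k0 U) (k1 U s)) U s)) U s"
      using openin_preimg[OF a(6) U] sheaf_homD(3)[OF a(7) _ s] U s by (simp add: preimg_compose[OF a(3)])
  qed (use a(1) in \<open>auto simp: compose_def\<close>)
next
  fix X Y and f :: "('x \<Rightarrow> 'x) \<times> ('x set \<Rightarrow> 's \<Rightarrow> 's)"
  assume o: "X \<in> Obj Sh_PS" "Y \<in> Obj Sh_PS" and h: "f \<in> Hom Sh_PS X Y"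
  obtain TX rX GX TY rY GY where eq: "X = (TX, rX, GX)" "Y = (TY, rY, GY)" by (metis prod_cases3)
  obtain f0 f1 where eq': "f = (f0, f1)" by (metis surj_pair)
  note o = o[unfolded eq] and h = h[unfolded eq eq']
  have a: "f0 \<in> topspace TX \<rightarrow>\<^sub>E topspace TY" "continuous_map TX TY f0"
    "f1 \<in> sheaf_hom (opens TY) GY (pushforward (preimg TX f0) GX)"
    using h unfolding Sh_PS_simps by blast+
  note a1 = sheaf_homD(3)[OF a(3)]
  show "Comp Sh_PS X X Y f (Ident Sh_PS X) = f"
    unfolding eq eq' Sh_PS_simps(3,4)
  proof (rule Sh_PS_hom_eqI[OF Sh_PS_comp_hom[OF o(1,2) Sh_PS_id_hom[OF o(1), unfolded Sh_PS_simps(3)] h, unfolded Sh_PS_simps(4)] h])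
  qed (use a1 a(2) in \<open>auto simp: compose_def openin_preimg\<close>)
  show "Comp Sh_PS X Y Y (Ident Sh_PS Y) f = f"
    unfolding eq eq' Sh_PS_simps(3,4)
  proof (rule Sh_PS_hom_eqI[OF Sh_PS_comp_hom[OF o(1,2) h Sh_PS_id_hom[OF o(2), unfolded Sh_PS_simps(3)], unfolded Sh_PS_simps(4)] h])
  qed (use a in \<open>auto simp: compose_def preimg_id\<close>)
next
  fix X Y Z and f g :: "('x \<Rightarrow> 'x) \<times> ('x set \<Rightarrow> 's \<Rightarrow> 's)"
  assume "X \<in> Obj Sh_PS" "Z \<in> Obj Sh_PS" "f \<in> Hom Sh_PS X Y" "g \<in> Hom Sh_PS Y Z"
  then show "Comp Sh_PS X Y Z g f \<in> Hom Sh_PS X Z"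
    using Sh_PS_comp_hom by (cases X; cases Y; cases Z; cases f; cases g) blast
next
  fix X :: "('x, 's) sh_ps" assume "X \<in> Obj Sh_PS"
  then show "Ident Sh_PS X \<in> Hom Sh_PS X X" using Sh_PS_id_hom by (cases X) blast
qed

text \<open>Stalks are nonempty because F has a section over every nucleus, in particular one over
  the whole space.\<close>

lemma spec_ob_closed:
  assumes "dsheaf L F"
  shows "spec_ob (L, F) \<in> Obj Sh_PS"
proof -
  interpret dsheaf L F by fact
  let ?T = "patch (spec L)" and ?G = "pushforward (j_inv L) F"
  have "sheaf (opens ?T) ?G"
    by (rule pushforward_sheaf[OF N.sheaf_frame_axioms opens_frame j_inv_hom])
  moreover have "stalk ?T ?G P \<noteq> {}" if P: "P \<in> topspace ?T" for P
  proof -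
    obtain s where "s \<in> sections ?G (topspace ?T)"
      using section_exists[OF j_inv_closed[OF openin_topspace]] by auto
    then have "germ ?T ?G P (topspace ?T) s \<in> stalk ?T ?G P" unfolding stalk_def using P by blast
    then show ?thesis by blast
  qed
  ultimately show ?thesis by (simp add: spec_ob_def Sh_PS_simps priestley_space_spec)
qed

context dissolution_hom
begin

definition spec_map where "spec_map = (\<lambda>P\<in>prime_filters L. {a \<in> carrier L'. f a \<in> P})"

lemma spec_map_closed: "spec_map \<in> prime_filters L \<rightarrow>\<^sub>E prime_filters L'"
  using preimage_prime_filter by (auto simp: spec_map_def)

lemma spec_map_continuous: "continuous_map (patch (spec L)) (patch (spec L')) spec_map"
  unfolding L'.patch_spec continuous_on_generated_topo_iff
proof (intro conjI allI impI)
  let ?T = "patch (spec L)"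
  have pre: "spec_map -` U \<inter> topspace ?T = preimg ?T spec_map U" for U by (auto simp: preimg_def)
  note basic = preimg_basic[folded spec_map_def]
  fix U assume "U \<in> L'.patch_subbase"
  then consider a where "a \<in> carrier L'" "U = basic_open L' a"
    | a where "a \<in> carrier L'" "U = prime_filters L' - basic_open L' a" unfolding L'.patch_subbase_def by blast
  then show "openin (patch (spec L)) (spec_map -` U \<inter> topspace (patch (spec L)))"
  proof cases
    case 1
    then show ?thesis unfolding pre by (simp add: basic)
  next
    case 2
    have "preimg ?T spec_map (prime_filters L' - B) = prime_filters L - preimg ?T spec_map B" for B
      unfolding preimg_def L.topspace_patch using spec_map_closed by blast
    then show ?thesis unfolding pre using 2 by (simp add: basic)
  qed
next
  show "spec_map ` topspace (patch (spec L)) \<subseteq> \<Union>L'.patch_subbase"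
    unfolding L'.Union_patch_subbase using spec_map_closed by auto
qed

text \<open>Naturality of j. Both composites are frame morphisms out of the patch topology, and they
  agree on basic opens, which determine such morphisms.\<close>

lemma dissolution_map_j_inv:
  assumes W: "openin (patch (spec L')) W"
  shows "g (j_inv L' W) = j_inv L (preimg (patch (spec L)) spec_map W)"
proof -
  let ?O' = "carrier (opens (patch (spec L')))"
  let ?p = "\<lambda>U\<in>?O'. preimg (patch (spec L)) spec_map U"
  have "compose ?O' g (j_inv L') = compose ?O' (j_inv L) ?p"
  proof (rule L'.patch_hom_unique[OF L.nuclei_frame])
    show "compose ?O' g (j_inv L') \<in> frame_hom (opens (patch (spec L'))) (nuclei L)"
      by (rule frame_hom_compose[OF L'.j_inv_hom dissolution_map_hom opens_complete_lattice])
    show "compose ?O' (j_inv L) ?p \<in> frame_hom (opens (patch (spec L'))) (nuclei L)"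
      by (rule frame_hom_compose[OF preimg_frame_hom[OF spec_map_continuous] L.j_inv_hom opens_complete_lattice])
    fix a assume "a \<in> carrier L'"
    then show "compose ?O' g (j_inv L') (basic_open L' a) = compose ?O' (j_inv L) ?p (basic_open L' a)"
      using preimg_basic by (simp add: compose_def spec_map_def)
  qed
  from fun_cong[OF this, of W] show ?thesis using W by (simp add: compose_def)
qed

end

text \<open>The sheaf part \<alpha> lives over nuclei and becomes a morphism over the spectra by
  naturality of j: its target over W is the direct image along the map of spectra.\<close>

lemma spec_arr_closed:
  assumes X: "dsheaf L F" and X': "dsheaf L' F'" and m: "(f, \<alpha>) \<in> sh_loc_hom (L, F) (L', F')"
  shows "spec_arr (L, F) (L', F') (f, \<alpha>) \<in> Hom Sh_PS (spec_ob (L, F)) (spec_ob (L', F'))"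
proof -
  interpret m: dsheaf_hom L' L f F' F \<alpha> using m sh_loc_hom_iff[OF X X'] by simp
  let ?T = "patch (spec L)" and ?T' = "patch (spec L')"
  let ?\<beta> = "\<lambda>W\<in>carrier (opens ?T'). \<lambda>s\<in>sections F' (j_inv L' W). \<alpha> (j_inv L' W) s"
  have mono: "(m.spec_map P, m.spec_map Q) \<in> spec_order L'" if "(P, Q) \<in> spec_order L" for P Q
    using that m.preimage_prime_filter by (auto simp: spec_order_def m.spec_map_def)
  have "?\<beta> \<in> sheaf_hom (opens ?T') (pushforward (j_inv L') F') (pushforward (preimg ?T m.spec_map) (pushforward (j_inv L) F))"
  proof (rule sheaf_homI)
    fix U s assume U: "U \<in> carrier (opens ?T')" and s: "s \<in> sections (pushforward (j_inv L') F') U"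
    then show "?\<beta> U s \<in> sections (pushforward (preimg ?T m.spec_map) (pushforward (j_inv L) F)) U"
      using m.\<alpha>_closed[of "j_inv L' U" s] by (simp add: m.dissolution_map_j_inv)
    fix V assume V: "V \<in> carrier (opens ?T')" "V \<sqsubseteq>\<^bsub>opens ?T'\<^esub> U"
    have j: "j_inv L' V \<preceq>\<^bsub>L'\<^esub> j_inv L' U"
      by (rule frame_hom_mono[OF opens_complete_lattice m.L'.nuclei_complete_lattice m.L'.j_inv_hom V(1) U V(2)])
    show "?\<beta> V (res (pushforward (j_inv L') F') U V s) =
        res (pushforward (preimg ?T m.spec_map) (pushforward (j_inv L) F)) U V (?\<beta> U s)"
      using m.\<alpha>_res[of "j_inv L' U" "j_inv L' V" s] m.X'.N.res_closed[of "j_inv L' U" "j_inv L' V" s] j U V s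
      by (simp add: m.dissolution_map_j_inv)
  qed simp_all
  then show ?thesis
    unfolding spec_arr_def spec_ob_def split_conv Sh_PS_simps m.spec_map_def[symmetric]
    using m.spec_map_closed m.spec_map_continuous mono by simp
qed

lemma is_functor_spec: "is_functor (Sh_Loc\<^sub>d :: (('l, 's) sh_loc, _) category) Sh_PS spec_ob spec_arr"
  unfolding is_functor_def Sh_Loc\<^sub>d_simps
proof (intro conjI ballI)
  show "is_category (Sh_Loc\<^sub>d :: (('l, 's) sh_loc, _) category)" by (rule is_category_Sh_Loc\<^sub>d)
  show "is_category Sh_PS" by (rule is_category_Sh_PS)
next
  fix X Y Z :: "('l, 's) sh_loc" and m n
  assume o: "X \<in> Obj Sh_Loc\<^sub>d" "Y \<in> Obj Sh_Loc\<^sub>d" "Z \<in> Obj Sh_Loc\<^sub>d" and h: "m \<in> sh_loc_hom X Y" "n \<in> sh_loc_hom Y Z"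
  obtain L F L' F' L'' F'' where eq: "X = (L, F)" "Y = (L', F')" "Z = (L'', F'')" by (metis surj_pair)
  obtain f \<alpha> f' \<alpha>' where eq': "m = (f, \<alpha>)" "n = (f', \<alpha>')" by (metis surj_pair)
  note o = o[unfolded eq Obj_Sh_Loc\<^sub>d] and h = h[unfolded eq eq']
  note c = sh_loc_comp_hom[OF o h]
  have ob: "spec_ob X \<in> Obj Sh_PS" "spec_ob Z \<in> Obj Sh_PS" unfolding eq by (rule spec_ob_closed[OF o(1)], rule spec_ob_closed[OF o(3)])
  interpret m: dsheaf_hom L' L f F' F \<alpha> using h(1) sh_loc_hom_iff[OF o(1,2)] by simp
  interpret n: dsheaf_hom L'' L' f' F'' F' \<alpha>' using h(2) sh_loc_hom_iff[OF o(2,3)] by simp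
  have s: "spec_arr (L, F) (L', F') (f, \<alpha>) = (m.spec_map, \<lambda>W\<in>carrier (opens (patch (spec L'))). \<lambda>s\<in>sections F' (j_inv L' W). \<alpha> (j_inv L' W) s)"
    "spec_arr (L', F') (L'', F'') (f', \<alpha>') = (n.spec_map, \<lambda>W\<in>carrier (opens (patch (spec L''))). \<lambda>s\<in>sections F'' (j_inv L'' W). \<alpha>' (j_inv L'' W) s)"
    by (simp_all add: spec_arr_def m.spec_map_def n.spec_map_def)
  note hom = spec_arr_closed[OF o(1,2) h(1), unfolded s spec_ob_def split_conv]
    spec_arr_closed[OF o(2,3) h(2), unfolded s spec_ob_def split_conv]
  note comp = Sh_PS_comp_hom[OF ob[unfolded eq spec_ob_def split_conv] hom, unfolded Sh_PS_simps(4)]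
  note chom = spec_arr_closed[OF o(1,3) c[unfolded sh_loc_comp_def split_conv], unfolded spec_arr_def spec_ob_def split_conv]
  show "spec_arr X Z (sh_loc_comp X Y Z n m) =
      Comp Sh_PS (spec_ob X) (spec_ob Y) (spec_ob Z) (spec_arr Y Z n) (spec_arr X Y m)"
    unfolding eq eq' s sh_loc_comp_def split_conv
    unfolding spec_arr_def spec_ob_def split_conv Sh_PS_simps(4)
  proof (rule Sh_PS_hom_eqI[OF chom comp])
    fix P assume P: "P \<in> topspace (patch (spec L))"
    then have "m.spec_map P \<in> prime_filters L'" using m.spec_map_closed by auto
    then show "(\<lambda>P\<in>prime_filters L. {a \<in> carrier L''. compose (carrier L'') f f' a \<in> P}) P = compose (topspace (patch (spec L))) n.spec_map m.spec_map P"
      using P by (auto simp: compose_def m.spec_map_def n.spec_map_def)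
  next
    fix W s assume W: "openin (patch (spec L'')) W" and s: "s \<in> sections (pushforward (j_inv L'') F'') W"
    have "openin (patch (spec L')) (preimg (patch (spec L')) n.spec_map W)"
      by (rule openin_preimg[OF n.spec_map_continuous W])
    then show "(\<lambda>W\<in>carrier (opens (patch (spec L''))). \<lambda>s\<in>sections F'' (j_inv L'' W).
          (\<lambda>\<nu>\<in>nucs L''. \<lambda>s\<in>sections F'' \<nu>. \<alpha> (dissolution_map L' L'' f' \<nu>) (\<alpha>' \<nu> s)) (j_inv L'' W) s) W s =
        (\<lambda>U\<in>carrier (opens (patch (spec L''))). \<lambda>s\<in>sections (pushforward (j_inv L'') F'') U.
          (\<lambda>W\<in>carrier (opens (patch (spec L'))). \<lambda>s\<in>sections F' (j_inv L' W). \<alpha> (j_inv L' W) s)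
           (preimg (patch (spec L')) n.spec_map U)
           ((\<lambda>W\<in>carrier (opens (patch (spec L''))). \<lambda>s\<in>sections F'' (j_inv L'' W). \<alpha>' (j_inv L'' W) s) U s)) W s"
      using W s n.\<alpha>_closed[of "j_inv L'' W" s] by (simp add: n.dissolution_map_j_inv)
  qed
next
  fix X Y :: "('l, 's) sh_loc" and m
  assume "X \<in> Obj Sh_Loc\<^sub>d" "Y \<in> Obj Sh_Loc\<^sub>d" "m \<in> sh_loc_hom X Y"
  then show "spec_arr X Y m \<in> Hom Sh_PS (spec_ob X) (spec_ob Y)"
    by (cases X; cases Y; cases m) (simp add: Obj_Sh_Loc\<^sub>d spec_arr_closed)
next
  fix X :: "('l, 's) sh_loc" assume o: "X \<in> Obj Sh_Loc\<^sub>d"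
  then show "spec_ob X \<in> Obj Sh_PS" by (cases X) (simp add: Obj_Sh_Loc\<^sub>d spec_ob_closed)
  obtain L F where eq: "X = (L, F)" by (metis surj_pair)
  interpret dsheaf L F using o by (simp add: eq Obj_Sh_Loc\<^sub>d)
  have "(\<lambda>P\<in>prime_filters L. {a \<in> carrier L. (\<lambda>a\<in>carrier L. a) a \<in> P}) = (\<lambda>P\<in>prime_filters L. P)"
    by (intro restrict_ext) (use prime_filterD(1) in auto)
  moreover have "(\<lambda>W\<in>carrier (opens (patch (spec L))). \<lambda>s\<in>sections F (j_inv L W).
      (\<lambda>\<nu>\<in>nucs L. \<lambda>s\<in>sections F \<nu>. s) (j_inv L W) s) =
      (\<lambda>W\<in>carrier (opens (patch (spec L))). \<lambda>s\<in>sections F (j_inv L W). s)"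
    by (intro restrict_ext) simp
  ultimately show "spec_arr X X (sh_loc_id X) = Ident Sh_PS (spec_ob X)"
    by (simp add: eq sh_loc_id_def spec_arr_def spec_ob_def Sh_PS_simps)
qed


section \<open>The equivalence\<close>

abbreviation sh_ob where "sh_ob X \<equiv> dsheaf (fst X) (snd X)"

lemma Obj_iff: "X \<in> Obj Sh_Loc\<^sub>d \<longleftrightarrow> sh_ob X"
  by (cases X) (simp add: Obj_Sh_Loc\<^sub>d)

lemma dual_ob_lnframe: "sh_ob X \<Longrightarrow> noncommutative_frame (dual_ob X) \<and> left_handed (dual_ob X)"
  using dsheaf.dual_ob_noncommutative_frame[of "fst X" "snd X"] by simp

lemma dual_hom:
  "\<lbrakk>sh_ob X; sh_ob Y; m \<in> sh_loc_hom X Y\<rbrakk> \<Longrightarrow> hdual_arr Y X m \<in> ncframe_hom (dual_ob Y) (dual_ob X)"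
  using hdual_arr_closed[of "fst X" "snd X" "fst Y" "snd Y"] by simp

lemma dual_faithful:
  "\<lbrakk>sh_ob X; sh_ob Y; m \<in> sh_loc_hom X Y; n \<in> sh_loc_hom X Y; hdual_arr Y X m = hdual_arr Y X n\<rbrakk> \<Longrightarrow> m = n"
  using hdual_arr_faithful[of "fst X" "snd X" "fst Y" "snd Y" m n] by simp

lemma dual_full:
  assumes "sh_ob X" "sh_ob Y" "\<phi> \<in> ncframe_hom (dual_ob Y) (dual_ob X)"
  shows "\<exists>m\<in>sh_loc_hom X Y. hdual_arr Y X m = \<phi>"
  using hdual_arr_full[OF assms(1,2), of \<phi>] assms(3) by auto

lemma dual_id: "sh_ob X \<Longrightarrow> hdual_arr X X (sh_loc_id X) = ncframe_id (dual_ob X)"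
  using hdual_arr_id[of "fst X" "snd X"] by simp

lemma dual_comp:
  "\<lbrakk>sh_ob X; sh_ob Y; sh_ob Z; m \<in> sh_loc_hom X Y; n \<in> sh_loc_hom Y Z\<rbrakk> \<Longrightarrow>
    hdual_arr Z X (sh_loc_comp X Y Z n m) = compose (carrier (dual_ob Z)) (hdual_arr Y X m) (hdual_arr Z Y n)"
  using hdual_arr_comp[of "fst X" "snd X" "fst Y" "snd Y" "fst Z" "snd Z"] by simp

lemma comp_hom:
  "\<lbrakk>sh_ob X; sh_ob Y; sh_ob Z; m \<in> sh_loc_hom X Y; n \<in> sh_loc_hom Y Z\<rbrakk> \<Longrightarrow> sh_loc_comp X Y Z n m \<in> sh_loc_hom X Z"
  using sh_loc_comp_hom[of "fst X" "snd X" "fst Y" "snd Y" "fst Z" "snd Z"] by simp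

lemma id_hom: "sh_ob X \<Longrightarrow> sh_loc_id X \<in> sh_loc_hom X X"
  using sh_loc_id_hom[of "fst X" "snd X"] by simp

lemma dual_arr_hdual: "sh_ob X' \<Longrightarrow> dual_arr X' X m = hdual_arr X' X m"
  using dsheaf.dual_arr_eq[of "fst X'" "snd X'" "fst X" "snd X" "fst m" "snd m"] by simp

text \<open>Fullness lifts the inverse, faithfulness lifts the two equations. The objects may live
  over different types, as required for the unit.\<close>

lemma dual_reflects_iso:
  assumes X: "sh_ob X" and Y: "sh_ob Y" and m: "m \<in> sh_loc_hom X Y"
    and iso: "hdual_arr Y X m \<in> ncframe_iso (dual_ob Y) (dual_ob X)"
  shows "m \<in> sh_loc_iso X Y"
proof -
  obtain \<psi> where \<psi>: "\<psi> \<in> ncframe_hom (dual_ob X) (dual_ob Y)"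
    "compose (carrier (dual_ob Y)) \<psi> (hdual_arr Y X m) = ncframe_id (dual_ob Y)"
    "compose (carrier (dual_ob X)) (hdual_arr Y X m) \<psi> = ncframe_id (dual_ob X)"
    using iso by (auto simp: ncframe_iso_def)
  obtain n where n: "n \<in> sh_loc_hom Y X" "hdual_arr X Y n = \<psi>" using dual_full[OF Y X \<psi>(1)] by blast
  have "sh_loc_comp X Y X n m = sh_loc_id X"
    by (rule dual_faithful[OF X X comp_hom[OF X Y X m n(1)] id_hom[OF X]])
      (simp add: dual_comp[OF X Y X m n(1)] n(2) \<psi>(3) dual_id[OF X])
  moreover have "sh_loc_comp Y X Y m n = sh_loc_id Y"
    by (rule dual_faithful[OF Y Y comp_hom[OF Y X Y n(1) m] id_hom[OF Y]])
      (simp add: dual_comp[OF Y X Y n(1) m] n(2) \<psi>(2) dual_id[OF Y])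
  ultimately show ?thesis using m n(1) by (auto simp: sh_loc_iso_def)
qed

text \<open>A choice from essential surjectivity. The construction of L and F depends on a maximal
  element; afterwards only the existence of an isomorphism with A is used.\<close>

definition quasi_ob :: "'a skew_lat \<Rightarrow> 'a sh_loc_of" where
  "quasi_ob A = (SOME X. sh_ob X \<and> ncframe_iso (dual_ob X) A \<noteq> {})"

definition counit where "counit A = (SOME \<phi>. \<phi> \<in> ncframe_iso (dual_ob (quasi_ob A)) A)"

definition counit_inv where
  "counit_inv A = (SOME \<psi>. \<psi> \<in> ncframe_hom A (dual_ob (quasi_ob A)) \<and>
     compose (carrier (dual_ob (quasi_ob A))) \<psi> (counit A) = ncframe_id (dual_ob (quasi_ob A)) \<and>
     compose (carrier A) (counit A) \<psi> = ncframe_id A)"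

text \<open>The morphism conjugated by the chosen isomorphisms and lifted along the full
  functor.\<close>

definition quasi_arr where
  "quasi_arr A B \<phi> = (SOME m. m \<in> sh_loc_hom (quasi_ob B) (quasi_ob A) \<and>
     hdual_arr (quasi_ob A) (quasi_ob B) m = (\<lambda>x\<in>carrier (dual_ob (quasi_ob A)). counit_inv B (\<phi> (counit A x))))"

text \<open>The lift of the counit at the dual of X. With this choice the dual of the unit is the
  counit, which reduces statements about the unit to the counit.\<close>

definition unit where
  "unit X = (SOME m. m \<in> sh_loc_hom X (quasi_ob (dual_ob X)) \<and>
     hdual_arr (quasi_ob (dual_ob X)) X m = counit (dual_ob X))"

lemma quasi_ob:
  assumes "noncommutative_frame A" "left_handed A"
  shows "sh_ob (quasi_ob A)" "ncframe_iso (dual_ob (quasi_ob A)) A \<noteq> {}"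
proof -
  have "\<exists>X :: 'a sh_loc_of. sh_ob X \<and> ncframe_iso (dual_ob X) A \<noteq> {}"
    using dual_ob_surjective[OF assms] by (metis empty_iff fst_conv snd_conv)
  from someI_ex[OF this] show "sh_ob (quasi_ob A)" "ncframe_iso (dual_ob (quasi_ob A)) A \<noteq> {}"
    by (simp_all add: quasi_ob_def)
qed

lemma counit:
  assumes "noncommutative_frame A" "left_handed A"
  shows "counit A \<in> ncframe_iso (dual_ob (quasi_ob A)) A"
    and "counit A \<in> ncframe_hom (dual_ob (quasi_ob A)) A"
    and "counit_inv A \<in> ncframe_hom A (dual_ob (quasi_ob A))"
    and "x \<in> carrier (dual_ob (quasi_ob A)) \<Longrightarrow> counit_inv A (counit A x) = x"
    and "y \<in> carrier A \<Longrightarrow> counit A (counit_inv A y) = y"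
proof -
  show iso: "counit A \<in> ncframe_iso (dual_ob (quasi_ob A)) A"
    unfolding counit_def using quasi_ob(2)[OF assms] by (simp only: some_in_eq simp_thms)
  then show "counit A \<in> ncframe_hom (dual_ob (quasi_ob A)) A" by (simp add: ncframe_iso_def)
  have "\<exists>\<psi>. \<psi> \<in> ncframe_hom A (dual_ob (quasi_ob A)) \<and>
     compose (carrier (dual_ob (quasi_ob A))) \<psi> (counit A) = ncframe_id (dual_ob (quasi_ob A)) \<and>
     compose (carrier A) (counit A) \<psi> = ncframe_id A"
    using iso unfolding ncframe_iso_def by blast
  note inv = someI_ex[OF this, folded counit_inv_def]
  then show "counit_inv A \<in> ncframe_hom A (dual_ob (quasi_ob A))" by simp
  show "x \<in> carrier (dual_ob (quasi_ob A)) \<Longrightarrow> counit_inv A (counit A x) = x"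
    using fun_cong[OF conjunct1[OF conjunct2[OF inv]], of x] by (simp add: compose_eq ncframe_id_def)
  show "y \<in> carrier A \<Longrightarrow> counit A (counit_inv A y) = y"
    using fun_cong[OF conjunct2[OF conjunct2[OF inv]], of y] by (simp add: compose_eq ncframe_id_def)
qed

lemma quasi_arr:
  assumes A: "noncommutative_frame A" "left_handed A" and B: "noncommutative_frame B" "left_handed B"
    and \<phi>: "\<phi> \<in> ncframe_hom A B"
  shows "quasi_arr A B \<phi> \<in> sh_loc_hom (quasi_ob B) (quasi_ob A)"
    and "hdual_arr (quasi_ob A) (quasi_ob B) (quasi_arr A B \<phi>) =
      (\<lambda>x\<in>carrier (dual_ob (quasi_ob A)). counit_inv B (\<phi> (counit A x)))"
proof -
  let ?D = "dual_ob (quasi_ob A)"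
  have D: "noncommutative_frame ?D" using dual_ob_lnframe[OF quasi_ob(1)[OF A]] by simp
  have "compose (carrier ?D) (counit_inv B) (compose (carrier ?D) \<phi> (counit A)) \<in> ncframe_hom ?D (dual_ob (quasi_ob B))"
    by (rule ncframe_hom_compose[OF ncframe_hom_compose[OF counit(2)[OF A] \<phi> D] counit(3)[OF B] D])
  moreover have "compose (carrier ?D) (counit_inv B) (compose (carrier ?D) \<phi> (counit A)) =
      (\<lambda>x\<in>carrier ?D. counit_inv B (\<phi> (counit A x)))"
    by (auto simp: compose_def)
  ultimately have "\<exists>m\<in>sh_loc_hom (quasi_ob B) (quasi_ob A). hdual_arr (quasi_ob A) (quasi_ob B) m =
      (\<lambda>x\<in>carrier ?D. counit_inv B (\<phi> (counit A x)))"
    using dual_full[OF quasi_ob(1)[OF B] quasi_ob(1)[OF A]] by simp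
  then have "\<exists>m. m \<in> sh_loc_hom (quasi_ob B) (quasi_ob A) \<and> hdual_arr (quasi_ob A) (quasi_ob B) m =
      (\<lambda>x\<in>carrier ?D. counit_inv B (\<phi> (counit A x)))" by blast
  from someI_ex[OF this, folded quasi_arr_def]
  show "quasi_arr A B \<phi> \<in> sh_loc_hom (quasi_ob B) (quasi_ob A)"
    "hdual_arr (quasi_ob A) (quasi_ob B) (quasi_arr A B \<phi>) = (\<lambda>x\<in>carrier ?D. counit_inv B (\<phi> (counit A x)))"
    by simp_all
qed

lemma unit:
  assumes X: "sh_ob X"
  shows "unit X \<in> sh_loc_hom X (quasi_ob (dual_ob X))"
    and "hdual_arr (quasi_ob (dual_ob X)) X (unit X) = counit (dual_ob X)"
    and "unit X \<in> sh_loc_iso X (quasi_ob (dual_ob X))"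
proof -
  note D = conjunct1[OF dual_ob_lnframe[OF X]] conjunct2[OF dual_ob_lnframe[OF X]]
  have "\<exists>m. m \<in> sh_loc_hom X (quasi_ob (dual_ob X)) \<and> hdual_arr (quasi_ob (dual_ob X)) X m = counit (dual_ob X)"
    using dual_full[OF X quasi_ob(1)[OF D] counit(2)[OF D]] by blast
  from someI_ex[OF this, folded unit_def]
  show u: "unit X \<in> sh_loc_hom X (quasi_ob (dual_ob X))"
    "hdual_arr (quasi_ob (dual_ob X)) X (unit X) = counit (dual_ob X)" by simp_all
  show "unit X \<in> sh_loc_iso X (quasi_ob (dual_ob X))"
    by (rule dual_reflects_iso[OF X quasi_ob(1)[OF D] u(1)]) (simp add: u(2) counit(1)[OF D])
qed

text \<open>Identities between lifted morphisms are checked on their duals by faithfulness, where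
  the chosen isomorphisms cancel.\<close>

lemma is_functor_quasi: "is_functor LNFrm (opposite Sh_Loc\<^sub>d) quasi_ob quasi_arr"
  unfolding is_functor_def opposite_simps Sh_Loc\<^sub>d_simps LNFrm_simps Obj_iff
proof (intro conjI ballI)
  show "is_category (LNFrm :: ('a skew_lat, 'a \<Rightarrow> 'a) category)" by (rule is_category_LNFrm)
  show "is_category (opposite Sh_Loc\<^sub>d)" by (intro is_category_opposite is_category_Sh_Loc\<^sub>d)
next
  fix A B C :: "'a skew_lat" and \<phi> \<psi>
  assume "A \<in> Obj LNFrm" "B \<in> Obj LNFrm" "C \<in> Obj LNFrm" and h: "\<phi> \<in> ncframe_hom A B" "\<psi> \<in> ncframe_hom B C"
  then have A: "noncommutative_frame A" "left_handed A" and B: "noncommutative_frame B" "left_handed B"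
    and C: "noncommutative_frame C" "left_handed C" by simp_all
  note QA = quasi_ob(1)[OF A] and QB = quasi_ob(1)[OF B] and QC = quasi_ob(1)[OF C]
  note q\<phi> = quasi_arr[OF A B h(1)] and q\<psi> = quasi_arr[OF B C h(2)]
  note qc = quasi_arr[OF A C ncframe_hom_compose[OF h A(1)]]
  show "quasi_arr A C (compose (carrier A) \<psi> \<phi>) =
      sh_loc_comp (quasi_ob C) (quasi_ob B) (quasi_ob A) (quasi_arr A B \<phi>) (quasi_arr B C \<psi>)"
  proof (rule dual_faithful[OF QC QA qc(1) comp_hom[OF QC QB QA q\<psi>(1) q\<phi>(1)]])
    have "counit_inv C (compose (carrier A) \<psi> \<phi> (counit A x)) =
        counit_inv C (\<psi> (counit B (counit_inv B (\<phi> (counit A x)))))"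
      if "x \<in> carrier (dual_ob (quasi_ob A))" for x
      using ncframe_homD(2)[OF counit(2)[OF A] that] ncframe_homD(2)[OF h(1)] counit(5)[OF B] by (simp add: compose_eq)
    moreover have "counit_inv B (\<phi> (counit A x)) \<in> carrier (dual_ob (quasi_ob B))"
      if "x \<in> carrier (dual_ob (quasi_ob A))" for x
      using ncframe_homD(2)[OF counit(2)[OF A] that] ncframe_homD(2)[OF h(1)] ncframe_homD(2)[OF counit(3)[OF B]] by blast
    ultimately show "hdual_arr (quasi_ob A) (quasi_ob C) (quasi_arr A C (compose (carrier A) \<psi> \<phi>)) =
        hdual_arr (quasi_ob A) (quasi_ob C)
          (sh_loc_comp (quasi_ob C) (quasi_ob B) (quasi_ob A) (quasi_arr A B \<phi>) (quasi_arr B C \<psi>))"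
      unfolding qc(2) dual_comp[OF QC QB QA q\<psi>(1) q\<phi>(1)] q\<phi>(2) q\<psi>(2)
      by (intro extensionalityI[of _ "carrier (dual_ob (quasi_ob A))"]) (simp_all add: compose_eq)
  qed
next
  fix A B :: "'a skew_lat" and \<phi> assume "A \<in> Obj LNFrm" "B \<in> Obj LNFrm" "\<phi> \<in> ncframe_hom A B"
  then show "quasi_arr A B \<phi> \<in> sh_loc_hom (quasi_ob B) (quasi_ob A)" by (simp add: quasi_arr(1))
next
  fix A :: "'a skew_lat" assume "A \<in> Obj LNFrm"
  then have A: "noncommutative_frame A" "left_handed A" by simp_all
  show Q: "sh_ob (quasi_ob A)" by (rule quasi_ob(1)[OF A])
  note q = quasi_arr[OF A A ncframe_id_hom[OF A(1)]]
  show "quasi_arr A A (ncframe_id A) = sh_loc_id (quasi_ob A)"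
  proof (rule dual_faithful[OF Q Q q(1) id_hom[OF Q]])
    show "hdual_arr (quasi_ob A) (quasi_ob A) (quasi_arr A A (ncframe_id A)) =
        hdual_arr (quasi_ob A) (quasi_ob A) (sh_loc_id (quasi_ob A))"
      unfolding q(2) dual_id[OF Q]
      by (intro extensionalityI[of _ "carrier (dual_ob (quasi_ob A))"])
        (simp_all add: ncframe_id_def ncframe_homD(2)[OF counit(2)[OF A]] counit(4)[OF A])
  qed
qed

lemma counit_natural:
  assumes A: "noncommutative_frame A" "left_handed A" and B: "noncommutative_frame B" "left_handed B"
    and \<phi>: "\<phi> \<in> ncframe_hom A B"
  shows "compose (carrier (dual_ob (quasi_ob A))) \<phi> (counit A) =
    compose (carrier (dual_ob (quasi_ob A))) (counit B) (hdual_arr (quasi_ob A) (quasi_ob B) (quasi_arr A B \<phi>))"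
  unfolding quasi_arr(2)[OF A B \<phi>] compose_def
  by (intro restrict_ext)
    (simp add: counit(5)[OF B] ncframe_homD(2)[OF \<phi>] ncframe_homD(2)[OF counit(2)[OF A]])

text \<open>On duals, which suffices by faithfulness, the unit becomes the counit and the equation
  becomes naturality of the counit at the dual of m.\<close>

lemma unit_natural:
  assumes X: "sh_ob X" and X': "sh_ob X'" and m: "m \<in> sh_loc_hom X X'"
  shows "sh_loc_comp X X' (quasi_ob (dual_ob X')) (unit X') m =
    sh_loc_comp X (quasi_ob (dual_ob X)) (quasi_ob (dual_ob X'))
      (quasi_arr (dual_ob X') (dual_ob X) (hdual_arr X' X m)) (unit X)"
proof -
  note D = conjunct1[OF dual_ob_lnframe[OF X]] conjunct2[OF dual_ob_lnframe[OF X]]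
  note D' = conjunct1[OF dual_ob_lnframe[OF X']] conjunct2[OF dual_ob_lnframe[OF X']]
  note Q = quasi_ob(1)[OF D] and Q' = quasi_ob(1)[OF D']
  note u = unit[OF X] and u' = unit[OF X'] and h = dual_hom[OF X X' m]
  note q = quasi_arr[OF D' D h]
  show ?thesis
    by (rule dual_faithful[OF X Q' comp_hom[OF X X' Q' m u'(1)] comp_hom[OF X Q Q' u(1) q(1)]])
      (simp only: dual_comp[OF X X' Q' m u'(1)] dual_comp[OF X Q Q' u(1) q(1)] u(2) u'(2) counit_natural[OF D' D h])
qed

text \<open>The quasi-inverse lands over larger types, so unit and counit compare objects over
  different types and their naturality is spelled out by \<open>sh_loc_comp\<close> and
  \<open>compose\<close>. The quasi-inverse is instantiated at the carrier type of
  \<open>dual_ob\<close>; the last conjunct adds essential surjectivity for carriers in an arbitrary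
  type.\<close>

theorem theorem6p9:
  shows "is_functor
           (Sh_Loc\<^sub>d :: (('l, 's) sh_loc, ('l, 's, 'l, 's) sh_loc_arr) category)
           Sh_PS spec_ob spec_arr \<and>
         is_functor
           (opposite (Sh_Loc\<^sub>d :: (('l, 's) sh_loc, ('l, 's, 'l, 's) sh_loc_arr) category))
           LNFrm dual_ob dual_arr \<and>
         (\<exists>(\<Psi>\<^sub>0 :: ('l set set \<times> 's) skew_lat \<Rightarrow> ('l set set \<times> 's) sh_loc_of)
           (\<Psi>\<^sub>1 :: ('l set set \<times> 's) skew_lat \<Rightarrow> ('l set set \<times> 's) skew_lat \<Rightarrow>
              ('l set set \<times> 's \<Rightarrow> 'l set set \<times> 's) \<Rightarrow> ('l set set \<times> 's) sh_loc_of_arr)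
           \<epsilon> \<eta>.
           is_functor LNFrm (opposite Sh_Loc\<^sub>d) \<Psi>\<^sub>0 \<Psi>\<^sub>1 \<and>
           (\<forall>A\<in>Obj LNFrm. \<epsilon> A \<in> ncframe_iso (dual_ob (\<Psi>\<^sub>0 A)) A) \<and>
           (\<forall>A\<in>Obj LNFrm. \<forall>B\<in>Obj LNFrm. \<forall>\<phi>\<in>Hom LNFrm A B.
              compose (carrier (dual_ob (\<Psi>\<^sub>0 A))) \<phi> (\<epsilon> A) =
              compose (carrier (dual_ob (\<Psi>\<^sub>0 A))) (\<epsilon> B) (dual_arr (\<Psi>\<^sub>0 A) (\<Psi>\<^sub>0 B) (\<Psi>\<^sub>1 A B \<phi>))) \<and>
           (\<forall>X\<in>Obj (Sh_Loc\<^sub>d :: (('l, 's) sh_loc, _) category). \<eta> X \<in> sh_loc_iso X (\<Psi>\<^sub>0 (dual_ob X))) \<and>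
           (\<forall>X\<in>Obj (Sh_Loc\<^sub>d :: (('l, 's) sh_loc, _) category). \<forall>X'\<in>Obj Sh_Loc\<^sub>d. \<forall>m\<in>Hom Sh_Loc\<^sub>d X X'.
              sh_loc_comp X X' (\<Psi>\<^sub>0 (dual_ob X')) (\<eta> X') m =
              sh_loc_comp X (\<Psi>\<^sub>0 (dual_ob X)) (\<Psi>\<^sub>0 (dual_ob X'))
                (\<Psi>\<^sub>1 (dual_ob X') (dual_ob X) (dual_arr X' X m)) (\<eta> X))) \<and>
         (\<forall>A\<in>Obj (LNFrm :: ('a skew_lat, 'a \<Rightarrow> 'a) category).
            \<exists>X\<in>Obj (Sh_Loc\<^sub>d :: ('a sh_loc_of, 'a sh_loc_of_arr) category).
              ncframe_iso (dual_ob X) A \<noteq> {})"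
proof -
  let ?L = "LNFrm :: (('l set set \<times> 's) skew_lat, _) category" and ?S = "Sh_Loc\<^sub>d :: (('l, 's) sh_loc, _) category"
  have 1: "\<forall>A\<in>Obj ?L. counit A \<in> ncframe_iso (dual_ob (quasi_ob A)) A"
    by (intro ballI counit(1)) simp_all
  have 2: "\<forall>A\<in>Obj ?L. \<forall>B\<in>Obj ?L. \<forall>\<phi>\<in>Hom ?L A B.
      compose (carrier (dual_ob (quasi_ob A))) \<phi> (counit A) =
      compose (carrier (dual_ob (quasi_ob A))) (counit B) (dual_arr (quasi_ob A) (quasi_ob B) (quasi_arr A B \<phi>))"
    by (intro ballI) (simp add: dual_arr_hdual quasi_ob(1) counit_natural)
  have 3: "\<forall>X\<in>Obj ?S. unit X \<in> sh_loc_iso X (quasi_ob (dual_ob X))"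
    by (intro ballI unit(3)) (simp add: Obj_iff)
  have 4: "\<forall>X\<in>Obj ?S. \<forall>X'\<in>Obj ?S. \<forall>m\<in>Hom ?S X X'.
      sh_loc_comp X X' (quasi_ob (dual_ob X')) (unit X') m =
      sh_loc_comp X (quasi_ob (dual_ob X)) (quasi_ob (dual_ob X'))
        (quasi_arr (dual_ob X') (dual_ob X) (dual_arr X' X m)) (unit X)"
    by (intro ballI) (simp add: Obj_iff dual_arr_hdual unit_natural)
  show ?thesis
  proof (intro conjI)
    show "\<forall>A\<in>Obj (LNFrm :: ('a skew_lat, 'a \<Rightarrow> 'a) category).
        \<exists>X\<in>Obj (Sh_Loc\<^sub>d :: ('a sh_loc_of, 'a sh_loc_of_arr) category). ncframe_iso (dual_ob X) A \<noteq> {}"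
    proof
      fix A :: "'a skew_lat" assume "A \<in> Obj LNFrm"
      then have "noncommutative_frame A" "left_handed A" by simp_all
      from quasi_ob[OF this] show "\<exists>X\<in>Obj Sh_Loc\<^sub>d. ncframe_iso (dual_ob (X :: 'a sh_loc_of)) A \<noteq> {}"
        by (intro bexI[of _ "quasi_ob A"]) (simp_all add: Obj_iff)
    qed
  qed (rule is_functor_spec, rule is_functor_dual, intro exI conjI, rule is_functor_quasi, (rule 1 2 3 4)+)
qed

end
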